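(* For $\varphi=(\varphi_1,\varphi_2) \in H^N_c$ with $N\geq 1$ an integer, the Dirichlet eigenvalues $(\mu_n)_{n\in\mathbb{Z}}$ of $L(\varphi)$ satisfy \[ \mu_n= n\pi +\sum_{k=1}^{N+1}\frac{c_k}{n^k} + \frac{1}{2}\big(\hat \varphi_1(-n) +\hat\varphi_2(n)\big) + \frac{\ell^2_n}{n^{N+1}} \quad \text{ as } |n|\to \infty \] uniformly on bounded sets of $H^N_c$. The coefficients $c_k\equiv c_k(\varphi)$ are independent of the choice of $n$ and $N$ and can be represented as integrals of polynomials of $\varphi_1,\varphi_2$ and their derivatives up to order $k-1$.
   Context: For an integer $N\ge0$, $H^N$ is the Sobolev space of 1-periodic complex-valued functions on $\mathbb{R}$ with its standard norm, $H^0=L^2$, and $H^N_c:=H^N\times H^N$. For $u\in L^2$, $\hat u(n):=\int_0^1u(x)e^{-2\pi i n x}\,dx$, $n\in\mathbb{Z}$, denotes the $n$-th Fourier coefficient. For $\varphi=(\varphi_1,\varphi_2)\in L^2_c:=H^0_c$ the Zakharov--Shabat operator is \[L(\varphi)= i \begin{pmatrix}1&0\\0&-1\end{pmatrix}\partial_x + \begin{pmatrix}0& \varphi_1 \\ \varphi_2 &0\end{pmatrix}.\] The Dirichlet spectrum of $L(\varphi)$ is the spectrum of $L(\varphi)$ on $[0,1]$ with domain the set of all $F=(F_1,F_2)\in H^1([0,1],\mathbb{C})\times H^1([0,1],\mathbb{C})$ with $F_1(0)=F_2(0)$ and $F_1(1)=F_2(1)$. It is discrete, and the eigenvalues, counted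 with algebraic multiplicities, are listed in lexicographic order $\cdots\preceq\mu_n\preceq\mu_{n+1}\preceq\cdots$ in such a way that $(\mu_n-n\pi)_{n\in\mathbb{Z}}$ is an $\ell^2$-sequence. Here $a\preceq b$ means $\operatorname{Re}a<\operatorname{Re}b$, or $\operatorname{Re}a=\operatorname{Re}b$ and $\operatorname{Im}a\le\operatorname{Im}b$. Notation: $x_n=y_n+\frac{\ell^2_n}{n^{s}}$ as $|n|\to\infty$ means that $x_n=y_n+\frac{e_n}{n^{s}}$ for $|n|$ large with $\sum|e_n|^2<\infty$. "Uniformly on bounded sets" means that for every bounded set of potentials there are $n_0\ge1$ and $C>0$ such that $\sum_{|n|\ge n_0}|e_n|^2\le C$ for all potentials in that set.
   Formalization: "Integrals of polynomials" is read as finite sums of products of integrals over [0,1] (equivalently multiple integrals); with a single integral the claim fails at k=3, since c_3 contains the square of the integral of φ_1φ_2. *)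

theory Defs
  imports
    "HOL-Analysis.Analysis"
    "HOL-Library.Poly_Mapping"
    "HOL-Library.Function_Algebras"
begin

text \<open>
  Elements of \<open>L\<^sup>2\<close> and of Sobolev spaces are represented by functions. Except where a continuous
  representative is requested explicitly, all notions below are invariant under changing a
  function on a null set.
\<close>

definition square_integrable_on :: "real set \<Rightarrow> (real \<Rightarrow> complex) \<Rightarrow> bool" where
  "square_integrable_on S u \<longleftrightarrow>
     set_borel_measurable lebesgue S u \<and> set_integrable lebesgue S (\<lambda>x. (norm (u x))\<^sup>2)"

definition L2_norm_01 :: "(real \<Rightarrow> complex) \<Rightarrow> real" where
  "L2_norm_01 u = sqrt (LINT x:{0..1}|lebesgue. (norm (u x))\<^sup>2)"

definition test_function :: "real set \<Rightarrow> (real \<Rightarrow> real) \<Rightarrow> bool" where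
  "test_function S \<psi> \<longleftrightarrow>
     (\<forall>k x. (deriv ^^ k) \<psi> field_differentiable at x) \<and>
     (\<exists>K. compact K \<and> K \<subseteq> S \<and> (\<forall>x. x \<notin> K \<longrightarrow> \<psi> x = 0))"

text \<open>\<open>v\<close> is the \<open>j\<close>-th weak derivative of \<open>u\<close> on the open set \<open>S\<close>. Only meaningful
  for \<open>u\<close> and \<open>v\<close> locally integrable on \<open>S\<close>; real-valued test functions
  suffice by linearity.\<close>

definition has_weak_deriv ::
    "real set \<Rightarrow> nat \<Rightarrow> (real \<Rightarrow> complex) \<Rightarrow> (real \<Rightarrow> complex) \<Rightarrow> bool" where
  "has_weak_deriv S j u v \<longleftrightarrow>
     (\<forall>\<psi>. test_function S \<psi> \<longrightarrow>
        (LINT x:S|lebesgue. u x * complex_of_real ((deriv ^^ j) \<psi> x)) =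
        (-1) ^ j * (LINT x:S|lebesgue. v x * complex_of_real (\<psi> x)))"


subsection \<open>Sobolev spaces of 1-periodic functions\<close>

definition L2_per :: "(real \<Rightarrow> complex) set" where
  "L2_per = {u. (\<forall>x. u (x + 1) = u x) \<and> u \<in> borel_measurable lebesgue \<and>
                square_integrable_on {0..1} u}"

definition H_per :: "nat \<Rightarrow> (real \<Rightarrow> complex) set" where
  "H_per N = {u \<in> L2_per. \<forall>j\<le>N. \<exists>v\<in>L2_per. has_weak_deriv UNIV j u v}"

text \<open>Unique up to null sets whenever it exists.\<close>

definition weak_deriv :: "nat \<Rightarrow> (real \<Rightarrow> complex) \<Rightarrow> real \<Rightarrow> complex" where
  "weak_deriv j u = (SOME v. v \<in> L2_per \<and> has_weak_deriv UNIV j u v)"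

definition H_norm :: "nat \<Rightarrow> (real \<Rightarrow> complex) \<Rightarrow> real" where
  "H_norm N u = sqrt (\<Sum>j\<le>N. (L2_norm_01 (weak_deriv j u))\<^sup>2)"

type_synonym fun_pair = "(real \<Rightarrow> complex) \<times> (real \<Rightarrow> complex)"

definition Hc :: "nat \<Rightarrow> fun_pair set" where
  "Hc N = H_per N \<times> H_per N"

definition Hc_norm :: "nat \<Rightarrow> fun_pair \<Rightarrow> real" where
  "Hc_norm N \<phi> = sqrt ((H_norm N (fst \<phi>))\<^sup>2 + (H_norm N (snd \<phi>))\<^sup>2)"

definition bounded_in_Hc :: "nat \<Rightarrow> fun_pair set \<Rightarrow> bool" where
  "bounded_in_Hc N B \<longleftrightarrow> B \<subseteq> Hc N \<and> (\<exists>R. \<forall>\<phi>\<in>B. Hc_norm N \<phi> \<le> R)"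

definition fourier_coeff :: "(real \<Rightarrow> complex) \<Rightarrow> int \<Rightarrow> complex" where
  "fourier_coeff u n =
     (LINT x:{0..1}|lebesgue. u x * exp (- 2 * of_real pi * \<i> * of_int n * of_real x))"


subsection \<open>The Zakharov--Shabat operator with Dirichlet boundary conditions\<close>

text \<open>
  \<open>H\<^sup>1([0,1], \<complex>)\<close>, each class being represented by its continuous representative on \<open>[0,1]\<close>,
  extended by zero so that distinct functions are distinct elements of the space. This makes
  the values at the end points meaningful.
\<close>

definition H1_01 :: "(real \<Rightarrow> complex) set" where
  "H1_01 = {f. continuous_on {0..1} f \<and> (\<forall>x. x \<notin> {0..1} \<longrightarrow> f x = 0) \<and>
               (\<exists>g. square_integrable_on {0..1} g \<and> has_weak_deriv {0<..<1} 1 f g)}"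

definition dirichlet_domain :: "fun_pair set" where
  "dirichlet_domain =
     {F \<in> H1_01 \<times> H1_01. fst F 0 = snd F 0 \<and> fst F 1 = snd F 1}"

text \<open>The graph of the operator: \<open>F\<close> lies in the domain and \<open>L(\<phi>) F = G\<close> in \<open>L\<^sup>2([0,1])\<close>.\<close>

definition ZS_dirichlet :: "fun_pair \<Rightarrow> fun_pair \<Rightarrow> fun_pair \<Rightarrow> bool" where
  "ZS_dirichlet \<phi> F G \<longleftrightarrow>
     F \<in> dirichlet_domain \<and>
     (\<exists>D1 D2. square_integrable_on {0..1} D1 \<and> has_weak_deriv {0<..<1} 1 (fst F) D1 \<and>
              square_integrable_on {0..1} D2 \<and> has_weak_deriv {0<..<1} 1 (snd F) D2 \<and>
              (AE x in lebesgue. x \<in> {0..1} \<longrightarrow>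
                 fst G x = \<i> * D1 x + fst \<phi> x * snd F x \<and>
                 snd G x = - \<i> * D2 x + snd \<phi> x * fst F x))"

definition cscale :: "complex \<Rightarrow> fun_pair \<Rightarrow> fun_pair" where
  "cscale a F = (\<lambda>x. a * fst F x, \<lambda>x. a * snd F x)"

global_interpretation cfun: vector_space cscale
  by unfold_locales (auto simp: cscale_def algebra_simps fun_eq_iff prod_eq_iff)

definition L2c_01 :: "fun_pair set" where
  "L2c_01 = {G. square_integrable_on {0..1} (fst G) \<and> square_integrable_on {0..1} (snd G)}"

definition L2c_norm_01 :: "fun_pair \<Rightarrow> real" where
  "L2c_norm_01 G = sqrt ((L2_norm_01 (fst G))\<^sup>2 + (L2_norm_01 (snd G))\<^sup>2)"

text \<open>Complement of the set of \<open>z\<close> for which \<open>L(\<phi>) - z\<close> is a bijection from the domain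
  onto \<open>L\<^sup>2([0,1])\<close> with bounded inverse.\<close>

definition dirichlet_spectrum :: "fun_pair \<Rightarrow> complex set" where
  "dirichlet_spectrum \<phi> =
     {z. \<not> ((\<forall>G\<in>L2c_01. \<exists>!F. ZS_dirichlet \<phi> F (cscale z F + G)) \<and>
            (\<exists>C. \<forall>F. \<forall>G\<in>L2c_01. ZS_dirichlet \<phi> F (cscale z F + G) \<longrightarrow>
                  L2c_norm_01 F \<le> C * L2c_norm_01 G))}"

text \<open>\<open>root_space \<phi> z k\<close> is the kernel of the \<open>k\<close>-th power of \<open>L(\<phi>) - z\<close>.\<close>

primrec root_space :: "fun_pair \<Rightarrow> complex \<Rightarrow> nat \<Rightarrow> fun_pair set" where
  "root_space \<phi> z 0 = {0}"
| "root_space \<phi> z (Suc k) = {F. \<exists>G\<in>root_space \<phi> z k. ZS_dirichlet \<phi> F (cscale z F + G)}"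

text \<open>A complex dimension; zero if \<open>z\<close> is not an eigenvalue.\<close>

definition alg_mult :: "fun_pair \<Rightarrow> complex \<Rightarrow> nat" where
  "alg_mult \<phi> z = cfun.dim (\<Union>k. root_space \<phi> z k)"

definition lex_le :: "complex \<Rightarrow> complex \<Rightarrow> bool" where
  "lex_le a b \<longleftrightarrow> Re a < Re b \<or> (Re a = Re b \<and> Im a \<le> Im b)"

text \<open>These conditions determine the sequence \<open>\<mu>\<close> uniquely: order and multiplicities fix it
  up to a shift of the index, and the \<open>\<ell>\<^sup>2\<close>-condition rules out shifts.\<close>

definition dirichlet_eigenvalues :: "fun_pair \<Rightarrow> (int \<Rightarrow> complex) \<Rightarrow> bool" where
  "dirichlet_eigenvalues \<phi> \<mu> \<longleftrightarrow>
     range \<mu> = dirichlet_spectrum \<phi> \<and>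
     (\<forall>z. finite {n. \<mu> n = z} \<and> card {n. \<mu> n = z} = alg_mult \<phi> z) \<and>
     (\<forall>n. lex_le (\<mu> n) (\<mu> (n + 1))) \<and>
     (\<lambda>n. (norm (\<mu> n - of_int n * of_real pi))\<^sup>2) summable_on UNIV"


subsection \<open>Integrals of polynomials in the potential and its derivatives\<close>

text \<open>Complex polynomials in the variables \<open>Inl i\<close>, \<open>Inr i\<close>, which stand for the \<open>i\<close>-th
  derivatives of \<open>\<phi>\<^sub>1\<close> and \<open>\<phi>\<^sub>2\<close>.\<close>

type_synonym diff_poly = "((nat + nat) \<Rightarrow>\<^sub>0 nat) \<Rightarrow>\<^sub>0 complex"

definition diff_poly_eval :: "diff_poly \<Rightarrow> (nat + nat \<Rightarrow> complex) \<Rightarrow> complex" where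
  "diff_poly_eval p a =
     (\<Sum>m\<in>Poly_Mapping.keys p. Poly_Mapping.lookup p m *
        (\<Prod>v\<in>Poly_Mapping.keys m. a v ^ Poly_Mapping.lookup m v))"

definition diff_poly_vars :: "diff_poly \<Rightarrow> (nat + nat) set" where
  "diff_poly_vars p = (\<Union>m\<in>Poly_Mapping.keys p. Poly_Mapping.keys m)"

definition jet :: "fun_pair \<Rightarrow> real \<Rightarrow> nat + nat \<Rightarrow> complex" where
  "jet \<phi> x = case_sum (\<lambda>i. weak_deriv i (fst \<phi>) x) (\<lambda>i. weak_deriv i (snd \<phi>) x)"

definition diff_poly_integral :: "diff_poly \<Rightarrow> fun_pair \<Rightarrow> complex" where
  "diff_poly_integral p \<phi> = (LINT x:{0..1}|lebesgue. diff_poly_eval p (jet \<phi> x))"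

text \<open>
  \<open>c\<close> is given by integrals of polynomials in \<open>\<phi>\<^sub>1\<close>, \<open>\<phi>\<^sub>2\<close> and their derivatives of order less
  than \<open>k\<close>. Multiple integrals are allowed; a polynomial integrated over \<open>[0,1]\<^sup>m\<close> is written out
  as a finite sum (outer list) of finite products (inner lists) of integrals over \<open>[0,1]\<close>.
  Single integrals would not suffice for the coefficients of the eigenvalue asymptotics: these
  arise by inverting an expansion \<open>n\<pi> = \<mu> - \<kappa>\<^sub>1/\<mu> - \<kappa>\<^sub>2/\<mu>\<^sup>2 - \<dots>\<close> with each \<open>\<kappa>\<^sub>j\<close> a single integral,
  so that already the coefficient of \<open>n\<^sup>-\<^sup>3\<close> contains the square of \<open>\<kappa>\<^sub>1\<close>, which is half the
  integral of \<open>\<phi>\<^sub>1\<phi>\<^sub>2\<close>.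
\<close>

definition given_by_integrals :: "nat \<Rightarrow> fun_pair set \<Rightarrow> (fun_pair \<Rightarrow> complex) \<Rightarrow> bool" where
  "given_by_integrals k X c \<longleftrightarrow>
     (\<exists>pss :: diff_poly list list.
        (\<forall>ps\<in>set pss. \<forall>p\<in>set ps.
           diff_poly_vars p \<subseteq> Inl ` {..<k} \<union> Inr ` {..<k} \<and>
           (\<forall>\<phi>\<in>X. set_integrable lebesgue {0..1} (\<lambda>x. diff_poly_eval p (jet \<phi> x)))) \<and>
        (\<forall>\<phi>\<in>X. c \<phi> = (\<Sum>ps\<leftarrow>pss. \<Prod>p\<leftarrow>ps. diff_poly_integral p \<phi>)))"

end

theory Submission
  imports Defs
begin

text \<open>
  Write \<open>p\<close>, \<open>q\<close> for the continuous representatives of the two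
  components of the potential. A number \<open>z\<close> is an eigenvalue iff the solution of
  \<open>U' = - i z U + i p V\<close>, \<open>V' = i z V - i q U\<close> with \<open>U 0 = V 0 = 1\<close> satisfies \<open>U 1 = V 1\<close>.

  The quotient \<open>V / U\<close> solves a Riccati equation, and this equation has a formal solution
  \<open>\<sigma> = \<Sum>k. s\<^sub>k \<zeta> ^ (k + 1)\<close> in powers of \<open>\<zeta> = 1 / (2 i z)\<close> whose coefficients are differential
  polynomials. A truncation of \<open>\<sigma>\<close> turns the system into an exact identity (\<open>wkb_identity\<close>):
  with \<open>E = exp (- i z x + i \<integral> p \<sigma>)\<close>, the value \<open>E (V - \<sigma> U)\<close> is \<open>1 - \<sigma> 0\<close> minus the integral of
  the residual of \<open>\<sigma>\<close> against \<open>E U\<close>. To leading order the residual is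
  \<open>i \<zeta> ^ N\<close> times the \<open>N\<close>-th derivative of \<open>q\<close>: the derivative that is merely in \<open>L\<^sup>2\<close> enters
  linearly. Since \<open>exp (2 i n \<pi> x) E U\<close> is close to 1, this integral is a Fourier coefficient to
  leading order, and \<open>N\<close> integrations by parts turn \<open>\<zeta> ^ N\<close> times that of the derivative into the one of
  \<open>q\<close>. The system is invariant under \<open>(z, U, V, p, q) \<mapsto> (- z, V, U, - q, - p)\<close>, so
  the same identity gives \<open>U 1\<close>. Equating the two end values and taking logarithms expands
  \<open>z - n \<pi>\<close> in powers of \<open>1 / z\<close> (\<open>two_sided_expansion\<close>).

  The error is \<open>\<theta>\<^sub>n / \<bar>n\<bar> ^ (N + 1)\<close>, where \<open>\<theta>\<^sub>n\<^sup>2\<close> is \<open>1 / n\<^sup>2\<close> plus finitely many terms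
  \<open>\<bar>T 1\<bar>\<^sup>2 + \<integral> \<bar>T x\<bar>\<^sup>2 dx\<close> for \<open>T x = \<integral>\<^sub>0\<^sup>x g (t) exp (2 i m \<pi> t) dt\<close> where \<open>m = n\<close> or
  \<open>m = - n\<close> and the function \<open>g\<close> is bounded in \<open>L\<^sup>2\<close>. These truncated Fourier coefficients appear
  because the factor next to the exponential is not constant and has to be integrated by parts (\<open>refined_integral\<close>). For each \<open>x\<close> Bessel's inequality
  bounds the sum over \<open>n\<close>, and integrating over \<open>x\<close> bounds the sum of all \<open>\<theta>\<^sub>n\<^sup>2\<close>
  (\<open>bessel_four_energy\<close>).

  The numbering (\<open>dirichlet_numbering\<close>): by the crude asymptotics every large eigenvalue lies near some
  \<open>m \<pi>\<close>; Brouwer's theorem produces one near each \<open>m \<pi>\<close>; it is unique and simple since \<open>L(\<phi>)\<close> is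
  symmetric for the bilinear form \<open>\<integral> F\<^sub>1 G\<^sub>2 + F\<^sub>2 G\<^sub>1\<close>, whose value on nearby eigenfunctions is not 0.
  As \<open>\<mu> n - n \<pi>\<close> tends to 0, the numbering is right far out, and the order propagates it
  inwards, to a threshold that depends only on the norm bound.

  Finally, inserting \<open>z = n \<pi> + C (1 / n)\<close> into \<open>z = n \<pi> + \<Sum>j. \<kappa>\<^sub>j / z ^ j\<close> gives the fixed point equation
  \<open>C = \<Sum>j. \<kappa>\<^sub>j (X / (\<pi> + X C)) ^ j\<close> for a formal power series \<open>C\<close>; its coefficients are polynomials in
  the single integrals \<open>\<kappa>\<^sub>j\<close> (\<open>inv_coeff_class\<close>, \<open>inverted_expansion\<close>).
\<close>

section \<open>Indefinite integrals and integration by parts\<close>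

type_synonym cfn = "real \<Rightarrow> complex"

lemmas HK_integral_diff = Henstock_Kurzweil_Integration.integral_diff
lemmas HK_restrict_Int = Henstock_Kurzweil_Integration.integral_restrict_Int

lemma absolutely_integrable_mult_continuous:
  fixes f g :: cfn
  assumes "continuous_on {a..b} f" "g absolutely_integrable_on {a..b}"
  shows "(\<lambda>x. f x * g x) absolutely_integrable_on {a..b}"
proof -
  have "bounded (f ` {a..b})"
    using assms(1) compact_continuous_image compact_imp_bounded by blast
  moreover have "f \<in> borel_measurable (lebesgue_on {a..b})"
    using assms(1) by (simp add: continuous_imp_measurable_on_sets_lebesgue)
  ultimately show ?thesis
    using absolutely_integrable_bounded_measurable_product[of "(*)" f "{a..b}" g] assms(2)
      bilinear_times by auto
qed

lemma absolutely_integrableD: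
  fixes f :: cfn
  assumes "f absolutely_integrable_on S"
  shows "f integrable_on S" "(\<lambda>x. norm (f x)) integrable_on S"
  using assms absolutely_integrable_on_def by blast+

lemma absolutely_integrable_mult_continuous':
  fixes f g :: cfn
  assumes "continuous_on {a..b} f" "g absolutely_integrable_on {a..b}"
  shows "(\<lambda>x. g x * f x) absolutely_integrable_on {a..b}"
  using absolutely_integrable_mult_continuous[OF assms] by (simp add: mult.commute)

lemma integral_split_diff:
  fixes f :: "real \<Rightarrow> 'b::banach"
  assumes "f integrable_on {a..b}" "a \<le> x" "x \<le> y" "y \<le> b"
  shows "integral {a..y} f - integral {a..x} f = integral {x..y} f" "f integrable_on {x..y}"
proof -
  have "f integrable_on {a..y}"
    using assms(1) by (rule integrable_on_subinterval) (use assms in auto)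
  then show "integral {a..y} f - integral {a..x} f = integral {x..y} f"
    using Henstock_Kurzweil_Integration.integral_combine[of a x y f] assms by (simp add: algebra_simps)
  show "f integrable_on {x..y}"
    using assms(1) by (rule integrable_on_subinterval) (use assms in auto)
qed

text \<open>
  Such a \<open>U\<close> has derivative 0 everywhere, because \<open>\<Gamma>\<close> is continuous. In the next lemma this stands in for the
  product rule, as a primitive of an integrable function need not be differentiable at every point.
\<close>

lemma constant_if_increments_small:
  fixes U :: cfn and \<Gamma> :: "real \<Rightarrow> real"
  assumes "continuous_on {a..b} \<Gamma>"
    and incr: "\<And>x y. a \<le> x \<Longrightarrow> x \<le> y \<Longrightarrow> y \<le> b \<Longrightarrow> norm (U y - U x) \<le> C * (y - x) * (\<Gamma> y - \<Gamma> x)"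
    and "x \<in> {a..b}"
  shows "U x = U a"
proof -
  have "(U has_vector_derivative 0) (at t within {a..b})" if t: "t \<in> {a..b}" for t
    unfolding has_vector_derivative_def has_derivative_within_alt
  proof (intro conjI allI impI)
    show "bounded_linear (\<lambda>x::real. x *\<^sub>R (0::complex))" by simp
    fix e :: real assume "e > 0"
    then have "e / (\<bar>C\<bar> + 1) > 0" by simp
    with assms(1) t obtain d where d: "d > 0"
      "\<And>y. y \<in> {a..b} \<Longrightarrow> dist y t < d \<Longrightarrow> dist (\<Gamma> y) (\<Gamma> t) < e / (\<bar>C\<bar> + 1)"
      unfolding continuous_on_iff by metis
    show "\<exists>d>0. \<forall>y\<in>{a..b}. norm (y - t) < d \<longrightarrow>
        norm (U y - U t - (y - t) *\<^sub>R 0) \<le> e * norm (y - t)"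
    proof (intro exI conjI ballI impI)
      fix y assume y: "y \<in> {a..b}" "norm (y - t) < d"
      have "dist (\<Gamma> y) (\<Gamma> t) < e / (\<bar>C\<bar> + 1)"
        using d(2)[of y] y by (simp add: dist_norm)
      then have \<Gamma>: "\<bar>\<Gamma> y - \<Gamma> t\<bar> * (\<bar>C\<bar> + 1) \<le> e"
        by (simp add: dist_real_def field_simps)
      have "norm (U y - U t) \<le> \<bar>C\<bar> * \<bar>y - t\<bar> * \<bar>\<Gamma> y - \<Gamma> t\<bar>"
      proof (cases "t \<le> y")
        case True
        then have "norm (U y - U t) \<le> C * (y - t) * (\<Gamma> y - \<Gamma> t)" using incr t y by auto
        also have "\<dots> \<le> \<bar>C * (y - t) * (\<Gamma> y - \<Gamma> t)\<bar>" by simp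
        finally show ?thesis by (simp add: abs_mult)
      next
        case False
        then have "norm (U t - U y) \<le> C * (t - y) * (\<Gamma> t - \<Gamma> y)" using incr t y by auto
        also have "\<dots> \<le> \<bar>C * (t - y) * (\<Gamma> t - \<Gamma> y)\<bar>" by simp
        finally show ?thesis by (simp add: abs_mult norm_minus_commute abs_minus_commute)
      qed
      also have "\<dots> \<le> (\<bar>\<Gamma> y - \<Gamma> t\<bar> * (\<bar>C\<bar> + 1)) * \<bar>y - t\<bar>"
        by (simp add: algebra_simps)
      also have "\<dots> \<le> e * \<bar>y - t\<bar>" using \<Gamma> by (intro mult_right_mono) auto
      finally show "norm (U y - U t - (y - t) *\<^sub>R 0) \<le> e * norm (y - t)" by simp
    qed (rule d(1))
  qed
  then obtain c where c: "\<And>t. t \<in> {a..b} \<Longrightarrow> U t = c"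
    using has_vector_derivative_zero_constant[of "{a..b}" U] by auto
  show ?thesis using c[of x] c[of a] assms(3) by auto
qed

text \<open>
  The function \<open>U x = \<integral> g h + \<integral> G h' - G h\<close> (integrals over \<open>{a..x}\<close>) has increments bounded by
  \<open>2 K (y - x)\<close> times the increment of \<open>\<integral> \<bar>g\<bar>\<close>, where \<open>K\<close> bounds \<open>h'\<close>; hence it is constant.
\<close>

lemma integral_by_parts_indefinite:
  fixes g h h' G :: cfn
  assumes ab: "a \<le> b" and g: "g absolutely_integrable_on {a..b}"
    and G: "\<And>x. x \<in> {a..b} \<Longrightarrow> G x = G a + integral {a..x} g"
    and h: "\<And>x. x \<in> {a..b} \<Longrightarrow> (h has_vector_derivative h' x) (at x within {a..b})"
    and h': "continuous_on {a..b} h'"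
  shows "integral {a..b} (\<lambda>x. g x * h x) = G b * h b - G a * h a - integral {a..b} (\<lambda>x. G x * h' x)"
proof -
  have hc: "continuous_on {a..b} h"
    using h continuous_on_eq_continuous_within has_vector_derivative_continuous by blast
  have gi: "g integrable_on {a..b}" "(\<lambda>x. norm (g x)) integrable_on {a..b}"
    using g absolutely_integrable_on_def by auto
  have Gc: "continuous_on {a..b} G"
    using indefinite_integral_continuous_1[OF gi(1)] G
    by (subst continuous_on_cong[OF refl G]) (auto intro!: continuous_intros)
  have gh: "(\<lambda>x. g x * h x) absolutely_integrable_on {a..b}"
    using absolutely_integrable_mult_continuous[OF hc g] by (simp add: mult.commute)
  then have ghi: "(\<lambda>x. g x * h x) integrable_on {a..b}" using absolutely_integrable_on_def by blast
  have Ghi: "(\<lambda>x. G x * h' x) integrable_on {a..b}"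
    by (intro integrable_continuous_real continuous_intros Gc h')
  define U where "U x = integral {a..x} (\<lambda>x. g x * h x) + integral {a..x} (\<lambda>x. G x * h' x) - G x * h x" for x
  define \<Gamma> where "\<Gamma> x = integral {a..x} (\<lambda>x. norm (g x))" for x
  have "bounded (h' ` {a..b})"
    using h' compact_continuous_image compact_imp_bounded by blast
  then obtain K where K: "\<And>x. x \<in> {a..b} \<Longrightarrow> norm (h' x) \<le> K" "K > 0"
    unfolding bounded_pos by blast
  have lip: "norm (h t - h y) \<le> K * (y - t)" if "a \<le> t" "t \<le> y" "y \<le> b" for t y
  proof -
    have "norm (h t - h y) \<le> K * norm (t - y)"
    proof (rule differentiable_bound[where S = "{a..b}" and f' = "\<lambda>x r. r *\<^sub>R h' x"])
      show "\<And>x. x \<in> {a..b} \<Longrightarrow> (h has_derivative (\<lambda>r. r *\<^sub>R h' x)) (at x within {a..b})"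
        using h unfolding has_vector_derivative_def by auto
      show "\<And>x. x \<in> {a..b} \<Longrightarrow> onorm (\<lambda>r. r *\<^sub>R h' x) \<le> K"
        using K(1) by (auto intro!: onorm_le mult_left_mono simp: mult.commute[of K])
    qed (use that in auto)
    then show ?thesis using that by simp
  qed
  have incr: "norm (U y - U x) \<le> (2 * K) * (y - x) * (\<Gamma> y - \<Gamma> x)" if xy: "a \<le> x" "x \<le> y" "y \<le> b" for x y
  proof -
    have i: "(\<lambda>x. g x * h x) integrable_on {x..y}" "(\<lambda>x. G x * h' x) integrable_on {x..y}"
       "g integrable_on {x..y}" "(\<lambda>x. norm (g x)) integrable_on {x..y}"
      using integral_split_diff(2)[OF ghi xy] integral_split_diff(2)[OF Ghi xy]
        integral_split_diff(2)[OF gi(1) xy] integral_split_diff(2)[OF gi(2) xy] by auto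
    have h'i: "h' integrable_on {x..y}"
      using xy h' by (intro integrable_continuous_real) (auto elim: continuous_on_subset)
    have \<Gamma>xy: "\<Gamma> y - \<Gamma> x = integral {x..y} (\<lambda>x. norm (g x))"
      unfolding \<Gamma>_def using integral_split_diff(1)[OF gi(2) xy] .
    have Gxy: "G t - G x = integral {x..t} g" if "x \<le> t" "t \<le> y" for t
      using integral_split_diff(1)[OF gi(1), of x t] G[of t] G[of x] xy that by auto
    have Gt: "norm (G t - G x) \<le> \<Gamma> y - \<Gamma> x" if t: "x \<le> t" "t \<le> y" for t
    proof -
      have "norm (integral {x..t} g) \<le> integral {x..t} (\<lambda>x. norm (g x))"
        by (rule integral_norm_bound_integral)
          (use i t in \<open>auto intro: integrable_on_subinterval\<close>)
      also have "\<dots> \<le> integral {x..y} (\<lambda>x. norm (g x))"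
        by (rule integral_subset_le) (use i t in \<open>auto intro: integrable_on_subinterval\<close>)
      finally show ?thesis using Gxy t \<Gamma>xy by simp
    qed
    have hxy: "h y - h x = integral {x..y} h'"
      using xy by (intro integral_unique[symmetric] fundamental_theorem_of_calculus
         has_vector_derivative_within_subset[OF h]) auto
    have e1: "integral {x..y} (\<lambda>t. g t * (h t - h y)) = integral {x..y} (\<lambda>x. g x * h x) - (G y - G x) * h y"
      using i Gxy[of y] xy by (simp add: right_diff_distrib HK_integral_diff integrable_on_mult_left)
    have e2: "integral {x..y} (\<lambda>t. (G t - G x) * h' t) = integral {x..y} (\<lambda>t. G t * h' t) - G x * (h y - h x)"
      using i h'i hxy by (simp add: left_diff_distrib HK_integral_diff integrable_on_mult_right)
    have "U y - U x = integral {x..y} (\<lambda>x. g x * h x) + integral {x..y} (\<lambda>x. G x * h' x) - (G y * h y - G x * h x)"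
      unfolding U_def using integral_split_diff(1)[OF ghi xy] integral_split_diff(1)[OF Ghi xy] by (simp add: algebra_simps)
    also have "\<dots> = integral {x..y} (\<lambda>t. g t * (h t - h y)) + integral {x..y} (\<lambda>t. (G t - G x) * h' t)"
      unfolding e1 e2 by (simp add: algebra_simps)
    finally have e: "norm (U y - U x) \<le> norm (integral {x..y} (\<lambda>t. g t * (h t - h y)))
         + norm (integral {x..y} (\<lambda>t. (G t - G x) * h' t))"
      by (simp add: norm_triangle_ineq)
    have "norm (integral {x..y} (\<lambda>t. g t * (h t - h y))) \<le> integral {x..y} (\<lambda>t. norm (g t) * (K * (y - x)))"
    proof (rule integral_norm_bound_integral)
      show "(\<lambda>t. g t * (h t - h y)) integrable_on {x..y}"
        using i by (simp add: right_diff_distrib integrable_diff integrable_on_mult_left)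
      fix t assume t: "t \<in> {x..y}"
      have "norm (h t - h y) \<le> K * (y - t)" using lip t xy by auto
      also have "\<dots> \<le> K * (y - x)" using K t by auto
      finally show "norm (g t * (h t - h y)) \<le> norm (g t) * (K * (y - x))"
        by (simp add: norm_mult mult_left_mono)
    qed (use i in \<open>auto intro: integrable_on_mult_left\<close>)
    also have "\<dots> = K * (y - x) * (\<Gamma> y - \<Gamma> x)"
      unfolding \<Gamma>xy by simp
    finally have b1: "norm (integral {x..y} (\<lambda>t. g t * (h t - h y))) \<le> K * (y - x) * (\<Gamma> y - \<Gamma> x)" .
    have "norm (integral {x..y} (\<lambda>t. (G t - G x) * h' t)) \<le> integral {x..y} (\<lambda>t. (\<Gamma> y - \<Gamma> x) * K)"
    proof (rule integral_norm_bound_integral)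
      show "(\<lambda>t. (G t - G x) * h' t) integrable_on {x..y}"
        using i h'i by (simp add: left_diff_distrib integrable_diff integrable_on_mult_right)
      fix t assume t: "t \<in> {x..y}"
      have "norm (G t - G x) \<le> \<Gamma> y - \<Gamma> x" "norm (h' t) \<le> K" using Gt K t xy by auto
      then show "norm ((G t - G x) * h' t) \<le> (\<Gamma> y - \<Gamma> x) * K"
        by (simp add: norm_mult mult_mono')
    qed auto
    also have "\<dots> = K * (y - x) * (\<Gamma> y - \<Gamma> x)" using xy by simp
    finally show ?thesis using e b1 by simp
  qed
  have "U b = U a"
    by (rule constant_if_increments_small[OF _ incr])
       (auto simp: \<Gamma>_def ab intro!: indefinite_integral_continuous_1 gi)
  then show ?thesis unfolding U_def by (simp add: algebra_simps)
qed

section \<open>Weak derivatives and primitives\<close>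

text \<open>
  For \<open>l > 0\<close> this is smooth on the whole line with all derivatives 0 at 0. The power \<open>m\<close> is there because
  the derivatives of \<open>exp (- l / y)\<close> are combinations of such functions. The parameter \<open>l\<close> will tend to 0,
  and then \<open>exp (- l / y)\<close> increases to the indicator function of \<open>y > 0\<close>.
\<close>

definition flat_fn :: "nat \<Rightarrow> real \<Rightarrow> real \<Rightarrow> real" where
  "flat_fn m l y = (if y > 0 then (1 / y) ^ m * exp (- l / y) else 0)"

lemma power_le_fact_exp: "(x::real) \<ge> 0 \<Longrightarrow> x ^ k \<le> fact k * exp x"
proof -
  assume x: "x \<ge> 0"
  have "(\<Sum>n\<in>{k}. x ^ n /\<^sub>R fact n) \<le> suminf (\<lambda>n. x ^ n /\<^sub>R fact n)"
    by (rule sum_le_suminf) (use x summable_exp_generic[of x] in auto)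
  then show ?thesis by (simp add: exp_def field_simps)
qed

lemma flat_fn_bound:
  assumes "l > 0"
  shows "\<bar>flat_fn m l y\<bar> \<le> fact m / l ^ m"
proof (cases "y > 0")
  case True
  have "(l / y) ^ m \<le> fact m * exp (l / y)" using assms True by (intro power_le_fact_exp) auto
  then have "(1 / y) ^ m * exp (- (l / y)) \<le> fact m / l ^ m"
    using assms True by (simp add: power_divide exp_minus field_simps)
  then show ?thesis using True by (simp add: flat_fn_def)
qed (use assms in \<open>auto simp: flat_fn_def\<close>)

lemma flat_fn_bound':
  assumes "l > 0"
  shows "\<bar>flat_fn m l y\<bar> \<le> fact (Suc m) / l ^ Suc m * \<bar>y\<bar>"
proof -
  have "flat_fn m l y = flat_fn (Suc m) l y * y" by (auto simp: flat_fn_def)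
  then have "\<bar>flat_fn m l y\<bar> = \<bar>flat_fn (Suc m) l y\<bar> * \<bar>y\<bar>" by (simp add: abs_mult)
  also have "\<dots> \<le> fact (Suc m) / l ^ Suc m * \<bar>y\<bar>"
    by (intro mult_right_mono flat_fn_bound assms) auto
  finally show ?thesis .
qed

lemma flat_fn_deriv:
  assumes l: "l > 0"
  shows "(flat_fn m l has_real_derivative (- real m * flat_fn (Suc m) l y + l * flat_fn (m + 2) l y)) (at y)"
proof -
  consider "y > 0" | "y < 0" | "y = 0" by linarith
  then show ?thesis
  proof cases
    case 1
    have d1: "((\<lambda>t. t ^ m * exp (- l * t)) has_real_derivative
       (real m * t ^ (m - 1) - l * t ^ m) * exp (- l * t)) (at t)" for t
      by (auto intro!: derivative_eq_intros simp: algebra_simps)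
    have d2: "((\<lambda>y. 1 / y) has_real_derivative - ((1 / y) * (1 / y))) (at y)"
      using 1 by (auto intro!: derivative_eq_intros)
    have "((\<lambda>y. (1 / y) ^ m * exp (- l / y)) has_real_derivative
       (- real m * flat_fn (Suc m) l y + l * flat_fn (m + 2) l y)) (at y)"
      using DERIV_chain'[OF d2 d1] 1
      by (cases m) (simp_all add: flat_fn_def algebra_simps divide_inverse)
    then show ?thesis
      by (rule has_field_derivative_transform_within_open[where S = "{0<..}"])
        (use 1 in \<open>auto simp: flat_fn_def\<close>)
  next
    case 2
    have "((\<lambda>y. 0) has_real_derivative
       (- real m * flat_fn (Suc m) l y + l * flat_fn (m + 2) l y)) (at y)"
      using 2 by (auto simp: flat_fn_def)
    then show ?thesis
      by (rule has_field_derivative_transform_within_open[where S = "{..<0}"])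
        (use 2 in \<open>auto simp: flat_fn_def\<close>)
  next
    case 3
    have q: "(flat_fn m l (0 + h) - flat_fn m l 0) / h = flat_fn (Suc m) l h" for h
      by (auto simp: flat_fn_def)
    have "(\<lambda>h. flat_fn (Suc m) l h) \<midarrow>0\<rightarrow> 0"
    proof (rule Lim_null_comparison)
      show "\<forall>\<^sub>F x in at 0. norm (flat_fn (Suc m) l x) \<le> fact (Suc (Suc m)) / l ^ Suc (Suc m) * \<bar>x\<bar>"
        by (intro always_eventually allI) (use flat_fn_bound'[OF l, of "Suc m"] in \<open>simp only: real_norm_def\<close>)
      show "((\<lambda>x. fact (Suc (Suc m)) / l ^ Suc (Suc m) * \<bar>x\<bar>) \<longlongrightarrow> 0) (at (0::real))"
        by (rule tendsto_eq_intros refl | simp)+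
    qed
    then have "((\<lambda>h. (flat_fn m l (0 + h) - flat_fn m l 0) / h) \<longlongrightarrow> 0) (at 0)"
      unfolding q .
    then have "DERIV (flat_fn m l) 0 :> 0" unfolding DERIV_def .
    then show ?thesis using 3 by (simp add: flat_fn_def)
  qed
qed

text \<open>
  An algebra of functions that contains the cutoff functions below and is closed under differentiation; its
  members are therefore smooth without any bookkeeping of higher derivatives.
\<close>

inductive_set bump_algebra :: "(real \<Rightarrow> real) set" where
  left: "l > 0 \<Longrightarrow> (\<lambda>x. flat_fn m l (x - c)) \<in> bump_algebra"
| right: "l > 0 \<Longrightarrow> (\<lambda>x. flat_fn m l (d - x)) \<in> bump_algebra"
| const: "(\<lambda>x. k) \<in> bump_algebra"
| add: "f \<in> bump_algebra \<Longrightarrow> g \<in> bump_algebra \<Longrightarrow> (\<lambda>x. f x + g x) \<in> bump_algebra"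
| mult: "f \<in> bump_algebra \<Longrightarrow> g \<in> bump_algebra \<Longrightarrow> (\<lambda>x. f x * g x) \<in> bump_algebra"

lemma bump_algebra_deriv:
  "f \<in> bump_algebra \<Longrightarrow> \<exists>f'\<in>bump_algebra. \<forall>x. (f has_real_derivative f' x) (at x)"
proof (induction rule: bump_algebra.induct)
  case (left l m c)
  let ?f' = "\<lambda>x. (- real m) * flat_fn (Suc m) l (x - c) + l * flat_fn (m + 2) l (x - c)"
  have "?f' \<in> bump_algebra" using left by (intro bump_algebra.intros)
  moreover have "((\<lambda>x. flat_fn m l (x - c)) has_real_derivative ?f' x) (at x)" for x
    by (rule DERIV_cong[OF DERIV_chain'[where f = "\<lambda>x. x - c" and g = "flat_fn m l", OF _ flat_fn_deriv[OF left]]])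
       (auto intro!: derivative_eq_intros)
  ultimately show ?case by (intro bexI[of _ ?f']) auto
next
  case (right l m d)
  let ?f' = "\<lambda>x. real m * flat_fn (Suc m) l (d - x) + (- l) * flat_fn (m + 2) l (d - x)"
  have "?f' \<in> bump_algebra" using right by (intro bump_algebra.intros)
  moreover have "((\<lambda>x. flat_fn m l (d - x)) has_real_derivative ?f' x) (at x)" for x
    by (rule DERIV_cong[OF DERIV_chain'[where f = "\<lambda>x. d - x" and g = "flat_fn m l", OF _ flat_fn_deriv[OF right]]])
       (auto intro!: derivative_eq_intros)
  ultimately show ?case by (intro bexI[of _ ?f']) auto
next
  case (const k)
  then show ?case by (intro bexI[of _ "\<lambda>x. 0"]) (auto intro: bump_algebra.intros)
next
  case (add f g)
  then obtain f' g' where "f' \<in> bump_algebra" "g' \<in> bump_algebra"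
    "\<And>x. (f has_real_derivative f' x) (at x)" "\<And>x. (g has_real_derivative g' x) (at x)" by blast
  then show ?case
    by (intro bexI[of _ "\<lambda>x. f' x + g' x"]) (auto intro: bump_algebra.intros derivative_intros)
next
  case (mult f g)
  then obtain f' g' where "f' \<in> bump_algebra" "g' \<in> bump_algebra"
    "\<And>x. (f has_real_derivative f' x) (at x)" "\<And>x. (g has_real_derivative g' x) (at x)" by blast
  then show ?case using mult
    by (intro bexI[of _ "\<lambda>x. f' x * g x + f x * g' x"])
      (auto intro!: bump_algebra.intros derivative_eq_intros)
qed

lemma bump_algebra_iterated_deriv:
  assumes "f \<in> bump_algebra"
  shows "(deriv ^^ k) f \<in> bump_algebra \<and> (deriv ^^ k) f field_differentiable at x"
proof -
  have d: "deriv f \<in> bump_algebra \<and> (\<forall>x. f field_differentiable at x)" if f: "f \<in> bump_algebra" for f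
  proof -
    obtain f' where f': "f' \<in> bump_algebra" "\<And>x. (f has_real_derivative f' x) (at x)"
      using bump_algebra_deriv[OF f] by blast
    then have "deriv f = f'" by (auto intro: DERIV_imp_deriv)
    with f' show ?thesis by (auto simp: field_differentiable_def)
  qed
  have "(deriv ^^ k) f \<in> bump_algebra"
    by (induction k) (use assms d in auto)
  with d show ?thesis by blast
qed

definition cutoff :: "nat \<Rightarrow> real \<Rightarrow> real \<Rightarrow> real \<Rightarrow> real" where
  "cutoff k c d x = flat_fn 0 (1 / Suc k) (x - c) * flat_fn 0 (1 / Suc k) (d - x)"

lemma cutoff_in [simp]: "cutoff k c d \<in> bump_algebra"
  unfolding cutoff_def[abs_def] by (intro bump_algebra.intros) auto

lemma cutoff_outside: "x \<notin> {c<..<d} \<Longrightarrow> cutoff k c d x = 0"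
  by (auto simp: cutoff_def flat_fn_def)

lemma cutoff_bounds: "0 \<le> cutoff k c d x" "cutoff k c d x \<le> 1"
  by (auto simp: cutoff_def flat_fn_def intro!: mult_le_one)

lemma cutoff_tendsto: "x \<in> {c<..<d} \<Longrightarrow> (\<lambda>k. cutoff k c d x) \<longlonglongrightarrow> 1"
proof -
  assume x: "x \<in> {c<..<d}"
  have lim: "(\<lambda>k. 1 / real (Suc k)) \<longlonglongrightarrow> 0" by (rule LIMSEQ_Suc[OF lim_1_over_n])
  have "(\<lambda>k. exp (- (1 / real (Suc k)) / (x - c)) * exp (- (1 / real (Suc k)) / (d - x))) \<longlonglongrightarrow> exp (- 0 / (x - c)) * exp (- 0 / (d - x))"
    by (intro tendsto_intros lim) (use x in auto)
  then show ?thesis using x by (simp add: cutoff_def flat_fn_def)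
qed

lemma bump_algebra_continuous: "f \<in> bump_algebra \<Longrightarrow> continuous_on S f"
proof -
  assume "f \<in> bump_algebra"
  then obtain f' where "\<And>x. (f has_real_derivative f' x) (at x)" using bump_algebra_deriv by force
  then show ?thesis by (intro continuous_at_imp_continuous_on ballI) (rule DERIV_isCont)
qed

lemma test_functionI:
  assumes "\<psi>' \<in> bump_algebra" "\<And>x. (\<psi> has_real_derivative \<psi>' x) (at x)"
    and "compact K" "K \<subseteq> S" "\<And>x. x \<notin> K \<Longrightarrow> \<psi> x = 0"
  shows "test_function S \<psi>"
proof -
  have "deriv \<psi> = \<psi>'" using assms(2) by (auto intro: DERIV_imp_deriv)
  moreover have "(deriv ^^ k) \<psi> = (if k = 0 then \<psi> else (deriv ^^ (k - 1)) (deriv \<psi>))" for k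
    by (cases k) (auto simp: funpow_swap1)
  ultimately have "(deriv ^^ k) \<psi> field_differentiable at x" for k x
    using bump_algebra_iterated_deriv[OF assms(1)] assms(2)
    by (cases "k = 0") (auto simp: field_differentiable_def intro!: exI[of _ "\<psi>' x"])
  then show ?thesis unfolding test_function_def using assms by blast
qed

lemma test_function_deriv:
  assumes "test_function S \<psi>"
  shows "test_function S (deriv \<psi>)"
proof -
  obtain K where K: "compact K" "K \<subseteq> S" "\<And>x. x \<notin> K \<Longrightarrow> \<psi> x = 0"
    using assms unfolding test_function_def by auto
  have "deriv \<psi> x = 0" if "x \<notin> K" for x
  proof -
    have "((\<lambda>x. 0) has_real_derivative 0) (at x)" by simp
    then have "(\<psi> has_real_derivative 0) (at x)"
      by (rule has_field_derivative_transform_within_open[where S = "- K"])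
         (use K that in \<open>auto simp: compact_imp_closed open_Compl\<close>)
    then show ?thesis by (rule DERIV_imp_deriv)
  qed
  moreover have "(deriv ^^ k) (deriv \<psi>) field_differentiable at x" for k x
  proof -
    have "(deriv ^^ Suc k) \<psi> field_differentiable at x"
      using assms unfolding test_function_def by blast
    then show ?thesis by (simp only: funpow_Suc_right comp_apply)
  qed
  ultimately show ?thesis using K unfolding test_function_def by blast
qed

text \<open>
  By Lebesgue's differentiation theorem \<open>h x\<close> is almost everywhere a limit of means over intervals.
\<close>

lemma interval_integrals_zero_imp_AE_zero:
  fixes h :: cfn
  assumes h: "h integrable_on {a..b}"
    and zero: "\<And>c d. a < c \<Longrightarrow> c < d \<Longrightarrow> d < b \<Longrightarrow> integral {c..d} h = 0"
  shows "AE x in lebesgue. x \<in> {a..b} \<longrightarrow> h x = 0"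
proof -
  define k where "k x = (if x \<in> {a..b} then h x else 0)" for x
  have k: "k integrable_on cbox c d" for c d
  proof -
    have "k integrable_on UNIV"
      unfolding k_def using Henstock_Kurzweil_Integration.integrable_restrict_UNIV[of "{a..b}" h] h by (simp only:)
    then show ?thesis using integrable_on_subcbox by blast
  qed
  obtain N where N: "negligible N" and lim: "\<And>x e. x \<notin> N \<Longrightarrow> 0 < e \<Longrightarrow>
       \<exists>d>0. \<forall>r. 0 < r \<and> r < d \<longrightarrow> norm (integral (cbox x (x + r *\<^sub>R One)) k /\<^sub>R r ^ DIM(real) - k x) < e"
    using integrable_ccontinuous_explicit[OF k] by metis
  have "h x = 0" if x: "x \<in> {a<..<b}" "x \<notin> N" for x
  proof (rule ccontr)
    assume "h x \<noteq> 0"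
    then obtain d where d: "d > 0" "\<And>r. 0 < r \<Longrightarrow> r < d \<Longrightarrow>
       norm (integral (cbox x (x + r *\<^sub>R One)) k /\<^sub>R r ^ DIM(real) - k x) < norm (h x)"
      using lim[OF x(2), of "norm (h x)"] by auto
    define r where "r = min (d / 2) ((b - x) / 2)"
    have r: "0 < r" "r < d" "x + r < b" using d(1) x by (auto simp: r_def min_def field_simps)
    have "integral (cbox x (x + r *\<^sub>R One)) k = integral {x..x + r} h"
      unfolding k_def using x r by (auto intro!: integral_cong)
    also have "\<dots> = 0" using zero x r by auto
    finally show False using d(2)[OF r(1,2)] x by (simp add: k_def)
  qed
  then have "{x. \<not> (x \<in> {a..b} \<longrightarrow> h x = 0)} \<subseteq> N \<union> {a, b}" by force
  moreover have "N \<union> {a, b} \<in> null_sets lebesgue"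
    using negligible_Un[OF N negligible_finite[of "{a, b}"]] unfolding negligible_iff_null_sets by blast
  ultimately show ?thesis by (intro AE_I'[of "N \<union> {a, b}"]) auto
qed

lemma set_integral_restrict_support:
  fixes f :: "real \<Rightarrow> 'b::euclidean_space"
  assumes "(\<lambda>x. f x) absolutely_integrable_on {a..b}" "{a<..<b} \<subseteq> S"
    and "\<And>x. x \<in> S \<Longrightarrow> x \<notin> {a<..<b} \<Longrightarrow> f x = 0"
  shows "(LINT x:S|lebesgue. f x) = integral {a..b} f"
proof -
  have "(LINT x:S|lebesgue. f x) = (LINT x:{a<..<b}|lebesgue. f x)"
    unfolding set_lebesgue_integral_def using assms(2,3)
    by (intro Bochner_Integration.integral_cong refl) (auto simp: indicator_def)
  also have "f absolutely_integrable_on {a<..<b}"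
    using assms(1) by (rule set_integrable_subset) auto
  then have "(LINT x:{a<..<b}|lebesgue. f x) = integral {a<..<b} f"
    by (rule set_lebesgue_integral_eq_integral)
  also have "\<dots> = integral {a..b} f"
    by (rule integral_open_interval_real[symmetric])
  finally show ?thesis .
qed

lemma cutoff_complex_continuous: "continuous_on T (\<lambda>x. complex_of_real (cutoff k c d x))"
  by (intro continuous_on_of_real bump_algebra_continuous cutoff_in)

lemma cutoff_integral_tendsto:
  fixes h :: cfn
  assumes h: "h absolutely_integrable_on {a..b}" and cd: "a \<le> c" "c < d" "d \<le> b"
  shows "(\<lambda>k. integral {a..b} (\<lambda>x. h x * of_real (cutoff k c d x))) \<longlonglongrightarrow> integral {c..d} h"
proof -
  have "(\<lambda>k. integral {a..b} (\<lambda>x. h x * of_real (cutoff k c d x))) \<longlonglongrightarrow> integral {a..b} (\<lambda>x. if x \<in> {c<..<d} then h x else 0)"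
  proof (rule dominated_convergence(2)[where h = "\<lambda>x. norm (h x)"])
    show "(\<lambda>x. h x * of_real (cutoff k c d x)) integrable_on {a..b}" for k
      by (intro absolutely_integrableD absolutely_integrable_mult_continuous' cutoff_complex_continuous h)
    show "(\<lambda>x. norm (h x)) integrable_on {a..b}"
      by (intro absolutely_integrableD h)
    show "norm (h x * of_real (cutoff k c d x)) \<le> norm (h x)" for k x
      using cutoff_bounds[of k c d x] by (simp add: norm_mult mult_left_le)
    show "(\<lambda>k. h x * of_real (cutoff k c d x)) \<longlonglongrightarrow> (if x \<in> {c<..<d} then h x else 0)" for x
    proof (cases "x \<in> {c<..<d}")
      case True
      then have "(\<lambda>k. h x * of_real (cutoff k c d x)) \<longlonglongrightarrow> h x * of_real 1"
        by (intro tendsto_mult tendsto_const tendsto_of_real cutoff_tendsto)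
      with True show ?thesis by simp
    next
      case False
      then have "cutoff k c d x = 0" for k by (rule cutoff_outside)
      then show ?thesis using False by (simp only: if_False of_real_0 mult_zero_right tendsto_const)
    qed
  qed
  also have "integral {a..b} (\<lambda>x. if x \<in> {c<..<d} then h x else 0) = integral ({c<..<d} \<inter> {a..b}) h"
    by (rule HK_restrict_Int)
  also have "{c<..<d} \<inter> {a..b} = {c<..<d}" using cd by auto
  also have "integral {c<..<d} h = integral {c..d} h" by (rule integral_open_interval_real[symmetric])
  finally show ?thesis .
qed

text \<open>
  The lemma of du Bois-Reymond. Let \<open>h = f - \<integral> g\<close>. A difference of two cutoff functions, normalised to have
  integral 0, is the derivative of a test function, so its integral against \<open>h\<close> vanishes. In the limit, the
  means of \<open>h\<close> over any two subintervals agree; hence \<open>h\<close> is constant almost everywhere.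
\<close>

theorem weak_deriv_imp_indefinite_integral:
  fixes f g :: cfn
  assumes ab: "a < b" "{a<..<b} \<subseteq> S"
    and f: "f absolutely_integrable_on {a..b}" and g: "g absolutely_integrable_on {a..b}"
    and weak: "has_weak_deriv S 1 f g"
  shows "\<exists>C. AE x in lebesgue. x \<in> {a..b} \<longrightarrow> f x = C + integral {a..x} g"
proof -
  define G where "G x = integral {a..x} g" for x
  have gi: "g integrable_on {a..b}" using g absolutely_integrable_on_def by blast
  have Gc: "continuous_on {a..b} G"
    unfolding G_def by (rule indefinite_integral_continuous_1[OF gi])
  define h where "h x = f x - G x" for x
  have hai: "h absolutely_integrable_on {a..b}"
    unfolding h_def using f absolutely_integrable_continuous_real[OF Gc] by (rule set_integral_diff)
  then have hi: "h integrable_on {a..b}" using absolutely_integrable_on_def by blast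
  define I where "I k c d = integral {a..b} (cutoff k c d)" for k c d
  define J where "J k c d = integral {a..b} (\<lambda>x. h x * of_real (cutoff k c d x))" for k c d
  have ci: "cutoff k c d integrable_on T" if "T = {s..t}" for k c d T s t
    unfolding that by (intro integrable_continuous_real bump_algebra_continuous cutoff_in)
  have Jlim: "(\<lambda>k. J k c d) \<longlonglongrightarrow> integral {c..d} h"
    if "a < c" "c < d" "d < b" for c d
    unfolding J_def by (rule cutoff_integral_tendsto[OF hai]) (use that in auto)
  have Ilim: "(\<lambda>k. complex_of_real (I k c d)) \<longlonglongrightarrow> of_real (d - c)"
    if "a < c" "c < d" "d < b" for c d
  proof -
    have "(\<lambda>k. integral {a..b} (\<lambda>x. 1 * complex_of_real (cutoff k c d x))) \<longlonglongrightarrow> integral {c..d} (\<lambda>x. 1)"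
      by (rule cutoff_integral_tendsto) (use that in \<open>auto intro!: absolutely_integrable_continuous_real\<close>)
    moreover have "integral {a..b} (\<lambda>x. 1 * complex_of_real (cutoff k c d x)) = of_real (I k c d)" for k
      using integral_linear[OF ci[OF refl] bounded_linear_of_real, of a b k c d] by (simp add: I_def o_def)
    ultimately show ?thesis using that by (simp add: scaleR_conv_of_real)
  qed
  have key: "I k c' d' * J k c d = I k c d * J k c' d'"
    if cd: "a < c" "c < d" "d < b" "a < c'" "c' < d'" "d' < b" for k c d c' d'
  proof -
    \<comment> \<open>a test function whose derivative is a combination of two cutoffs with mean zero\<close>
    define \<psi>' where "\<psi>' x = I k c' d' * cutoff k c d x + (- I k c d) * cutoff k c' d' x" for x
    have \<psi>'_in: "\<psi>' \<in> bump_algebra"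
      unfolding \<psi>'_def[abs_def] by (intro bump_algebra.intros cutoff_in)
    have \<psi>'c: "continuous_on T \<psi>'" for T using bump_algebra_continuous[OF \<psi>'_in] .
    define l r where "l = min c c'" and "r = max d d'"
    have lr: "a < l" "l < r" "r < b" using cd by (auto simp: l_def r_def)
    have \<psi>'0: "\<psi>' x = 0" if "x \<notin> {l<..<r}" for x
    proof -
      have "x \<notin> {c<..<d}" "x \<notin> {c'<..<d'}" using that by (auto simp: l_def r_def)
      then show ?thesis using cutoff_outside[of x c d k] cutoff_outside[of x c' d' k] by (simp add: \<psi>'_def)
    qed
    have \<psi>'int: "integral {a..b} \<psi>' = 0"
    proof -
      have "integral {a..b} \<psi>' = integral {a..b} (\<lambda>x. I k c' d' * cutoff k c d x)
          + integral {a..b} (\<lambda>x. (- I k c d) * cutoff k c' d' x)"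
        unfolding \<psi>'_def by (intro integral_add integrable_on_mult_right ci[OF refl])
      also have "\<dots> = I k c' d' * I k c d + (- I k c d) * I k c' d'"
        unfolding integral_mult_right by (simp only: I_def)
      finally show ?thesis by simp
    qed
    define \<psi> where "\<psi> x = integral {a - 1..x} \<psi>'" for x
    have \<psi>d: "(\<psi> has_real_derivative \<psi>' x) (at x)" for x
    proof (cases "x < l")
      case True
      have "\<psi> y = 0" if "y < l" for y
        unfolding \<psi>_def using that \<psi>'0 by (intro integral_unique has_integral_is_0) auto
      have "((\<lambda>y. 0) has_real_derivative \<psi>' x) (at x)" using True \<psi>'0[of x] by auto
      then show ?thesis
        by (rule has_field_derivative_transform_within_open[where S = "{..<l}"])
           (use True \<open>\<And>y. y < l \<Longrightarrow> \<psi> y = 0\<close> in auto)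
    next
      case False
      have "(\<psi> has_vector_derivative \<psi>' x) (at x within {a - 1..x + 1})"
        unfolding \<psi>_def by (rule integral_has_vector_derivative) (use False lr \<psi>'c in auto)
      moreover have "at x within {a - 1..x + 1} = at x"
        by (rule at_within_interior) (use False lr in auto)
      ultimately show ?thesis by (simp add: has_real_derivative_iff_has_vector_derivative)
    qed
    have \<psi>0: "\<psi> x = 0" if x: "x \<notin> {l..r}" for x
    proof (cases "x < l")
      case True
      then show ?thesis unfolding \<psi>_def using \<psi>'0 by (intro integral_unique has_integral_is_0) auto
    next
      case False
      then have "x > r" using x by auto
      then have "\<psi> x = integral ({a - 1..x} \<inter> {l..r}) \<psi>'"
        unfolding \<psi>_def Int_commute[of _ "{l..r}"] HK_restrict_Int[symmetric]
        by (intro integral_cong) (use \<psi>'0 in auto)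
      also have "{a - 1..x} \<inter> {l..r} = {a..b} \<inter> {l..r}" using lr \<open>x > r\<close> by auto
      also have "integral \<dots> \<psi>' = integral {a..b} \<psi>'"
        unfolding Int_commute[of _ "{l..r}"] HK_restrict_Int[symmetric]
        by (intro integral_cong) (use \<psi>'0 in auto)
      finally show ?thesis using \<psi>'int by simp
    qed
    have test: "test_function S \<psi>"
      by (rule test_functionI[OF \<psi>'_in \<psi>d, of "{l..r}"]) (use lr ab \<psi>0 in auto)
    have der: "deriv \<psi> = \<psi>'" using \<psi>d by (auto intro: DERIV_imp_deriv)
    have \<psi>c: "continuous_on T \<psi>" for T
      by (intro continuous_at_imp_continuous_on ballI DERIV_isCont[OF \<psi>d])
    have eq: "(LINT x:S|lebesgue. f x * of_real (\<psi>' x)) = - (LINT x:S|lebesgue. g x * of_real (\<psi> x))"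
      using weak test unfolding has_weak_deriv_def by (auto simp: der)
    have f\<psi>: "(\<lambda>x. f x * of_real (\<psi>' x)) absolutely_integrable_on {a..b}"
      by (intro absolutely_integrable_mult_continuous' f continuous_on_of_real \<psi>'c)
    have g\<psi>: "(\<lambda>x. g x * of_real (\<psi> x)) absolutely_integrable_on {a..b}"
      by (intro absolutely_integrable_mult_continuous' g continuous_on_of_real \<psi>c)
    have out: "x \<notin> {l<..<r} \<and> x \<notin> {l..r}" if "x \<notin> {a<..<b}" for x using that lr by auto
    have i1: "integral {a..b} (\<lambda>x. f x * of_real (\<psi>' x)) = - integral {a..b} (\<lambda>x. g x * of_real (\<psi> x))"
    proof -
      have "(LINT x:S|lebesgue. f x * of_real (\<psi>' x)) = integral {a..b} (\<lambda>x. f x * of_real (\<psi>' x))"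
        by (rule set_integral_restrict_support[OF f\<psi> ab(2)]) (simp add: \<psi>'0[OF conjunct1[OF out]])
      moreover have "(LINT x:S|lebesgue. g x * of_real (\<psi> x)) = integral {a..b} (\<lambda>x. g x * of_real (\<psi> x))"
        by (rule set_integral_restrict_support[OF g\<psi> ab(2)]) (simp add: \<psi>0[OF conjunct2[OF out]])
      ultimately show ?thesis using eq by simp
    qed
    have i2: "integral {a..b} (\<lambda>x. g x * of_real (\<psi> x)) =
        G b * of_real (\<psi> b) - G a * of_real (\<psi> a) - integral {a..b} (\<lambda>x. G x * of_real (\<psi>' x))"
    proof (rule integral_by_parts_indefinite[where G = G and h = "\<lambda>x. of_real (\<psi> x)" and h' = "\<lambda>x. of_real (\<psi>' x)",
          OF less_imp_le[OF ab(1)] g])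
      show "G x = G a + integral {a..x} g" for x by (simp add: G_def)
      show "((\<lambda>x. complex_of_real (\<psi> x)) has_vector_derivative of_real (\<psi>' x)) (at x within {a..b})" for x
        by (rule has_vector_derivative_of_real[OF has_field_derivative_at_within[OF \<psi>d]])
      show "continuous_on {a..b} (\<lambda>x. complex_of_real (\<psi>' x))" by (intro continuous_intros \<psi>'c)
    qed
    have "\<psi> b = 0" "\<psi> a = 0" using \<psi>0 lr by auto
    with i1 i2 have "integral {a..b} (\<lambda>x. f x * of_real (\<psi>' x)) - integral {a..b} (\<lambda>x. G x * of_real (\<psi>' x)) = 0" by simp
    moreover have "(\<lambda>x. G x * of_real (\<psi>' x)) integrable_on {a..b}"
      by (intro integrable_continuous_real continuous_intros Gc \<psi>'c)
    moreover have "(\<lambda>x. f x * of_real (\<psi>' x)) integrable_on {a..b}"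
      by (intro absolutely_integrableD f\<psi>)
    ultimately have z: "integral {a..b} (\<lambda>x. h x * of_real (\<psi>' x)) = 0"
      unfolding h_def by (simp add: left_diff_distrib HK_integral_diff)
    have hc: "(\<lambda>x. h x * of_real (cutoff k c d x)) integrable_on {a..b}" for c d
      by (intro absolutely_integrableD absolutely_integrable_mult_continuous' cutoff_complex_continuous hai)
    have "integral {a..b} (\<lambda>x. h x * of_real (\<psi>' x)) =
       integral {a..b} (\<lambda>x. of_real (I k c' d') * (h x * of_real (cutoff k c d x)) - of_real (I k c d) * (h x * of_real (cutoff k c' d' x)))"
      by (rule integral_cong) (simp add: \<psi>'_def algebra_simps)
    also have "\<dots> = integral {a..b} (\<lambda>x. of_real (I k c' d') * (h x * of_real (cutoff k c d x)))
        - integral {a..b} (\<lambda>x. of_real (I k c d) * (h x * of_real (cutoff k c' d' x)))"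
      by (rule HK_integral_diff) (rule integrable_on_mult_right hc)+
    also have "\<dots> = I k c' d' * J k c d - I k c d * J k c' d'"
      unfolding integral_mult_right by (simp only: J_def)
    finally show ?thesis using z by simp
  qed
  have mean: "(d' - c') * integral {c..d} h = (d - c) * integral {c'..d'} h"
    if cd: "a < c" "c < d" "d < b" "a < c'" "c' < d'" "d' < b" for c d c' d'
  proof -
    have "(\<lambda>k. I k c' d' * J k c d) \<longlonglongrightarrow> of_real (d' - c') * integral {c..d} h"
      by (intro tendsto_mult Ilim Jlim) (use cd in auto)
    moreover have "(\<lambda>k. I k c d * J k c' d') \<longlonglongrightarrow> of_real (d - c) * integral {c'..d'} h"
      by (intro tendsto_mult Ilim Jlim) (use cd in auto)
    ultimately show ?thesis unfolding key[OF cd] using LIMSEQ_unique by force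
  qed
  define l r where "l = a + (b - a) / 3" and "r = a + 2 * (b - a) / 3"
  have lr: "a < l" "l < r" "r < b" using ab(1) by (auto simp: l_def r_def field_simps)
  define C where "C = integral {l..r} h / (r - l)"
  have "AE x in lebesgue. x \<in> {a..b} \<longrightarrow> h x - C = 0"
  proof (rule interval_integrals_zero_imp_AE_zero)
    show "(\<lambda>x. h x - C) integrable_on {a..b}" by (intro integrable_diff hi) auto
    fix c d assume cd: "a < c" "c < d" "d < b"
    have "h integrable_on {c..d}" using hi by (rule integrable_on_subinterval) (use cd in auto)
    then have "integral {c..d} (\<lambda>x. h x - C) = integral {c..d} h - (d - c) * C"
      using cd HK_integral_diff[of h "{c..d}" "\<lambda>x. C"]
        integrable_continuous_real[OF continuous_on_const[of "{c..d}" C]]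
      by (simp add: scaleR_conv_of_real)
    also have "\<dots> = 0" using mean[OF cd lr] lr by (simp add: C_def field_simps)
    finally show "integral {c..d} (\<lambda>x. h x - C) = 0" .
  qed
  then have "AE x in lebesgue. x \<in> {a..b} \<longrightarrow> f x = C + integral {a..x} g"
    by (rule AE_mp) (auto simp: h_def G_def algebra_simps)
  then show ?thesis by blast
qed

section \<open>Continuous representatives of Sobolev functions\<close>

lemma AE_on_negligibleE:
  assumes "AE x in lebesgue. x \<in> S \<longrightarrow> P x"
  obtains Z where "negligible Z" "\<And>x. x \<in> S - Z \<Longrightarrow> P x"
proof -
  obtain Z where "Z \<in> null_sets lebesgue" "{x \<in> space lebesgue. \<not> (x \<in> S \<longrightarrow> P x)} \<subseteq> Z"
    using assms unfolding eventually_ae_filter by blast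
  then show ?thesis using that[of Z] by (auto simp: negligible_iff_null_sets)
qed

lemma negligible_AE_on:
  assumes "negligible Z" "\<And>x. x \<in> S - Z \<Longrightarrow> P x"
  shows "AE x in lebesgue. x \<in> S \<longrightarrow> P x"
  using assms by (intro AE_I'[of Z]) (auto simp: negligible_iff_null_sets)

lemma integral_cong_AE_on:
  fixes f g :: "real \<Rightarrow> 'b::euclidean_space"
  assumes "AE x in lebesgue. x \<in> S \<longrightarrow> f x = g x" "T \<subseteq> S"
  shows "integral T f = integral T g" "f integrable_on T \<longleftrightarrow> g integrable_on T"
    "f absolutely_integrable_on T \<longleftrightarrow> g absolutely_integrable_on T"
proof -
  obtain Z where Z: "negligible Z" "\<And>x. x \<in> S - Z \<Longrightarrow> f x = g x"
    using AE_on_negligibleE[OF assms(1)] by metis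
  show "integral T f = integral T g"
    by (rule integral_spike[OF Z(1)]) (use Z(2) assms(2) in auto)
  show "f integrable_on T \<longleftrightarrow> g integrable_on T"
    unfolding integrable_on_def by (intro ex_cong1 has_integral_spike_eq[OF Z(1)]) (use Z(2) assms(2) in force)
  moreover have "(\<lambda>x. norm (f x)) integrable_on T \<longleftrightarrow> (\<lambda>x. norm (g x)) integrable_on T"
    unfolding integrable_on_def by (intro ex_cong1 has_integral_spike_eq[OF Z(1)]) (use Z(2) assms(2) in force)
  ultimately show "f absolutely_integrable_on T \<longleftrightarrow> g absolutely_integrable_on T"
    unfolding absolutely_integrable_on_def by simp
qed

lemma continuous_AE_eq_on_interval:
  fixes f g :: cfn
  assumes ab: "a < b" and f: "continuous_on {a..b} f" and g: "continuous_on {a..b} g"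
    and eq: "AE x in lebesgue. x \<in> {a..b} \<longrightarrow> f x = g x" and x: "x \<in> {a..b}"
  shows "f x = g x"
proof -
  have "((\<lambda>u. integral {a..u} f) has_vector_derivative f x) (at x within {a..b})"
    using integral_has_vector_derivative[OF f x] .
  moreover have "((\<lambda>u. integral {a..u} f) has_vector_derivative g x) (at x within {a..b})"
    by (rule has_vector_derivative_transform[OF x _ integral_has_vector_derivative[OF g x]])
      (rule integral_cong_AE_on(1)[OF eq], auto)
  ultimately show ?thesis using vector_derivative_unique_within_closed_interval[OF ab x[folded cbox_interval]]
    by (metis cbox_interval)
qed

lemma square_integrable_imp_absolutely_integrable:
  assumes "square_integrable_on {0..1} u"
  shows "u absolutely_integrable_on {0..1}" "(\<lambda>x. (norm (u x))\<^sup>2) integrable_on {0..1}"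
    "integral {0..1} (\<lambda>x. (norm (u x))\<^sup>2) = (L2_norm_01 u)\<^sup>2"
    "integral {0..1} (\<lambda>x. norm (u x)) \<le> (1 + (L2_norm_01 u)\<^sup>2) / 2"
proof -
  have m: "set_borel_measurable lebesgue {0..1} u" and i: "set_integrable lebesgue {0..1} (\<lambda>x. (norm (u x))\<^sup>2)"
    using assms unfolding square_integrable_on_def by auto
  have le: "norm (u x) \<le> (1 + (norm (u x))\<^sup>2) / 2" for x
    using sum_squares_bound[of 1 "norm (u x)"] by (simp add: power2_eq_square)
  have i1: "set_integrable lebesgue {0..1} (\<lambda>x. (1 + (norm (u x))\<^sup>2) / 2)"
    by (intro set_integrable_divide set_integral_add i) auto
  show ui: "u absolutely_integrable_on {0..1}"
    by (rule set_integrable_bound[OF i1 m]) (use le in \<open>auto intro: order_trans\<close>)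
  show ii: "(\<lambda>x. (norm (u x))\<^sup>2) integrable_on {0..1}"
    using set_lebesgue_integral_eq_integral(1)[OF i] .
  show eq: "integral {0..1} (\<lambda>x. (norm (u x))\<^sup>2) = (L2_norm_01 u)\<^sup>2"
    unfolding L2_norm_01_def using set_lebesgue_integral_eq_integral(2)[OF i]
    by (subst real_sqrt_pow2) (auto intro!: integral_nonneg ii)
  have "integral {0..1} (\<lambda>x. norm (u x)) \<le> integral {0..1} (\<lambda>x. (1 + (norm (u x))\<^sup>2) / 2)"
    by (rule integral_le) (use absolutely_integrableD[OF ui] set_lebesgue_integral_eq_integral(1)[OF i1] le in auto)
  also have "\<dots> = (1 + (L2_norm_01 u)\<^sup>2) / 2"
    using ii integral_add[of "\<lambda>x. 1" "{0..1}" "\<lambda>x. (norm (u x))\<^sup>2"]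
      integrable_continuous_real[OF continuous_on_const[of "{0..1}" "1::real"]] by (simp add: eq[symmetric])
  finally show "integral {0..1} (\<lambda>x. norm (u x)) \<le> (1 + (L2_norm_01 u)\<^sup>2) / 2" .
qed

lemma L2_per_absolutely_integrable:
  assumes "u \<in> L2_per"
  shows "u absolutely_integrable_on {0..2}"
proof -
  have per: "u (x + 1) = u x" for x
    using assms unfolding L2_per_def by auto
  have sq: "square_integrable_on {0..1} u"
    using assms unfolding L2_per_def by auto
  have per': "u (x - 1) = u x" for x using per[of "x - 1"] by simp
  have u: "u absolutely_integrable_on {0..1}"
    using square_integrable_imp_absolutely_integrable[OF sq] by blast
  have "u absolutely_integrable_on {1..2}"
    unfolding absolutely_integrable_on_def
    using integrable_shift_real_ivl[OF absolutely_integrableD(1)[OF u], of "-1"]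
      integrable_shift_real_ivl[OF absolutely_integrableD(2)[OF u], of "-1"] by (simp add: per')
  then have "u absolutely_integrable_on {0..1} \<union> {1..2}" using u by (intro set_integrable_Un) auto
  also have "{0..1} \<union> {1..2} = {0..2::real}" by auto
  finally show ?thesis .
qed

text \<open>
  The classical content of membership in \<open>H\<^sup>N\<close> on one period: \<open>a j\<close> represents the \<open>j\<close>-th derivative, every
  derivative below the top one is continuous, periodic and bounded by \<open>M\<close>, and the top one is in \<open>L\<^sup>2\<close>. Nothing is
  said about \<open>a j\<close> for \<open>j > N\<close>.
\<close>

definition sobolev_jet :: "nat \<Rightarrow> real \<Rightarrow> (nat \<Rightarrow> cfn) \<Rightarrow> bool" where
  "sobolev_jet N M a \<longleftrightarrow>
     (\<forall>j<N. continuous_on {0..1} (a j) \<and> a j 1 = a j 0 \<and>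
        (\<forall>x\<in>{0..1}. a j x = a j 0 + integral {0..x} (a (Suc j)) \<and> norm (a j x) \<le> M)) \<and>
     a N absolutely_integrable_on {0..1} \<and>
     (\<lambda>x. (norm (a N x))\<^sup>2) integrable_on {0..1} \<and>
     integral {0..1} (\<lambda>x. (norm (a N x))\<^sup>2) \<le> M"

lemma weak_deriv_0_AE_eq:
  fixes f g :: cfn
  assumes ab: "a < b" "{a<..<b} \<subseteq> S" and f: "f absolutely_integrable_on {a..b}"
    and g: "g absolutely_integrable_on {a..b}" and weak: "has_weak_deriv S 0 f g"
  shows "AE x in lebesgue. x \<in> {a..b} \<longrightarrow> f x = g x"
proof -
  define h where "h x = f x - g x" for x
  have h: "h absolutely_integrable_on {a..b}" unfolding h_def by (intro set_integral_diff f g)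
  have "AE x in lebesgue. x \<in> {a..b} \<longrightarrow> h x = 0"
  proof (rule interval_integrals_zero_imp_AE_zero)
    show "h integrable_on {a..b}" by (rule absolutely_integrableD[OF h])
    fix c d assume cd: "a < c" "c < d" "d < b"
    have z: "integral {a..b} (\<lambda>x. h x * of_real (cutoff k c d x)) = 0" for k
    proof -
      let ?\<psi> = "cutoff k c d"
      obtain \<psi>' where "\<psi>' \<in> bump_algebra" "\<And>x. (?\<psi> has_real_derivative \<psi>' x) (at x)"
        using bump_algebra_deriv[OF cutoff_in] by blast
      then have t: "test_function S ?\<psi>"
        by (rule test_functionI[where K = "{c..d}"]) (use cd ab in \<open>auto intro!: cutoff_outside\<close>)
      have out: "?\<psi> x = 0" if "x \<notin> {a<..<b}" for x by (rule cutoff_outside) (use that cd in auto)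
      have fi: "(\<lambda>x. f x * of_real (?\<psi> x)) absolutely_integrable_on {a..b}"
         "(\<lambda>x. g x * of_real (?\<psi> x)) absolutely_integrable_on {a..b}"
        by (intro absolutely_integrable_mult_continuous' cutoff_complex_continuous f g)+
      have "(LINT x:S|lebesgue. f x * of_real (?\<psi> x)) = (LINT x:S|lebesgue. g x * of_real (?\<psi> x))"
        using weak t unfolding has_weak_deriv_def by auto
      then have "integral {a..b} (\<lambda>x. f x * of_real (?\<psi> x)) = integral {a..b} (\<lambda>x. g x * of_real (?\<psi> x))"
        by (subst (asm) (1 2) set_integral_restrict_support[OF _ ab(2)]) (use fi out in auto)
      then show ?thesis unfolding h_def
        using absolutely_integrableD(1)[OF fi(1)] absolutely_integrableD(1)[OF fi(2)]
        by (simp add: left_diff_distrib HK_integral_diff)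
    qed
    have "(\<lambda>k. integral {a..b} (\<lambda>x. h x * of_real (cutoff k c d x))) \<longlonglongrightarrow> integral {c..d} h"
      by (rule cutoff_integral_tendsto[OF h]) (use cd in auto)
    then show "integral {c..d} h = 0" unfolding z using LIMSEQ_unique tendsto_const by blast
  qed
  then show ?thesis by (simp add: h_def)
qed

lemma negligible_shift_AE:
  assumes "AE x in lebesgue. x \<in> {0..2} \<longrightarrow> P x"
  shows "AE x in lebesgue. x \<in> {0..1::real} \<longrightarrow> P (x + 1)"
proof -
  obtain Z where Z: "negligible Z" "\<And>x. x \<in> {0..2} - Z \<Longrightarrow> P x"
    using AE_on_negligibleE[OF assms] by metis
  have "negligible ((+) (-1) ` Z)" using Z(1) by (rule negligible_translation)
  then show ?thesis
  proof (rule negligible_AE_on)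
    fix x assume x: "x \<in> {0..1} - (+) (-1) ` Z"
    have "x + 1 \<notin> Z"
    proof
      assume "x + 1 \<in> Z"
      then have "(-1) + (x + 1) \<in> (+) (-1) ` Z" by (rule imageI)
      with x show False by simp
    qed
    with Z(2)[of "x + 1"] x show "P (x + 1)" by simp
  qed
qed

text \<open>
  The \<open>j\<close>-th weak derivative is a primitive of the next one. Working on \<open>{0..2}\<close>, two periods, allows the
  values at 0 and 1 of the continuous representative to be compared. The sup bound comes from the mean value
  of \<open>\<bar>a j\<bar>\<close> and the total variation; both are at most \<open>(1 + R\<^sup>2) / 2\<close> since \<open>t \<le> (1 + t\<^sup>2) / 2\<close>.
\<close>

theorem H_per_sobolev_jet:
  assumes u: "u \<in> H_per N" and N: "N \<ge> 1" and R: "H_norm N u \<le> R"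
  obtains a where "sobolev_jet N (1 + R\<^sup>2) a"
    "\<And>j. j \<le> N \<Longrightarrow> AE x in lebesgue. x \<in> {0..1} \<longrightarrow> weak_deriv j u x = a j x"
    "AE x in lebesgue. x \<in> {0..1} \<longrightarrow> u x = a 0 x"
proof -
  define v where "v j = weak_deriv j u" for j
  have v: "v j \<in> L2_per" "has_weak_deriv UNIV j u (v j)" if "j \<le> N" for j
  proof -
    have "\<exists>v. v \<in> L2_per \<and> has_weak_deriv UNIV j u v" using u that unfolding H_per_def by blast
    from someI_ex[OF this] show "v j \<in> L2_per" "has_weak_deriv UNIV j u (v j)"
      unfolding v_def weak_deriv_def by auto
  qed
  have per: "v j (x + 1) = v j x" if "j \<le> N" for j x
    using v(1)[OF that] unfolding L2_per_def by blast
  have sq: "square_integrable_on {0..1} (v j)" if "j \<le> N" for j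
    using v(1)[OF that] unfolding L2_per_def by blast
  have ai: "v j absolutely_integrable_on {0..2}" if "j \<le> N" for j
    using v(1)[OF that] by (rule L2_per_absolutely_integrable)
  have "(L2_norm_01 (v j))\<^sup>2 \<le> R\<^sup>2" if "j \<le> N" for j
  proof -
    have "(L2_norm_01 (v j))\<^sup>2 \<le> (\<Sum>j\<le>N. (L2_norm_01 (v j))\<^sup>2)"
      using that by (intro member_le_sum) auto
    also have "\<dots> = (H_norm N u)\<^sup>2"
      unfolding H_norm_def v_def by (subst real_sqrt_pow2) (auto intro: sum_nonneg)
    also have "\<dots> \<le> R\<^sup>2" using R by (intro power_mono) (auto simp: H_norm_def intro!: sum_nonneg)
    finally show ?thesis .
  qed
  note L2 = this
  have step: "has_weak_deriv UNIV 1 (v j) (v (Suc j))" if j: "Suc j \<le> N" for j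
    unfolding has_weak_deriv_def
  proof (intro allI impI)
    fix \<psi> assume t: "test_function UNIV \<psi>"
    have "(LINT x:UNIV|lebesgue. u x * complex_of_real ((deriv ^^ j) (deriv \<psi>) x)) =
        (-1) ^ j * (LINT x:UNIV|lebesgue. v j x * complex_of_real (deriv \<psi> x))"
      using v(2)[of j] j test_function_deriv[OF t] unfolding has_weak_deriv_def by auto
    moreover have "(LINT x:UNIV|lebesgue. u x * complex_of_real ((deriv ^^ Suc j) \<psi> x)) =
        (-1) ^ Suc j * (LINT x:UNIV|lebesgue. v (Suc j) x * complex_of_real (\<psi> x))"
      using v(2)[of "Suc j"] j t unfolding has_weak_deriv_def by auto
    ultimately have "(-1) ^ j * (LINT x:UNIV|lebesgue. v j x * complex_of_real (deriv \<psi> x)) =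
        (-1) ^ j * (- (LINT x:UNIV|lebesgue. v (Suc j) x * complex_of_real (\<psi> x)))"
      unfolding funpow_Suc_right comp_apply by simp
    then have "(LINT x:UNIV|lebesgue. v j x * complex_of_real (deriv \<psi> x)) =
        - (LINT x:UNIV|lebesgue. v (Suc j) x * complex_of_real (\<psi> x))"
      by (simp only: mult_cancel_left) auto
    then show "(LINT x:UNIV|lebesgue. v j x * complex_of_real ((deriv ^^ 1) \<psi> x)) =
        (-1) ^ 1 * (LINT x:UNIV|lebesgue. v (Suc j) x * complex_of_real (\<psi> x))" by simp
  qed
  have "\<forall>j. \<exists>C. Suc j \<le> N \<longrightarrow> (AE x in lebesgue. x \<in> {0..2} \<longrightarrow> v j x = C + integral {0..x} (v (Suc j)))"
  proof (intro allI)
    fix j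
    show "\<exists>C. Suc j \<le> N \<longrightarrow> (AE x in lebesgue. x \<in> {0..2} \<longrightarrow> v j x = C + integral {0..x} (v (Suc j)))"
    proof (cases "Suc j \<le> N")
      case True
      then show ?thesis
        using weak_deriv_imp_indefinite_integral[of 0 2 UNIV "v j" "v (Suc j)", OF _ _ ai ai step] by simp
    qed simp
  qed
  then obtain C where C: "\<And>j. Suc j \<le> N \<Longrightarrow>
      AE x in lebesgue. x \<in> {0..2} \<longrightarrow> v j x = C j + integral {0..x} (v (Suc j))"
    by metis
  define a where "a j = (if j < N then (\<lambda>x. C j + integral {0..x} (v (Suc j))) else v N)" for j
  have eq: "AE x in lebesgue. x \<in> {0..2} \<longrightarrow> v j x = a j x" if "j \<le> N" for j
    using that C[of j] by (cases "j < N") (auto simp: a_def)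
  have eq1: "AE x in lebesgue. x \<in> {0..1} \<longrightarrow> v j x = a j x" if "j \<le> N" for j
    using eq[OF that] by (rule AE_mp) (auto intro!: AE_I2)
  have ac: "continuous_on {0..2} (a j)" if "j < N" for j
  proof -
    have "continuous_on {0..2} (\<lambda>x. C j + integral {0..x} (v (Suc j)))"
      by (intro continuous_on_add continuous_on_const indefinite_integral_continuous_1
          absolutely_integrableD(1) ai) (use that in simp)
    then show ?thesis using that by (simp add: a_def)
  qed
  have prim: "a j x = a j 0 + integral {0..x} (v (Suc j))" if "j < N" for j x
    using that by (simp add: a_def)
  have prim': "a j x = a j 0 + integral {0..x} (a (Suc j))" if "j < N" "x \<in> {0..1}" for j x
  proof -
    have "integral {0..x} (v (Suc j)) = integral {0..x} (a (Suc j))"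
      by (rule integral_cong_AE_on(1)[OF eq]) (use that in auto)
    then show ?thesis using prim[OF that(1), of x] by simp
  qed
  have per_a: "a j 1 = a j 0" if j: "j < N" for j
  proof -
    have "a j (0 + 1) = a j 0"
    proof (rule continuous_AE_eq_on_interval[where f = "\<lambda>x. a j (x + 1)"])
      show "continuous_on {0..1} (\<lambda>x. a j (x + 1))"
        by (rule continuous_on_compose2[OF ac[OF j]]) (auto intro!: continuous_intros)
      show "continuous_on {0..1} (a j)" using ac[OF j] by (rule continuous_on_subset) auto
      have "AE x in lebesgue. x \<in> {0..1} \<longrightarrow> v j (x + 1) = a j (x + 1)"
        by (rule negligible_shift_AE[OF eq]) (use j in auto)
      with eq1[OF less_imp_le[OF j]] show "AE x in lebesgue. x \<in> {0..1} \<longrightarrow> a j (x + 1) = a j x"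
        by eventually_elim (use per[OF less_imp_le[OF j]] in auto)
    qed auto
    then show ?thesis by simp
  qed
  have L1: "integral {0..1} (\<lambda>x. norm (v j x)) \<le> (1 + R\<^sup>2) / 2" if "j \<le> N" for j
    using square_integrable_imp_absolutely_integrable(4)[OF sq[OF that]] L2[OF that] by auto
  have bound: "norm (a j x) \<le> 1 + R\<^sup>2" if j: "j < N" and x: "x \<in> {0..1}" for j x
  proof -
    have vi: "v (Suc j) absolutely_integrable_on {0..1}"
      by (rule square_integrable_imp_absolutely_integrable(1)[OF sq]) (use j in auto)
    note vi' = absolutely_integrableD[OF vi]
    have d: "norm (a j t - a j s) \<le> (1 + R\<^sup>2) / 2" if "0 \<le> s" "s \<le> t" "t \<le> 1" for s t
    proof -
      have "a j t - a j s = integral {s..t} (v (Suc j))"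
        using prim[OF j, of t] prim[OF j, of s] integral_split_diff(1)[OF vi'(1), of s t] that by simp
      also have "norm \<dots> \<le> integral {s..t} (\<lambda>x. norm (v (Suc j) x))"
        by (rule integral_norm_bound_integral)
          (use integral_split_diff(2)[OF vi'(1), of s t] integral_split_diff(2)[OF vi'(2), of s t] that in auto)
      also have "\<dots> \<le> integral {0..1} (\<lambda>x. norm (v (Suc j) x))"
        by (rule integral_subset_le) (use vi' that integral_split_diff(2)[OF vi'(2), of s t] in auto)
      also have "\<dots> \<le> (1 + R\<^sup>2) / 2" using L1[of "Suc j"] j by auto
      finally show ?thesis .
    qed
    have le: "norm (a j x) \<le> norm (a j y) + (1 + R\<^sup>2) / 2" if y: "y \<in> {0..1}" for y
    proof -
      have "norm (a j x - a j y) \<le> (1 + R\<^sup>2) / 2"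
        using d[of x y] d[of y x] x y by (cases "x \<le> y") (auto simp: norm_minus_commute)
      then show ?thesis using norm_triangle_ineq2[of "a j x" "a j y"] by linarith
    qed
    have c: "continuous_on {0..1} (a j)" using ac[OF j] by (rule continuous_on_subset) auto
    have "norm (a j x) = integral {0..1} (\<lambda>y::real. norm (a j x))" by simp
    also have "\<dots> \<le> integral {0..1} (\<lambda>y. norm (a j y) + (1 + R\<^sup>2) / 2)"
      by (rule integral_le) (use le c in \<open>auto intro!: integrable_continuous_real continuous_intros\<close>)
    also have "\<dots> = integral {0..1} (\<lambda>y. norm (a j y)) + (1 + R\<^sup>2) / 2"
      by (subst integral_add) (use c in \<open>auto intro!: integrable_continuous_real continuous_intros\<close>)
    also have "integral {0..1} (\<lambda>y. norm (a j y)) = integral {0..1} (\<lambda>y. norm (v j y))"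
      by (rule integral_cong_AE_on(1)[of "{0..1}"]) (use eq1[OF less_imp_le[OF j]] in \<open>auto elim!: eventually_mono\<close>)
    also have "\<dots> \<le> (1 + R\<^sup>2) / 2" using L1 j by auto
    finally show ?thesis by simp
  qed
  have jet: "sobolev_jet N (1 + R\<^sup>2) a"
    unfolding sobolev_jet_def
  proof (intro conjI allI impI ballI)
    fix j assume "j < N"
    then show "continuous_on {0..1} (a j)" by (intro continuous_on_subset[OF ac]) auto
  next
    have aN: "a N = v N" by (simp add: a_def)
    note s = square_integrable_imp_absolutely_integrable[OF sq[OF order_refl]]
    show "a N absolutely_integrable_on {0..1}" "(\<lambda>x. (norm (a N x))\<^sup>2) integrable_on {0..1}"
      unfolding aN by (rule s)+
    show "integral {0..1} (\<lambda>x. (norm (a N x))\<^sup>2) \<le> 1 + R\<^sup>2"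
      unfolding aN s using L2[OF order_refl] by simp
    show "\<And>j. j < N \<Longrightarrow> a j 1 = a j 0" by (rule per_a)
    show "\<And>j x. j < N \<Longrightarrow> x \<in> {0..1} \<Longrightarrow> a j x = a j 0 + integral {0..x} (a (Suc j))" by (rule prim')
    show "\<And>j x. j < N \<Longrightarrow> x \<in> {0..1} \<Longrightarrow> norm (a j x) \<le> 1 + R\<^sup>2" by (rule bound)
  qed
  have "u \<in> L2_per" using u unfolding H_per_def by auto
  then have "AE x in lebesgue. x \<in> {0..2} \<longrightarrow> u x = v 0 x"
    by (intro weak_deriv_0_AE_eq[where S = UNIV] L2_per_absolutely_integrable v) auto
  with eq[OF le0] have "AE x in lebesgue. x \<in> {0..1} \<longrightarrow> u x = a 0 x"
    by eventually_elim auto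
  with jet eq1 show ?thesis using that[of a] unfolding v_def by blast
qed

section \<open>The Dirichlet operator in classical terms\<close>

lemma continuous_imp_square_integrable:
  assumes "continuous_on {0..1} u"
  shows "square_integrable_on {0..1} u"
proof -
  have "(\<lambda>x. complex_of_real ((norm (u x))\<^sup>2)) absolutely_integrable_on {0..1}"
    by (intro absolutely_integrable_continuous_real continuous_intros assms)
  then have "set_integrable lebesgue {0..1} (\<lambda>x. Re (complex_of_real ((norm (u x))\<^sup>2)))"
    unfolding set_integrable_def by (auto dest: integrable_Re)
  moreover have "set_borel_measurable lebesgue {0..1} u"
    using absolutely_integrable_continuous_real[OF assms] unfolding set_integrable_def set_borel_measurable_def
    by (rule borel_measurable_integrable)
  ultimately show ?thesis unfolding square_integrable_on_def by simp
qed

lemma H1_01_weak_deriv_imp_integral: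
  assumes F: "continuous_on {0..1} F" and D: "square_integrable_on {0..1} D"
    and weak: "has_weak_deriv {0<..<1} 1 F D" and x: "x \<in> {0..1}"
  shows "F x = F 0 + integral {0..x} D"
proof -
  note Di = square_integrable_imp_absolutely_integrable(1)[OF D]
  obtain C where C: "AE x in lebesgue. x \<in> {0..1} \<longrightarrow> F x = C + integral {0..x} D"
    using weak_deriv_imp_indefinite_integral[OF _ _ absolutely_integrable_continuous_real[OF F] Di weak] by auto
  have eq: "F y = C + integral {0..y} D" if "y \<in> {0..1}" for y
    by (rule continuous_AE_eq_on_interval[OF _ F _ C that])
      (auto intro!: continuous_intros indefinite_integral_continuous_1 absolutely_integrableD Di)
  show ?thesis using eq[of 0] eq[OF x] by simp
qed

lemma classical_imp_weak_deriv:
  assumes F: "\<And>x. x \<in> {0..1} \<Longrightarrow> (F has_vector_derivative D x) (at x within {0..1})"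
    and D: "continuous_on {0..1} D"
  shows "has_weak_deriv {0<..<1} 1 F D"
  unfolding has_weak_deriv_def
proof (intro allI impI)
  fix \<psi> assume t: "test_function {0<..<1} \<psi>"
  then obtain K where K: "K \<subseteq> {0<..<1}" "\<And>x. x \<notin> K \<Longrightarrow> \<psi> x = 0"
    unfolding test_function_def by blast
  have sm: "(deriv ^^ k) \<psi> field_differentiable at x" for k x
    using t unfolding test_function_def by blast
  have d: "(\<psi> has_real_derivative deriv \<psi> x) (at x)" for x
    using sm[of 0 x] by (simp add: field_differentiable_derivI)
  have d': "(deriv \<psi> has_real_derivative deriv (deriv \<psi>) x) (at x)" for x
    using sm[of 1 x] by (simp add: field_differentiable_derivI)
  have c: "continuous_on T \<psi>" "continuous_on T (deriv \<psi>)" for T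
    by (intro continuous_at_imp_continuous_on ballI DERIV_isCont[OF d] DERIV_isCont[OF d'])+
  have Fc: "continuous_on {0..1} F"
    using F continuous_on_eq_continuous_within has_vector_derivative_continuous by blast
  have i1: "(\<lambda>x. F x * complex_of_real (deriv \<psi> x)) absolutely_integrable_on {0..1}"
    by (intro absolutely_integrable_continuous_real continuous_intros Fc c)
  have i2: "(\<lambda>x. D x * complex_of_real (\<psi> x)) absolutely_integrable_on {0..1}"
    by (intro absolutely_integrable_continuous_real continuous_intros D c)
  have prim: "F x = F 0 + integral {0..x} D" if "x \<in> {0..1}" for x
  proof -
    have "(D has_integral F x - F 0) {0..x}"
      by (rule fundamental_theorem_of_calculus)
        (use that in \<open>auto intro!: has_vector_derivative_within_subset[OF F]\<close>)
    then show ?thesis by (simp add: integral_unique)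
  qed
  have "integral {0..1} (\<lambda>x. D x * complex_of_real (\<psi> x)) =
      F 1 * of_real (\<psi> 1) - F 0 * of_real (\<psi> 0) - integral {0..1} (\<lambda>x. F x * of_real (deriv \<psi> x))"
  proof (rule integral_by_parts_indefinite[where G = F and h = "\<lambda>x. of_real (\<psi> x)" and h' = "\<lambda>x. of_real (deriv \<psi> x)"])
    show "((\<lambda>x. complex_of_real (\<psi> x)) has_vector_derivative of_real (deriv \<psi> x)) (at x within {0..1})" for x
      by (rule has_vector_derivative_of_real[OF has_field_derivative_at_within[OF d]])
    show "continuous_on {0..1} (\<lambda>x. complex_of_real (deriv \<psi> x))"
      by (intro continuous_on_of_real c)
    show "D absolutely_integrable_on {0..1}" using D by (rule absolutely_integrable_continuous_real)
  qed (simp, rule prim)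
  moreover have "\<psi> 1 = 0" "\<psi> 0 = 0" using K(1) by (auto intro!: K(2))
  ultimately show "(LINT x:{0<..<1}|lebesgue. F x * complex_of_real ((deriv ^^ 1) \<psi> x)) =
      (-1) ^ 1 * (LINT x:{0<..<1}|lebesgue. D x * complex_of_real (\<psi> x))"
    using set_integral_restrict_support[OF i1, of "{0<..<1}"] set_integral_restrict_support[OF i2, of "{0<..<1}"]
    by simp
qed

text \<open>
  For continuous potentials and right-hand sides the weak derivatives of a solution have continuous
  representatives, so the solution is classical.
\<close>

theorem ZS_dirichlet_classical:
  assumes p: "continuous_on {0..1} p" and q: "continuous_on {0..1} q"
    and \<phi>1: "AE x in lebesgue. x \<in> {0..1} \<longrightarrow> fst \<phi> x = p x"
    and \<phi>2: "AE x in lebesgue. x \<in> {0..1} \<longrightarrow> snd \<phi> x = q x"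
    and G: "continuous_on {0..1} (fst G)" "continuous_on {0..1} (snd G)"
  shows "ZS_dirichlet \<phi> F G \<longleftrightarrow>
    fst F 0 = snd F 0 \<and> fst F 1 = snd F 1 \<and> (\<forall>x. x \<notin> {0..1} \<longrightarrow> fst F x = 0 \<and> snd F x = 0) \<and>
    (\<forall>x\<in>{0..1}. (fst F has_vector_derivative - \<i> * fst G x + \<i> * p x * snd F x) (at x within {0..1}) \<and>
       (snd F has_vector_derivative \<i> * snd G x - \<i> * q x * fst F x) (at x within {0..1}))"
    (is "?L \<longleftrightarrow> ?R")
proof
  assume ?L
  then obtain D1 D2 where D: "square_integrable_on {0..1} D1" "has_weak_deriv {0<..<1} 1 (fst F) D1"
    "square_integrable_on {0..1} D2" "has_weak_deriv {0<..<1} 1 (snd F) D2"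
    and ae: "AE x in lebesgue. x \<in> {0..1} \<longrightarrow>
                 fst G x = \<i> * D1 x + fst \<phi> x * snd F x \<and>
                 snd G x = - \<i> * D2 x + snd \<phi> x * fst F x"
    and dom: "F \<in> dirichlet_domain"
    unfolding ZS_dirichlet_def by blast
  have c: "continuous_on {0..1} (fst F)" "continuous_on {0..1} (snd F)"
    using dom unfolding dirichlet_domain_def H1_01_def by (auto simp: mem_Times_iff)
  let ?D1 = "\<lambda>x. - \<i> * fst G x + \<i> * p x * snd F x" and ?D2 = "\<lambda>x. \<i> * snd G x - \<i> * q x * fst F x"
  have Dc: "continuous_on {0..1} ?D1" "continuous_on {0..1} ?D2"
    by (intro continuous_intros p q G c)+
  have "AE x in lebesgue. x \<in> {0..1} \<longrightarrow> D1 x = ?D1 x"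
    using ae \<phi>1 by eventually_elim (auto simp: algebra_simps)
  then have 1: "fst F x = fst F 0 + integral {0..x} ?D1" if "x \<in> {0..1}" for x
    using H1_01_weak_deriv_imp_integral[OF c(1) D(1,2) that] integral_cong_AE_on(1)[of "{0..1}" D1 ?D1 "{0..x}"] that
    by auto
  have "AE x in lebesgue. x \<in> {0..1} \<longrightarrow> D2 x = ?D2 x"
    using ae \<phi>2
  proof eventually_elim
    case (elim x)
    show ?case
    proof
      assume "x \<in> {0..1}"
      then have "\<i> * D2 x = q x * fst F x - snd G x" using elim by (simp add: algebra_simps)
      then have "- (\<i> * (\<i> * D2 x)) = - (\<i> * (q x * fst F x - snd G x))" by simp
      then show "D2 x = ?D2 x" by (simp add: algebra_simps)
    qed
  qed
  then have 2: "snd F x = snd F 0 + integral {0..x} ?D2" if "x \<in> {0..1}" for x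
    using H1_01_weak_deriv_imp_integral[OF c(2) D(3,4) that] integral_cong_AE_on(1)[of "{0..1}" D2 ?D2 "{0..x}"] that
    by auto
  have "(fst F has_vector_derivative ?D1 x) (at x within {0..1})" if x: "x \<in> {0..1}" for x
  proof (rule has_vector_derivative_transform[OF x 1])
    show "((\<lambda>x. fst F 0 + integral {0..x} ?D1) has_vector_derivative ?D1 x) (at x within {0..1})"
      using has_vector_derivative_add[OF has_vector_derivative_const integral_has_vector_derivative[OF Dc(1) x]] by simp
  qed
  moreover have "(snd F has_vector_derivative ?D2 x) (at x within {0..1})" if x: "x \<in> {0..1}" for x
  proof (rule has_vector_derivative_transform[OF x 2])
    show "((\<lambda>x. snd F 0 + integral {0..x} ?D2) has_vector_derivative ?D2 x) (at x within {0..1})"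
      using has_vector_derivative_add[OF has_vector_derivative_const integral_has_vector_derivative[OF Dc(2) x]] by simp
  qed
  ultimately show ?R using dom unfolding dirichlet_domain_def H1_01_def by (auto simp: mem_Times_iff)
next
  assume R: ?R
  let ?D1 = "\<lambda>x. - \<i> * fst G x + \<i> * p x * snd F x" and ?D2 = "\<lambda>x. \<i> * snd G x - \<i> * q x * fst F x"
  have d: "\<And>x. x \<in> {0..1} \<Longrightarrow> (fst F has_vector_derivative ?D1 x) (at x within {0..1})"
    "\<And>x. x \<in> {0..1} \<Longrightarrow> (snd F has_vector_derivative ?D2 x) (at x within {0..1})" using R by auto
  have c: "continuous_on {0..1} (fst F)" "continuous_on {0..1} (snd F)"
    using d continuous_on_eq_continuous_within has_vector_derivative_continuous by blast+
  have Dc: "continuous_on {0..1} ?D1" "continuous_on {0..1} ?D2"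
    by (intro continuous_intros p q G c)+
  note w = classical_imp_weak_deriv[OF d(1) Dc(1)] classical_imp_weak_deriv[OF d(2) Dc(2)]
  note s = Dc[THEN continuous_imp_square_integrable]
  have "F \<in> dirichlet_domain"
    unfolding dirichlet_domain_def H1_01_def using R c w s by (auto simp: mem_Times_iff)
  moreover have "AE x in lebesgue. x \<in> {0..1} \<longrightarrow>
                 fst G x = \<i> * ?D1 x + fst \<phi> x * snd F x \<and>
                 snd G x = - \<i> * ?D2 x + snd \<phi> x * fst F x"
    using \<phi>1 \<phi>2 by eventually_elim (auto simp: algebra_simps)
  ultimately show ?L unfolding ZS_dirichlet_def using w s by blast
qed

section \<open>The Zakharov--Shabat system on the unit interval\<close>

definition zs_sol ::
    "(cfn) \<Rightarrow> (cfn) \<Rightarrow> complex \<Rightarrow> (cfn) \<Rightarrow> (cfn) \<Rightarrow> bool" where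
  "zs_sol p q z U V \<longleftrightarrow> (\<forall>x\<in>{0..1}.
     (U has_vector_derivative - \<i> * z * U x + \<i> * p x * V x) (at x within {0..1}) \<and>
     (V has_vector_derivative \<i> * z * V x - \<i> * q x * U x) (at x within {0..1}))"

text \<open>
  The symmetry of the system that yields every statement on \<open>U\<close> from the corresponding one on \<open>V\<close>.
\<close>

lemma zs_sol_mirror:
  assumes "zs_sol p q z U V"
  shows "zs_sol (\<lambda>x. - q x) (\<lambda>x. - p x) (- z) V U"
  using assms unfolding zs_sol_def by simp

lemma has_vd_continuous_on:
  assumes "\<And>x. x \<in> S \<Longrightarrow> (f has_vector_derivative f' x) (at x within S)"
  shows "continuous_on S f"
  using assms continuous_on_eq_continuous_within has_vector_derivative_continuous by blast

lemma zs_sol_continuous: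
  assumes "zs_sol p q z U V"
  shows "continuous_on {0..1} U" "continuous_on {0..1} V"
  using assms unfolding zs_sol_def by (auto intro: has_vd_continuous_on)

lemma gronwall_unit_interval:
  fixes u u' :: "real \<Rightarrow> real"
  assumes d: "\<And>x. x \<in> {0..1} \<Longrightarrow> (u has_vector_derivative u' x) (at x within {0..1})"
    and le: "\<And>x. x \<in> {0..1} \<Longrightarrow> u' x \<le> c * u x + D" and "c \<ge> 0" "D \<ge> 0" and x: "x \<in> {0..1}"
  shows "u x \<le> exp (c * x) * (u 0 + D)"
proof -
  define w where "w t = exp (- c * t) * u t - D * t" for t
  define dw where "dw t = - c * exp (- c * t) * u t + exp (- c * t) * u' t - D" for t
  have wd: "(w has_vector_derivative dw t) (at t within {0..1})"
    if "t \<in> {0..1}" for t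
    unfolding w_def dw_def
    using d[OF that] unfolding has_real_derivative_iff_has_vector_derivative[symmetric]
    by (auto intro!: derivative_eq_intros)
  have "w x \<le> w 0"
  proof (cases "x = 0")
    case False
    then have "\<exists>t\<in>{0<..<x}. w x - w 0 = (x - 0) *\<^sub>R dw t"
      using x has_vector_derivative_within_subset[OF wd, of _ "{0..x}"]
      by (intro mvt_simple[where f' = "\<lambda>t h. h *\<^sub>R dw t"]) (auto simp: has_vector_derivative_def)
    then obtain t where t: "t \<in> {0<..<x}" "w x - w 0 = x * dw t" by auto
    have "exp (- c * t) * u' t \<le> exp (- c * t) * (c * u t + D)"
      using t x by (intro mult_left_mono le) auto
    also have "\<dots> \<le> exp (- c * t) * (c * u t) + 1 * D"
      unfolding distrib_left using assms t by (intro add_left_mono mult_right_mono) auto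
    finally have "dw t \<le> 0" by (simp add: dw_def algebra_simps)
    then have "w x - w 0 \<le> 0" unfolding t(2) using x by (intro mult_nonneg_nonpos) auto
    then show ?thesis by simp
  qed simp
  then have "exp (- c * x) * u x \<le> u 0 + D * x" by (simp add: w_def)
  also have "\<dots> \<le> u 0 + D" using x assms by (simp add: mult_left_le)
  finally have "exp (c * x) * (exp (- c * x) * u x) \<le> exp (c * x) * (u 0 + D)"
    by (intro mult_left_mono) auto
  then show ?thesis by (simp add: mult.assoc[symmetric] mult_exp_exp)
qed

lemma inner_ii_mult: "inner U (- \<i> * z * U) = Im z * (norm U)\<^sup>2" "inner U (\<i> * z * U) = - Im z * (norm U)\<^sup>2"
  unfolding cmod_power2 by (simp_all add: inner_complex_def power2_eq_square algebra_simps)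

lemma has_vd_inner_self:
  fixes U :: cfn
  assumes "(U has_vector_derivative U') (at x within S)"
  shows "((\<lambda>x. (norm (U x))\<^sup>2) has_vector_derivative 2 * inner (U x) U') (at x within S)"
  using bounded_bilinear.has_vector_derivative[OF bounded_bilinear_inner assms assms]
  by (simp add: power2_norm_eq_inner inner_commute)

lemma inner_le_norm: "inner (a::complex) b \<le> norm a * norm b" "- (norm a * norm b) \<le> inner a b"
  using Cauchy_Schwarz_ineq2[of a b] by (auto simp: abs_le_iff)

text \<open>
  Gronwall's inequality for \<open>\<bar>U\<bar>\<^sup>2 + \<bar>V\<bar>\<^sup>2\<close>: the real part of \<open>z\<close> only rotates the components, so that the
  growth rate depends on \<open>Im z\<close> alone and the bound is uniform for \<open>z\<close> in a horizontal strip.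
\<close>

theorem zs_energy_estimate:
  assumes U: "\<And>x. x \<in> {0..1} \<Longrightarrow>
      (U has_vector_derivative - \<i> * z * U x + \<i> * p x * V x + f x) (at x within {0..1})"
    and V: "\<And>x. x \<in> {0..1} \<Longrightarrow>
      (V has_vector_derivative \<i> * z * V x - \<i> * q x * U x + g x) (at x within {0..1})"
    and R: "\<And>x. x \<in> {0..1} \<Longrightarrow> norm (p x) \<le> R" "\<And>x. x \<in> {0..1} \<Longrightarrow> norm (q x) \<le> R"
    and D: "\<And>x. x \<in> {0..1} \<Longrightarrow> norm (f x) \<le> D" "\<And>x. x \<in> {0..1} \<Longrightarrow> norm (g x) \<le> D"
    and M: "\<bar>Im z\<bar> \<le> M" and x: "x \<in> {0..1}"
  shows "(norm (U x))\<^sup>2 + (norm (V x))\<^sup>2 \<le>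
      exp (2 * M + 2 * R + 1) * ((norm (U 0))\<^sup>2 + (norm (V 0))\<^sup>2 + 2 * D\<^sup>2)"
proof -
  have R0: "R \<ge> 0" by (rule order_trans[OF norm_ge_zero R(1)[of 0]]) simp
  have M0: "M \<ge> 0" using M by simp
  define u where "u t = (norm (U t))\<^sup>2 + (norm (V t))\<^sup>2" for t
  define u' where "u' t = 2 * inner (U t) (- \<i> * z * U t + \<i> * p t * V t + f t) +
      2 * inner (V t) (\<i> * z * V t - \<i> * q t * U t + g t)" for t
  have c0: "2 * M + 2 * R + 1 \<ge> 0" using R0 M0 by simp
  have "u x \<le> exp ((2 * M + 2 * R + 1) * x) * (u 0 + 2 * D\<^sup>2)"
  proof (rule gronwall_unit_interval[OF _ _ c0 _ x])
    show "(u has_vector_derivative u' t) (at t within {0..1})" if "t \<in> {0..1}" for t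
      unfolding u_def u'_def by (intro has_vector_derivative_add has_vd_inner_self U V that)
    fix t :: real assume t: "t \<in> {0..1}"
    define a b where "a = norm (U t)" and "b = norm (V t)"
    have h1: "inner (U t) (\<i> * p t * V t) \<le> a * (R * b)"
      by (rule order_trans[OF inner_le_norm(1)])
        (auto simp: a_def b_def norm_mult intro!: mult_left_mono mult_right_mono R t)
    have h2: "- inner (V t) (\<i> * q t * U t) \<le> b * (R * a)"
      by (rule order_trans[of _ "norm (V t) * norm (\<i> * q t * U t)"])
        (use inner_le_norm(2)[of "V t" "\<i> * q t * U t"] in
         \<open>auto simp: a_def b_def norm_mult intro!: mult_left_mono mult_right_mono R t\<close>)
    have h3: "inner (U t) (f t) \<le> a * D" "inner (V t) (g t) \<le> b * D"
      by (rule order_trans[OF inner_le_norm(1)]; auto simp: a_def b_def intro!: mult_left_mono D t)+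
    have h4: "Im z * a\<^sup>2 \<le> M * a\<^sup>2" "- Im z * b\<^sup>2 \<le> M * b\<^sup>2" using M by (intro mult_right_mono; auto)+
    have "u' t = 2 * (Im z * a\<^sup>2 + inner (U t) (\<i> * p t * V t) + inner (U t) (f t)) +
        2 * (- Im z * b\<^sup>2 + - inner (V t) (\<i> * q t * U t) + inner (V t) (g t))"
      unfolding u'_def inner_add_right inner_diff_right inner_ii_mult a_def b_def by simp
    also have "\<dots> \<le> 2 * (M * a\<^sup>2 + a * (R * b) + a * D) + 2 * (M * b\<^sup>2 + b * (R * a) + b * D)"
      by (intro add_mono mult_left_mono h1 h2 h3 h4) auto
    also have "\<dots> \<le> (2 * M + 2 * R + 1) * (a\<^sup>2 + b\<^sup>2) + 2 * D\<^sup>2"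
    proof -
      have "0 \<le> R * (a - b)\<^sup>2" using R0 by simp
      then have "4 * (R * a * b) \<le> 2 * R * (a\<^sup>2 + b\<^sup>2)" by (simp add: power2_eq_square algebra_simps)
      moreover have "2 * (a * D) \<le> a\<^sup>2 + D\<^sup>2" "2 * (b * D) \<le> b\<^sup>2 + D\<^sup>2"
        using sum_squares_bound[of a D] sum_squares_bound[of b D] by auto
      ultimately show ?thesis by (simp add: algebra_simps)
    qed
    finally show "u' t \<le> (2 * M + 2 * R + 1) * u t + 2 * D\<^sup>2" by (simp add: u_def a_def b_def)
  qed simp
  also have "\<dots> \<le> exp (2 * M + 2 * R + 1) * (u 0 + 2 * D\<^sup>2)"
    using x c0 by (intro mult_right_mono) (auto simp: u_def mult_left_le)
  finally show ?thesis by (simp add: u_def)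
qed

lemma zs_sol_bound:
  assumes sol: "zs_sol p q z U V"
    and R: "\<And>x. x \<in> {0..1} \<Longrightarrow> norm (p x) \<le> R" "\<And>x. x \<in> {0..1} \<Longrightarrow> norm (q x) \<le> R"
    and M: "\<bar>Im z\<bar> \<le> M" and x: "x \<in> {0..1}"
  shows "(norm (U x))\<^sup>2 + (norm (V x))\<^sup>2 \<le> exp (2 * M + 2 * R + 1) * ((norm (U 0))\<^sup>2 + (norm (V 0))\<^sup>2)"
  using zs_energy_estimate[of U z p V "\<lambda>x. 0" q "\<lambda>x. 0" R 0 M x] assms unfolding zs_sol_def by auto

lemma continuous_pair_bounded:
  fixes p q :: cfn
  assumes p: "continuous_on {0..1} p" and q: "continuous_on {0..1} q"
  obtains R where "\<And>x. x \<in> {0..1} \<Longrightarrow> norm (p x) \<le> R" "\<And>x. x \<in> {0..1} \<Longrightarrow> norm (q x) \<le> R"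
proof -
  have "bounded (p ` {0..1} \<union> q ` {0..1})"
    using p q by (simp add: compact_continuous_image compact_imp_bounded)
  then show ?thesis using that unfolding bounded_iff by blast
qed

lemma zs_sol_scaled_diff:
  assumes "zs_sol p q z U V" "zs_sol p q z X Y"
  shows "zs_sol p q z (\<lambda>x. U x - c * X x) (\<lambda>x. V x - c * Y x)"
  unfolding zs_sol_def
proof (intro ballI)
  fix x :: real assume x: "x \<in> {0..1}"
  note a = assms[unfolded zs_sol_def, rule_format, OF x]
  have "((\<lambda>x. U x - c * X x) has_vector_derivative
      (- \<i> * z * U x + \<i> * p x * V x) - c * (- \<i> * z * X x + \<i> * p x * Y x)) (at x within {0..1})"
    using a by (intro has_vector_derivative_diff has_vector_derivative_mult_right) auto
  moreover have "((\<lambda>x. V x - c * Y x) has_vector_derivative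
      (\<i> * z * V x - \<i> * q x * U x) - c * (\<i> * z * Y x - \<i> * q x * X x)) (at x within {0..1})"
    using a by (intro has_vector_derivative_diff has_vector_derivative_mult_right) auto
  ultimately show "((\<lambda>x. U x - c * X x) has_vector_derivative
      - \<i> * z * (U x - c * X x) + \<i> * p x * (V x - c * Y x)) (at x within {0..1}) \<and>
      ((\<lambda>x. V x - c * Y x) has_vector_derivative
      \<i> * z * (V x - c * Y x) - \<i> * q x * (U x - c * X x)) (at x within {0..1})"
    by (simp add: algebra_simps)
qed

lemma zs_sol_unique:
  assumes sol: "zs_sol p q z U V" "zs_sol p q z X Y"
    and p: "continuous_on {0..1} p" and q: "continuous_on {0..1} q"
    and init: "U 0 = c * X 0" "V 0 = c * Y 0" and x: "x \<in> {0..1}"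
  shows "U x = c * X x" "V x = c * Y x"
proof -
  from continuous_pair_bounded[OF p q] obtain R where
    R: "\<And>x. x \<in> {0..1} \<Longrightarrow> norm (p x) \<le> R" "\<And>x. x \<in> {0..1} \<Longrightarrow> norm (q x) \<le> R" by blast
  have "(norm (U x - c * X x))\<^sup>2 + (norm (V x - c * Y x))\<^sup>2 \<le> 0"
    using zs_sol_bound[OF zs_sol_scaled_diff[OF sol, of c] R order_refl x] init by simp
  then have "(norm (U x - c * X x))\<^sup>2 = 0 \<and> (norm (V x - c * Y x))\<^sup>2 = 0"
    by (simp only: sum_power2_le_zero_iff) simp
  then show "U x = c * X x" "V x = c * Y x" by auto
qed

text \<open>
  Picard iteration; the series of the increments converges uniformly, like that of \<open>exp (L x)\<close>.
\<close>

theorem linear_ivp_exists: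
  fixes A :: "real \<Rightarrow> 'a \<Rightarrow> 'a::banach"
  assumes lin: "\<And>x. x \<in> {0..1} \<Longrightarrow> linear (A x)"
    and bound: "\<And>x v. x \<in> {0..1} \<Longrightarrow> norm (A x v) \<le> L * norm v" and L: "L \<ge> 0"
    and cont: "\<And>y. continuous_on {0..1} y \<Longrightarrow> continuous_on {0..1} (\<lambda>x. A x (y x))"
  shows "\<exists>y. y 0 = y0 \<and> (\<forall>x\<in>{0..1}. (y has_vector_derivative A x (y x)) (at x within {0..1}))"
proof -
  define Y where "Y = rec_nat (\<lambda>x. y0) (\<lambda>_ y x. integral {0..x} (\<lambda>t. A t (y t)))"
  have Y0: "Y 0 = (\<lambda>x. y0)" and YS: "Y (Suc n) = (\<lambda>x. integral {0..x} (\<lambda>t. A t (Y n t)))" for n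
    by (simp_all add: Y_def)
  have Yc: "continuous_on {0..1} (Y n)" for n
    by (induction n) (auto simp: Y0 YS intro!: indefinite_integral_continuous_1 integrable_continuous_real cont)
  have AYi: "(\<lambda>t. A t (Y n t)) integrable_on {0..x}" if "x \<in> {0..1}" for n x
    using that by (intro integrable_continuous_real continuous_on_subset[OF cont[OF Yc]]) auto
  have Yb: "norm (Y n x) \<le> norm y0 * ((L * x) ^ n / fact n)" if "x \<in> {0..1}" for n x
    using that
  proof (induction n arbitrary: x)
    case 0
    then show ?case by (simp add: Y0)
  next
    case (Suc n)
    have F: "((\<lambda>t. L * (norm y0 * ((L * t) ^ n / fact n))) has_integral
        norm y0 * ((L * x) ^ Suc n / fact (Suc n)) - norm y0 * ((L * 0) ^ Suc n / fact (Suc n))) {0..x}"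
    proof (rule fundamental_theorem_of_calculus)
      fix t
      have "((\<lambda>x. (L * x) ^ Suc n) has_real_derivative real (Suc n) * (L * (L * t) ^ n)) (at t within {0..x})"
        by (rule derivative_eq_intros refl | simp)+
      then have "((\<lambda>x. norm y0 * ((L * x) ^ Suc n / fact (Suc n))) has_real_derivative
         norm y0 * (real (Suc n) * (L * (L * t) ^ n) / fact (Suc n))) (at t within {0..x})"
        by (intro DERIV_cmult DERIV_cdivide)
      moreover have "norm y0 * (real (Suc n) * (L * (L * t) ^ n) / fact (Suc n)) = L * (norm y0 * ((L * t) ^ n / fact n))"
        by (simp add: field_simps del: of_nat_Suc)
      ultimately show "((\<lambda>x. norm y0 * ((L * x) ^ Suc n / fact (Suc n))) has_vector_derivative
        L * (norm y0 * ((L * t) ^ n / fact n))) (at t within {0..x})"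
        by (simp only: has_real_derivative_iff_has_vector_derivative)
    qed (use Suc in auto)
    have "norm (Y (Suc n) x) \<le> integral {0..x} (\<lambda>t. L * (norm y0 * ((L * t) ^ n / fact n)))"
      unfolding YS
    proof (rule integral_norm_bound_integral[OF AYi[OF Suc.prems] has_integral_integrable[OF F]])
      fix t assume "t \<in> {0..x}"
      then have t: "t \<in> {0..1}" using Suc.prems by auto
      show "norm (A t (Y n t)) \<le> L * (norm y0 * ((L * t) ^ n / fact n))"
        by (rule order_trans[OF bound[OF t] mult_left_mono[OF Suc.IH[OF t] L]])
    qed
    then show ?case using integral_unique[OF F] by simp
  qed
  define y where "y x = suminf (\<lambda>n. Y n x)" for x
  define S where "S n x = (\<Sum>i<n. Y i x)" for n x
  have lim: "uniform_limit {0..1} S y sequentially"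
    unfolding S_def y_def
  proof (rule Weierstrass_m_test)
    show "norm (Y n x) \<le> norm y0 * (L ^ n / fact n)" if "x \<in> {0..1}" for n x
      by (rule order_trans[OF Yb[OF that]])
        (use that L in \<open>auto intro!: mult_left_mono divide_right_mono power_mono simp: mult_left_le\<close>)
    show "summable (\<lambda>n. norm y0 * (L ^ n / fact n))"
      using summable_exp_generic[of L] by (intro summable_mult) (simp add: divide_inverse mult.commute)
  qed
  have Sc: "continuous_on {0..1} (S n)" for n
    unfolding S_def by (intro continuous_intros Yc)
  have yc: "continuous_on {0..1} y"
    by (rule uniform_limit_theorem[OF _ lim]) (use Sc in auto)
  have AS: "A t (S n t) = (\<Sum>i<n. A t (Y i t))" if "t \<in> {0..1}" for t n
    unfolding S_def using linear_sum[OF lin[OF that]] by (simp add: o_def)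
  have SS: "S (Suc n) x = y0 + integral {0..x} (\<lambda>t. A t (S n t))" if x: "x \<in> {0..1}" for n x
  proof -
    have "integral {0..x} (\<lambda>t. A t (S n t)) = integral {0..x} (\<lambda>t. \<Sum>i<n. A t (Y i t))"
      by (rule integral_cong) (use x AS in auto)
    also have "\<dots> = (\<Sum>i<n. integral {0..x} (\<lambda>t. A t (Y i t)))"
      by (rule integral_sum) (use AYi[OF x] in auto)
    finally show ?thesis unfolding S_def by (subst sum.lessThan_Suc_shift) (simp add: Y0 YS)
  qed
  have yint: "y x = y0 + integral {0..x} (\<lambda>t. A t (y t))" if x: "x \<in> {0..1}" for x
  proof (rule LIMSEQ_unique)
    show "(\<lambda>n. S (Suc n) x) \<longlonglongrightarrow> y x"
      using tendsto_uniform_limitI[OF lim x] by (rule LIMSEQ_Suc)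
    have bl: "norm (A t v - A t w) \<le> L * norm (v - w)" if "t \<in> {0..1}" for t v w
      using bound[OF that, of "v - w"] linear_diff[OF lin[OF that]] by simp
    have ul: "uniform_limit {0..x} (\<lambda>n t. A t (S n t)) (\<lambda>t. A t (y t)) sequentially"
    proof (rule uniform_limitI)
      fix e :: real assume e: "e > 0"
      have "\<forall>\<^sub>F n in sequentially. \<forall>t\<in>{0..1}. dist (S n t) (y t) < e / (L + 1)"
        using uniform_limitD[OF lim, of "e / (L + 1)"] e L by simp
      then show "\<forall>\<^sub>F n in sequentially. \<forall>t\<in>{0..x}. dist (A t (S n t)) (A t (y t)) < e"
      proof (rule eventually_mono, intro ballI)
        fix n t assume h: "\<forall>t\<in>{0..1}. dist (S n t) (y t) < e / (L + 1)" and t: "t \<in> {0..x}"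
        have t1: "t \<in> {0..1}" using t x by auto
        have "(L + 1) * norm (S n t - y t) < e" using h[rule_format, OF t1] L by (simp add: dist_norm field_simps)
        moreover have "norm (A t (S n t) - A t (y t)) \<le> L * norm (S n t - y t)" using bl[OF t1] .
        moreover have "L * norm (S n t - y t) \<le> (L + 1) * norm (S n t - y t)" by (simp add: distrib_right)
        ultimately show "dist (A t (S n t)) (A t (y t)) < e" by (simp add: dist_norm)
      qed
    qed
    have Ac: "continuous_on {0..x} (\<lambda>t. A t (S n t))" for n
      by (rule continuous_on_subset[OF cont[OF Sc]]) (use x in auto)
    obtain I J where IJ: "\<And>n. ((\<lambda>t. A t (S n t)) has_integral I n) {0..x}"
      "((\<lambda>t. A t (y t)) has_integral J) {0..x}" "I \<longlonglongrightarrow> J"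
      using uniform_limit_integral[OF ul Ac sequentially_bot] by blast
    have "(\<lambda>n. integral {0..x} (\<lambda>t. A t (S n t))) \<longlonglongrightarrow> integral {0..x} (\<lambda>t. A t (y t))"
      unfolding integral_unique[OF IJ(1)] integral_unique[OF IJ(2)] by (rule IJ(3))
    then show "(\<lambda>n. S (Suc n) x) \<longlonglongrightarrow> y0 + integral {0..x} (\<lambda>t. A t (y t))"
      unfolding SS[OF x] by (intro tendsto_add tendsto_const) simp
  qed
  show ?thesis
  proof (intro exI conjI ballI)
    show "y 0 = y0" using yint[of 0] by simp
    fix x :: real assume x: "x \<in> {0..1}"
    show "(y has_vector_derivative A x (y x)) (at x within {0..1})"
    proof (rule has_vector_derivative_transform[OF x yint])
      show "((\<lambda>x. y0 + integral {0..x} (\<lambda>t. A t (y t))) has_vector_derivative A x (y x)) (at x within {0..1})"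
        using has_vector_derivative_add[OF has_vector_derivative_const integral_has_vector_derivative[OF cont[OF yc] x]]
        by simp
    qed
  qed
qed

lemma zs_sol_exists:
  assumes p: "continuous_on {0..1} p" and q: "continuous_on {0..1} q"
  shows "\<exists>U V. zs_sol p q z U V \<and> U 0 = 1 \<and> V 0 = 1"
proof -
  from continuous_pair_bounded[OF p q] obtain R where
    R: "\<And>x. x \<in> {0..1} \<Longrightarrow> norm (p x) \<le> R" "\<And>x. x \<in> {0..1} \<Longrightarrow> norm (q x) \<le> R" by blast
  define A where "A x v = (- \<i> * z * fst v + \<i> * p x * snd v, \<i> * z * snd v - \<i> * q x * fst v)" for x v
  have R0: "R \<ge> 0" by (rule order_trans[OF norm_ge_zero R(1)[of 0]]) simp
  have "\<exists>y. y 0 = (1, 1) \<and> (\<forall>x\<in>{0..1}. (y has_vector_derivative A x (y x)) (at x within {0..1}))"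
  proof (rule linear_ivp_exists[where L = "2 * (norm z + R)"])
    show "linear (A x)" for x
      by (intro linearI) (auto simp: A_def algebra_simps)
    show "norm (A x v) \<le> 2 * (norm z + R) * norm v" if x: "x \<in> {0..1}" for x v
    proof -
      have f: "norm (fst v) \<le> norm v" "norm (snd v) \<le> norm v"
        using norm_fst_le[of "fst v" "snd v"] norm_snd_le[of "snd v" "fst v"] by auto
      have "norm (- \<i> * z * fst v + \<i> * p x * snd v) \<le> norm z * norm (fst v) + norm (p x) * norm (snd v)"
        by (rule order_trans[OF norm_triangle_ineq]) (simp add: norm_mult)
      also have "\<dots> \<le> norm z * norm v + R * norm v"
        by (intro add_mono mult_mono f R x order_refl R0) auto
      finally have 1: "norm (- \<i> * z * fst v + \<i> * p x * snd v) \<le> (norm z + R) * norm v" by (simp add: algebra_simps)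
      have "norm (\<i> * z * snd v - \<i> * q x * fst v) \<le> norm z * norm (snd v) + norm (q x) * norm (fst v)"
        by (rule order_trans[OF norm_triangle_ineq4]) (simp add: norm_mult)
      also have "\<dots> \<le> norm z * norm v + R * norm v"
        by (intro add_mono mult_mono f R x order_refl R0) auto
      finally have 2: "norm (\<i> * z * snd v - \<i> * q x * fst v) \<le> (norm z + R) * norm v" by (simp add: algebra_simps)
      show ?thesis
        unfolding A_def using norm_Pair_le[of "- \<i> * z * fst v + \<i> * p x * snd v" "\<i> * z * snd v - \<i> * q x * fst v"] 1 2
        by (simp add: algebra_simps)
    qed
    show "continuous_on {0..1} (\<lambda>x. A x (y x))" if "continuous_on {0..1} y" for y
      unfolding A_def by (intro continuous_intros that p q)
  qed (use R0 in auto)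
  then obtain y where y: "y 0 = (1, 1)"
    "\<And>x. x \<in> {0..1} \<Longrightarrow> (y has_vector_derivative A x (y x)) (at x within {0..1})" by blast
  have "zs_sol p q z (\<lambda>x. fst (y x)) (\<lambda>x. snd (y x))"
    unfolding zs_sol_def
    using bounded_linear.has_vector_derivative[OF bounded_linear_fst y(2)]
      bounded_linear.has_vector_derivative[OF bounded_linear_snd y(2)]
    by (auto simp: A_def)
  with y(1) show ?thesis by (metis fst_conv snd_conv)
qed

definition zs_fund :: "(cfn) \<Rightarrow> (cfn) \<Rightarrow> complex \<Rightarrow> (cfn) \<times> (cfn)" where
  "zs_fund p q z = (SOME F. zs_sol p q z (fst F) (snd F) \<and> fst F 0 = 1 \<and> snd F 0 = 1)"

lemma zs_fund:
  assumes p: "continuous_on {0..1} p" and q: "continuous_on {0..1} q"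
  shows "zs_sol p q z (fst (zs_fund p q z)) (snd (zs_fund p q z))"
    "fst (zs_fund p q z) 0 = 1" "snd (zs_fund p q z) 0 = 1"
proof -
  have "\<exists>F. zs_sol p q z (fst F) (snd F) \<and> fst F 0 = 1 \<and> snd F 0 = 1"
    using zs_sol_exists[OF assms, of z] by auto
  from someI_ex[OF this] show "zs_sol p q z (fst (zs_fund p q z)) (snd (zs_fund p q z))"
    "fst (zs_fund p q z) 0 = 1" "snd (zs_fund p q z) 0 = 1"
    unfolding zs_fund_def by auto
qed

text \<open>
  The difference of the solutions for \<open>z\<close> and \<open>w\<close> solves the system with a right-hand side of size
  \<open>\<bar>z - w\<bar>\<close>, so the energy estimate gives a Lipschitz bound.
\<close>

lemma zs_fund_continuous:
  assumes p: "continuous_on {0..1} p" and q: "continuous_on {0..1} q" and S: "bounded S"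
  shows "continuous_on S (\<lambda>z. fst (zs_fund p q z) 1)" "continuous_on S (\<lambda>z. snd (zs_fund p q z) 1)"
proof -
  from continuous_pair_bounded[OF p q] obtain R where
    R: "\<And>x. x \<in> {0..1} \<Longrightarrow> norm (p x) \<le> R" "\<And>x. x \<in> {0..1} \<Longrightarrow> norm (q x) \<le> R" by blast
  obtain M where M: "\<And>z. z \<in> S \<Longrightarrow> norm z \<le> M" using S unfolding bounded_iff by blast
  have Im: "\<bar>Im z\<bar> \<le> M" if "z \<in> S" for z using M[OF that] abs_Im_le_cmod[of z] by simp
  define E where "E = exp (2 * M + 2 * R + 1)"
  have E0: "E > 0" by (simp add: E_def)
  define U V where "U z = fst (zs_fund p q z)" and "V z = snd (zs_fund p q z)" for z
  note fund = zs_fund[OF p q, folded U_def V_def]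
  have b: "norm (U z x) \<le> sqrt (2 * E)" "norm (V z x) \<le> sqrt (2 * E)" if "z \<in> S" "x \<in> {0..1}" for z x
  proof -
    have "(norm (U z x))\<^sup>2 + (norm (V z x))\<^sup>2 \<le> 2 * E"
      using zs_sol_bound[OF fund(1) R Im[OF that(1)] that(2)] fund(2,3) by (simp add: E_def)
    then have "(norm (U z x))\<^sup>2 \<le> 2 * E" "(norm (V z x))\<^sup>2 \<le> 2 * E"
      by (smt (verit) zero_le_power2)+
    then show "norm (U z x) \<le> sqrt (2 * E)" "norm (V z x) \<le> sqrt (2 * E)"
      by (simp_all add: real_le_rsqrt)
  qed
  have lip: "(norm (U z 1 - U w 1))\<^sup>2 + (norm (V z 1 - V w 1))\<^sup>2 \<le> (2 * E * norm (z - w))\<^sup>2"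
    if z: "z \<in> S" and w: "w \<in> S" for z w
  proof -
    define D where "D = norm (z - w) * sqrt (2 * E)"
    have "(norm (U z 1 - U w 1))\<^sup>2 + (norm (V z 1 - V w 1))\<^sup>2 \<le>
        exp (2 * M + 2 * R + 1) * ((norm (U z 0 - U w 0))\<^sup>2 + (norm (V z 0 - V w 0))\<^sup>2 + 2 * D\<^sup>2)"
    proof (rule zs_energy_estimate[where U = "\<lambda>x. U z x - U w x" and V = "\<lambda>x. V z x - V w x" and
          f = "\<lambda>x. - \<i> * (z - w) * U w x" and g = "\<lambda>x. \<i> * (z - w) * V w x" and x = 1, OF _ _ R _ _ Im[OF z]])
      fix x :: real assume x: "x \<in> {0..1}"
      note a = fund(1)[of z, unfolded zs_sol_def, rule_format, OF x] fund(1)[of w, unfolded zs_sol_def, rule_format, OF x]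
      show "((\<lambda>x. U z x - U w x) has_vector_derivative
         - \<i> * z * (U z x - U w x) + \<i> * p x * (V z x - V w x) + - \<i> * (z - w) * U w x) (at x within {0..1})"
        using has_vector_derivative_diff[OF conjunct1[OF a(1)] conjunct1[OF a(2)]] by (simp add: algebra_simps)
      show "((\<lambda>x. V z x - V w x) has_vector_derivative
         \<i> * z * (V z x - V w x) - \<i> * q x * (U z x - U w x) + \<i> * (z - w) * V w x) (at x within {0..1})"
        using has_vector_derivative_diff[OF conjunct2[OF a(1)] conjunct2[OF a(2)]] by (simp add: algebra_simps)
      show "norm (- \<i> * (z - w) * U w x) \<le> D" "norm (\<i> * (z - w) * V w x) \<le> D"
        using b[OF w x] by (auto simp: D_def norm_mult intro: mult_left_mono)
    qed auto
    also have "\<dots> = (2 * E * norm (z - w))\<^sup>2"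
      unfolding E_def[symmetric] using E0 by (simp add: fund D_def power_mult_distrib power2_eq_square algebra_simps)
    finally show ?thesis .
  qed
  have l: "(2 * E)-lipschitz_on S (\<lambda>z. U z 1)" "(2 * E)-lipschitz_on S (\<lambda>z. V z 1)"
  proof -
    have "norm (U z 1 - U w 1) \<le> 2 * E * norm (z - w) \<and> norm (V z 1 - V w 1) \<le> 2 * E * norm (z - w)"
      if zw: "z \<in> S" "w \<in> S" for z w
    proof -
      have "(norm (U z 1 - U w 1))\<^sup>2 \<le> (2 * E * norm (z - w))\<^sup>2" "(norm (V z 1 - V w 1))\<^sup>2 \<le> (2 * E * norm (z - w))\<^sup>2"
        using lip[OF zw] by (smt (verit) zero_le_power2)+
      then show ?thesis using E0 by (auto intro!: power2_le_imp_le)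
    qed
    then show "(2 * E)-lipschitz_on S (\<lambda>z. U z 1)" "(2 * E)-lipschitz_on S (\<lambda>z. V z 1)"
      using E0 by (auto simp: lipschitz_on_def dist_norm)
  qed
  show "continuous_on S (\<lambda>z. fst (zs_fund p q z) 1)" "continuous_on S (\<lambda>z. snd (zs_fund p q z) 1)"
    using l[THEN lipschitz_on_continuous_on] unfolding U_def V_def by auto
qed

text \<open>
  If \<open>\<bar>Im z\<bar> > R\<close>, then \<open>\<bar>U\<bar>\<^sup>2 - \<bar>V\<bar>\<^sup>2\<close> is strictly monotone at 0, but the boundary conditions make it vanish
  at both ends.
\<close>

theorem zs_eigenvalue_Im_bound:
  assumes sol: "zs_sol p q z U V" and init: "U 0 = 1" "V 0 = 1" and bdry: "U 1 = V 1"
    and R: "\<And>x. x \<in> {0..1} \<Longrightarrow> norm (p x) \<le> R" "\<And>x. x \<in> {0..1} \<Longrightarrow> norm (q x) \<le> R"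
  shows "\<bar>Im z\<bar> \<le> R"
proof (rule ccontr)
  assume neg: "\<not> \<bar>Im z\<bar> \<le> R"
  define s where "s = sgn (Im z)"
  have s: "s * Im z = \<bar>Im z\<bar>" "\<bar>s\<bar> \<le> 1" by (auto simp: s_def sgn_if abs_if)
  \<comment> \<open>The sign \<open>s\<close> makes \<open>w\<close> increasing in both half planes.\<close>
  define w where "w t = s * ((norm (U t))\<^sup>2 - (norm (V t))\<^sup>2)" for t
  define w' where "w' t = s * (2 * inner (U t) (- \<i> * z * U t + \<i> * p t * V t)
      - 2 * inner (V t) (\<i> * z * V t - \<i> * q t * U t))" for t
  have wd: "(w has_vector_derivative w' t) (at t within {0..1})" if t: "t \<in> {0..1}" for t
    unfolding w_def w'_def
    using sol[unfolded zs_sol_def, rule_format, OF t]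
    by (intro has_vector_derivative_mult_right has_vector_derivative_diff has_vd_inner_self) auto
  have w': "w' t \<ge> 2 * (\<bar>Im z\<bar> - R) * ((norm (U t))\<^sup>2 + (norm (V t))\<^sup>2)" if t: "t \<in> {0..1}" for t
  proof -
    define a b where "a = norm (U t)" and "b = norm (V t)"
    define e where "e = inner (U t) (\<i> * p t * V t) + inner (V t) (\<i> * q t * U t)"
    have "\<bar>inner (U t) (\<i> * p t * V t)\<bar> \<le> a * (R * b)"
      by (rule order_trans[OF Cauchy_Schwarz_ineq2])
        (auto simp: a_def b_def norm_mult intro!: mult_left_mono mult_right_mono R t)
    moreover have "\<bar>inner (V t) (\<i> * q t * U t)\<bar> \<le> b * (R * a)"
      by (rule order_trans[OF Cauchy_Schwarz_ineq2])
        (auto simp: a_def b_def norm_mult intro!: mult_left_mono mult_right_mono R t)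
    ultimately have "\<bar>e\<bar> \<le> 2 * R * (a * b)" unfolding e_def by (simp add: algebra_simps)
    moreover have "R \<ge> 0" by (rule order_trans[OF norm_ge_zero R(1)[OF t]])
    then have "0 \<le> R * (a - b)\<^sup>2" by simp
    then have "2 * R * (a * b) \<le> R * (a\<^sup>2 + b\<^sup>2)" by (simp add: power2_eq_square algebra_simps)
    moreover have "\<bar>s * e\<bar> \<le> \<bar>e\<bar>" using s(2) by (simp add: abs_mult mult_left_le_one_le)
    ultimately have "- (s * e) \<le> R * (a\<^sup>2 + b\<^sup>2)" by linarith
    moreover have "w' t = 2 * (s * Im z) * (a\<^sup>2 + b\<^sup>2) + 2 * (s * e)"
      unfolding w'_def inner_add_right inner_diff_right inner_ii_mult a_def b_def e_def by (simp add: algebra_simps)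
    ultimately show ?thesis unfolding s(1) a_def[symmetric] b_def[symmetric] by (simp add: algebra_simps)
  qed
  have w'0: "w' t \<ge> 0" if "t \<in> {0..1}" for t
    by (rule order_trans[OF _ w'[OF that]]) (use neg in auto)
  have mono: "w s \<le> w t" if "0 \<le> s" "s \<le> t" "t \<le> 1" for s t
  proof (cases "s = t")
    case False
    then have "\<exists>x\<in>{s<..<t}. w t - w s = (t - s) *\<^sub>R w' x"
      using that has_vector_derivative_within_subset[OF wd, of _ "{s..t}"]
      by (intro mvt_simple[where f' = "\<lambda>x h. h *\<^sub>R w' x"]) (auto simp: has_vector_derivative_def)
    then obtain x where x: "x \<in> {s<..<t}" "w t - w s = (t - s) * w' x" by auto
    have "0 \<le> (t - s) * w' x" using w'0[of x] x that by (intro mult_nonneg_nonneg) auto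
    then show ?thesis using x by simp
  qed simp
  have "w 0 = 0" "w 1 = 0" using init bdry by (auto simp: w_def)
  then have w0: "w t = 0" if "t \<in> {0..1}" for t using mono[of 0 t] mono[of t 1] that by auto
  have "((\<lambda>t. 0) has_vector_derivative w' 0) (at 0 within {0..1::real})"
    by (rule has_vector_derivative_transform[OF _ _ wd]) (use w0 in auto)
  moreover have "((\<lambda>t. 0) has_vector_derivative (0::real)) (at 0 within {0..1::real})" by simp
  ultimately have "w' 0 = 0"
    using vector_derivative_unique_within_closed_interval[of 0 1 0 "\<lambda>t. 0::real" "w' 0" 0] by simp
  moreover have "w' 0 \<ge> 2 * (\<bar>Im z\<bar> - R) * 2" using w'[of 0] init by simp
  ultimately show False using neg by simp
qed

text \<open>
  The symmetry of the operator for the bilinear form \<open>\<integral> F\<^sub>1 G\<^sub>2 + F\<^sub>2 G\<^sub>1\<close>: integrate the derivative of the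
  Wronskian \<open>U Y - V X\<close>, which the boundary conditions annihilate at both ends. The functions \<open>h1\<close> and \<open>h2\<close>
  make it applicable to generalised eigenvectors \<open>(X, Y)\<close>.
\<close>

theorem zs_wronskian:
  assumes sol: "zs_sol p q z U V" and bF: "U 0 = V 0" "U 1 = V 1"
    and X: "\<And>x. x \<in> {0..1} \<Longrightarrow>
      (X has_vector_derivative - \<i> * (w * X x + h1 x) + \<i> * p x * Y x) (at x within {0..1})"
    and Y: "\<And>x. x \<in> {0..1} \<Longrightarrow>
      (Y has_vector_derivative \<i> * (w * Y x + h2 x) - \<i> * q x * X x) (at x within {0..1})"
    and bG: "X 0 = Y 0" "X 1 = Y 1"
  shows "((\<lambda>x. (w - z) * (U x * Y x + V x * X x) + (h2 x * U x + h1 x * V x)) has_integral 0) {0..1}"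
proof -
  have "((\<lambda>x. \<i> * ((w - z) * (U x * Y x + V x * X x) + (h2 x * U x + h1 x * V x))) has_integral
      (U 1 * Y 1 - V 1 * X 1) - (U 0 * Y 0 - V 0 * X 0)) {0..1}"
  proof (rule fundamental_theorem_of_calculus)
    fix x :: real assume x: "x \<in> {0..1}"
    note a = sol[unfolded zs_sol_def, rule_format, OF x]
    show "((\<lambda>x. U x * Y x - V x * X x) has_vector_derivative
        \<i> * ((w - z) * (U x * Y x + V x * X x) + (h2 x * U x + h1 x * V x))) (at x within {0..1})"
      using has_vector_derivative_diff[OF has_vector_derivative_mult[OF conjunct1[OF a] Y[OF x]]
          has_vector_derivative_mult[OF conjunct2[OF a] X[OF x]]]
      by (simp add: algebra_simps)
  qed auto
  then have "((\<lambda>x. \<i> * ((w - z) * (U x * Y x + V x * X x) + (h2 x * U x + h1 x * V x))) has_integral 0) {0..1}"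
    using bF bG by simp
  from has_integral_mult_right[OF this, of "- \<i>"] show ?thesis by (simp add: mult.assoc[symmetric])
qed

section \<open>Differential polynomials\<close>

lemma diff_poly_eval_superset:
  assumes "finite S" "Poly_Mapping.keys p \<subseteq> S"
  shows "diff_poly_eval p a = (\<Sum>m\<in>S. Poly_Mapping.lookup p m *
        (\<Prod>v\<in>Poly_Mapping.keys m. a v ^ Poly_Mapping.lookup m v))"
  unfolding diff_poly_eval_def using assms
  by (intro sum.mono_neutral_left) (auto simp: in_keys_iff)

lemma diff_poly_eval_add: "diff_poly_eval (p + q) a = diff_poly_eval p a + diff_poly_eval q a"
proof -
  let ?S = "Poly_Mapping.keys p \<union> Poly_Mapping.keys q"
  have "Poly_Mapping.keys (p + q) \<subseteq> ?S" by (rule Poly_Mapping.keys_add)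
  then show ?thesis
    by (simp add: diff_poly_eval_superset[of ?S] lookup_add distrib_right sum.distrib)
qed

lemma diff_poly_eval_zero: "diff_poly_eval 0 a = 0"
  by (simp add: diff_poly_eval_def)

lemma diff_poly_eval_sum: "diff_poly_eval (sum f A) a = (\<Sum>i\<in>A. diff_poly_eval (f i) a)"
  by (induction A rule: infinite_finite_induct) (auto simp: diff_poly_eval_zero diff_poly_eval_add)

definition monomial_eval :: "((nat + nat) \<Rightarrow>\<^sub>0 nat) \<Rightarrow> (nat + nat \<Rightarrow> complex) \<Rightarrow> complex" where
  "monomial_eval m a = (\<Prod>v\<in>Poly_Mapping.keys m. a v ^ Poly_Mapping.lookup m v)"

lemma monomial_eval_superset:
  assumes "finite S" "Poly_Mapping.keys m \<subseteq> S"
  shows "monomial_eval m a = (\<Prod>v\<in>S. a v ^ Poly_Mapping.lookup m v)"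
  unfolding monomial_eval_def using assms
  by (intro prod.mono_neutral_left) (auto simp: in_keys_iff)

lemma monomial_eval_add: "monomial_eval (m + n) a = monomial_eval m a * monomial_eval n a"
proof -
  let ?S = "Poly_Mapping.keys m \<union> Poly_Mapping.keys n"
  have "Poly_Mapping.keys (m + n) \<subseteq> ?S" by (rule Poly_Mapping.keys_add)
  then show ?thesis
    by (simp add: monomial_eval_superset[of ?S] lookup_add power_add prod.distrib)
qed

lemma diff_poly_eval_single: "diff_poly_eval (Poly_Mapping.single m c) a = c * monomial_eval m a"
  by (simp add: diff_poly_eval_def monomial_eval_def)

lemma diff_poly_sum_monomials:
  "(\<Sum>m\<in>Poly_Mapping.keys p. Poly_Mapping.single m (Poly_Mapping.lookup p m)) = (p :: diff_poly)"
  by (rule poly_mapping_eqI)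
    (auto simp: Poly_Mapping.lookup_sum lookup_single when_def in_keys_iff sum.delta)

lemma diff_poly_eval_mult: "diff_poly_eval (p * q) a = diff_poly_eval p a * diff_poly_eval q a"
proof -
  let ?s = "\<lambda>p m. Poly_Mapping.single m (Poly_Mapping.lookup p m)"
  have e: "diff_poly_eval r a = (\<Sum>m\<in>Poly_Mapping.keys r. diff_poly_eval (?s r m) a)" for r :: diff_poly
    by (simp add: diff_poly_eval_single) (simp add: diff_poly_eval_def monomial_eval_def)
  have "p * q = (\<Sum>m\<in>Poly_Mapping.keys p. ?s p m) * (\<Sum>n\<in>Poly_Mapping.keys q. ?s q n)"
    by (simp only: diff_poly_sum_monomials)
  also have "\<dots> = (\<Sum>m\<in>Poly_Mapping.keys p. \<Sum>n\<in>Poly_Mapping.keys q.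
      Poly_Mapping.single (m + n) (Poly_Mapping.lookup p m * Poly_Mapping.lookup q n))"
    by (simp add: sum_product Poly_Mapping.mult_single)
  finally have "diff_poly_eval (p * q) a = (\<Sum>m\<in>Poly_Mapping.keys p. \<Sum>n\<in>Poly_Mapping.keys q.
      diff_poly_eval (?s p m) a * diff_poly_eval (?s q n) a)"
    by (simp add: diff_poly_eval_sum diff_poly_eval_single monomial_eval_add mult_ac)
  also have "\<dots> = diff_poly_eval p a * diff_poly_eval q a"
    unfolding e[of p] e[of q] by (rule sum_product[symmetric])
  finally show ?thesis .
qed

text \<open>
  Syntax for differential polynomials in \<open>(p, q)\<close>. Recursions and inductions on their structure are awkward for
  finitely supported maps, so they are done on expressions; \<open>to_diff_poly\<close> translates them at the very end.
\<close>

datatype dexpr = Cst complex | VarP nat | VarQ nat | Plus dexpr dexpr | Times dexpr dexpr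

primrec dval :: "dexpr \<Rightarrow> (nat \<Rightarrow> complex) \<Rightarrow> (nat \<Rightarrow> complex) \<Rightarrow> complex" where
  "dval (Cst c) a b = c"
| "dval (VarP j) a b = a j"
| "dval (VarQ j) a b = b j"
| "dval (Plus e f) a b = dval e a b + dval f a b"
| "dval (Times e f) a b = dval e a b * dval f a b"

abbreviation dval_at :: "dexpr \<Rightarrow> (nat \<Rightarrow> cfn) \<Rightarrow> (nat \<Rightarrow> cfn) \<Rightarrow> cfn" where
  "dval_at e a b x \<equiv> dval e (\<lambda>j. a j x) (\<lambda>j. b j x)"

primrec dtotal :: "dexpr \<Rightarrow> dexpr" where
  "dtotal (Cst c) = Cst 0"
| "dtotal (VarP j) = VarP (Suc j)"
| "dtotal (VarQ j) = VarQ (Suc j)"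
| "dtotal (Plus e f) = Plus (dtotal e) (dtotal f)"
| "dtotal (Times e f) = Plus (Times (dtotal e) f) (Times e (dtotal f))"

primrec below :: "nat \<Rightarrow> dexpr \<Rightarrow> bool" where
  "below k (Cst c) = True"
| "below k (VarP j) = (j < k)"
| "below k (VarQ j) = (j < k)"
| "below k (Plus e f) = (below k e \<and> below k f)"
| "below k (Times e f) = (below k e \<and> below k f)"

text \<open>
  The substitution \<open>(p, q) \<mapsto> (- q, - p)\<close> of the mirror symmetry.
\<close>

primrec dmirror :: "dexpr \<Rightarrow> dexpr" where
  "dmirror (Cst c) = Cst c"
| "dmirror (VarP j) = Times (Cst (-1)) (VarQ j)"
| "dmirror (VarQ j) = Times (Cst (-1)) (VarP j)"
| "dmirror (Plus e f) = Plus (dmirror e) (dmirror f)"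
| "dmirror (Times e f) = Times (dmirror e) (dmirror f)"

primrec to_diff_poly :: "dexpr \<Rightarrow> diff_poly" where
  "to_diff_poly (Cst c) = Poly_Mapping.single 0 c"
| "to_diff_poly (VarP j) = Poly_Mapping.single (Poly_Mapping.single (Inl j) 1) 1"
| "to_diff_poly (VarQ j) = Poly_Mapping.single (Poly_Mapping.single (Inr j) 1) 1"
| "to_diff_poly (Plus e f) = to_diff_poly e + to_diff_poly f"
| "to_diff_poly (Times e f) = to_diff_poly e * to_diff_poly f"

lemma diff_poly_eval_to_diff_poly: "diff_poly_eval (to_diff_poly e) (case_sum a b) = dval e a b"
  by (induction e) (auto simp: diff_poly_eval_single monomial_eval_def diff_poly_eval_add diff_poly_eval_mult)

lemma diff_poly_vars_add: "diff_poly_vars (p + q) \<subseteq> diff_poly_vars p \<union> diff_poly_vars q"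
  unfolding diff_poly_vars_def using Poly_Mapping.keys_add[of p q] by blast

lemma diff_poly_vars_mult: "diff_poly_vars (p * q) \<subseteq> diff_poly_vars p \<union> diff_poly_vars q"
proof
  fix v assume "v \<in> diff_poly_vars (p * q)"
  then obtain m where m: "m \<in> Poly_Mapping.keys (p * q)" "v \<in> Poly_Mapping.keys m"
    unfolding diff_poly_vars_def by blast
  obtain m1 m2 where m12: "m = m1 + m2" "m1 \<in> Poly_Mapping.keys p" "m2 \<in> Poly_Mapping.keys q"
    using m(1) Poly_Mapping.keys_mult[of p q] by blast
  have "v \<in> Poly_Mapping.keys m1 \<union> Poly_Mapping.keys m2"
    using m(2) Poly_Mapping.keys_add[of m1 m2] unfolding m12(1) by blast
  with m12 show "v \<in> diff_poly_vars p \<union> diff_poly_vars q"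
    unfolding diff_poly_vars_def by blast
qed

lemma diff_poly_vars_to_diff_poly:
  "below k e \<Longrightarrow> diff_poly_vars (to_diff_poly e) \<subseteq> Inl ` {..<k} \<union> Inr ` {..<k}"
proof (induction e)
  case (Plus e f)
  then show ?case
    using diff_poly_vars_add[of "to_diff_poly e" "to_diff_poly f"] by (simp del: Un_subset_iff) blast
next
  case (Times e f)
  then show ?case
    using diff_poly_vars_mult[of "to_diff_poly e" "to_diff_poly f"] by (simp del: Un_subset_iff) blast
qed (auto simp: diff_poly_vars_def split: if_splits)

lemma below_mono: "below k e \<Longrightarrow> k \<le> l \<Longrightarrow> below l e"
  by (induction e) auto

lemma below_dtotal: "below k e \<Longrightarrow> below (Suc k) (dtotal e)"
  by (induction e) (auto intro: below_mono)

lemma dval_dmirror: "dval (dmirror e) a b = dval e (\<lambda>j. - b j) (\<lambda>j. - a j)"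
  by (induction e) auto

lemma below_dmirror: "below k (dmirror e) = below k e"
  by (induction e) auto

lemma dval_cong:
  assumes "below k e" "\<And>j. j < k \<Longrightarrow> a j = a' j" "\<And>j. j < k \<Longrightarrow> b j = b' j"
  shows "dval e a b = dval e a' b'"
  using assms by (induction e) auto

lemma dval_bound:
  "\<exists>C\<ge>0. \<forall>a b. below k e \<longrightarrow> (\<forall>j<k. norm (a j) \<le> R \<and> norm (b j) \<le> R) \<longrightarrow> norm (dval e a b) \<le> C"
proof (induction e)
  case (Plus e f)
  obtain C where C: "C \<ge> 0"
    "\<forall>a b. below k e \<longrightarrow> (\<forall>j<k. norm (a j) \<le> R \<and> norm (b j) \<le> R) \<longrightarrow> norm (dval e a b) \<le> C"
    using Plus.IH(1) by blast
  obtain C' where C': "C' \<ge> 0"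
    "\<forall>a b. below k f \<longrightarrow> (\<forall>j<k. norm (a j) \<le> R \<and> norm (b j) \<le> R) \<longrightarrow> norm (dval f a b) \<le> C'"
    using Plus.IH(2) by blast
  show ?case
  proof (intro exI[of _ "C + C'"] conjI allI impI)
    fix a b :: "nat \<Rightarrow> complex" assume "below k (Plus e f)" "\<forall>j<k. norm (a j) \<le> R \<and> norm (b j) \<le> R"
    then have "norm (dval e a b) \<le> C" "norm (dval f a b) \<le> C'" using C(2) C'(2) by simp_all
    then show "norm (dval (Plus e f) a b) \<le> C + C'"
      unfolding dval.simps by (rule norm_triangle_mono)
  qed (use C C' in simp)
next
  case (Times e f)
  obtain C where C: "C \<ge> 0"
    "\<forall>a b. below k e \<longrightarrow> (\<forall>j<k. norm (a j) \<le> R \<and> norm (b j) \<le> R) \<longrightarrow> norm (dval e a b) \<le> C"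
    using Times.IH(1) by blast
  obtain C' where C': "C' \<ge> 0"
    "\<forall>a b. below k f \<longrightarrow> (\<forall>j<k. norm (a j) \<le> R \<and> norm (b j) \<le> R) \<longrightarrow> norm (dval f a b) \<le> C'"
    using Times.IH(2) by blast
  show ?case
  proof (intro exI[of _ "C * C'"] conjI allI impI)
    fix a b :: "nat \<Rightarrow> complex" assume "below k (Times e f)" "\<forall>j<k. norm (a j) \<le> R \<and> norm (b j) \<le> R"
    then have "norm (dval e a b) \<le> C" "norm (dval f a b) \<le> C'" using C(2) C'(2) by simp_all
    then show "norm (dval (Times e f) a b) \<le> C * C'"
      unfolding dval.simps norm_mult using C(1) by (intro mult_mono) auto
  qed (use C C' in simp)
next
  case (Cst c)
  then show ?case by (intro exI[of _ "norm c"]) auto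
next
  case (VarP j)
  then show ?case by (intro exI[of _ "max R 0"]) (auto simp: le_max_iff_disj)
next
  case (VarQ j)
  then show ?case by (intro exI[of _ "max R 0"]) (auto simp: le_max_iff_disj)
qed

lemma dval_continuous_on:
  assumes "below k e" "\<And>j. j < k \<Longrightarrow> continuous_on S (a j)" "\<And>j. j < k \<Longrightarrow> continuous_on S (b j)"
  shows "continuous_on S (\<lambda>x. dval_at e a b x)"
  using assms by (induction e) (auto intro!: continuous_intros)

lemma dval_has_vector_derivative:
  assumes "below k e" "\<And>j. j < k \<Longrightarrow> (a j has_vector_derivative a (Suc j) x) (at x within S)"
    "\<And>j. j < k \<Longrightarrow> (b j has_vector_derivative b (Suc j) x) (at x within S)"
  shows "((\<lambda>x. dval_at e a b x) has_vector_derivative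
      dval_at (dtotal e) a b x) (at x within S)"
  using assms
proof (induction e)
  case (Times e f)
  then have "((\<lambda>x. dval_at e a b x * dval_at f a b x) has_vector_derivative
      dval_at e a b x * dval_at (dtotal f) a b x +
      dval_at (dtotal e) a b x * dval_at f a b x) (at x within S)"
    by (intro has_vector_derivative_mult) auto
  then show ?case by (simp add: add.commute)
qed (auto intro!: derivative_intros)

section \<open>The coefficients of the formal Riccati solution\<close>

definition dsum :: "dexpr list \<Rightarrow> dexpr" where
  "dsum es = foldr Plus es (Cst 0)"

lemma dval_dsum: "dval (dsum es) a b = (\<Sum>e\<leftarrow>es. dval e a b)"
  by (induction es) (auto simp: dsum_def)

lemma below_dsum: "below k (dsum es) \<longleftrightarrow> (\<forall>e\<in>set es. below k e)"
  by (induction es) (auto simp: dsum_def)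

text \<open>
  Comparing powers of \<open>\<zeta>\<close> in the Riccati equation \<open>\<sigma>' = \<sigma> / \<zeta> - i q - i p \<sigma>\<^sup>2\<close> for
  \<open>\<sigma> = \<Sum>k. s\<^sub>k \<zeta> ^ (k + 1)\<close> gives \<open>s\<^sub>0 = i q\<close> and \<open>s\<^sub>k\<^sub>+\<^sub>1 = s\<^sub>k' + i p \<Sum>j<k. s\<^sub>j s\<^sub>k\<^sub>-\<^sub>1\<^sub>-\<^sub>j\<close>. Separating the linear
  term, \<open>s\<^sub>k\<close> is \<open>i\<close> times the \<open>k\<close>-th derivative of \<open>q\<close> plus a polynomial \<open>m\<^sub>k\<close> (\<open>ric_m\<close>) that contains only
  derivatives of order below \<open>k - 1\<close>. The list collects \<open>m\<^sub>0, \<dots>, m\<^sub>k\<close>, as the recursion uses all of them.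
\<close>

primrec ric_list :: "nat \<Rightarrow> dexpr list" where
  "ric_list 0 = [Cst 0]"
| "ric_list (Suc k) = ric_list k @ [Plus (dtotal (ric_list k ! k)) (dsum (map (\<lambda>j.
     Times (Times (Cst \<i>) (VarP 0))
       (Times (Plus (Times (Cst \<i>) (VarQ j)) (ric_list k ! j))
         (Plus (Times (Cst \<i>) (VarQ (k - 1 - j))) (ric_list k ! (k - 1 - j))))) [0..<k]))]"

definition ric_m :: "nat \<Rightarrow> dexpr" where
  "ric_m k = ric_list k ! k"

definition ric_s :: "nat \<Rightarrow> dexpr" where
  "ric_s j = Plus (Times (Cst \<i>) (VarQ j)) (ric_m j)"

lemma length_ric_list: "length (ric_list k) = Suc k"
  by (induction k) auto

lemma ric_list_nth: "j \<le> k \<Longrightarrow> ric_list k ! j = ric_m j"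
proof (induction k)
  case 0
  then show ?case by (simp add: ric_m_def)
next
  case (Suc k)
  then show ?case
    by (cases "j = Suc k") (auto simp: ric_m_def nth_append length_ric_list simp del: ric_list.simps(2),
       simp add: nth_append length_ric_list)
qed

lemma ric_m_0: "ric_m 0 = Cst 0"
  by (simp add: ric_m_def)

lemma ric_m_Suc:
  "ric_m (Suc k) = Plus (dtotal (ric_m k))
     (dsum (map (\<lambda>j. Times (Times (Cst \<i>) (VarP 0)) (Times (ric_s j) (ric_s (k - 1 - j)))) [0..<k]))"
proof -
  have "map (\<lambda>j. Times (Times (Cst \<i>) (VarP 0))
       (Times (Plus (Times (Cst \<i>) (VarQ j)) (ric_list k ! j))
         (Plus (Times (Cst \<i>) (VarQ (k - 1 - j))) (ric_list k ! (k - 1 - j))))) [0..<k] =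
     map (\<lambda>j. Times (Times (Cst \<i>) (VarP 0)) (Times (ric_s j) (ric_s (k - 1 - j)))) [0..<k]"
    by (rule map_cong) (auto simp: ric_s_def ric_list_nth)
  then show ?thesis
    by (simp only: ric_m_def[of "Suc k"] ric_list.simps nth_append length_ric_list less_irrefl if_False
        diff_self_eq_0 nth_Cons_0 ric_list_nth order_refl)
qed

lemma ric_m_below: "below (k - 1) (ric_m k)"
proof (induction k rule: less_induct)
  case (less k)
  show ?case
  proof (cases k)
    case (Suc k')
    have "below k' (dtotal (ric_m k'))"
    proof (cases k')
      case (Suc k'')
      then show ?thesis using below_dtotal[OF less[of k']] \<open>k = Suc k'\<close> by simp
    qed (simp add: ric_m_0)
    moreover have "below k' (ric_m j)" if "j < k'" for j
      using less[of j] that Suc by (auto intro: below_mono)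
    ultimately show ?thesis using Suc by (auto simp: ric_m_Suc ric_s_def below_dsum)
  qed (simp add: ric_m_0)
qed

lemma ric_s_below: "below (Suc k) (ric_s k)"
  unfolding ric_s_def using below_mono[OF ric_m_below, of k "Suc k"] by simp

lemma dval_ric_s: "dval (ric_s j) a b = \<i> * b j + dval (ric_m j) a b"
  by (simp add: ric_s_def)

lemma dval_ric_m_Suc:
  "dval (ric_m (Suc k)) a b = dval (dtotal (ric_m k)) a b +
     \<i> * a 0 * (\<Sum>j<k. dval (ric_s j) a b * dval (ric_s (k - 1 - j)) a b)"
  unfolding ric_m_Suc dval.simps(4) dval_dsum
  by (simp add: sum_list_distinct_conv_sum_set comp_def atLeast0LessThan sum_distrib_left mult.assoc)

lemma sobolev_jetD:
  assumes "sobolev_jet N M a" "j < N"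
  shows "continuous_on {0..1} (a j)" "a j 1 = a j 0"
    "x \<in> {0..1} \<Longrightarrow> a j x = a j 0 + integral {0..x} (a (Suc j))" "x \<in> {0..1} \<Longrightarrow> norm (a j x) \<le> M"
  using conjunct1[OF assms(1)[unfolded sobolev_jet_def], rule_format, OF assms(2)] by blast+

lemma sobolev_jet_top:
  assumes "sobolev_jet N M a"
  shows "a N absolutely_integrable_on {0..1}" "(\<lambda>x. (norm (a N x))\<^sup>2) integrable_on {0..1}"
    "integral {0..1} (\<lambda>x. (norm (a N x))\<^sup>2) \<le> M"
  using assms unfolding sobolev_jet_def by blast+

lemma sobolev_jet_minus:
  assumes "sobolev_jet N M a"
  shows "sobolev_jet N M (\<lambda>j x. - a j x)"
proof -
  note d = assms[unfolded sobolev_jet_def]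
  have 1: "continuous_on {0..1} (\<lambda>x. - a j x) \<and> - a j 1 = - a j 0 \<and>
      (\<forall>x\<in>{0..1}. - a j x = - a j 0 + integral {0..x} (\<lambda>x. - a (Suc j) x) \<and> norm (- a j x) \<le> M)"
    if "j < N" for j
  proof (intro conjI ballI)
    note e = sobolev_jetD[OF assms that]
    show "continuous_on {0..1} (\<lambda>x. - a j x)" by (intro continuous_on_minus e)
    show "- a j 1 = - a j 0" by (simp only: e(2))
    fix x :: real assume x: "x \<in> {0..1}"
    have "- a j x = - (a j 0 + integral {0..x} (a (Suc j)))" by (simp only: e(3)[OF x])
    also have "\<dots> = - a j 0 + integral {0..x} (\<lambda>x. - a (Suc j) x)" by simp
    finally show "- a j x = - a j 0 + integral {0..x} (\<lambda>x. - a (Suc j) x)" .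
    show "norm (- a j x) \<le> M" using e(4)[OF x] by simp
  qed
  have "(\<lambda>x. - a N x) absolutely_integrable_on {0..1}"
    using sobolev_jet_top(1)[OF assms] unfolding absolutely_integrable_on_def
    by (simp add: integrable_neg)
  then show ?thesis unfolding sobolev_jet_def norm_minus_cancel[of "a N _"]
    using 1 sobolev_jet_top[OF assms] by blast
qed

lemma sobolev_jet_deriv:
  assumes "sobolev_jet N M a" "Suc j < N" "x \<in> {0..1}"
  shows "(a j has_vector_derivative a (Suc j) x) (at x within {0..1})"
proof (rule has_vector_derivative_transform[OF assms(3)])
  show "a j t = a j 0 + integral {0..t} (a (Suc j))" if "t \<in> {0..1}" for t
    by (rule sobolev_jetD(3)[OF assms(1) _ that]) (use assms in simp)
  have "continuous_on {0..1} (a (Suc j))" by (rule sobolev_jetD(1)[OF assms(1,2)])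
  then show "((\<lambda>t. a j 0 + integral {0..t} (a (Suc j))) has_vector_derivative a (Suc j) x) (at x within {0..1})"
    using has_vector_derivative_add[OF has_vector_derivative_const integral_has_vector_derivative[OF _ assms(3)]]
    by simp
qed

section \<open>Uniform asymptotic bounds\<close>

text \<open>
  A bound \<open>O(g)\<close> as \<open>\<bar>z t\<bar>\<close> tends to infinity, uniform in the parameter \<open>t \<in> T\<close> and in \<open>x \<in> {0..1}\<close>. The parameter
  will comprise the potential together with its eigenvalue and index, so that uniformity on bounded sets
  of potentials is built in.
\<close>

definition unif_O ::
    "'t set \<Rightarrow> ('t \<Rightarrow> complex) \<Rightarrow> ('t \<Rightarrow> real \<Rightarrow> 'a::real_normed_vector) \<Rightarrow> ('t \<Rightarrow> real) \<Rightarrow> bool" where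
  "unif_O T z f g \<longleftrightarrow> (\<exists>C\<ge>0. \<exists>K\<ge>1. \<forall>t\<in>T. K \<le> norm (z t) \<longrightarrow> (\<forall>x\<in>{0..1}. norm (f t x) \<le> C * g t))"

lemma unif_OE:
  assumes "unif_O T z f g"
  obtains C K where "C \<ge> 0" "K \<ge> 1"
    "\<And>t x. t \<in> T \<Longrightarrow> K \<le> norm (z t) \<Longrightarrow> x \<in> {0..1} \<Longrightarrow> norm (f t x) \<le> C * g t"
  using assms unfolding unif_O_def by blast

lemma unif_OI:
  assumes "C \<ge> 0"
    "\<And>t x. t \<in> T \<Longrightarrow> K \<le> norm (z t) \<Longrightarrow> 1 \<le> norm (z t) \<Longrightarrow> x \<in> {0..1} \<Longrightarrow> norm (f t x) \<le> C * g t"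
  shows "unif_O T z f g"
  unfolding unif_O_def using assms by (intro exI[of _ C] conjI exI[of _ "max K 1"]) auto

lemma unif_O_uminus_param: "unif_O T (\<lambda>t. - z t) f g = unif_O T z f g"
  by (simp add: unif_O_def)

lemma unif_O_add:
  assumes "unif_O T z f g" "unif_O T z h g"
  shows "unif_O T z (\<lambda>t x. f t x + h t x) g"
proof -
  obtain C K where C: "C \<ge> 0" "K \<ge> 1" and
    1: "\<And>t x. t \<in> T \<Longrightarrow> K \<le> norm (z t) \<Longrightarrow> x \<in> {0..1} \<Longrightarrow> norm (f t x) \<le> C * g t"
    using unif_OE[OF assms(1)] by metis
  obtain C' K' where C': "C' \<ge> 0" "K' \<ge> 1" and
    2: "\<And>t x. t \<in> T \<Longrightarrow> K' \<le> norm (z t) \<Longrightarrow> x \<in> {0..1} \<Longrightarrow> norm (h t x) \<le> C' * g t"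
    using unif_OE[OF assms(2)] by metis
  show ?thesis
  proof (rule unif_OI[of "C + C'" _ "max K K'"])
    fix t x assume t: "t \<in> T" "max K K' \<le> norm (z t)" "x \<in> {0..1::real}"
    have "norm (f t x + h t x) \<le> C * g t + C' * g t"
      by (rule norm_triangle_mono[OF 1 2]) (use t in auto)
    then show "norm (f t x + h t x) \<le> (C + C') * g t" by (simp add: distrib_right)
  qed (use C C' in auto)
qed

lemma unif_O_minus:
  assumes "unif_O T z f g"
  shows "unif_O T z (\<lambda>t x. - f t x) g"
  using assms unfolding unif_O_def by simp

lemma unif_O_diff:
  assumes "unif_O T z f g" "unif_O T z h g"
  shows "unif_O T z (\<lambda>t x. f t x - h t x) g"
  using unif_O_add[OF assms(1) unif_O_minus[OF assms(2)]] by simp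

lemma unif_O_mult:
  fixes f h :: "'t \<Rightarrow> cfn"
  assumes "unif_O T z f g" "unif_O T z h k"
  shows "unif_O T z (\<lambda>t x. f t x * h t x) (\<lambda>t. g t * k t)"
proof -
  obtain C K where C: "C \<ge> 0" "K \<ge> 1" and
    1: "\<And>t x. t \<in> T \<Longrightarrow> K \<le> norm (z t) \<Longrightarrow> x \<in> {0..1} \<Longrightarrow> norm (f t x) \<le> C * g t"
    using unif_OE[OF assms(1)] by metis
  obtain C' K' where C': "C' \<ge> 0" "K' \<ge> 1" and
    2: "\<And>t x. t \<in> T \<Longrightarrow> K' \<le> norm (z t) \<Longrightarrow> x \<in> {0..1} \<Longrightarrow> norm (h t x) \<le> C' * k t"
    using unif_OE[OF assms(2)] by metis
  show ?thesis
  proof (rule unif_OI[of "C * C'" _ "max K K'"])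
    fix t x assume t: "t \<in> T" "max K K' \<le> norm (z t)" "x \<in> {0..1::real}"
    have "norm (f t x * h t x) \<le> (C * g t) * (C' * k t)"
      unfolding norm_mult by (rule mult_mono'[OF 1 2]) (use t in auto)
    then show "norm (f t x * h t x) \<le> C * C' * (g t * k t)" by (simp add: mult_ac)
  qed (use C C' in auto)
qed

lemma unif_O_weaken:
  assumes "unif_O T z f g" "c \<ge> 0"
    and "\<And>t. t \<in> T \<Longrightarrow> 1 \<le> norm (z t) \<Longrightarrow> g t \<le> c * h t"
  shows "unif_O T z f h"
proof -
  obtain C K where C: "C \<ge> 0" "K \<ge> 1" and
    1: "\<And>t x. t \<in> T \<Longrightarrow> K \<le> norm (z t) \<Longrightarrow> x \<in> {0..1} \<Longrightarrow> norm (f t x) \<le> C * g t"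
    using unif_OE[OF assms(1)] by metis
  show ?thesis
  proof (rule unif_OI[of "C * c" _ K])
    fix t x assume t: "t \<in> T" "K \<le> norm (z t)" "1 \<le> norm (z t)" "x \<in> {0..1::real}"
    have "norm (f t x) \<le> C * g t" using 1 t by auto
    also have "\<dots> \<le> C * (c * h t)" using assms(3) t C by (intro mult_left_mono) auto
    finally show "norm (f t x) \<le> C * c * h t" by (simp add: mult.assoc)
  qed (use C assms in auto)
qed

lemma unif_O_cong:
  assumes "unif_O T z f g"
    and "\<And>t x. t \<in> T \<Longrightarrow> 1 \<le> norm (z t) \<Longrightarrow> x \<in> {0..1} \<Longrightarrow> f t x = h t x"
  shows "unif_O T z h g"
proof -
  obtain C K where C: "C \<ge> 0" "K \<ge> 1" and
    1: "\<And>t x. t \<in> T \<Longrightarrow> K \<le> norm (z t) \<Longrightarrow> x \<in> {0..1} \<Longrightarrow> norm (f t x) \<le> C * g t"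
    using unif_OE[OF assms(1)] by metis
  show ?thesis
  proof (rule unif_OI[OF C(1), of _ K])
    fix t x assume t: "t \<in> T" "K \<le> norm (z t)" "1 \<le> norm (z t)" "x \<in> {0..1::real}"
    show "norm (h t x) \<le> C * g t" using 1[OF t(1,2,4)] assms(2)[OF t(1,3,4)] by simp
  qed
qed

lemma unif_O_bounded:
  assumes "\<And>t x. t \<in> T \<Longrightarrow> 1 \<le> norm (z t) \<Longrightarrow> x \<in> {0..1} \<Longrightarrow> norm (f t x) \<le> C"
  shows "unif_O T z f (\<lambda>t. 1)"
proof (rule unif_OI[of "max C 0" _ 1])
  fix t x assume "t \<in> T" "1 \<le> norm (z t)" "x \<in> {0..1::real}"
  then have "norm (f t x) \<le> C" by (rule assms)
  then show "norm (f t x) \<le> max C 0 * 1" by simp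
qed simp

lemma unif_O_at:
  assumes "unif_O T z f g" "x \<in> {0..1}"
  shows "unif_O T z (\<lambda>t _. f t x) g"
  using assms unfolding unif_O_def by blast

lemma unif_O_sum:
  assumes "finite A" "\<And>i. i \<in> A \<Longrightarrow> unif_O T z (f i) g" "\<And>t. t \<in> T \<Longrightarrow> g t \<ge> 0"
  shows "unif_O T z (\<lambda>t x. \<Sum>i\<in>A. f i t x) g"
  using assms(1,2)
proof (induction A rule: finite_induct)
  case empty
  show ?case by (rule unif_OI[of 0 _ 1]) auto
next
  case (insert i A)
  then show ?case by (simp add: unif_O_add)
qed

lemma unif_O_integral_mult:
  fixes f h :: "'t \<Rightarrow> cfn"
  assumes "unif_O T z h g" and G: "\<And>t. t \<in> T \<Longrightarrow> integral {0..1} (\<lambda>x. norm (f t x)) \<le> G"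
    and f: "\<And>t. t \<in> T \<Longrightarrow> f t absolutely_integrable_on {0..1}"
    and h: "\<And>t. t \<in> T \<Longrightarrow> continuous_on {0..1} (h t)"
  shows "unif_O T z (\<lambda>t x. integral {0..x} (\<lambda>y. f t y * h t y)) g"
proof -
  obtain C K where C: "C \<ge> 0" "K \<ge> 1" and
    1: "\<And>t x. t \<in> T \<Longrightarrow> K \<le> norm (z t) \<Longrightarrow> x \<in> {0..1} \<Longrightarrow> norm (h t x) \<le> C * g t"
    using unif_OE[OF assms(1)] by metis
  show ?thesis
  proof (rule unif_OI[of "max G 0 * C" _ K])
    fix t x assume t: "t \<in> T" "K \<le> norm (z t)" "x \<in> {0..1::real}"
    have ai: "(\<lambda>y. f t y * h t y) absolutely_integrable_on {0..1}"
      by (rule absolutely_integrable_mult_continuous'[OF h f]) (use t in auto)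
    note i = absolutely_integrableD[OF ai] absolutely_integrableD[OF f[OF t(1)]]
    have sub: "k integrable_on {0..x}" if "k integrable_on {0..1}" for k :: "real \<Rightarrow> 'b::banach"
      using that by (rule integrable_on_subinterval) (use t in auto)
    have g0: "C * g t \<ge> 0" by (rule order_trans[OF norm_ge_zero 1[OF t]])
    have "norm (integral {0..x} (\<lambda>y. f t y * h t y)) \<le> integral {0..x} (\<lambda>y. norm (f t y) * (C * g t))"
    proof (rule integral_norm_bound_integral)
      show "(\<lambda>y. f t y * h t y) integrable_on {0..x}" by (rule sub[OF i(1)])
      show "(\<lambda>y. norm (f t y) * (C * g t)) integrable_on {0..x}" by (intro integrable_on_mult_left sub i)
      fix y assume "y \<in> {0..x}"
      then have "norm (h t y) \<le> C * g t" using 1[of t y] t by auto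
      then show "norm (f t y * h t y) \<le> norm (f t y) * (C * g t)"
        by (simp add: norm_mult mult_left_mono)
    qed
    also have "\<dots> = integral {0..x} (\<lambda>y. norm (f t y)) * (C * g t)" by simp
    also have "integral {0..x} (\<lambda>y. norm (f t y)) \<le> integral {0..1} (\<lambda>y. norm (f t y))"
      by (rule integral_subset_le) (use t i sub[OF i(4)] in auto)
    also have "\<dots> \<le> max G 0" using G[OF t(1)] by simp
    finally show "norm (integral {0..x} (\<lambda>y. f t y * h t y)) \<le> max G 0 * C * g t"
      using g0 by (simp add: mult_right_mono mult.assoc)
  qed (use C in auto)
qed

lemma unif_O_integral:
  fixes h :: "'t \<Rightarrow> cfn"
  assumes "unif_O T z h g" and h: "\<And>t. t \<in> T \<Longrightarrow> continuous_on {0..1} (h t)"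
  shows "unif_O T z (\<lambda>t x. integral {0..x} (h t)) g"
  using unif_O_integral_mult[OF assms(1), of "\<lambda>t x. 1" 1] h
  by (simp add: absolutely_integrable_continuous_real)

lemma norm_exp_minus_1_le: "norm (exp w - 1) \<le> norm w * exp (norm (w::complex))"
proof -
  have "norm (exp w - (\<Sum>i\<le>0. w ^ i / fact i)) \<le> exp (norm w) * (norm w ^ Suc 0) / fact 0"
    by (rule Taylor_exp_field)
  then show ?thesis by (simp add: mult.commute)
qed

lemma unif_O_exp:
  assumes "unif_O T z f g" and "\<And>t. t \<in> T \<Longrightarrow> 1 \<le> norm (z t) \<Longrightarrow> g t \<le> 1"
  shows "unif_O T z (\<lambda>t x. exp (f t x) - (1::complex)) g"
proof -
  obtain C K where C: "C \<ge> 0" "K \<ge> 1" and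
    1: "\<And>t x. t \<in> T \<Longrightarrow> K \<le> norm (z t) \<Longrightarrow> x \<in> {0..1} \<Longrightarrow> norm (f t x) \<le> C * g t"
    using unif_OE[OF assms(1)] by metis
  show ?thesis
  proof (rule unif_OI[of "C * exp C" _ K])
    fix t x assume t: "t \<in> T" "K \<le> norm (z t)" "1 \<le> norm (z t)" "x \<in> {0..1::real}"
    have f: "norm (f t x) \<le> C * g t" using 1 t by auto
    also have "\<dots> \<le> C * 1" using assms(2) t C by (intro mult_left_mono) auto
    finally have f1: "norm (f t x) \<le> C" by simp
    have "norm (exp (f t x) - 1) \<le> norm (f t x) * exp (norm (f t x))" by (rule norm_exp_minus_1_le)
    also have "\<dots> \<le> (C * g t) * exp C" using f f1 by (intro mult_mono) (auto intro: order_trans[OF norm_ge_zero f])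
    finally show "norm (exp (f t x) - 1) \<le> C * exp C * g t" by (simp add: mult_ac)
  qed (use C in auto)
qed

definition inv_size :: "('t \<Rightarrow> complex) \<Rightarrow> 't \<Rightarrow> real" where
  "inv_size z t = 1 / norm (z t)"

lemma inv_size_nonneg: "inv_size z t \<ge> 0"
  by (simp add: inv_size_def)

lemma inv_size_le_1: "1 \<le> norm (z t) \<Longrightarrow> inv_size z t \<le> 1"
  by (simp add: inv_size_def divide_le_eq_1)

lemma inv_size_uminus: "inv_size (\<lambda>t. - z t) = inv_size z"
  by (simp add: inv_size_def fun_eq_iff)

lemma unif_O_power_mono:
  assumes "unif_O T z f (\<lambda>t. inv_size z t ^ k)" "l \<le> k"
  shows "unif_O T z f (\<lambda>t. inv_size z t ^ l)"
  by (rule unif_O_weaken[OF assms(1), of 1])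
    (use assms(2) in \<open>auto intro!: power_decreasing inv_size_nonneg inv_size_le_1\<close>)

lemma unif_O_inverse:
  fixes f :: "'t \<Rightarrow> cfn"
  assumes "unif_O T z f (inv_size z)"
  shows "unif_O T z (\<lambda>t x. inverse (1 - f t x) - 1) (inv_size z)"
    and "\<exists>K\<ge>1. \<forall>t\<in>T. K \<le> norm (z t) \<longrightarrow> (\<forall>x\<in>{0..1}. norm (f t x) \<le> 1 / 2)"
proof -
  obtain C K where C: "C \<ge> 0" "K \<ge> 1" and
    1: "\<And>t x. t \<in> T \<Longrightarrow> K \<le> norm (z t) \<Longrightarrow> x \<in> {0..1} \<Longrightarrow> norm (f t x) \<le> C * inv_size z t"
    using unif_OE[OF assms(1)] by metis
  have half: "norm (f t x) \<le> 1 / 2"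
    if t: "t \<in> T" "max K (2 * C) \<le> norm (z t)" "x \<in> {0..1::real}" for t x
  proof -
    have "norm (f t x) \<le> C * inv_size z t" using 1 t by auto
    also have "\<dots> \<le> 1 / 2"
    proof -
      have "norm (z t) > 0" "2 * C \<le> norm (z t)" using t(2) C(2) by auto
      then show ?thesis by (simp add: inv_size_def field_simps)
    qed
    finally show ?thesis .
  qed
  then show "\<exists>K\<ge>1. \<forall>t\<in>T. K \<le> norm (z t) \<longrightarrow> (\<forall>x\<in>{0..1}. norm (f t x) \<le> 1 / 2)"
    using C by (intro exI[of _ "max K (2 * C)"]) auto
  show "unif_O T z (\<lambda>t x. inverse (1 - f t x) - 1) (inv_size z)"
  proof (rule unif_OI[of "2 * C" _ "max K (2 * C)"])
    fix t x assume t: "t \<in> T" "max K (2 * C) \<le> norm (z t)" "x \<in> {0..1::real}"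
    note h = half[OF t]
    have n: "norm (1 - f t x) \<ge> 1 / 2" using h norm_triangle_ineq2[of 1 "f t x"] by simp
    then have "1 - f t x \<noteq> 0" by auto
    then have "inverse (1 - f t x) - 1 = f t x * inverse (1 - f t x)" by (simp add: field_simps)
    then have "norm (inverse (1 - f t x) - 1) = norm (f t x) / norm (1 - f t x)"
      by (simp add: norm_mult norm_inverse divide_inverse)
    also have "\<dots> \<le> norm (f t x) / (1 / 2)" using n by (intro divide_left_mono) auto
    also have "\<dots> \<le> 2 * (C * inv_size z t)" using 1[of t x] t by simp
    finally show "norm (inverse (1 - f t x) - 1) \<le> 2 * C * inv_size z t" by simp
  qed (use C in auto)
qed

section \<open>The Riccati residual\<close>

lemma sum_sum_pair_reindex:
  fixes f :: "nat \<Rightarrow> nat \<Rightarrow> complex"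
  shows "(\<Sum>k\<le>N. \<Sum>j<k. f j (k - 1 - j)) = (\<Sum>(j, l)\<in>{(j, l). j + l < N}. f j l)"
proof -
  have "(\<Sum>k\<le>N. \<Sum>j<k. f j (k - 1 - j)) = (\<Sum>(k, j)\<in>(SIGMA k:{..N}. {..<k}). f j (k - 1 - j))"
    by (rule sum.Sigma) auto
  also have "\<dots> = (\<Sum>(j, l)\<in>{(j, l). j + l < N}. f j l)"
    by (rule sum.reindex_bij_witness[where i = "\<lambda>(j, l). (j + l + 1, j)" and j = "\<lambda>(k, j). (j, k - 1 - j)"]) auto
  finally show ?thesis .
qed

text \<open>
  The purely algebraic part of the WKB method, at a fixed point \<open>x\<close>: \<open>\<beta> k\<close> is the value of the \<open>k\<close>-th derivative of
  \<open>q\<close>, \<open>\<mu>\<close> and \<open>\<mu>'\<close> are those of \<open>m\<^sub>k\<close> and its total derivative, and \<open>\<alpha> = i p\<close>. The last coefficient of the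
  truncation is \<open>m\<^sub>N\<close> instead of \<open>s\<^sub>N\<close>, because \<open>s\<^sub>N\<close> would bring the derivative of \<open>\<beta> N\<close>, which does not exist.
  All terms below \<open>\<zeta> ^ N\<close> cancel by the recursion.
\<close>

lemma riccati_residual:
  fixes \<beta> \<mu> \<mu>' s :: "nat \<Rightarrow> complex" and \<zeta> \<alpha> :: complex and N :: nat
  assumes \<zeta>: "\<zeta> \<noteq> 0" and \<mu>0: "\<mu> 0 = 0"
    and rec: "\<And>k. \<mu> (Suc k) = \<mu>' k + \<alpha> * (\<Sum>j<k. s j * s (k - 1 - j))"
    and s: "\<And>k. s k = \<i> * \<beta> k + \<mu> k"
  defines "\<sigma> \<equiv> (\<lambda>k. if k < N then s k else \<mu> N)"
  shows "(\<Sum>k<N. (\<i> * \<beta> (Suc k) + \<mu>' k) * \<zeta> ^ Suc k) + \<mu>' N * \<zeta> ^ Suc N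
      - ((\<Sum>k<N. s k * \<zeta> ^ Suc k) + \<mu> N * \<zeta> ^ Suc N) / \<zeta> + \<i> * \<beta> 0
      + \<alpha> * ((\<Sum>k<N. s k * \<zeta> ^ Suc k) + \<mu> N * \<zeta> ^ Suc N)\<^sup>2 =
    \<zeta> ^ N * (\<i> * \<beta> N) + \<zeta> ^ Suc N * (\<mu>' N + \<alpha> * (\<Sum>j<N. s j * s (N - 1 - j)))
    + \<zeta> ^ (N + 2) * (\<alpha> * (\<Sum>(j, l)\<in>{(j, l). j \<le> N \<and> l \<le> N \<and> N \<le> j + l}. \<sigma> j * \<sigma> l * \<zeta> ^ (j + l - N)))"
proof -
  let ?S = "(\<Sum>k<N. s k * \<zeta> ^ Suc k) + \<mu> N * \<zeta> ^ Suc N"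
  let ?c = "\<lambda>k. \<Sum>j<k. s j * s (k - 1 - j)"
  let ?B = "{(j, l). j \<le> N \<and> l \<le> N \<and> N \<le> j + l}"
  have Sz: "?S / \<zeta> = (\<Sum>k<N. s k * \<zeta> ^ k) + \<mu> N * \<zeta> ^ N"
    using \<zeta> by (simp add: add_divide_distrib sum_divide_distrib)
  have tel: "(\<Sum>k<N. \<i> * \<beta> (Suc k) * \<zeta> ^ Suc k) - (\<Sum>k<N. \<i> * \<beta> k * \<zeta> ^ k) = \<i> * \<beta> N * \<zeta> ^ N - \<i> * \<beta> 0"
    using sum_lessThan_telescope[of "\<lambda>k. \<i> * \<beta> k * \<zeta> ^ k" N] by (simp add: sum_subtractf)
  have shift: "(\<Sum>k<N. \<mu> k * \<zeta> ^ k) + \<mu> N * \<zeta> ^ N = (\<Sum>k<N. \<mu> (Suc k) * \<zeta> ^ Suc k)"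
    using sum.lessThan_Suc_shift[of "\<lambda>k. \<mu> k * \<zeta> ^ k" N] \<mu>0 by simp
  have "(\<Sum>k<N. (\<i> * \<beta> (Suc k) + \<mu>' k) * \<zeta> ^ Suc k) - (\<Sum>k<N. s k * \<zeta> ^ k) - \<mu> N * \<zeta> ^ N + \<i> * \<beta> 0 =
      ((\<Sum>k<N. \<i> * \<beta> (Suc k) * \<zeta> ^ Suc k) - (\<Sum>k<N. \<i> * \<beta> k * \<zeta> ^ k)) + \<i> * \<beta> 0
      + ((\<Sum>k<N. \<mu>' k * \<zeta> ^ Suc k) - ((\<Sum>k<N. \<mu> k * \<zeta> ^ k) + \<mu> N * \<zeta> ^ N))"
    unfolding s by (simp add: distrib_right sum.distrib)
  also have "\<dots> = \<i> * \<beta> N * \<zeta> ^ N + (\<Sum>k<N. (\<mu>' k - \<mu> (Suc k)) * \<zeta> ^ Suc k)"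
    unfolding tel shift by (simp add: left_diff_distrib sum_subtractf)
  also have "(\<Sum>k<N. (\<mu>' k - \<mu> (Suc k)) * \<zeta> ^ Suc k) = (\<Sum>k<N. - (\<alpha> * (?c k * \<zeta> ^ Suc k)))"
    by (rule sum.cong) (simp_all add: rec algebra_simps)
  also have "\<dots> = - (\<alpha> * (\<Sum>k<N. ?c k * \<zeta> ^ Suc k))"
    by (simp only: sum_negf sum_distrib_left)
  also have "\<i> * \<beta> N * \<zeta> ^ N + - (\<alpha> * (\<Sum>k<N. ?c k * \<zeta> ^ Suc k)) = \<i> * \<beta> N * \<zeta> ^ N - \<alpha> * (\<Sum>k<N. ?c k * \<zeta> ^ Suc k)"
    by simp
  finally have lin: "(\<Sum>k<N. (\<i> * \<beta> (Suc k) + \<mu>' k) * \<zeta> ^ Suc k) - ?S / \<zeta> + \<i> * \<beta> 0 =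
      \<i> * \<beta> N * \<zeta> ^ N - \<alpha> * (\<Sum>k<N. ?c k * \<zeta> ^ Suc k)"
    unfolding Sz by (simp add: algebra_simps)
  have "?S = (\<Sum>k\<le>N. \<sigma> k * \<zeta> ^ Suc k)"
    unfolding lessThan_Suc_atMost[symmetric] by (simp add: \<sigma>_def)
  then have "?S\<^sup>2 = (\<Sum>j\<le>N. \<Sum>l\<le>N. (\<sigma> j * \<zeta> ^ Suc j) * (\<sigma> l * \<zeta> ^ Suc l))"
    unfolding power2_eq_square by (simp only: sum_product)
  also have "\<dots> = (\<Sum>(j, l)\<in>{..N} \<times> {..N}. (\<sigma> j * \<sigma> l) * \<zeta> ^ (j + l + 2))"
    unfolding sum.cartesian_product by (intro sum.cong) (auto simp: power_add)
  also have "{..N} \<times> {..N} = {(j, l). j + l < N} \<union> ?B" by auto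
  also have "(\<Sum>(j, l)\<in>{(j, l). j + l < N} \<union> ?B. (\<sigma> j * \<sigma> l) * \<zeta> ^ (j + l + 2)) =
      (\<Sum>(j, l)\<in>{(j, l). j + l < N}. (\<sigma> j * \<sigma> l) * \<zeta> ^ (j + l + 2)) +
      (\<Sum>(j, l)\<in>?B. (\<sigma> j * \<sigma> l) * \<zeta> ^ (j + l + 2))"
    by (rule sum.union_disjoint) (auto intro: finite_subset[of _ "{..N} \<times> {..N}"])
  also have "(\<Sum>(j, l)\<in>?B. (\<sigma> j * \<sigma> l) * \<zeta> ^ (j + l + 2)) =
      \<zeta> ^ (N + 2) * (\<Sum>(j, l)\<in>?B. \<sigma> j * \<sigma> l * \<zeta> ^ (j + l - N))"
    unfolding sum_distrib_left
    by (intro sum.cong) (auto simp: mult.left_commute simp flip: power_add intro!: arg_cong[where f = "(*) _"])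
  also have "(\<Sum>(j, l)\<in>{(j, l). j + l < N}. (\<sigma> j * \<sigma> l) * \<zeta> ^ (j + l + 2)) =
      (\<Sum>(j, l)\<in>{(j, l). j + l < N}. (s j * s l) * \<zeta> ^ (j + l + 2))"
    by (intro sum.cong) (auto simp: \<sigma>_def)
  also have "\<dots> = (\<Sum>k\<le>N. \<Sum>j<k. (s j * s (k - 1 - j)) * \<zeta> ^ (j + (k - 1 - j) + 2))"
    by (rule sum_sum_pair_reindex[symmetric])
  also have "\<dots> = (\<Sum>k\<le>N. ?c k * \<zeta> ^ Suc k)"
    unfolding sum_distrib_right by (intro sum.cong refl) auto
  also have "\<dots> = (\<Sum>k<N. ?c k * \<zeta> ^ Suc k) + ?c N * \<zeta> ^ Suc N"
    unfolding lessThan_Suc_atMost[symmetric] by simp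
  finally have sq: "?S\<^sup>2 = (\<Sum>k<N. ?c k * \<zeta> ^ Suc k) + ?c N * \<zeta> ^ Suc N +
      \<zeta> ^ (N + 2) * (\<Sum>(j, l)\<in>?B. \<sigma> j * \<sigma> l * \<zeta> ^ (j + l - N))" .
  have "(\<Sum>k<N. (\<i> * \<beta> (Suc k) + \<mu>' k) * \<zeta> ^ Suc k) + \<mu>' N * \<zeta> ^ Suc N - ?S / \<zeta> + \<i> * \<beta> 0 + \<alpha> * ?S\<^sup>2 =
     ((\<Sum>k<N. (\<i> * \<beta> (Suc k) + \<mu>' k) * \<zeta> ^ Suc k) - ?S / \<zeta> + \<i> * \<beta> 0) + \<mu>' N * \<zeta> ^ Suc N + \<alpha> * ?S\<^sup>2" by simp
  also have "\<dots> = \<zeta> ^ N * (\<i> * \<beta> N) + \<zeta> ^ Suc N * (\<mu>' N + \<alpha> * ?c N)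
    + \<zeta> ^ (N + 2) * (\<alpha> * (\<Sum>(j, l)\<in>?B. \<sigma> j * \<sigma> l * \<zeta> ^ (j + l - N)))"
    unfolding lin sq by (simp add: algebra_simps)
  finally show ?thesis .
qed

section \<open>The WKB transformation\<close>

definition indefinite :: "(cfn) \<Rightarrow> (cfn) \<Rightarrow> bool" where
  "indefinite f f' \<longleftrightarrow> f' absolutely_integrable_on {0..1} \<and> (\<forall>x\<in>{0..1}. f x = f 0 + integral {0..x} f')"

lemma indefiniteD:
  assumes "indefinite f f'"
  shows "f' absolutely_integrable_on {0..1}" "f' integrable_on {0..1}"
    "x \<in> {0..1} \<Longrightarrow> f x = f 0 + integral {0..x} f'" "x \<in> {0..1} \<Longrightarrow> f' integrable_on {0..x}"
proof -
  show 1: "f' absolutely_integrable_on {0..1}" using assms unfolding indefinite_def by blast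
  show 2: "f' integrable_on {0..1}" by (rule absolutely_integrableD[OF 1])
  show "x \<in> {0..1} \<Longrightarrow> f x = f 0 + integral {0..x} f'" using assms unfolding indefinite_def by blast
  show "x \<in> {0..1} \<Longrightarrow> f' integrable_on {0..x}" by (rule integrable_on_subinterval[OF 2]) auto
qed

lemma indefinite_add:
  assumes "indefinite f f'" "indefinite g g'"
  shows "indefinite (\<lambda>x. f x + g x) (\<lambda>x. f' x + g' x)"
  unfolding indefinite_def
proof (intro conjI ballI)
  show "(\<lambda>x. f' x + g' x) absolutely_integrable_on {0..1}"
    by (intro set_integral_add indefiniteD[OF assms(1)] indefiniteD[OF assms(2)])
  fix x :: real assume x: "x \<in> {0..1}"
  have "f x + g x = (f 0 + integral {0..x} f') + (g 0 + integral {0..x} g')"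
    by (simp only: indefiniteD(3)[OF assms(1) x] indefiniteD(3)[OF assms(2) x])
  also have "\<dots> = f 0 + g 0 + integral {0..x} (\<lambda>x. f' x + g' x)"
    using integral_add[OF indefiniteD(4)[OF assms(1) x] indefiniteD(4)[OF assms(2) x]] by simp
  finally show "f x + g x = f 0 + g 0 + integral {0..x} (\<lambda>x. f' x + g' x)" .
qed

lemma indefinite_mult_right:
  assumes "indefinite f f'"
  shows "indefinite (\<lambda>x. f x * c) (\<lambda>x. f' x * c)"
  unfolding indefinite_def
proof (intro conjI ballI)
  show "(\<lambda>x. f' x * c) absolutely_integrable_on {0..1}"
    by (rule absolutely_integrable_mult_continuous'[OF continuous_on_const indefiniteD(1)[OF assms]])
  fix x :: real assume x: "x \<in> {0..1}"
  have "f x * c = (f 0 + integral {0..x} f') * c" by (simp only: indefiniteD(3)[OF assms x])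
  then show "f x * c = f 0 * c + integral {0..x} (\<lambda>x. f' x * c)" by (simp add: distrib_right)
qed

lemma indefinite_sum:
  assumes "finite A" "\<And>i. i \<in> A \<Longrightarrow> indefinite (f i) (f' i)"
  shows "indefinite (\<lambda>x. \<Sum>i\<in>A. f i x) (\<lambda>x. \<Sum>i\<in>A. f' i x)"
  using assms
proof (induction A rule: finite_induct)
  case empty
  show ?case unfolding indefinite_def by (auto intro!: absolutely_integrable_continuous_real)
next
  case (insert i A)
  then show ?case by (simp add: indefinite_add)
qed

lemma indefinite_C1:
  assumes "\<And>x. x \<in> {0..1} \<Longrightarrow> (f has_vector_derivative f' x) (at x within {0..1})" "continuous_on {0..1} f'"
  shows "indefinite f f'"
  unfolding indefinite_def
proof (intro conjI ballI)
  show "f' absolutely_integrable_on {0..1}" by (rule absolutely_integrable_continuous_real[OF assms(2)])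
  fix x :: real assume x: "x \<in> {0..1}"
  have "(f' has_integral f x - f 0) {0..x}"
    by (rule fundamental_theorem_of_calculus)
      (use x in \<open>auto intro!: has_vector_derivative_within_subset[OF assms(1)]\<close>)
  then show "f x = f 0 + integral {0..x} f'" by (simp add: integral_unique)
qed

lemma indefinite_continuous:
  assumes "indefinite f f'"
  shows "continuous_on {0..1} f"
proof -
  have "continuous_on {0..1} (\<lambda>x. f 0 + integral {0..x} f')"
    by (intro continuous_on_add continuous_on_const indefinite_integral_continuous_1 indefiniteD[OF assms])
  then show ?thesis
    by (rule continuous_on_eq) (simp add: indefiniteD(3)[OF assms, symmetric])
qed

lemma indefinite_by_parts:
  assumes f: "indefinite f f'"
    and h: "\<And>x. x \<in> {0..1} \<Longrightarrow> (h has_vector_derivative h' x) (at x within {0..1})"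
    and h': "continuous_on {0..1} h'" and x: "x \<in> {0..1}"
  shows "integral {0..x} (\<lambda>y. f' y * h y) = f x * h x - f 0 * h 0 - integral {0..x} (\<lambda>y. f y * h' y)"
proof (rule integral_by_parts_indefinite[where G = f])
  show "f' absolutely_integrable_on {0..x}"
    by (rule set_integrable_subset[OF indefiniteD(1)[OF f]]) (use x in auto)
  show "f y = f 0 + integral {0..y} f'" if "y \<in> {0..x}" for y
    by (rule indefiniteD(3)[OF f]) (use x that in auto)
  show "(h has_vector_derivative h' y) (at y within {0..x})" if "y \<in> {0..x}" for y
    by (rule has_vector_derivative_within_subset[OF h]) (use x that in auto)
  show "continuous_on {0..x} h'" by (rule continuous_on_subset[OF h']) (use x in auto)
qed (use x in auto)

lemma indefinite_sobolev_jet: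
  assumes "sobolev_jet N M a" "j < N"
  shows "indefinite (a j) (a (Suc j))"
  unfolding indefinite_def
proof (intro conjI ballI)
  show "a (Suc j) absolutely_integrable_on {0..1}"
  proof (cases "Suc j < N")
    case True
    then show ?thesis by (intro absolutely_integrable_continuous_real sobolev_jetD(1)[OF assms(1)])
  next
    case False
    then have "Suc j = N" using assms by simp
    then show ?thesis using sobolev_jet_top(1)[OF assms(1)] by simp
  qed
qed (rule sobolev_jetD(3)[OF assms])

lemma unif_O_mult1:
  fixes f h :: "'t \<Rightarrow> cfn"
  assumes "unif_O T z f (\<lambda>t. 1)" "unif_O T z h g"
  shows "unif_O T z (\<lambda>t x. f t x * h t x) g"
  using unif_O_mult[OF assms] by simp

lemma unif_O_const: "unif_O T z (\<lambda>t x. c) (\<lambda>t. 1)"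
  by (rule unif_O_bounded[of _ _ _ "norm c"]) simp

lemma unif_O_cmult:
  assumes "unif_O T z f g"
  shows "unif_O T z (\<lambda>t x. (c::complex) * f t x) g"
  by (rule unif_O_mult1[OF unif_O_const assms])

lemma integral_norm_le_of_square:
  fixes f :: cfn
  assumes f: "f absolutely_integrable_on {0..1}" and f2: "(\<lambda>x. (norm (f x))\<^sup>2) integrable_on {0..1}"
    and G: "integral {0..1} (\<lambda>x. (norm (f x))\<^sup>2) \<le> G"
  shows "integral {0..1} (\<lambda>x. norm (f x)) \<le> 1 + G"
proof -
  have le: "norm (f x) \<le> 1 + (norm (f x))\<^sup>2" for x
  proof -
    have "2 * norm (f x) \<le> 1 + (norm (f x))\<^sup>2" using sum_squares_bound[of 1 "norm (f x)"] by simp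
    then show ?thesis using norm_ge_zero[of "f x"] by linarith
  qed
  have c: "(\<lambda>x. 1::real) integrable_on {0..1::real}" by (rule integrable_continuous_real) simp
  have "integral {0..1} (\<lambda>x. norm (f x)) \<le> integral {0..1} (\<lambda>x. 1 + (norm (f x))\<^sup>2)"
    by (rule integral_le[OF absolutely_integrableD(2)[OF f] integrable_add[OF c f2]]) (rule le)
  also have "\<dots> = 1 + integral {0..1} (\<lambda>x. (norm (f x))\<^sup>2)"
    using integral_add[OF c f2] by simp
  finally show ?thesis using G by simp
qed

locale zs_family =
  fixes N :: nat and R :: real and T :: "'t set"
    and a b :: "'t \<Rightarrow> nat \<Rightarrow> cfn" and z :: "'t \<Rightarrow> complex" and U V :: "'t \<Rightarrow> cfn"
  assumes N: "N \<ge> 1"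
    and jet_a: "\<And>t. t \<in> T \<Longrightarrow> sobolev_jet N R (a t)"
    and jet_b: "\<And>t. t \<in> T \<Longrightarrow> sobolev_jet N R (b t)"
    and sol: "\<And>t. t \<in> T \<Longrightarrow> zs_sol (a t 0) (b t 0) (z t) (U t) (V t)"
    and init: "\<And>t. t \<in> T \<Longrightarrow> U t 0 = 1" "\<And>t. t \<in> T \<Longrightarrow> V t 0 = 1"
    and Im_bound: "\<And>t. t \<in> T \<Longrightarrow> \<bar>Im (z t)\<bar> \<le> R"
begin

abbreviation "BO \<equiv> unif_O T z"
abbreviation "ep \<equiv> inv_size z"

text \<open>
  Here \<open>cs k\<close>, \<open>cm k\<close> are the coefficients \<open>s\<^sub>k\<close>, \<open>m\<^sub>k\<close> of the Riccati solution along the potential, \<open>cm' k\<close> is the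
  derivative of \<open>cm k\<close>, \<open>sig\<close> the truncated solution with derivative \<open>sig'\<close>, and \<open>res\<close> its residual in the
  Riccati equation, of which \<open>rem1\<close>, \<open>rem2\<close> are the coefficients of the orders \<open>N + 1\<close> and from \<open>N + 2\<close> on. The
  factor \<open>E\<close> removes the growth of \<open>V\<close>; its phase correction is \<open>Bf\<close>.
\<close>

definition "zeta t = 1 / (2 * \<i> * z t)"
definition "cs k t x = dval_at (ric_s k) (a t) (b t) x"
definition "cm k t x = dval_at (ric_m k) (a t) (b t) x"
definition "cm' k t x = dval_at (dtotal (ric_m k)) (a t) (b t) x"
definition "ck k t x = (if k < N then cs k t x else cm N t x)"
definition "sig t x = (\<Sum>k<N. cs k t x * zeta t ^ Suc k) + cm N t x * zeta t ^ Suc N"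
definition "sig' t x = (\<Sum>k<N. (\<i> * b t (Suc k) x + cm' k t x) * zeta t ^ Suc k) + cm' N t x * zeta t ^ Suc N"
definition "res t x = sig' t x - sig t x / zeta t + \<i> * b t 0 x + \<i> * a t 0 x * (sig t x)\<^sup>2"
definition "rem1 t x = cm' N t x + \<i> * a t 0 x * (\<Sum>j<N. cs j t x * cs (N - 1 - j) t x)"
definition "rem2 t x = \<i> * a t 0 x *
  (\<Sum>(j, l)\<in>{(j, l). j \<le> N \<and> l \<le> N \<and> N \<le> j + l}. ck j t x * ck l t x * zeta t ^ (j + l - N))"
definition "Bf t x = integral {0..x} (\<lambda>y. a t 0 y * sig t y)"
definition "E t x = exp (- \<i> * z t * of_real x + \<i> * Bf t x)"

lemma ab_cont: "t \<in> T \<Longrightarrow> j < N \<Longrightarrow> continuous_on {0..1} (a t j)" "t \<in> T \<Longrightarrow> j < N \<Longrightarrow> continuous_on {0..1} (b t j)"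
  using sobolev_jetD(1)[OF jet_a] sobolev_jetD(1)[OF jet_b] by blast+

lemma ab_bound: "t \<in> T \<Longrightarrow> j < N \<Longrightarrow> x \<in> {0..1} \<Longrightarrow> norm (a t j x) \<le> R"
  "t \<in> T \<Longrightarrow> j < N \<Longrightarrow> x \<in> {0..1} \<Longrightarrow> norm (b t j x) \<le> R"
  using sobolev_jetD(4)[OF jet_a] sobolev_jetD(4)[OF jet_b] by blast+

lemma dval_cont:
  "t \<in> T \<Longrightarrow> below N e \<Longrightarrow> continuous_on {0..1} (\<lambda>x. dval_at e (a t) (b t) x)"
  by (rule dval_continuous_on) (use ab_cont in auto)

lemma dval_O:
  assumes "below N e"
  shows "BO (\<lambda>t x. dval_at e (a t) (b t) x) (\<lambda>t. 1)"
proof -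
  obtain C where C: "\<forall>a b. below N e \<longrightarrow> (\<forall>j<N. norm (a j) \<le> R \<and> norm (b j) \<le> R) \<longrightarrow> norm (dval e a b) \<le> C"
    using dval_bound by blast
  show ?thesis
  proof (rule unif_O_bounded[of _ _ _ C])
    fix t x assume "t \<in> T" "x \<in> {0..1::real}"
    then show "norm (dval_at e (a t) (b t) x) \<le> C"
      by (intro C[rule_format, OF assms] conjI ab_bound)
  qed
qed

lemma below_cs: "k < N \<Longrightarrow> below N (ric_s k)"
  by (rule below_mono[OF ric_s_below]) simp
lemma below_cm: "k \<le> N \<Longrightarrow> below (N - 1) (ric_m k)"
  by (rule below_mono[OF ric_m_below]) simp
lemma below_cm': "k \<le> N \<Longrightarrow> below N (dtotal (ric_m k))"
  using below_dtotal[OF below_cm, of k] N by simp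

lemma cm_deriv:
  assumes "t \<in> T" "k \<le> N" "x \<in> {0..1}"
  shows "(cm k t has_vector_derivative cm' k t x) (at x within {0..1})"
  unfolding cm_def[abs_def] cm'_def
  by (rule dval_has_vector_derivative[OF below_cm[OF assms(2)]])
    (rule sobolev_jet_deriv[OF jet_a[OF assms(1)] _ assms(3)] sobolev_jet_deriv[OF jet_b[OF assms(1)] _ assms(3)], simp)+

lemma cont_coeffs:
  assumes "t \<in> T"
  shows "k < N \<Longrightarrow> continuous_on {0..1} (cs k t)" "k \<le> N \<Longrightarrow> continuous_on {0..1} (cm k t)"
    "k \<le> N \<Longrightarrow> continuous_on {0..1} (cm' k t)" "continuous_on {0..1} (ck k t)"
proof -
  show 1: "k < N \<Longrightarrow> continuous_on {0..1} (cs k t)" for k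
    unfolding cs_def[abs_def] by (intro dval_cont assms below_cs)
  show 2: "k \<le> N \<Longrightarrow> continuous_on {0..1} (cm k t)" for k
    unfolding cm_def[abs_def] by (intro dval_cont assms below_mono[OF below_cm]) auto
  show "k \<le> N \<Longrightarrow> continuous_on {0..1} (cm' k t)"
    unfolding cm'_def[abs_def] by (intro dval_cont assms below_cm')
  show "continuous_on {0..1} (ck k t)"
    unfolding ck_def[abs_def] by (cases "k < N") (simp_all add: 1 2)
qed

lemma O_coeffs:
  shows "k < N \<Longrightarrow> BO (cs k) (\<lambda>t. 1)" "k \<le> N \<Longrightarrow> BO (cm k) (\<lambda>t. 1)"
    "k \<le> N \<Longrightarrow> BO (cm' k) (\<lambda>t. 1)" "BO (ck k) (\<lambda>t. 1)" "BO (\<lambda>t. a t 0) (\<lambda>t. 1)" "BO (\<lambda>t. b t 0) (\<lambda>t. 1)"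
proof -
  show 1: "k < N \<Longrightarrow> BO (cs k) (\<lambda>t. 1)" for k
    unfolding cs_def[abs_def] by (intro dval_O below_cs)
  show 2: "k \<le> N \<Longrightarrow> BO (cm k) (\<lambda>t. 1)" for k
    unfolding cm_def[abs_def] by (intro dval_O below_mono[OF below_cm]) auto
  show "k \<le> N \<Longrightarrow> BO (cm' k) (\<lambda>t. 1)"
    unfolding cm'_def[abs_def] by (intro dval_O below_cm')
  show "BO (ck k) (\<lambda>t. 1)"
    unfolding ck_def[abs_def] by (cases "k < N") (simp_all add: 1 2)
  show "BO (\<lambda>t. a t 0) (\<lambda>t. 1)" "BO (\<lambda>t. b t 0) (\<lambda>t. 1)"
    by (rule unif_O_bounded, rule ab_bound; use N in auto)+
qed

lemma norm_zeta: "norm (zeta t) = ep t / 2"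
  by (simp add: zeta_def inv_size_def norm_mult norm_divide)

lemma zeta_O: "BO (\<lambda>t x. zeta t ^ k) (\<lambda>t. ep t ^ k)"
proof (rule unif_OI[of 1])
  fix t
  show "norm (zeta t ^ k) \<le> 1 * ep t ^ k"
    unfolding norm_power norm_zeta using inv_size_nonneg[of z t] by (simp add: power_mono)
qed simp

lemma zeta_nz: "norm (z t) \<ge> 1 \<Longrightarrow> zeta t \<noteq> 0"
  by (auto simp: zeta_def)

lemma ep_power_O_mult:
  assumes "BO f (\<lambda>t. 1)" "l \<le> k"
  shows "BO (\<lambda>t x. f t x * zeta t ^ k) (\<lambda>t. ep t ^ l)"
  by (rule unif_O_power_mono[OF unif_O_mult1[OF assms(1) zeta_O] assms(2)])

lemma rem1_eq: "rem1 t = (\<lambda>x. dval_at (ric_m (Suc N)) (a t) (b t) x)"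
  by (simp add: fun_eq_iff rem1_def cm'_def cs_def dval_ric_m_Suc)

lemma sig_O: "BO sig ep"
proof -
  have "BO (\<lambda>t x. (\<Sum>k<N. cs k t x * zeta t ^ Suc k) + cm N t x * zeta t ^ Suc N) (\<lambda>t. ep t ^ 1)"
    by (intro unif_O_add unif_O_sum ep_power_O_mult O_coeffs) (auto simp: inv_size_nonneg)
  then show ?thesis unfolding sig_def[abs_def] by simp
qed

lemma sig_indefinite:
  assumes t: "t \<in> T"
  shows "indefinite (sig t) (sig' t)"
proof -
  have cs: "indefinite (cs k t) (\<lambda>x. \<i> * b t (Suc k) x + cm' k t x)" if k: "k < N" for k
  proof -
    have "indefinite (\<lambda>x. b t k x * \<i> + cm k t x) (\<lambda>x. b t (Suc k) x * \<i> + cm' k t x)"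
      by (intro indefinite_add indefinite_mult_right indefinite_sobolev_jet[OF jet_b[OF t] k]
          indefinite_C1 cm_deriv t cont_coeffs) (use k in auto)
    then show ?thesis unfolding cs_def[abs_def] cm_def dval_ric_s by (simp add: mult.commute)
  qed
  show ?thesis
    unfolding sig_def[abs_def] sig'_def[abs_def]
    by (intro indefinite_add indefinite_mult_right indefinite_sum cs indefinite_C1 cm_deriv t cont_coeffs) auto
qed

lemma sig_cont: "t \<in> T \<Longrightarrow> continuous_on {0..1} (sig t)"
  by (rule indefinite_continuous[OF sig_indefinite])

lemma sig_periodic:
  assumes t: "t \<in> T"
  shows "sig t 1 = sig t 0"
proof -
  have "dval_at e (a t) (b t) 1 = dval_at e (a t) (b t) 0" if "below N e" for e
    by (rule dval_cong[OF that]) (use sobolev_jetD(2)[OF jet_a[OF t]] sobolev_jetD(2)[OF jet_b[OF t]] in auto)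
  then show ?thesis
    unfolding sig_def cs_def cm_def using below_cs below_mono[OF below_cm[OF order_refl], of N] by simp
qed

lemma res_expand:
  assumes "norm (z t) \<ge> 1"
  shows "res t x = zeta t ^ N * (\<i> * b t N x) + zeta t ^ Suc N * rem1 t x + zeta t ^ (N + 2) * rem2 t x"
proof -
  have "cm 0 t x = 0" by (simp add: cm_def ric_m_0)
  moreover have "cm (Suc k) t x = cm' k t x + \<i> * a t 0 x * (\<Sum>j<k. cs j t x * cs (k - 1 - j) t x)" for k
    unfolding cm_def cm'_def cs_def by (rule dval_ric_m_Suc)
  moreover have "cs k t x = \<i> * b t k x + cm k t x" for k
    unfolding cm_def cs_def by (rule dval_ric_s)
  ultimately show ?thesis
    unfolding res_def rem1_def rem2_def sig_def sig'_def ck_def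
    by (rule riccati_residual[OF zeta_nz[OF assms], of "\<lambda>k. cm k t x" "\<lambda>k. cm' k t x" "\<i> * a t 0 x"
          "\<lambda>k. cs k t x" "\<lambda>k. b t k x"])
qed

lemma rem_O: "BO rem1 (\<lambda>t. 1)" "BO rem2 (\<lambda>t. 1)"
proof -
  have "BO (\<lambda>t x. cs j t x * cs (N - 1 - j) t x) (\<lambda>t. 1)" if "j < N" for j
    by (rule unif_O_mult1) (rule O_coeffs, use that in simp)+
  then show "BO rem1 (\<lambda>t. 1)"
    unfolding rem1_def[abs_def] mult.assoc
    by (intro unif_O_add O_coeffs unif_O_mult1 unif_O_const unif_O_sum) auto
  have "BO (\<lambda>t x. ck (fst i) t x * ck (snd i) t x * zeta t ^ (fst i + snd i - N)) (\<lambda>t. ep t ^ 0)" for i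
    by (intro ep_power_O_mult unif_O_mult1 O_coeffs) auto
  then have "BO (\<lambda>t x. \<Sum>i\<in>{(j, l). j \<le> N \<and> l \<le> N \<and> N \<le> j + l}.
      ck (fst i) t x * ck (snd i) t x * zeta t ^ (fst i + snd i - N)) (\<lambda>t. 1)"
    by (intro unif_O_sum) (auto intro: finite_subset[of _ "{..N} \<times> {..N}"])
  then show "BO rem2 (\<lambda>t. 1)"
    unfolding rem2_def[abs_def] mult.assoc case_prod_unfold
    by (intro unif_O_mult1 unif_O_const O_coeffs)
qed

lemma rem_cont:
  assumes "t \<in> T"
  shows "continuous_on {0..1} (rem1 t)" "continuous_on {0..1} (rem2 t)"
proof -
  show "continuous_on {0..1} (rem1 t)"
    unfolding rem1_def[abs_def]
    by (intro continuous_intros cont_coeffs[OF assms] ab_cont[OF assms]) (use N in auto)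
  show "continuous_on {0..1} (rem2 t)"
    unfolding rem2_def[abs_def] case_prod_unfold
    by (intro continuous_intros cont_coeffs[OF assms] ab_cont[OF assms]) (use N in auto)
qed

lemma UV_cont: "t \<in> T \<Longrightarrow> continuous_on {0..1} (U t)" "t \<in> T \<Longrightarrow> continuous_on {0..1} (V t)"
  using zs_sol_continuous[OF sol] by blast+

lemma UV_O: "BO U (\<lambda>t. 1)" "BO V (\<lambda>t. 1)"
proof -
  have b: "norm (U t x) \<le> sqrt (exp (2 * R + 2 * R + 1) * 2) \<and> norm (V t x) \<le> sqrt (exp (2 * R + 2 * R + 1) * 2)"
    if "t \<in> T" "x \<in> {0..1}" for t x
  proof -
    have "(norm (U t x))\<^sup>2 + (norm (V t x))\<^sup>2 \<le> exp (2 * R + 2 * R + 1) * ((norm (U t 0))\<^sup>2 + (norm (V t 0))\<^sup>2)"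
      by (rule zs_sol_bound[OF sol[OF that(1)] _ _ Im_bound[OF that(1)] that(2)])
        (use ab_bound[OF that(1)] N in auto)
    then have "(norm (U t x))\<^sup>2 + (norm (V t x))\<^sup>2 \<le> exp (2 * R + 2 * R + 1) * 2" using init[OF that(1)] by simp
    then have "(norm (U t x))\<^sup>2 \<le> exp (2 * R + 2 * R + 1) * 2" "(norm (V t x))\<^sup>2 \<le> exp (2 * R + 2 * R + 1) * 2"
      using zero_le_power2[of "norm (U t x)"] zero_le_power2[of "norm (V t x)"] by linarith+
    then show ?thesis by (simp add: real_le_rsqrt)
  qed
  show "BO U (\<lambda>t. 1)" "BO V (\<lambda>t. 1)"
    by (rule unif_O_bounded, use b in blast)+
qed

lemma exp_z_O: "BO (\<lambda>t x. exp (- \<i> * z t * of_real x)) (\<lambda>t. 1)"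
proof (rule unif_O_bounded)
  fix t x assume t: "t \<in> T" "x \<in> {0..1::real}"
  have "Im (z t) * x \<le> R * 1" using Im_bound[OF t(1)] t(2) by (intro mult_mono) auto
  then show "norm (exp (- \<i> * z t * of_real x)) \<le> exp R" by (simp add: norm_exp_eq_Re)
qed

lemma Bf_cont: "t \<in> T \<Longrightarrow> continuous_on {0..1} (\<lambda>y. a t 0 y * sig t y)"
  by (intro continuous_intros ab_cont sig_cont) (use N in auto)

lemma Bf_O: "BO Bf ep"
  unfolding Bf_def[abs_def]
  by (rule unif_O_integral[OF unif_O_mult1[OF O_coeffs(5) sig_O] Bf_cont])

lemma Bf_deriv:
  "t \<in> T \<Longrightarrow> x \<in> {0..1} \<Longrightarrow> (Bf t has_vector_derivative a t 0 x * sig t x) (at x within {0..1})"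
  unfolding Bf_def[abs_def] by (rule integral_has_vector_derivative[OF Bf_cont])

lemma exp_Bf_O: "BO (\<lambda>t x. exp (\<i> * Bf t x) - 1) ep" "BO (\<lambda>t x. exp (- (\<i> * Bf t x)) - 1) ep"
  "BO (\<lambda>t x. exp (\<i> * Bf t x)) (\<lambda>t. 1)" "BO (\<lambda>t x. exp (- (\<i> * Bf t x))) (\<lambda>t. 1)"
proof -
  show 1: "BO (\<lambda>t x. exp (\<i> * Bf t x) - 1) ep"
    by (rule unif_O_exp[OF unif_O_cmult[OF Bf_O] inv_size_le_1])
  show 2: "BO (\<lambda>t x. exp (- (\<i> * Bf t x)) - 1) ep"
    by (rule unif_O_exp[OF unif_O_minus[OF unif_O_cmult[OF Bf_O]] inv_size_le_1])
  have w: "BO f (\<lambda>t. 1)" if "BO f ep" for f :: "'t \<Rightarrow> cfn"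
    by (rule unif_O_weaken[OF that, of 1]) (auto simp: inv_size_le_1)
  show "BO (\<lambda>t x. exp (\<i> * Bf t x)) (\<lambda>t. 1)"
    using unif_O_add[OF w[OF 1] unif_O_const[of _ _ 1]] by simp
  show "BO (\<lambda>t x. exp (- (\<i> * Bf t x))) (\<lambda>t. 1)"
    using unif_O_add[OF w[OF 2] unif_O_const[of _ _ 1]] by simp
qed

lemma E_eq: "E t x = exp (- \<i> * z t * of_real x) * exp (\<i> * Bf t x)"
  unfolding E_def by (rule exp_add)

lemma E_O: "BO E (\<lambda>t. 1)"
  unfolding E_eq[abs_def] by (rule unif_O_mult1[OF exp_z_O exp_Bf_O(3)])

lemma E_0: "E t 0 = 1"
  by (simp add: E_def Bf_def)

lemma E_deriv:
  assumes "t \<in> T" "x \<in> {0..1}"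
  shows "(E t has_vector_derivative (- \<i> * z t + \<i> * (a t 0 x * sig t x)) * E t x) (at x within {0..1})"
proof -
  have "((\<lambda>x. - \<i> * z t * of_real x + \<i> * Bf t x) has_vector_derivative
      (- \<i> * z t * of_real 1 + \<i> * (a t 0 x * sig t x))) (at x within {0..1})"
    by (intro has_vector_derivative_add has_vector_derivative_mult_right Bf_deriv[OF assms]
        has_vector_derivative_of_real DERIV_ident)
  from field_vector_diff_chain_within[OF this, of exp, unfolded o_def, OF has_field_derivative_at_within[OF DERIV_exp]]
  show ?thesis unfolding E_def[abs_def] by (simp add: mult.commute)
qed

lemma E_cont: "t \<in> T \<Longrightarrow> continuous_on {0..1} (E t)"
  by (rule has_vd_continuous_on[OF E_deriv])

definition "hE t x = E t x * U t x"
definition "hE' t x = E t x * (- (2 * \<i> * z t) * U t x + \<i> * a t 0 x * sig t x * U t x + \<i> * a t 0 x * V t x)"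

lemma hE_O: "BO hE (\<lambda>t. 1)"
  unfolding hE_def[abs_def] by (rule unif_O_mult1[OF E_O UV_O(1)])

lemma hE_cont: "t \<in> T \<Longrightarrow> continuous_on {0..1} (hE t)"
  unfolding hE_def[abs_def] by (intro continuous_intros E_cont UV_cont)

lemma hE_deriv:
  assumes "t \<in> T" "x \<in> {0..1}"
  shows "(hE t has_vector_derivative hE' t x) (at x within {0..1})"
proof -
  have "(U t has_vector_derivative - \<i> * z t * U t x + \<i> * a t 0 x * V t x) (at x within {0..1})"
    using sol[OF assms(1)] assms(2) unfolding zs_sol_def by blast
  from has_vector_derivative_mult[OF E_deriv[OF assms] this]
  show ?thesis unfolding hE_def[abs_def] hE'_def by (simp add: algebra_simps)
qed

lemma hE'_cont: "t \<in> T \<Longrightarrow> continuous_on {0..1} (hE' t)"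
  unfolding hE'_def[abs_def] by (intro continuous_intros E_cont UV_cont ab_cont sig_cont) (use N in auto)

text \<open>
  The derivative of \<open>E (V - \<sigma> U)\<close> is \<open>- res E U\<close>. The function \<open>\<sigma>\<close> is only absolutely continuous, while \<open>E U\<close> and
  \<open>E V\<close> are continuously differentiable, so one integration by parts suffices.
\<close>

lemma wkb_identity:
  assumes t: "t \<in> T" and z: "norm (z t) \<ge> 1" and x: "x \<in> {0..1}"
  shows "E t x * (V t x - sig t x * U t x) = 1 - sig t 0 - integral {0..x} (\<lambda>y. res t y * hE t y)"
proof -
  define vE' where "vE' y = E t y * (\<i> * a t 0 y * sig t y * V t y - \<i> * b t 0 y * U t y)" for y
  have vE'c: "continuous_on {0..1} vE'"
    unfolding vE'_def[abs_def] by (intro continuous_intros E_cont UV_cont ab_cont sig_cont t) (use N in auto)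
  have "((\<lambda>y. E t y * V t y) has_vector_derivative vE' y) (at y within {0..1})" if y: "y \<in> {0..1}" for y
  proof -
    have "(V t has_vector_derivative \<i> * z t * V t y - \<i> * b t 0 y * U t y) (at y within {0..1})"
      using sol[OF t] y unfolding zs_sol_def by blast
    from has_vector_derivative_mult[OF E_deriv[OF t y] this]
    show ?thesis unfolding vE'_def by (simp add: algebra_simps)
  qed
  then have "indefinite (\<lambda>y. E t y * V t y) vE'" by (rule indefinite_C1[OF _ vE'c])
  from indefiniteD(3)[OF this x] have v: "E t x * V t x = 1 + integral {0..x} vE'"
    using E_0 init(2)[OF t] by simp
  have u: "integral {0..x} (\<lambda>y. sig' t y * hE t y) = sig t x * hE t x - sig t 0 * hE t 0 - integral {0..x} (\<lambda>y. sig t y * hE' t y)"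
    by (rule indefinite_by_parts[OF sig_indefinite[OF t] hE_deriv[OF t] hE'_cont[OF t] x])
  have sub: "k integrable_on {0..x}" if "k integrable_on {0..1}" for k :: cfn
    using that by (rule integrable_on_subinterval) (use x in auto)
  have i1: "(\<lambda>y. sig' t y * hE t y) integrable_on {0..x}"
    by (intro sub absolutely_integrableD(1) absolutely_integrable_mult_continuous' hE_cont t indefiniteD(1)[OF sig_indefinite])
  have i2: "(\<lambda>y. sig t y * hE' t y) integrable_on {0..x}"
    by (intro sub integrable_continuous_real continuous_intros hE'_cont sig_cont t)
  have i3: "vE' integrable_on {0..x}"
    by (intro sub integrable_continuous_real vE'c)
  have z0: "z t \<noteq> 0" using z by auto
  have "res t y * hE t y = sig' t y * hE t y + sig t y * hE' t y - vE' y" for y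
    using z0 unfolding res_def hE_def hE'_def vE'_def zeta_def
    by (simp add: algebra_simps power2_eq_square)
  then have "integral {0..x} (\<lambda>y. res t y * hE t y) =
      integral {0..x} (\<lambda>y. sig' t y * hE t y) + integral {0..x} (\<lambda>y. sig t y * hE' t y) - integral {0..x} vE'"
    using i1 i2 i3 by (simp add: HK_integral_diff integral_add integrable_add)
  also have "\<dots> = sig t x * hE t x - sig t 0 - (E t x * V t x - 1)"
    unfolding u v using E_0 init(1)[OF t] by (simp add: hE_def)
  finally show ?thesis unfolding hE_def by (simp add: algebra_simps)
qed

lemma b_top_L1: "t \<in> T \<Longrightarrow> integral {0..1} (\<lambda>x. norm (b t N x)) \<le> 1 + R"
  by (rule integral_norm_le_of_square[OF sobolev_jet_top[OF jet_b]])

lemma res_integral_split: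
  assumes t: "t \<in> T" and z: "norm (z t) \<ge> 1" and x: "x \<in> {0..1}"
  shows "integral {0..x} (\<lambda>y. res t y * hE t y) =
     zeta t ^ N * (\<i> * integral {0..x} (\<lambda>y. b t N y * hE t y))
     + zeta t ^ Suc N * integral {0..x} (\<lambda>y. rem1 t y * hE t y)
     + zeta t ^ (N + 2) * integral {0..x} (\<lambda>y. rem2 t y * hE t y)"
proof -
  have sub: "k integrable_on {0..x}" if "k integrable_on {0..1}" for k :: cfn
    using that by (rule integrable_on_subinterval) (use x in auto)
  have i1: "(\<lambda>y. (zeta t ^ N * \<i>) * (b t N y * hE t y)) integrable_on {0..x}"
    by (intro integrable_on_mult_right sub absolutely_integrableD(1) absolutely_integrable_mult_continuous' hE_cont t
        sobolev_jet_top(1)[OF jet_b])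
  have i2: "(\<lambda>y. zeta t ^ Suc N * (rem1 t y * hE t y)) integrable_on {0..x}"
    "(\<lambda>y. zeta t ^ (N + 2) * (rem2 t y * hE t y)) integrable_on {0..x}"
    by (intro integrable_on_mult_right sub integrable_continuous_real continuous_intros rem_cont hE_cont t)+
  have "res t y * hE t y = (zeta t ^ N * \<i>) * (b t N y * hE t y) + zeta t ^ Suc N * (rem1 t y * hE t y)
      + zeta t ^ (N + 2) * (rem2 t y * hE t y)" for y
    unfolding res_expand[OF z] by (simp add: algebra_simps)
  then have "integral {0..x} (\<lambda>y. res t y * hE t y) = integral {0..x} (\<lambda>y. (zeta t ^ N * \<i>) * (b t N y * hE t y))
     + integral {0..x} (\<lambda>y. zeta t ^ Suc N * (rem1 t y * hE t y)) + integral {0..x} (\<lambda>y. zeta t ^ (N + 2) * (rem2 t y * hE t y))"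
    using i1 i2 by (simp only: integral_add integrable_add)
  then show ?thesis by (simp only: integral_mult_right mult.assoc)
qed

lemma integral_hE_O:
  "BO (\<lambda>t x. integral {0..x} (\<lambda>y. b t N y * hE t y)) (\<lambda>t. 1)"
  "BO (\<lambda>t x. integral {0..x} (\<lambda>y. rem1 t y * hE t y)) (\<lambda>t. 1)"
  "BO (\<lambda>t x. integral {0..x} (\<lambda>y. rem2 t y * hE t y)) (\<lambda>t. 1)"
  by (rule unif_O_integral_mult[OF hE_O b_top_L1 sobolev_jet_top(1)[OF jet_b] hE_cont] unif_O_integral[OF unif_O_mult1[OF _ hE_O]],
      assumption?, (rule rem_O)?, (intro continuous_intros rem_cont hE_cont)?; assumption?)+

lemma res_integral_O: "BO (\<lambda>t x. integral {0..x} (\<lambda>y. res t y * hE t y)) (\<lambda>t. ep t ^ N)"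
proof (rule unif_O_cong)
  show "BO (\<lambda>t x. (\<i> * integral {0..x} (\<lambda>y. b t N y * hE t y)) * zeta t ^ N
     + integral {0..x} (\<lambda>y. rem1 t y * hE t y) * zeta t ^ Suc N
     + integral {0..x} (\<lambda>y. rem2 t y * hE t y) * zeta t ^ (N + 2)) (\<lambda>t. ep t ^ N)"
    by (intro unif_O_add ep_power_O_mult unif_O_cmult integral_hE_O) auto
qed (simp add: res_integral_split mult.commute)

lemma sig0_O: "BO (\<lambda>t _. sig t 0) ep"
  by (rule unif_O_at[OF sig_O]) simp

theorem crude_asymptotics: "BO (\<lambda>t x. exp (- \<i> * z t * of_real x) * V t x - 1) ep"
proof (rule unif_O_cong)
  have I: "BO (\<lambda>t x. integral {0..x} (\<lambda>y. res t y * hE t y)) ep"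
    using unif_O_power_mono[OF res_integral_O N] by simp
  show "BO (\<lambda>t x. (exp (- (\<i> * Bf t x)) - 1)
      + exp (- (\<i> * Bf t x)) * (- sig t 0 - integral {0..x} (\<lambda>y. res t y * hE t y))
      + exp (- \<i> * z t * of_real x) * (U t x * sig t x)) ep"
    by (intro unif_O_add exp_Bf_O(2) unif_O_mult1 exp_Bf_O(4) unif_O_diff unif_O_minus sig0_O I exp_z_O UV_O(1) sig_O)
  fix t x assume t: "t \<in> T" "1 \<le> norm (z t)" "x \<in> {0..1::real}"
  have "exp (- (\<i> * Bf t x)) * (E t x * (V t x - sig t x * U t x)) =
      exp (- (\<i> * Bf t x)) * (1 - sig t 0 - integral {0..x} (\<lambda>y. res t y * hE t y))"
    unfolding wkb_identity[OF t] ..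
  moreover have "exp (- (\<i> * Bf t x)) * E t x = exp (- \<i> * z t * of_real x)"
    unfolding E_def by (simp add: mult_exp_exp)
  ultimately have "exp (- \<i> * z t * of_real x) * (V t x - sig t x * U t x) =
      exp (- (\<i> * Bf t x)) * (1 - sig t 0 - integral {0..x} (\<lambda>y. res t y * hE t y))"
    by (simp only: mult.assoc[symmetric])
  then show "(exp (- (\<i> * Bf t x)) - 1)
      + exp (- (\<i> * Bf t x)) * (- sig t 0 - integral {0..x} (\<lambda>y. res t y * hE t y))
      + exp (- \<i> * z t * of_real x) * (U t x * sig t x) = exp (- \<i> * z t * of_real x) * V t x - 1"
    by (simp add: algebra_simps)
qed

end

section \<open>Fourier coefficients and their truncations\<close>

abbreviation npi :: "int \<Rightarrow> complex" where
  "npi m \<equiv> of_int m * of_real pi"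

definition osc :: "int \<Rightarrow> cfn" where
  "osc m x = exp (2 * \<i> * of_int m * of_real pi * of_real x)"

lemma norm_osc: "norm (osc m x) = 1"
  by (simp add: osc_def norm_exp_eq_Re)

lemma osc_0: "osc m 0 = 1"
  by (simp add: osc_def)

lemma osc_1: "osc m 1 = 1"
proof -
  have "osc m 1 = exp (of_real (2 * of_int m * pi) * \<i>)" by (simp add: osc_def mult_ac)
  also have "\<dots> = 1" by (rule exp_integer_2pi) simp
  finally show ?thesis .
qed

lemma osc_mult_inverse: "osc (- m) x * osc m x = 1"
  by (simp add: osc_def mult_exp_exp)

lemma osc_deriv:
  "(osc m has_vector_derivative 2 * \<i> * npi m * osc m x) (at x within S)"
proof -
  have "((\<lambda>x. (2 * \<i> * of_int m * of_real pi) * of_real x) has_vector_derivative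
      (2 * \<i> * of_int m * of_real pi) * of_real 1) (at x within S)"
    by (intro has_vector_derivative_mult_right has_vector_derivative_of_real DERIV_ident)
  from field_vector_diff_chain_within[OF this, of exp, unfolded o_def, OF has_field_derivative_at_within[OF DERIV_exp]]
  show ?thesis unfolding osc_def[abs_def] by (simp add: mult_ac)
qed

lemma osc_cont: "continuous_on S (osc m)"
  by (rule has_vd_continuous_on[OF osc_deriv])

text \<open>
  The Fourier coefficient of \<open>g\<close> cut off at \<open>x\<close>; at \<open>x = 1\<close> it is the usual one.
\<close>

definition trunc_four :: "(cfn) \<Rightarrow> int \<Rightarrow> cfn" where
  "trunc_four g m x = integral {0..x} (\<lambda>y. g y * osc (- m) y)"

definition four_energy :: "(cfn) \<Rightarrow> int \<Rightarrow> real" where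
  "four_energy g m = (norm (trunc_four g m 1))\<^sup>2 + integral {0..1} (\<lambda>x. (norm (trunc_four g m x))\<^sup>2)"

lemma trunc_four_indefinite:
  assumes "g absolutely_integrable_on {0..1}"
  shows "indefinite (trunc_four g m) (\<lambda>y. g y * osc (- m) y)"
  unfolding indefinite_def trunc_four_def
  using absolutely_integrable_mult_continuous'[OF osc_cont assms] by simp

lemma trunc_four_0: "trunc_four g m 0 = 0"
  by (simp add: trunc_four_def)

lemma trunc_four_cont:
  "g absolutely_integrable_on {0..1} \<Longrightarrow> continuous_on {0..1} (trunc_four g m)"
  by (rule indefinite_continuous[OF trunc_four_indefinite])

lemma four_energy_bounds:
  assumes g: "g absolutely_integrable_on {0..1}" and e: "four_energy g m \<le> \<theta>\<^sup>2" and \<theta>: "\<theta> > 0"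
  shows "norm (trunc_four g m 1) \<le> \<theta>" "integral {0..1} (\<lambda>x. (norm (trunc_four g m x))\<^sup>2) \<le> \<theta>\<^sup>2"
    "integral {0..1} (\<lambda>x. norm (trunc_four g m x)) \<le> \<theta>"
proof -
  let ?T = "trunc_four g m"
  have i: "(\<lambda>x. (norm (?T x))\<^sup>2) integrable_on {0..1}"
    by (intro integrable_continuous_real continuous_intros trunc_four_cont g)
  have i1: "(\<lambda>x. norm (?T x)) integrable_on {0..1}"
    by (intro integrable_continuous_real continuous_intros trunc_four_cont g)
  have n: "integral {0..1} (\<lambda>x. (norm (?T x))\<^sup>2) \<ge> 0" by (rule integral_nonneg[OF i]) simp
  then have "(norm (?T 1))\<^sup>2 \<le> \<theta>\<^sup>2" using e unfolding four_energy_def by simp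
  then show "norm (?T 1) \<le> \<theta>" using \<theta> by (auto intro: power2_le_imp_le)
  show 2: "integral {0..1} (\<lambda>x. (norm (?T x))\<^sup>2) \<le> \<theta>\<^sup>2"
    using e unfolding four_energy_def by (smt (verit) zero_le_power2)
  have le: "norm (?T x) \<le> (\<theta> + (norm (?T x))\<^sup>2 / \<theta>) / 2" for x
    using sum_squares_bound[of \<theta> "norm (?T x)"] \<theta> by (simp add: field_simps power2_eq_square)
  have c: "(\<lambda>x. \<theta>) integrable_on {0..1::real}" by (rule integrable_continuous_real) simp
  have i2: "(\<lambda>x. (norm (?T x))\<^sup>2 / \<theta>) integrable_on {0..1}" by (rule integrable_on_divide[OF i])
  have "integral {0..1} (\<lambda>x. norm (?T x)) \<le> integral {0..1} (\<lambda>x. (\<theta> + (norm (?T x))\<^sup>2 / \<theta>) / 2)"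
    by (rule integral_le[OF i1 integrable_on_divide[OF integrable_add[OF c i2]]]) (rule le)
  also have "\<dots> = (\<theta> + integral {0..1} (\<lambda>x. (norm (?T x))\<^sup>2) / \<theta>) / 2"
    using integral_add[OF c i2] by simp
  also have "\<dots> \<le> (\<theta> + \<theta>\<^sup>2 / \<theta>) / 2" using 2 \<theta> by (simp add: divide_right_mono)
  also have "\<dots> = \<theta>" using \<theta> by (simp add: power2_eq_square)
  finally show "integral {0..1} (\<lambda>x. norm (?T x)) \<le> \<theta>" .
qed

lemma integral_mult_le_square:
  fixes g P :: cfn
  assumes g: "g absolutely_integrable_on {0..1}" "(\<lambda>x. (norm (g x))\<^sup>2) integrable_on {0..1}"
      "integral {0..1} (\<lambda>x. (norm (g x))\<^sup>2) \<le> G"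
    and P: "continuous_on {0..1} P" "integral {0..1} (\<lambda>x. (norm (P x))\<^sup>2) \<le> \<theta>\<^sup>2" and \<theta>: "\<theta> > 0"
  shows "norm (integral {0..1} (\<lambda>x. g x * P x)) \<le> (G + 1) * \<theta>"
proof -
  have iP: "(\<lambda>x. (norm (P x))\<^sup>2) integrable_on {0..1}"
    by (intro integrable_continuous_real continuous_intros P)
  have gP: "(\<lambda>x. g x * P x) absolutely_integrable_on {0..1}"
    by (rule absolutely_integrable_mult_continuous'[OF P(1) g(1)])
  have i1: "(\<lambda>x. (norm (g x))\<^sup>2 * \<theta>) integrable_on {0..1}" using g(2) by (rule integrable_on_mult_left)
  have i2: "(\<lambda>x. (norm (P x))\<^sup>2 / \<theta>) integrable_on {0..1}" by (rule integrable_on_divide[OF iP])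
  have G0: "G \<ge> 0" by (rule order_trans[OF integral_nonneg[OF g(2)] g(3)]) simp
  have "norm (integral {0..1} (\<lambda>x. g x * P x)) \<le> integral {0..1} (\<lambda>x. ((norm (g x))\<^sup>2 * \<theta> + (norm (P x))\<^sup>2 / \<theta>) / 2)"
  proof (rule integral_norm_bound_integral[OF absolutely_integrableD(1)[OF gP] integrable_on_divide[OF integrable_add[OF i1 i2]]])
    fix x
    have "2 * norm (g x) * norm (P x) * \<theta> \<le> (norm (g x))\<^sup>2 * \<theta> * \<theta> + (norm (P x))\<^sup>2"
      using sum_squares_bound[of "norm (g x) * \<theta>" "norm (P x)"] by (simp add: power2_eq_square mult_ac)
    then show "norm (g x * P x) \<le> ((norm (g x))\<^sup>2 * \<theta> + (norm (P x))\<^sup>2 / \<theta>) / 2"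
      using \<theta> by (simp add: norm_mult field_simps)
  qed
  also have "\<dots> = (integral {0..1} (\<lambda>x. (norm (g x))\<^sup>2) * \<theta> + integral {0..1} (\<lambda>x. (norm (P x))\<^sup>2) / \<theta>) / 2"
    using integral_add[OF i1 i2] by simp
  also have "\<dots> \<le> (G * \<theta> + \<theta>\<^sup>2 / \<theta>) / 2"
    using g(3) P(2) \<theta> by (intro divide_right_mono add_mono mult_right_mono) auto
  also have "\<dots> \<le> (G + 1) * \<theta>" using \<theta> G0 by (simp add: power2_eq_square field_simps)
  finally show ?thesis .
qed

lemma unif_O_cong_eventually:
  assumes "unif_O T z f g"
    and "\<And>t x. t \<in> T \<Longrightarrow> K \<le> norm (z t) \<Longrightarrow> x \<in> {0..1} \<Longrightarrow> f t x = h t x"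
  shows "unif_O T z h g"
proof -
  obtain C K' where C: "C \<ge> 0" "K' \<ge> 1" and
    1: "\<And>t x. t \<in> T \<Longrightarrow> K' \<le> norm (z t) \<Longrightarrow> x \<in> {0..1} \<Longrightarrow> norm (f t x) \<le> C * g t"
    using unif_OE[OF assms(1)] by metis
  show ?thesis
  proof (rule unif_OI[OF C(1), of _ "max K K'"])
    fix t x assume t: "t \<in> T" "max K K' \<le> norm (z t)" "x \<in> {0..1::real}"
    then show "norm (h t x) \<le> C * g t" using 1[of t x] assms(2)[of t x] by simp
  qed
qed

section \<open>Integrals against the modulated solution\<close>

text \<open>
  Now every parameter is an eigenvalue with an index. The number \<open>\<theta> t\<close> bounds the truncated Fourier coefficients that
  occur in the error; in the end its squares are summable over the index.
\<close>

locale zs_eigen = zs_family +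
  fixes n :: "'a \<Rightarrow> int" and \<theta> :: "'a \<Rightarrow> real" and \<Theta> :: real
  assumes bdry: "\<And>t. t \<in> T \<Longrightarrow> U t 1 = V t 1"
    and crudeU: "unif_O T z (\<lambda>t x. exp (\<i> * z t * of_real x) * U t x - 1) (inv_size z)"
    and near: "unif_O T z (\<lambda>t x. z t - npi (n t)) (inv_size z)"
    and \<theta>_ep: "\<And>t. t \<in> T \<Longrightarrow> 1 \<le> norm (z t) \<Longrightarrow> inv_size z t \<le> \<theta> t"
    and \<theta>_b: "\<And>t. t \<in> T \<Longrightarrow> four_energy (b t N) (n t) \<le> (\<theta> t)\<^sup>2"
    and \<theta>_rem: "\<And>t. t \<in> T \<Longrightarrow> four_energy (rem1 t) (n t) \<le> (\<theta> t)\<^sup>2"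
    and \<theta>_a: "\<And>t. t \<in> T \<Longrightarrow> four_energy (a t 1) (- n t) \<le> (\<theta> t)\<^sup>2"
    and \<theta>_bdd: "\<And>t. t \<in> T \<Longrightarrow> \<theta> t \<le> \<Theta>"
begin

definition "nu t = (npi (n t) :: complex)"
definition "zn t = 1 / (2 * \<i> * nu t)"

lemma near': "BO (\<lambda>t x. z t - nu t) ep"
  using near unfolding nu_def .

lemma \<theta>_pos: "t \<in> T \<Longrightarrow> 1 \<le> norm (z t) \<Longrightarrow> \<theta> t > 0"
  by (rule less_le_trans[OF _ \<theta>_ep]) (auto simp: inv_size_def)

lemma nu_large: obtains K where "K \<ge> 1" "\<And>t. t \<in> T \<Longrightarrow> K \<le> norm (z t) \<Longrightarrow> norm (z t) / 2 \<le> norm (nu t)"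
proof -
  obtain C K where C: "C \<ge> 0" "K \<ge> 1" and
    1: "\<And>t x. t \<in> T \<Longrightarrow> K \<le> norm (z t) \<Longrightarrow> x \<in> {0..1::real} \<Longrightarrow> norm (z t - nu t) \<le> C * ep t"
    using unif_OE[OF near'] by metis
  show ?thesis
  proof (rule that[of "max K (2 * C)"])
    fix t assume t: "t \<in> T" "max K (2 * C) \<le> norm (z t)"
    have "norm (z t - nu t) \<le> C * ep t" using 1[of t 0] t by simp
    also have "\<dots> \<le> C * 1" using t C by (intro mult_left_mono inv_size_le_1) auto
    also have "\<dots> \<le> norm (z t) / 2" using t by simp
    finally show "norm (z t) / 2 \<le> norm (nu t)" using norm_triangle_ineq2[of "z t" "nu t"] by linarith
  qed (use C in simp)
qed

lemma zn_O: "BO (\<lambda>t x. zn t) ep"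
proof -
  obtain K where K: "K \<ge> 1" "\<And>t. t \<in> T \<Longrightarrow> K \<le> norm (z t) \<Longrightarrow> norm (z t) / 2 \<le> norm (nu t)"
    using nu_large by blast
  show ?thesis
  proof (rule unif_OI[of 1 _ K])
    fix t assume t: "t \<in> T" "K \<le> norm (z t)" "1 \<le> norm (z t)"
    have "norm (z t) / 2 \<le> norm (nu t)" using K(2) t by blast
    moreover have "0 < norm (z t) / 2" using t by linarith
    ultimately have "1 / norm (nu t) \<le> 1 / (norm (z t) / 2)" by (intro frac_le) auto
    then show "norm (zn t) \<le> 1 * ep t"
      by (simp add: zn_def norm_divide norm_mult inv_size_def)
  qed simp
qed

lemma nu_nz: obtains K where "K \<ge> 1" "\<And>t. t \<in> T \<Longrightarrow> K \<le> norm (z t) \<Longrightarrow> nu t \<noteq> 0"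
proof -
  obtain K where K: "K \<ge> 1" "\<And>t. t \<in> T \<Longrightarrow> K \<le> norm (z t) \<Longrightarrow> norm (z t) / 2 \<le> norm (nu t)"
    using nu_large by blast
  show ?thesis
  proof (rule that[OF K(1)])
    fix t assume "t \<in> T" "K \<le> norm (z t)"
    then have "norm (z t) / 2 \<le> norm (nu t)" "norm (z t) > 0" using K by auto
    then show "nu t \<noteq> 0" by auto
  qed
qed

lemma zeta_zn: "BO (\<lambda>t x. zeta t - zn t) (\<lambda>t. ep t ^ 2)"
proof -
  obtain K where K: "K \<ge> 1" "\<And>t. t \<in> T \<Longrightarrow> K \<le> norm (z t) \<Longrightarrow> nu t \<noteq> 0" using nu_nz by blast
  have w: "BO (\<lambda>t x. z t - nu t) (\<lambda>t. 1)"
    by (rule unif_O_weaken[OF near', of 1]) (auto simp: inv_size_le_1)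
  have "BO (\<lambda>t x. zeta t * zn t) (\<lambda>t. ep t ^ 2)"
    using unif_O_mult[OF zeta_O[of 1] zn_O] by (simp add: power2_eq_square)
  then have "BO (\<lambda>t x. (- 2 * \<i>) * ((z t - nu t) * (zeta t * zn t))) (\<lambda>t. ep t ^ 2)"
    by (intro unif_O_cmult unif_O_mult1[OF w])
  then show ?thesis
  proof (rule unif_O_cong_eventually)
    fix t assume t: "t \<in> T" "K \<le> norm (z t)"
    then have "nu t \<noteq> 0" "z t \<noteq> 0" using K by auto
    then show "(- 2 * \<i>) * ((z t - nu t) * (zeta t * zn t)) = zeta t - zn t"
      by (simp add: zeta_def zn_def field_simps)
  qed
qed

lemma zeta_zn_power: "BO (\<lambda>t x. zeta t ^ k - zn t ^ k) (\<lambda>t. ep t ^ Suc k)"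
proof (induction k)
  case 0
  show ?case by (rule unif_OI[of 0]) auto
next
  case (Suc k)
  have znk: "BO (\<lambda>t x. zn t ^ k) (\<lambda>t. ep t ^ k)"
  proof (induction k)
    case 0
    show ?case by (simp add: unif_O_const)
  next
    case (Suc k)
    then show ?case using unif_O_mult[OF zn_O Suc] by simp
  qed
  have "BO (\<lambda>t x. zeta t * (zeta t ^ k - zn t ^ k)) (\<lambda>t. ep t ^ Suc (Suc k))"
    using unif_O_mult[OF zeta_O[of 1] Suc] by simp
  moreover have "BO (\<lambda>t x. (zeta t - zn t) * zn t ^ k) (\<lambda>t. ep t ^ Suc (Suc k))"
    using unif_O_mult[OF zeta_zn znk] by (simp add: power2_eq_square mult.assoc)
  ultimately have "BO (\<lambda>t x. zeta t * (zeta t ^ k - zn t ^ k) + (zeta t - zn t) * zn t ^ k) (\<lambda>t. ep t ^ Suc (Suc k))"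
    by (rule unif_O_add)
  then show ?case by (simp add: algebra_simps)
qed

text \<open>
  Along an eigenvalue \<open>exp (2 i n \<pi> x) E U\<close> is nearly constant: its derivative is \<open>i p exp (2 i n \<pi> x)\<close> plus an error
  \<open>eta\<close> of order \<open>1 / \<bar>z\<bar>\<close>.
\<close>

definition "hh t x = osc (n t) x * hE t x"
definition "eta t x = (- (2 * \<i>) * (z t - nu t) + \<i> * (a t 0 x * sig t x)) * hh t x
    + \<i> * (a t 0 x * (osc (n t) x * (E t x * V t x - 1)))"

lemma osc_O: "BO (\<lambda>t. osc (n t)) (\<lambda>t. 1)"
  by (rule unif_O_bounded[of _ _ _ 1]) (simp add: norm_osc)

lemma x_O: "BO (\<lambda>t x. complex_of_real x) (\<lambda>t. 1)"
  by (rule unif_O_bounded[of _ _ _ 1]) simp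

lemma O_1_of_minus_1:
  assumes "BO (\<lambda>t x. f t x - (1::complex)) ep"
  shows "BO f (\<lambda>t. 1)"
proof -
  have "BO (\<lambda>t x. f t x - 1) (\<lambda>t. 1)"
    by (rule unif_O_weaken[OF assms, of 1]) (auto simp: inv_size_le_1)
  from unif_O_add[OF this unif_O_const[of _ _ 1]] show ?thesis by simp
qed

lemma O_prod_minus_1:
  assumes f: "BO (\<lambda>t x. f t x - (1::complex)) ep" and g: "BO (\<lambda>t x. g t x - (1::complex)) ep"
  shows "BO (\<lambda>t x. f t x * g t x - 1) ep"
proof -
  have "BO (\<lambda>t x. f t x * (g t x - 1) + (f t x - 1)) ep"
    by (intro unif_O_add f unif_O_mult1[OF O_1_of_minus_1[OF f] g])
  then show ?thesis by (simp add: algebra_simps)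
qed

lemma EV_O: "BO (\<lambda>t x. E t x * V t x - 1) ep"
proof -
  have "BO (\<lambda>t x. exp (\<i> * Bf t x) * (exp (- \<i> * z t * of_real x) * V t x) - 1) ep"
    by (rule O_prod_minus_1[OF exp_Bf_O(1) crude_asymptotics])
  then show ?thesis unfolding E_eq by (simp add: mult_ac)
qed

lemma hh_O: "BO (\<lambda>t x. hh t x - 1) ep"
proof -
  have "BO (\<lambda>t x. of_real x * ((- 2 * \<i>) * (z t - nu t))) ep"
    by (intro unif_O_mult1[OF x_O] unif_O_cmult near')
  then have "BO (\<lambda>t x. exp (of_real x * ((- 2 * \<i>) * (z t - nu t))) - 1) ep"
    by (rule unif_O_exp[OF _ inv_size_le_1])
  from O_prod_minus_1[OF this O_prod_minus_1[OF exp_Bf_O(1) crudeU]] show ?thesis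
  proof (rule unif_O_cong)
    fix t x
    have "exp (of_real x * ((- 2 * \<i>) * (z t - nu t))) * exp (\<i> * z t * of_real x) =
       osc (n t) x * exp (- \<i> * z t * of_real x)"
      unfolding osc_def mult_exp_exp by (simp add: nu_def algebra_simps)
    moreover have "exp A * (exp B * (exp C * u)) = (exp A * exp C) * (exp B * u)" for A B C u :: complex
      by (simp add: mult_ac)
    ultimately have "exp (of_real x * ((- 2 * \<i>) * (z t - nu t))) * (exp (\<i> * Bf t x) * (exp (\<i> * z t * of_real x) * U t x)) =
        (osc (n t) x * exp (- \<i> * z t * of_real x)) * (exp (\<i> * Bf t x) * U t x)"
      by (simp only:)
    then show "exp (of_real x * ((- 2 * \<i>) * (z t - nu t))) * (exp (\<i> * Bf t x) * (exp (\<i> * z t * of_real x) * U t x)) - 1 = hh t x - 1"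
      unfolding hh_def hE_def E_eq by (simp only: mult.assoc)
  qed
qed

lemma eta_O: "BO eta ep"
  unfolding eta_def[abs_def]
proof (intro unif_O_add)
  have 1: "BO (\<lambda>t x. - (2 * \<i>) * (z t - nu t) + \<i> * (a t 0 x * sig t x)) ep"
    by (intro unif_O_add unif_O_cmult near' unif_O_mult1[OF O_coeffs(5) sig_O])
  show "BO (\<lambda>t x. (- (2 * \<i>) * (z t - nu t) + \<i> * (a t 0 x * sig t x)) * hh t x) ep"
    using unif_O_mult1[OF O_1_of_minus_1[OF hh_O] 1] by (simp add: mult.commute)
  show "BO (\<lambda>t x. \<i> * (a t 0 x * (osc (n t) x * (E t x * V t x - 1)))) ep"
    by (intro unif_O_cmult unif_O_mult1[OF O_coeffs(5)] unif_O_mult1[OF osc_O] EV_O)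
qed

lemma hh_cont: "t \<in> T \<Longrightarrow> continuous_on {0..1} (hh t)"
  unfolding hh_def[abs_def] by (intro continuous_intros osc_cont hE_cont)

lemma eta_cont: "t \<in> T \<Longrightarrow> continuous_on {0..1} (eta t)"
  unfolding eta_def[abs_def]
  by (intro continuous_intros osc_cont hh_cont ab_cont sig_cont E_cont UV_cont) (use N in auto)

lemma hh_deriv:
  assumes "t \<in> T" "x \<in> {0..1}"
  shows "(hh t has_vector_derivative \<i> * (a t 0 x * osc (n t) x) + eta t x) (at x within {0..1})"
proof -
  have "osc (n t) x * hE' t x + 2 * \<i> * npi (n t) * osc (n t) x * hE t x =
     \<i> * (a t 0 x * osc (n t) x) + eta t x"
    unfolding eta_def hh_def hE'_def hE_def nu_def by (simp add: algebra_simps)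
  with has_vector_derivative_mult[OF osc_deriv hE_deriv[OF assms], of "n t"]
  show ?thesis unfolding hh_def[abs_def] by simp
qed

definition "Wf t x = integral {0..x} (\<lambda>y. \<i> * (a t 0 y * osc (n t) y))"

lemma aosc_cont: "t \<in> T \<Longrightarrow> continuous_on {0..1} (\<lambda>y. \<i> * (a t 0 y * osc (n t) y))"
  by (intro continuous_intros osc_cont ab_cont) (use N in auto)

lemma a1_absint: "t \<in> T \<Longrightarrow> a t 1 absolutely_integrable_on {0..1}"
  using indefiniteD(1)[OF indefinite_sobolev_jet[OF jet_a, of t 0]] N by simp

lemma Wf_eq:
  assumes t: "t \<in> T" and nz: "nu t \<noteq> 0" and x: "x \<in> {0..1}"
  shows "Wf t x = \<i> * zn t * (a t 0 x * osc (n t) x - a t 0 0 - trunc_four (a t 1) (- n t) x)"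
proof -
  have "integral {0..x} (\<lambda>y. a t (Suc 0) y * osc (n t) y) =
      a t 0 x * osc (n t) x - a t 0 0 * osc (n t) 0 - integral {0..x} (\<lambda>y. a t 0 y * (2 * \<i> * npi (n t) * osc (n t) y))"
    by (rule indefinite_by_parts[OF indefinite_sobolev_jet[OF jet_a[OF t]] osc_deriv _ x])
      (use N in \<open>auto intro!: continuous_intros osc_cont\<close>)
  moreover have "integral {0..x} (\<lambda>y. a t 0 y * (2 * \<i> * npi (n t) * osc (n t) y)) = 2 * nu t * Wf t x"
    unfolding Wf_def integral_mult_right[symmetric] by (rule integral_cong) (simp add: nu_def)
  ultimately have "2 * nu t * Wf t x = a t 0 x * osc (n t) x - a t 0 0 - trunc_four (a t 1) (- n t) x"
    by (simp add: trunc_four_def osc_0)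
  then have "\<i> * zn t * (a t 0 x * osc (n t) x - a t 0 0 - trunc_four (a t 1) (- n t) x) = \<i> * zn t * (2 * nu t * Wf t x)" by simp
  also have "\<dots> = Wf t x" using nz by (simp add: zn_def)
  finally show ?thesis by simp
qed

lemma trunc_a_O: "BO (\<lambda>t _. trunc_four (a t 1) (- n t) 1) \<theta>"
proof (rule unif_OI[of 1 _ 1])
  fix t assume t: "t \<in> T" "1 \<le> norm (z t)"
  show "norm (trunc_four (a t 1) (- n t) 1) \<le> 1 * \<theta> t"
    using four_energy_bounds(1)[OF a1_absint[OF t(1)] \<theta>_a[OF t(1)] \<theta>_pos[OF t]] by simp
qed simp

lemma \<theta>_weaken: "BO f \<theta> \<Longrightarrow> BO f (\<lambda>t. 1)"
proof (rule unif_O_weaken[of _ _ _ \<theta> "max \<Theta> 0"])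
  fix t assume "t \<in> T"
  then have "\<theta> t \<le> \<Theta>" by (rule \<theta>_bdd)
  then show "\<theta> t \<le> max \<Theta> 0 * 1" by simp
qed simp_all

lemma Wf1_O: "BO (\<lambda>t _. Wf t 1) ep"
proof -
  obtain K where K: "K \<ge> 1" "\<And>t. t \<in> T \<Longrightarrow> K \<le> norm (z t) \<Longrightarrow> nu t \<noteq> 0" using nu_nz by blast
  have "BO (\<lambda>t _. trunc_four (a t 1) (- n t) 1 * ((- \<i>) * zn t)) ep"
    by (intro unif_O_mult1[OF \<theta>_weaken[OF trunc_a_O]] unif_O_cmult zn_O)
  then show ?thesis
  proof (rule unif_O_cong_eventually)
    fix t assume t: "t \<in> T" "K \<le> norm (z t)"
    have "a t 0 1 = a t 0 0" using sobolev_jetD(2)[OF jet_a[OF t(1)]] N by simp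
    then show "trunc_four (a t 1) (- n t) 1 * ((- \<i>) * zn t) = Wf t 1"
      using Wf_eq[OF t(1) K(2)[OF t], of 1] by (simp add: osc_1)
  qed
qed

text \<open>
  Write the integrand as \<open>g exp (- 2 i n \<pi> x)\<close> times \<open>hh\<close> and integrate by parts, with \<open>T\<close> the truncated Fourier
  coefficient of \<open>g\<close>: the boundary term is \<open>T 1\<close>, and \<open>\<integral> T eta\<close> is small. The derivative of \<open>hh\<close> has the main
  term \<open>i p exp (2 i n \<pi> x)\<close>; moving it back to its primitive \<open>Wf\<close> and integrating \<open>Wf\<close> by parts, the two
  exponentials cancel, which leaves the non-oscillating integral of \<open>g p\<close>, of order \<open>1 / n\<close>, and a truncated
  Fourier coefficient of \<open>p'\<close>.
\<close>

theorem refined_integral: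
  assumes g: "\<And>t. t \<in> T \<Longrightarrow> g t absolutely_integrable_on {0..1}"
    "\<And>t. t \<in> T \<Longrightarrow> (\<lambda>x. (norm (g t x))\<^sup>2) integrable_on {0..1}"
    "\<And>t. t \<in> T \<Longrightarrow> integral {0..1} (\<lambda>x. (norm (g t x))\<^sup>2) \<le> G"
    and e: "\<And>t. t \<in> T \<Longrightarrow> four_energy (g t) (n t) \<le> (\<theta> t)\<^sup>2"
  shows "BO (\<lambda>t _. integral {0..1} (\<lambda>x. g t x * hE t x)
      - (trunc_four (g t) (n t) 1 + \<i> * zn t * integral {0..1} (\<lambda>x. g t x * a t 0 x))) (\<lambda>t. ep t * \<theta> t)"
proof -
  obtain K where K: "K \<ge> 1" "\<And>t. t \<in> T \<Longrightarrow> K \<le> norm (z t) \<Longrightarrow> nu t \<noteq> 0" using nu_nz by blast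
  define Tg where "Tg t x = trunc_four (g t) (n t) x" for t x
  define P where "P t x = trunc_four (a t 1) (- n t) x" for t x
  have Tgc: "continuous_on {0..1} (Tg t)" if "t \<in> T" for t
    unfolding Tg_def[abs_def] by (rule trunc_four_cont[OF g(1)[OF that]])
  have Pc: "continuous_on {0..1} (P t)" if "t \<in> T" for t
    unfolding P_def[abs_def] by (rule trunc_four_cont[OF a1_absint[OF that]])
  have T1: "BO (\<lambda>t _. Tg t 1) \<theta>"
  proof (rule unif_OI[of 1 _ 1])
    fix t assume t: "t \<in> T" "1 \<le> norm (z t)"
    show "norm (Tg t 1) \<le> 1 * \<theta> t"
      using four_energy_bounds(1)[OF g(1)[OF t(1)] e[OF t(1)] \<theta>_pos[OF t]] by (simp add: Tg_def)
  qed simp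
  have gP: "BO (\<lambda>t _. integral {0..1} (\<lambda>x. (g t x * osc (- n t) x) * P t x)) \<theta>"
  proof (rule unif_OI[of "max G 0 + 1" _ 1])
    fix t assume t: "t \<in> T" "1 \<le> norm (z t)"
    show "norm (integral {0..1} (\<lambda>x. (g t x * osc (- n t) x) * P t x)) \<le> (max G 0 + 1) * \<theta> t"
    proof (rule integral_mult_le_square)
      show "(\<lambda>x. g t x * osc (- n t) x) absolutely_integrable_on {0..1}"
        by (rule absolutely_integrable_mult_continuous'[OF osc_cont g(1)[OF t(1)]])
      show "(\<lambda>x. (norm (g t x * osc (- n t) x))\<^sup>2) integrable_on {0..1}"
        unfolding norm_mult norm_osc mult_1_right by (rule g(2)[OF t(1)])
      show "integral {0..1} (\<lambda>x. (norm (g t x * osc (- n t) x))\<^sup>2) \<le> max G 0"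
        unfolding norm_mult norm_osc mult_1_right using g(3)[OF t(1)] by simp
      show "integral {0..1} (\<lambda>x. (norm (P t x))\<^sup>2) \<le> (\<theta> t)\<^sup>2"
        unfolding P_def by (rule four_energy_bounds(2)[OF a1_absint[OF t(1)] \<theta>_a[OF t(1)] \<theta>_pos[OF t]])
    qed (use Pc t \<theta>_pos in auto)
  qed simp
  have Te: "BO (\<lambda>t _. integral {0..1} (\<lambda>x. Tg t x * eta t x)) (\<lambda>t. ep t * \<theta> t)"
  proof -
    obtain C K' where C: "C \<ge> 0" "K' \<ge> 1" and
      1: "\<And>t x. t \<in> T \<Longrightarrow> K' \<le> norm (z t) \<Longrightarrow> x \<in> {0..1} \<Longrightarrow> norm (eta t x) \<le> C * ep t"
      using unif_OE[OF eta_O] by metis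
    show ?thesis
    proof (rule unif_OI[OF C(1), of _ K'])
      fix t assume t: "t \<in> T" "K' \<le> norm (z t)" "1 \<le> norm (z t)"
      have "norm (integral {0..1} (\<lambda>x. Tg t x * eta t x)) \<le> integral {0..1} (\<lambda>x. norm (Tg t x) * (C * ep t))"
      proof (rule integral_norm_bound_integral)
        show "(\<lambda>x. Tg t x * eta t x) integrable_on {0..1}" "(\<lambda>x. norm (Tg t x) * (C * ep t)) integrable_on {0..1}"
          by (intro integrable_continuous_real continuous_intros Tgc eta_cont t)+
        show "norm (Tg t x * eta t x) \<le> norm (Tg t x) * (C * ep t)" if "x \<in> {0..1}" for x
          unfolding norm_mult by (rule mult_left_mono[OF 1[OF t(1,2) that] norm_ge_zero])
      qed
      also have "\<dots> = integral {0..1} (\<lambda>x. norm (Tg t x)) * (C * ep t)" by simp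
      also have "\<dots> \<le> \<theta> t * (C * ep t)"
        using four_energy_bounds(3)[OF g(1)[OF t(1)] e[OF t(1)] \<theta>_pos[OF t(1,3)]] C inv_size_nonneg[of z t]
        by (intro mult_right_mono) (auto simp: Tg_def)
      finally show "norm (integral {0..1} (\<lambda>x. Tg t x * eta t x)) \<le> C * (ep t * \<theta> t)" by (simp add: mult_ac)
    qed
  qed
  have h1: "BO (\<lambda>t _. hh t 1 - 1) ep" by (rule unif_O_at[OF hh_O]) simp
  have a0: "BO (\<lambda>t _. a t 0 0) (\<lambda>t. 1)" by (rule unif_O_at[OF O_coeffs(5)]) simp
  have "BO (\<lambda>t _. (hh t 1 - 1) * Tg t 1 - (a t 0 0 * (\<i> * zn t)) * Tg t 1
     - (\<i> * zn t) * integral {0..1} (\<lambda>x. (g t x * osc (- n t) x) * P t x)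
     - Wf t 1 * Tg t 1 - integral {0..1} (\<lambda>x. Tg t x * eta t x)) (\<lambda>t. ep t * \<theta> t)"
    by (intro unif_O_diff unif_O_mult h1 T1 Te unif_O_mult1[OF a0] unif_O_cmult zn_O Wf1_O gP)
  then show ?thesis
  proof (rule unif_O_cong_eventually)
    fix t assume t: "t \<in> T" "K \<le> norm (z t)"
    note nz = K(2)[OF t]
    note TI = trunc_four_indefinite[OF g(1)[OF t(1)], of "n t", folded Tg_def[abs_def]]
    have TI': "indefinite (Tg t) (\<lambda>y. g t y * osc (- n t) y)" using TI by (simp add: Tg_def[abs_def])
    have T0: "Tg t 0 = 0" by (simp add: Tg_def trunc_four_0)
    have c: "continuous_on {0..1} (\<lambda>x. \<i> * (a t 0 x * osc (n t) x) + eta t x)"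
      by (intro continuous_on_add aosc_cont eta_cont t)
    have "integral {0..1} (\<lambda>y. (g t y * osc (- n t) y) * hh t y) =
       Tg t 1 * hh t 1 - Tg t 0 * hh t 0 - integral {0..1} (\<lambda>y. Tg t y * (\<i> * (a t 0 y * osc (n t) y) + eta t y))"
      by (rule indefinite_by_parts[OF TI' hh_deriv[OF t(1)] c]) auto
    moreover have "(g t y * osc (- n t) y) * hh t y = g t y * hE t y" for y
      unfolding hh_def using osc_mult_inverse[of "n t" y] by (metis mult.assoc mult_1)
    moreover have "integral {0..1} (\<lambda>y. Tg t y * (\<i> * (a t 0 y * osc (n t) y) + eta t y)) =
       integral {0..1} (\<lambda>y. Tg t y * (\<i> * (a t 0 y * osc (n t) y))) + integral {0..1} (\<lambda>y. Tg t y * eta t y)"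
      unfolding distrib_left
      by (rule integral_add) (intro integrable_continuous_real continuous_on_mult Tgc aosc_cont eta_cont t)+
    ultimately have 1: "integral {0..1} (\<lambda>y. g t y * hE t y) = Tg t 1 * hh t 1
       - integral {0..1} (\<lambda>y. Tg t y * (\<i> * (a t 0 y * osc (n t) y))) - integral {0..1} (\<lambda>y. Tg t y * eta t y)"
      using T0 by simp
    have Wd: "(Wf t has_vector_derivative \<i> * (a t 0 x * osc (n t) x)) (at x within {0..1})" if "x \<in> {0..1}" for x
      unfolding Wf_def[abs_def] by (rule integral_has_vector_derivative[OF aosc_cont[OF t(1)] that])
    have 2: "integral {0..1} (\<lambda>y. (g t y * osc (- n t) y) * Wf t y) =
       Tg t 1 * Wf t 1 - Tg t 0 * Wf t 0 - integral {0..1} (\<lambda>y. Tg t y * (\<i> * (a t 0 y * osc (n t) y)))"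
      by (rule indefinite_by_parts[OF TI' Wd aosc_cont[OF t(1)]]) auto
    have gi: "(\<lambda>y. g t y * a t 0 y) absolutely_integrable_on {0..1}"
      by (rule absolutely_integrable_mult_continuous'[OF ab_cont(1)[OF t(1)] g(1)[OF t(1)]]) (use N in simp)
    have goi: "(\<lambda>y. g t y * osc (- n t) y) absolutely_integrable_on {0..1}"
      by (rule absolutely_integrable_mult_continuous'[OF osc_cont g(1)[OF t(1)]])
    have gPi: "(\<lambda>y. (g t y * osc (- n t) y) * P t y) absolutely_integrable_on {0..1}"
      by (rule absolutely_integrable_mult_continuous'[OF Pc[OF t(1)] goi])
    have e3: "(g t y * osc (- n t) y) * Wf t y = (\<i> * zn t) * (g t y * a t 0 y)
         - (\<i> * zn t) * (a t 0 0 * (g t y * osc (- n t) y)) - (\<i> * zn t) * ((g t y * osc (- n t) y) * P t y)"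
      if "y \<in> {0..1}" for y
    proof -
      have "(g t y * osc (- n t) y) * Wf t y = (\<i> * zn t) * (g t y * a t 0 y * (osc (- n t) y * osc (n t) y))
         - (\<i> * zn t) * (a t 0 0 * (g t y * osc (- n t) y)) - (\<i> * zn t) * ((g t y * osc (- n t) y) * P t y)"
        unfolding Wf_eq[OF t(1) nz that] P_def by (simp add: algebra_simps)
      then show ?thesis unfolding osc_mult_inverse by simp
    qed
    have "integral {0..1} (\<lambda>y. (g t y * osc (- n t) y) * Wf t y) =
       integral {0..1} (\<lambda>y. (\<i> * zn t) * (g t y * a t 0 y)
         - (\<i> * zn t) * (a t 0 0 * (g t y * osc (- n t) y)) - (\<i> * zn t) * ((g t y * osc (- n t) y) * P t y))"
      by (rule integral_cong) (rule e3)
    also have "\<dots> = integral {0..1} (\<lambda>y. (\<i> * zn t) * (g t y * a t 0 y))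
         - integral {0..1} (\<lambda>y. (\<i> * zn t) * (a t 0 0 * (g t y * osc (- n t) y)))
         - integral {0..1} (\<lambda>y. (\<i> * zn t) * ((g t y * osc (- n t) y) * P t y))"
      using absolutely_integrableD(1)[OF gi] absolutely_integrableD(1)[OF goi] absolutely_integrableD(1)[OF gPi]
      by (simp only: HK_integral_diff integrable_diff integrable_on_mult_right)
    finally have 3: "integral {0..1} (\<lambda>y. (g t y * osc (- n t) y) * Wf t y) =
        (\<i> * zn t) * integral {0..1} (\<lambda>y. g t y * a t 0 y) - (\<i> * zn t) * (a t 0 0 * Tg t 1)
        - (\<i> * zn t) * integral {0..1} (\<lambda>y. (g t y * osc (- n t) y) * P t y)"
      by (simp only: integral_mult_right Tg_def trunc_four_def)
    show "(hh t 1 - 1) * Tg t 1 - (a t 0 0 * (\<i> * zn t)) * Tg t 1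
     - (\<i> * zn t) * integral {0..1} (\<lambda>x. (g t x * osc (- n t) x) * P t x)
     - Wf t 1 * Tg t 1 - integral {0..1} (\<lambda>x. Tg t x * eta t x) =
      integral {0..1} (\<lambda>x. g t x * hE t x)
      - (trunc_four (g t) (n t) 1 + \<i> * zn t * integral {0..1} (\<lambda>x. g t x * a t 0 x))"
      unfolding 1 Tg_def[symmetric] using 2 unfolding 3 T0 by (simp add: algebra_simps)
  qed
qed

end

section \<open>Expansion of one component at the right end point\<close>

context zs_eigen begin

text \<open>
  \<open>Ires\<close> is the residual integral of the WKB identity; \<open>Yb\<close>, \<open>Y1\<close>, \<open>Y2\<close> are the parts of the orders \<open>N\<close>, \<open>N + 1\<close>,
  \<open>N + 2\<close>. \<open>Jq\<close> is the deviation of \<open>E V\<close> from 1 at the end point, and \<open>Sser\<close> the sum that becomes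
  the expansion in powers of \<open>1 / z\<close>.
\<close>

definition "fc t = trunc_four (b t 0) (n t) 1"
definition "Tb t = trunc_four (b t N) (n t) 1"
definition "Yb t = integral {0..1} (\<lambda>x. b t N x * hE t x)"
definition "Y1 t = integral {0..1} (\<lambda>x. rem1 t x * hE t x)"
definition "Y2 t = integral {0..1} (\<lambda>x. rem2 t x * hE t x)"
definition "Ib t = integral {0..1} (\<lambda>x. b t N x * a t 0 x)"
definition "Ires t = integral {0..1} (\<lambda>x. res t x * hE t x)"
definition "Jq t = Ires t * inverse (1 - sig t 0)"
definition "Sser t = (\<Sum>k\<le>N. zeta t ^ Suc k * integral {0..1} (\<lambda>x. a t 0 x * cs k t x))"

lemma trunc_four_b_Suc:
  assumes t: "t \<in> T" and j: "j < N"
  shows "trunc_four (b t (Suc j)) (n t) 1 = 2 * \<i> * nu t * trunc_four (b t j) (n t) 1"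
proof -
  have "integral {0..1} (\<lambda>y. b t (Suc j) y * osc (- n t) y) =
      b t j 1 * osc (- n t) 1 - b t j 0 * osc (- n t) 0
      - integral {0..1} (\<lambda>y. b t j y * (2 * \<i> * npi (- n t) * osc (- n t) y))"
    by (rule indefinite_by_parts[OF indefinite_sobolev_jet[OF jet_b[OF t] j] osc_deriv])
      (auto intro!: continuous_intros osc_cont)
  also have "integral {0..1} (\<lambda>y. b t j y * (2 * \<i> * npi (- n t) * osc (- n t) y)) =
     - (2 * \<i> * nu t) * integral {0..1} (\<lambda>y. b t j y * osc (- n t) y)"
    unfolding integral_mult_right[symmetric] by (rule integral_cong) (simp add: nu_def)
  finally show ?thesis
    using sobolev_jetD(2)[OF jet_b[OF t] j] by (simp add: trunc_four_def osc_0 osc_1)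
qed

text \<open>
  The factor \<open>n ^ N\<close> from periodicity of the lower derivatives compensates \<open>\<zeta> ^ N\<close> in front of the residual.
\<close>

lemma Tb_fc:
  assumes t: "t \<in> T"
  shows "Tb t = (2 * \<i> * nu t) ^ N * fc t"
proof -
  have "trunc_four (b t k) (n t) 1 = (2 * \<i> * nu t) ^ k * fc t" if "k \<le> N" for k
    using that
  proof (induction k)
    case (Suc k)
    then show ?case using trunc_four_b_Suc[OF t, of k] by simp
  qed (simp add: fc_def)
  then show ?thesis by (simp add: Tb_def)
qed

lemma O_ep_\<theta>: "BO f (\<lambda>t. ep t ^ Suc k) \<Longrightarrow> BO f (\<lambda>t. ep t ^ k * \<theta> t)"
  by (rule unif_O_weaken[of _ _ _ _ 1])
    (auto simp: mult.commute[of "ep _"] intro!: mult_left_mono \<theta>_ep zero_le_power inv_size_nonneg)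

lemma Tb_O: "BO (\<lambda>t _. Tb t) \<theta>"
proof (rule unif_OI[of 1 _ 1])
  fix t assume t: "t \<in> T" "1 \<le> norm (z t)"
  show "norm (Tb t) \<le> 1 * \<theta> t"
    using four_energy_bounds(1)[OF sobolev_jet_top(1)[OF jet_b[OF t(1)]] \<theta>_b[OF t(1)] \<theta>_pos[OF t]] by (simp add: Tb_def)
qed simp

lemma Ib_O: "BO (\<lambda>t _. Ib t) (\<lambda>t. 1)"
proof -
  have "BO (\<lambda>t x. integral {0..x} (\<lambda>y. b t N y * a t 0 y)) (\<lambda>t. 1)"
    by (rule unif_O_integral_mult[OF O_coeffs(5) b_top_L1 sobolev_jet_top(1)[OF jet_b] ab_cont(1)]) (use N in auto)
  from unif_O_at[OF this, of 1] show ?thesis by (simp add: Ib_def)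
qed

lemma Yb_O: "BO (\<lambda>t _. Yb t - (Tb t + \<i> * zn t * Ib t)) (\<lambda>t. ep t * \<theta> t)"
  unfolding Yb_def Tb_def Ib_def
  by (rule refined_integral[of "\<lambda>t. b t N" R]) (intro sobolev_jet_top[OF jet_b] \<theta>_b; assumption)+

lemma Y1_O: "BO (\<lambda>t _. Y1 t) \<theta>"
proof -
  have bel: "below N (ric_m (Suc N))" using ric_m_below[of "Suc N"] by simp
  obtain C where C: "C \<ge> 0" "\<forall>a b. below N (ric_m (Suc N)) \<longrightarrow> (\<forall>j<N. norm (a j) \<le> R \<and> norm (b j) \<le> R) \<longrightarrow>
      norm (dval (ric_m (Suc N)) a b) \<le> C"
    using dval_bound by blast
  have b: "norm (rem1 t x) \<le> C" if "t \<in> T" "x \<in> {0..1}" for t x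
    unfolding rem1_eq by (intro C(2)[rule_format, OF bel] conjI ab_bound that)
  have ai: "rem1 t absolutely_integrable_on {0..1}" if "t \<in> T" for t
    by (rule absolutely_integrable_continuous_real[OF rem_cont(1)[OF that]])
  have 1: "BO (\<lambda>t _. Y1 t - (trunc_four (rem1 t) (n t) 1 + \<i> * zn t * integral {0..1} (\<lambda>x. rem1 t x * a t 0 x))) (\<lambda>t. ep t * \<theta> t)"
    unfolding Y1_def
  proof (rule refined_integral[of rem1 "C\<^sup>2"])
    fix t assume t: "t \<in> T"
    show "(\<lambda>x. (norm (rem1 t x))\<^sup>2) integrable_on {0..1}"
      by (intro integrable_continuous_real continuous_intros rem_cont t)
    have "integral {0..1} (\<lambda>x. (norm (rem1 t x))\<^sup>2) \<le> integral {0..1} (\<lambda>x::real. C\<^sup>2)"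
      by (rule integral_le) (use b[OF t] t in \<open>auto intro!: integrable_continuous_real continuous_intros rem_cont power_mono\<close>)
    then show "integral {0..1} (\<lambda>x. (norm (rem1 t x))\<^sup>2) \<le> C\<^sup>2" by simp
  qed (intro ai \<theta>_rem; assumption)+
  have 2: "BO (\<lambda>t _. trunc_four (rem1 t) (n t) 1) \<theta>"
  proof (rule unif_OI[of 1 _ 1])
    fix t assume t: "t \<in> T" "1 \<le> norm (z t)"
    show "norm (trunc_four (rem1 t) (n t) 1) \<le> 1 * \<theta> t"
      using four_energy_bounds(1)[OF ai[OF t(1)] \<theta>_rem[OF t(1)] \<theta>_pos[OF t]] by simp
  qed simp
  have "BO (\<lambda>t x. integral {0..x} (\<lambda>x. rem1 t x * a t 0 x)) (\<lambda>t. 1)"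
    by (rule unif_O_integral[OF unif_O_mult1[OF rem_O(1) O_coeffs(5)]])
      (intro continuous_intros rem_cont ab_cont, use N in auto)
  then have "BO (\<lambda>t _. integral {0..1} (\<lambda>x. rem1 t x * a t 0 x)) (\<lambda>t. 1)" by (rule unif_O_at) simp
  then have "BO (\<lambda>t _. integral {0..1} (\<lambda>x. rem1 t x * a t 0 x) * (\<i> * zn t)) ep"
    by (intro unif_O_mult1 unif_O_cmult zn_O)
  then have 3: "BO (\<lambda>t _. integral {0..1} (\<lambda>x. rem1 t x * a t 0 x) * (\<i> * zn t)) \<theta>"
    using O_ep_\<theta>[of _ 0] by simp
  have one': "BO (\<lambda>t _. Y1 t - (trunc_four (rem1 t) (n t) 1 + \<i> * zn t * integral {0..1} (\<lambda>x. rem1 t x * a t 0 x))) \<theta>"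
    by (rule unif_O_weaken[OF 1, of 1])
      (auto intro!: mult_left_le_one_le inv_size_le_1 inv_size_nonneg less_imp_le[OF \<theta>_pos])
  from unif_O_add[OF one' unif_O_add[OF 2 3]] show ?thesis by (simp add: algebra_simps)
qed

lemma Y2_O: "BO (\<lambda>t _. Y2 t) (\<lambda>t. 1)"
  using unif_O_at[OF integral_hE_O(3), of 1] by (simp add: Y2_def)

lemma mult_zeta_\<theta>:
  assumes "BO f (\<lambda>t. 1)" "k \<ge> N + 2"
  shows "BO (\<lambda>t x. f t x * zeta t ^ k) (\<lambda>t. ep t ^ Suc N * \<theta> t)"
  by (rule O_ep_\<theta>[OF ep_power_O_mult[OF assms(1)]]) (use assms in simp)

lemma Ires_O: "BO (\<lambda>t _. Ires t - (\<i> * fc t - zeta t ^ Suc N * Ib t)) (\<lambda>t. ep t ^ Suc N * \<theta> t)"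
proof -
  obtain K where K: "K \<ge> 1" "\<And>t. t \<in> T \<Longrightarrow> K \<le> norm (z t) \<Longrightarrow> nu t \<noteq> 0" using nu_nz by blast
  have 1: "BO (\<lambda>t _. \<i> * (zeta t ^ N * (Yb t - (Tb t + \<i> * zn t * Ib t)))) (\<lambda>t. ep t ^ Suc N * \<theta> t)"
    using unif_O_cmult[OF unif_O_mult[OF zeta_O[of N] Yb_O]] by (simp add: mult_ac)
  have 2: "BO (\<lambda>t _. \<i> * ((zeta t ^ N - zn t ^ N) * Tb t)) (\<lambda>t. ep t ^ Suc N * \<theta> t)"
    using unif_O_cmult[OF unif_O_mult[OF zeta_zn_power[of N] Tb_O]] by simp
  have "BO (\<lambda>t _. zeta t ^ N * (zeta t - zn t)) (\<lambda>t. ep t ^ (N + 2))"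
    using unif_O_mult[OF zeta_O[of N] zeta_zn] by (simp only: power_add)
  from unif_O_mult1[OF Ib_O this] have "BO (\<lambda>t _. Ib t * (zeta t ^ N * (zeta t - zn t))) (\<lambda>t. ep t ^ Suc (Suc N))" by simp
  then have 3: "BO (\<lambda>t _. Ib t * (zeta t ^ N * (zeta t - zn t))) (\<lambda>t. ep t ^ Suc N * \<theta> t)" by (rule O_ep_\<theta>)
  have 4: "BO (\<lambda>t _. zeta t ^ Suc N * Y1 t) (\<lambda>t. ep t ^ Suc N * \<theta> t)"
    by (rule unif_O_mult[OF zeta_O Y1_O])
  have 5: "BO (\<lambda>t _. Y2 t * zeta t ^ (N + 2)) (\<lambda>t. ep t ^ Suc N * \<theta> t)"
    by (rule mult_zeta_\<theta>[OF Y2_O order_refl])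
  have "BO (\<lambda>t _. \<i> * (zeta t ^ N * (Yb t - (Tb t + \<i> * zn t * Ib t))) + \<i> * ((zeta t ^ N - zn t ^ N) * Tb t)
     + Ib t * (zeta t ^ N * (zeta t - zn t)) + zeta t ^ Suc N * Y1 t + Y2 t * zeta t ^ (N + 2)) (\<lambda>t. ep t ^ Suc N * \<theta> t)"
    by (intro unif_O_add 1 2 3 4 5)
  then show ?thesis
  proof (rule unif_O_cong_eventually)
    fix t assume t: "t \<in> T" "K \<le> norm (z t)"
    have "zn t ^ N * Tb t = (zn t * (2 * \<i> * nu t)) ^ N * fc t"
      unfolding Tb_fc[OF t(1)] by (simp add: power_mult_distrib)
    also have "zn t * (2 * \<i> * nu t) = 1" using K(2)[OF t] by (simp add: zn_def)
    finally have f: "zn t ^ N * Tb t = fc t" by simp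
    have I: "Ires t = zeta t ^ N * (\<i> * Yb t) + zeta t ^ Suc N * Y1 t + zeta t ^ (N + 2) * Y2 t"
      unfolding Ires_def Yb_def Y1_def Y2_def
      by (rule res_integral_split[OF t(1)]) (use t K(1) in auto)
    have "Ires t - (\<i> * fc t - zeta t ^ Suc N * Ib t) =
       (zeta t ^ N * (\<i> * Yb t) + zeta t ^ Suc N * Y1 t + zeta t ^ (N + 2) * Y2 t)
       - (\<i> * (zn t ^ N * Tb t) - zeta t ^ Suc N * Ib t)" unfolding I f ..
    also have "\<dots> = \<i> * (zeta t ^ N * (Yb t - (Tb t + \<i> * zn t * Ib t))) + \<i> * ((zeta t ^ N - zn t ^ N) * Tb t)
     + Ib t * (zeta t ^ N * (zeta t - zn t)) + zeta t ^ Suc N * Y1 t + Y2 t * zeta t ^ (N + 2)"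
      by (simp add: algebra_simps)
    finally show "\<i> * (zeta t ^ N * (Yb t - (Tb t + \<i> * zn t * Ib t))) + \<i> * ((zeta t ^ N - zn t ^ N) * Tb t)
     + Ib t * (zeta t ^ N * (zeta t - zn t)) + zeta t ^ Suc N * Y1 t + Y2 t * zeta t ^ (N + 2) =
      Ires t - (\<i> * fc t - zeta t ^ Suc N * Ib t)" ..
  qed
qed

lemma fc_O: "BO (\<lambda>t _. fc t) (\<lambda>t. ep t ^ N * \<theta> t)"
proof -
  obtain K where K: "K \<ge> 1" "\<And>t. t \<in> T \<Longrightarrow> K \<le> norm (z t) \<Longrightarrow> nu t \<noteq> 0" using nu_nz by blast
  have znk: "BO (\<lambda>t x. zn t ^ k) (\<lambda>t. ep t ^ k)" for k
  proof (induction k)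
    case 0
    show ?case by (simp add: unif_O_const)
  next
    case (Suc k)
    then show ?case using unif_O_mult[OF zn_O Suc] by simp
  qed
  from unif_O_mult[OF znk[of N] Tb_O] show ?thesis
  proof (rule unif_O_cong_eventually)
    fix t assume t: "t \<in> T" "K \<le> norm (z t)"
    have "zn t ^ N * Tb t = (zn t * (2 * \<i> * nu t)) ^ N * fc t"
      unfolding Tb_fc[OF t(1)] by (simp add: power_mult_distrib)
    also have "zn t * (2 * \<i> * nu t) = 1" using K(2)[OF t] by (simp add: zn_def)
    finally show "zn t ^ N * Tb t = fc t" by simp
  qed
qed

lemma O_Suc_\<theta>: "BO f (\<lambda>t. ep t ^ Suc k * \<theta> t) \<Longrightarrow> BO f (\<lambda>t. ep t ^ k * \<theta> t)"
  by (rule unif_O_weaken[of _ _ _ _ 1])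
    (auto intro!: mult_right_mono mult_left_le_one_le inv_size_le_1 zero_le_power inv_size_nonneg less_imp_le[OF \<theta>_pos])

lemma Ires_O': "BO (\<lambda>t _. Ires t) (\<lambda>t. ep t ^ N * \<theta> t)"
proof -
  have "BO (\<lambda>t _. Ib t * zeta t ^ Suc N) (\<lambda>t. ep t ^ Suc N)"
    by (rule ep_power_O_mult[OF Ib_O order_refl])
  then have "BO (\<lambda>t _. Ib t * zeta t ^ Suc N) (\<lambda>t. ep t ^ N * \<theta> t)" by (rule O_ep_\<theta>)
  from unif_O_add[OF O_Suc_\<theta>[OF Ires_O] unif_O_diff[OF unif_O_cmult[OF fc_O, of \<i>] this]]
  show ?thesis by (simp add: mult.commute)
qed

lemma Jq_Ires: "BO (\<lambda>t _. Jq t - Ires t) (\<lambda>t. ep t ^ Suc N * \<theta> t)"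
proof -
  have "BO (\<lambda>t _. inverse (1 - sig t 0) - 1) ep" by (rule unif_O_inverse(1)[OF sig0_O])
  from unif_O_mult[OF this Ires_O'] show ?thesis by (simp add: Jq_def algebra_simps)
qed

theorem Jq_O: "BO (\<lambda>t _. Jq t) (\<lambda>t. ep t ^ N * \<theta> t)"
  using unif_O_add[OF O_Suc_\<theta>[OF Jq_Ires] Ires_O'] by simp

text \<open>
  At an eigenvalue \<open>U 1 = V 1\<close>, and \<open>\<sigma>\<close> is periodic, so \<open>1 - \<sigma> 0\<close> can be divided out of the WKB identity.
\<close>

theorem E_V_Jq: "\<exists>K. \<forall>t\<in>T. K \<le> norm (z t) \<longrightarrow> E t 1 * V t 1 = 1 - Jq t"
proof -
  obtain K where K: "K \<ge> 1" "\<And>t x. t \<in> T \<Longrightarrow> K \<le> norm (z t) \<Longrightarrow> x \<in> {0..1::real} \<Longrightarrow> norm (sig t 0) \<le> 1 / 2"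
    using unif_O_inverse(2)[OF sig0_O] by blast
  show ?thesis
  proof (intro exI[of _ K] ballI impI)
    fix t assume t: "t \<in> T" "K \<le> norm (z t)"
    have "norm (sig t 0) \<le> 1 / 2" using K(2)[OF t, of 0] by simp
    then have nz: "1 - sig t 0 \<noteq> 0" by auto
    have "E t 1 * (V t 1 - sig t 1 * U t 1) = 1 - sig t 0 - Ires t"
      unfolding Ires_def by (rule wkb_identity[OF t(1)]) (use t K(1) in auto)
    then have "E t 1 * V t 1 * (1 - sig t 0) = (1 - sig t 0) - Ires t"
      unfolding bdry[OF t(1)] sig_periodic[OF t(1)] by (simp add: algebra_simps)
    then have "E t 1 * V t 1 = ((1 - sig t 0) - Ires t) / (1 - sig t 0)"
      using nz by (simp only: nonzero_eq_divide_eq not_False_eq_True)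
    also have "\<dots> = 1 - Ires t / (1 - sig t 0)" using nz by (simp add: diff_divide_distrib)
    finally show "E t 1 * V t 1 = 1 - Jq t" by (simp only: Jq_def divide_inverse)
  qed
qed

text \<open>
  The integral of \<open>p\<close> times the \<open>N\<close>-th derivative of \<open>q\<close>, which \<open>refined_integral\<close> leaves at the order \<open>N + 1\<close>, is exactly what the phase
  lacks because \<open>sig\<close> ends with \<open>m\<^sub>N\<close> instead of \<open>s\<^sub>N\<close>.
\<close>

lemma Bf_Sser:
  assumes t: "t \<in> T"
  shows "\<i> * Bf t 1 - zeta t ^ Suc N * Ib t = \<i> * Sser t"
proof -
  have c: "(\<lambda>x. a t 0 x * cs k t x) integrable_on {0..1}" if "k < N" for k
    by (intro integrable_continuous_real continuous_intros ab_cont cont_coeffs t that) (use N in simp)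
  have c': "(\<lambda>x. a t 0 x * cm N t x) integrable_on {0..1}"
    by (intro integrable_continuous_real continuous_intros ab_cont cont_coeffs t) (use N in auto)
  have cb: "(\<lambda>x. b t N x * a t 0 x) integrable_on {0..1}"
    by (intro absolutely_integrableD(1) absolutely_integrable_mult_continuous' ab_cont t sobolev_jet_top(1)[OF jet_b]) (use N in simp)
  have "Bf t 1 = integral {0..1} (\<lambda>x. (\<Sum>k<N. zeta t ^ Suc k * (a t 0 x * cs k t x)) + zeta t ^ Suc N * (a t 0 x * cm N t x))"
    unfolding Bf_def by (rule integral_cong) (simp add: sig_def distrib_left sum_distrib_left mult_ac)
  also have "\<dots> = integral {0..1} (\<lambda>x. \<Sum>k<N. zeta t ^ Suc k * (a t 0 x * cs k t x)) + integral {0..1} (\<lambda>x. zeta t ^ Suc N * (a t 0 x * cm N t x))"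
    by (rule integral_add) (intro integrable_sum integrable_on_mult_right c c'; simp)+
  also have "integral {0..1} (\<lambda>x. \<Sum>k<N. zeta t ^ Suc k * (a t 0 x * cs k t x)) = (\<Sum>k<N. integral {0..1} (\<lambda>x. zeta t ^ Suc k * (a t 0 x * cs k t x)))"
    by (rule integral_sum) (intro finite_lessThan integrable_on_mult_right c; simp)+
  finally have B: "Bf t 1 = (\<Sum>k<N. zeta t ^ Suc k * integral {0..1} (\<lambda>x. a t 0 x * cs k t x)) + zeta t ^ Suc N * integral {0..1} (\<lambda>x. a t 0 x * cm N t x)"
    by (simp only: integral_mult_right)
  have "integral {0..1} (\<lambda>x. a t 0 x * cs N t x) = integral {0..1} (\<lambda>x. \<i> * (b t N x * a t 0 x) + a t 0 x * cm N t x)"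
    by (rule integral_cong) (simp add: cs_def cm_def dval_ric_s algebra_simps)
  also have "\<dots> = \<i> * Ib t + integral {0..1} (\<lambda>x. a t 0 x * cm N t x)"
    unfolding Ib_def integral_mult_right[symmetric] by (rule integral_add) (intro integrable_on_mult_right cb c')+
  finally have "integral {0..1} (\<lambda>x. a t 0 x * cs N t x) = \<i> * Ib t + integral {0..1} (\<lambda>x. a t 0 x * cm N t x)" .
  then have "Sser t = Bf t 1 + zeta t ^ Suc N * (\<i> * Ib t)"
    unfolding Sser_def B lessThan_Suc_atMost[symmetric] by (simp add: algebra_simps)
  then show ?thesis by (simp add: algebra_simps)
qed

theorem one_sided_expansion:
  "BO (\<lambda>t _. \<i> * Bf t 1 + Jq t - (\<i> * Sser t + \<i> * fc t)) (\<lambda>t. ep t ^ Suc N * \<theta> t)"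
  using unif_O_add[OF Jq_Ires Ires_O]
  by (rule unif_O_cong) (simp add: Bf_Sser[symmetric] algebra_simps)

end

section \<open>Two-sided asymptotics of eigenvalues\<close>

lemma norm_exp_taylor2:
  assumes "norm (w::complex) \<le> 1 / 4"
  shows "norm (exp w - 1 - w) \<le> 2 * (norm w)\<^sup>2" "norm w \<le> 2 * norm (exp w - 1)"
proof -
  have "norm (exp w - (\<Sum>k\<le>1. w ^ k / fact k)) \<le> exp \<bar>Re w\<bar> * norm w ^ Suc 1 / fact 1"
    by (rule Taylor_exp)
  then have 1: "norm (exp w - 1 - w) \<le> exp \<bar>Re w\<bar> * (norm w)\<^sup>2"
    by (simp add: power2_eq_square diff_diff_eq)
  have "\<bar>Re w\<bar> \<le> 1 / 2" using abs_Re_le_cmod[of w] assms by linarith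
  then have "exp \<bar>Re w\<bar> \<le> exp (1 / 2)" by simp
  also have "exp (1 / 2 :: real) \<le> 2"
    using exp_bound_half[of "1 / 2 :: real"] by simp
  finally have e: "exp \<bar>Re w\<bar> \<le> 2" .
  then show 2: "norm (exp w - 1 - w) \<le> 2 * (norm w)\<^sup>2"
    using 1 mult_right_mono[OF e, of "(norm w)\<^sup>2"] by simp
  have "2 * (norm w)\<^sup>2 \<le> norm w / 2"
    using mult_right_mono[OF assms, of "norm w"] by (simp add: power2_eq_square)
  then have "norm (exp w - 1 - w) \<le> norm w / 2" using 2 by linarith
  moreover have "norm w \<le> norm (exp w - 1) + norm (exp w - 1 - w)"
    using norm_triangle_ineq4[of "exp w - 1" "exp w - 1 - w"] by simp
  ultimately show "norm w \<le> 2 * norm (exp w - 1)" by linarith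
qed

text \<open>
  The family together with its mirror image, in which \<open>z\<close> and \<open>n\<close> change sign and the two components swap roles.
\<close>

locale zs_pair =
  dir: zs_eigen N R T a b z U V n \<theta> \<Theta> +
  mir: zs_eigen N R T "\<lambda>t j x. - b t j x" "\<lambda>t j x. - a t j x" "\<lambda>t. - z t" V U "\<lambda>t. - n t" \<theta> \<Theta>
  for N R and T :: "'t set" and a b z U V n \<theta> \<Theta>
begin

abbreviation "BO \<equiv> unif_O T z"
abbreviation "ep \<equiv> inv_size z"

lemma mir_O: "unif_O T (\<lambda>t. - z t) f g = BO f g"
  by (rule unif_O_uminus_param)

lemma mir_E_U_Jq: "\<exists>K. \<forall>t\<in>T. K \<le> norm (z t) \<longrightarrow> mir.E t 1 * U t 1 = 1 - mir.Jq t"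
  using mir.E_V_Jq by simp

lemma mir_Jq_O: "BO (\<lambda>t _. mir.Jq t) (\<lambda>t. ep t ^ N * \<theta> t)"
  using mir.Jq_O unfolding mir_O inv_size_uminus .

lemma mir_Bf_O: "BO (\<lambda>t _. mir.Bf t 1) ep"
  using unif_O_at[OF mir.Bf_O, of 1] unfolding mir_O inv_size_uminus by simp

lemma mir_expansion:
  "BO (\<lambda>t _. \<i> * mir.Bf t 1 + mir.Jq t - (\<i> * mir.Sser t + \<i> * mir.fc t)) (\<lambda>t. ep t ^ Suc N * \<theta> t)"
  using mir.one_sided_expansion unfolding mir_O inv_size_uminus .

definition "ww t = - 2 * \<i> * (z t - dir.nu t) + \<i> * dir.Bf t 1 - \<i> * mir.Bf t 1"

lemma ww_ep: "BO (\<lambda>t _. ww t) ep"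
proof -
  have "BO (\<lambda>t _. (- 2 * \<i>) * (z t - dir.nu t) + \<i> * dir.Bf t 1 - \<i> * mir.Bf t 1) ep"
    by (intro unif_O_add unif_O_diff unif_O_cmult dir.near' unif_O_at[OF dir.Bf_O] mir_Bf_O) auto
  then show ?thesis by (simp add: ww_def)
qed

lemma exp_ww: "\<exists>K. \<forall>t\<in>T. K \<le> norm (z t) \<longrightarrow> (1 - mir.Jq t) * exp (ww t) = 1 - dir.Jq t"
proof -
  obtain K1 where K1: "\<And>t. t \<in> T \<Longrightarrow> K1 \<le> norm (z t) \<Longrightarrow> dir.E t 1 * V t 1 = 1 - dir.Jq t"
    using dir.E_V_Jq by blast
  obtain K2 where K2: "\<And>t. t \<in> T \<Longrightarrow> K2 \<le> norm (z t) \<Longrightarrow> mir.E t 1 * U t 1 = 1 - mir.Jq t"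
    using mir_E_U_Jq by blast
  show ?thesis
  proof (intro exI[of _ "max K1 K2"] ballI impI)
    fix t assume t: "t \<in> T" "max K1 K2 \<le> norm (z t)"
    have "exp (2 * \<i> * dir.nu t) = osc (n t) 1" by (simp add: osc_def dir.nu_def mult_ac)
    then have o: "exp (2 * \<i> * dir.nu t) = 1" by (simp add: osc_1)
    have "ww t + (\<i> * z t + \<i> * mir.Bf t 1) = 2 * \<i> * dir.nu t + (- \<i> * z t + \<i> * dir.Bf t 1)"
      by (simp add: ww_def algebra_simps)
    then have "exp (ww t) * exp (\<i> * z t + \<i> * mir.Bf t 1) = exp (2 * \<i> * dir.nu t) * exp (- \<i> * z t + \<i> * dir.Bf t 1)"
      unfolding mult_exp_exp by (rule arg_cong[where f = exp])
    then have e: "exp (ww t) * mir.E t 1 = dir.E t 1"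
      unfolding dir.E_def mir.E_def o by simp
    have "(1 - mir.Jq t) * exp (ww t) = (exp (ww t) * mir.E t 1) * U t 1"
      using K2[of t] t by (simp add: mult_ac)
    also have "\<dots> = dir.E t 1 * V t 1" unfolding e dir.bdry[OF t(1)] ..
    also have "\<dots> = 1 - dir.Jq t" using K1[of t] t by simp
    finally show "(1 - mir.Jq t) * exp (ww t) = 1 - dir.Jq t" .
  qed
qed

lemma \<theta>_ep_1: "BO f (\<lambda>t. ep t ^ N * \<theta> t) \<Longrightarrow> BO f ep"
proof (rule unif_O_weaken[of _ _ _ _ "max \<Theta> 0"])
  fix t assume t: "t \<in> T" "1 \<le> norm (z t)"
  have "ep t ^ N * \<theta> t \<le> ep t ^ 1 * max \<Theta> 0"
  proof (rule mult_mono)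
    show "ep t ^ N \<le> ep t ^ 1"
      by (rule power_decreasing[OF dir.N inv_size_nonneg inv_size_le_1]) (rule t)
    show "\<theta> t \<le> max \<Theta> 0" using dir.\<theta>_bdd[OF t(1)] by simp
  qed (use inv_size_nonneg[of z t] less_imp_le[OF dir.\<theta>_pos[OF t]] in auto)
  then show "ep t ^ N * \<theta> t \<le> max \<Theta> 0 * ep t" by (simp add: mult.commute)
qed simp_all

text \<open>
  The number \<open>ww\<close> is the logarithm of a quotient of two numbers \<open>1 - J\<close> close to 1. Its square is negligible: it is
  of order \<open>\<theta> / \<bar>z\<bar> ^ N\<close> and also of order \<open>1 / \<bar>z\<bar>\<close>.
\<close>

lemma ww_J: "BO (\<lambda>t _. ww t - (mir.Jq t - dir.Jq t)) (\<lambda>t. ep t ^ Suc N * \<theta> t)"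
proof -
  define D where "D t = exp (ww t) - 1" for t
  obtain K where K: "\<And>t. t \<in> T \<Longrightarrow> K \<le> norm (z t) \<Longrightarrow> (1 - mir.Jq t) * exp (ww t) = 1 - dir.Jq t"
    using exp_ww by blast
  have jm: "BO (\<lambda>t _. mir.Jq t) ep" by (rule \<theta>_ep_1[OF mir_Jq_O])
  obtain K2 where K2: "K2 \<ge> 1" "\<And>t x. t \<in> T \<Longrightarrow> K2 \<le> norm (z t) \<Longrightarrow> x \<in> {0..1::real} \<Longrightarrow> norm (mir.Jq t) \<le> 1 / 2"
    using unif_O_inverse(2)[OF jm] by blast
  have jd: "BO (\<lambda>t _. mir.Jq t - dir.Jq t) (\<lambda>t. ep t ^ N * \<theta> t)"
    by (rule unif_O_diff[OF mir_Jq_O dir.Jq_O])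
  have inv: "BO (\<lambda>t _. inverse (1 - mir.Jq t)) (\<lambda>t. 1)"
    by (rule dir.O_1_of_minus_1[OF unif_O_inverse(1)[OF jm]])
  have D1: "D t = inverse (1 - mir.Jq t) * (mir.Jq t - dir.Jq t)"
    if t: "t \<in> T" "max K K2 \<le> norm (z t)" for t
  proof -
    have "norm (mir.Jq t) \<le> 1 / 2" using K2(2)[of t 0] t by simp
    then have nz: "1 - mir.Jq t \<noteq> 0" by auto
    have "(1 - mir.Jq t) * D t = mir.Jq t - dir.Jq t"
      unfolding D_def right_diff_distrib using K[of t] t by simp
    then show ?thesis using nz by (simp add: field_simps)
  qed
  have DO: "BO (\<lambda>t _. D t) (\<lambda>t. ep t ^ N * \<theta> t)"
    using unif_O_mult1[OF inv jd] by (rule unif_O_cong_eventually[where K = "max K K2"]) (rule D1[symmetric])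
  have JD: "BO (\<lambda>t _. mir.Jq t * D t) (\<lambda>t. ep t ^ Suc N * \<theta> t)"
    using unif_O_mult[OF jm DO] by (simp add: mult_ac)
  obtain Cw Kw where Cw: "Cw \<ge> 0" "Kw \<ge> 1" and
    w1: "\<And>t x. t \<in> T \<Longrightarrow> Kw \<le> norm (z t) \<Longrightarrow> x \<in> {0..1::real} \<Longrightarrow> norm (ww t) \<le> Cw * ep t"
    using unif_OE[OF ww_ep] by metis
  define K3 where "K3 = max Kw (4 * Cw)"
  have quarter: "norm (ww t) \<le> 1 / 4" if t: "t \<in> T" "K3 \<le> norm (z t)" for t
  proof -
    have "norm (z t) > 0" "4 * Cw \<le> norm (z t)" using t Cw(2) by (auto simp: K3_def)
    then have "Cw * ep t \<le> 1 / 4" by (simp add: inv_size_def field_simps)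
    moreover have "norm (ww t) \<le> Cw * ep t" using w1[of t 0] t by (simp add: K3_def)
    ultimately show ?thesis by linarith
  qed
  obtain CD KD where CD: "CD \<ge> 0" "KD \<ge> 1" and
    d1: "\<And>t x. t \<in> T \<Longrightarrow> KD \<le> norm (z t) \<Longrightarrow> x \<in> {0..1::real} \<Longrightarrow> norm (D t) \<le> CD * (ep t ^ N * \<theta> t)"
    using unif_OE[OF DO] by metis
  have quad: "BO (\<lambda>t _. D t - ww t) (\<lambda>t. ep t ^ Suc N * \<theta> t)"
  proof (rule unif_OI[of "4 * Cw * CD" _ "max K3 (max Kw KD)"])
    fix t assume t: "t \<in> T" "max K3 (max Kw KD) \<le> norm (z t)"
    have q: "norm (ww t) \<le> 1 / 4" using quarter t by simp
    have "norm (D t - ww t) \<le> 2 * (norm (ww t))\<^sup>2"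
      using norm_exp_taylor2(1)[OF q] by (simp add: D_def)
    also have "\<dots> = 2 * (norm (ww t) * norm (ww t))" by (simp add: power2_eq_square)
    also have "\<dots> \<le> 2 * ((Cw * ep t) * (2 * (CD * (ep t ^ N * \<theta> t))))"
    proof (intro mult_left_mono mult_mono)
      show "norm (ww t) \<le> Cw * ep t" using w1[of t 0] t by simp
      show "norm (ww t) \<le> 2 * (CD * (ep t ^ N * \<theta> t))"
        using norm_exp_taylor2(2)[OF q] d1[of t 0] t by (simp add: D_def)
    qed (use Cw inv_size_nonneg[of z t] in auto)
    finally show "norm (D t - ww t) \<le> 4 * Cw * CD * (ep t ^ Suc N * \<theta> t)" by (simp add: mult_ac)
  qed (use Cw CD in auto)
  from unif_O_diff[OF JD quad] show ?thesis
  proof (rule unif_O_cong_eventually)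
    fix t assume t: "t \<in> T" "K \<le> norm (z t)"
    have "(1 - mir.Jq t) * D t = mir.Jq t - dir.Jq t"
      unfolding D_def right_diff_distrib using K[of t] t by simp
    then show "mir.Jq t * D t - (D t - ww t) = ww t - (mir.Jq t - dir.Jq t)"
      by (simp add: algebra_simps)
  qed
qed

theorem two_sided_expansion:
  "BO (\<lambda>t _. z t - dir.nu t - (dir.Sser t - mir.Sser t + dir.fc t - mir.fc t) / 2) (\<lambda>t. ep t ^ Suc N * \<theta> t)"
proof -
  have "BO (\<lambda>t _. (\<i> / 2) * ((ww t - (mir.Jq t - dir.Jq t))
      - (\<i> * dir.Bf t 1 + dir.Jq t - (\<i> * dir.Sser t + \<i> * dir.fc t))
      + (\<i> * mir.Bf t 1 + mir.Jq t - (\<i> * mir.Sser t + \<i> * mir.fc t)))) (\<lambda>t. ep t ^ Suc N * \<theta> t)"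
    by (intro unif_O_cmult unif_O_add unif_O_diff ww_J dir.one_sided_expansion mir_expansion)
  then show ?thesis
    by (rule unif_O_cong) (simp add: ww_def field_simps)
qed

end

section \<open>Location of the eigenvalues\<close>

abbreviation fundU where "fundU p q z \<equiv> fst (zs_fund p q z)"
abbreviation fundV where "fundV p q z \<equiv> snd (zs_fund p q z)"

definition dir_eigenvalue :: "(cfn) \<Rightarrow> (cfn) \<Rightarrow> complex \<Rightarrow> bool" where
  "dir_eigenvalue p q z \<longleftrightarrow> fundU p q z 1 = fundV p q z 1"

lemma sobolev_jet_0:
  assumes "sobolev_jet N M a" "N \<ge> 1"
  shows "continuous_on {0..1} (a 0)" "x \<in> {0..1} \<Longrightarrow> norm (a 0 x) \<le> M" "a 0 1 = a 0 0"
proof -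
  have 0: "0 < N" using assms(2) by simp
  show "continuous_on {0..1} (a 0)" "x \<in> {0..1} \<Longrightarrow> norm (a 0 x) \<le> M" "a 0 1 = a 0 0"
    by (rule sobolev_jetD[OF assms(1) 0], assumption?)+
qed

lemma dir_eigenvalue_Im:
  assumes "sobolev_jet N M a" "sobolev_jet N M b" "N \<ge> 1" "dir_eigenvalue (a 0) (b 0) z"
  shows "\<bar>Im z\<bar> \<le> M"
proof -
  note f = zs_fund[OF sobolev_jet_0(1)[OF assms(1,3)] sobolev_jet_0(1)[OF assms(2,3)], of z]
  show ?thesis
    by (rule zs_eigenvalue_Im_bound[OF f assms(4)[unfolded dir_eigenvalue_def]])
      (rule sobolev_jet_0(2)[OF assms(1,3)] sobolev_jet_0(2)[OF assms(2,3)], assumption)+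
qed

lemma crude_uniform:
  assumes N: "N \<ge> 1"
  obtains C K where "C \<ge> 0" "K \<ge> 1"
    "\<And>a b z x. sobolev_jet N M a \<Longrightarrow> sobolev_jet N M b \<Longrightarrow> \<bar>Im z\<bar> \<le> M \<Longrightarrow> K \<le> norm z \<Longrightarrow> x \<in> {0..1} \<Longrightarrow>
       norm (exp (- \<i> * z * of_real x) * fundV (a 0) (b 0) z x - 1) \<le> C / norm z \<and>
       norm (exp (\<i> * z * of_real x) * fundU (a 0) (b 0) z x - 1) \<le> C / norm z"
proof -
  define T :: "((nat \<Rightarrow> cfn) \<times> (nat \<Rightarrow> cfn) \<times> complex) set"
    where "T = {(a, b, z). sobolev_jet N M a \<and> sobolev_jet N M b \<and> \<bar>Im z\<bar> \<le> M}"
  define a b z where "a t = fst t" and "b t = fst (snd t)" and "z t = snd (snd t)"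
    for t :: "(nat \<Rightarrow> cfn) \<times> (nat \<Rightarrow> cfn) \<times> complex"
  define U V where "U t = fundU (a t 0) (b t 0) (z t)" and "V t = fundV (a t 0) (b t 0) (z t)" for t
  have T: "sobolev_jet N M (a t)" "sobolev_jet N M (b t)" "\<bar>Im (z t)\<bar> \<le> M" if "t \<in> T" for t
    using that by (auto simp: T_def a_def b_def z_def)
  have F: "zs_sol (a t 0) (b t 0) (z t) (U t) (V t)" "U t 0 = 1" "V t 0 = 1" if "t \<in> T" for t
    unfolding U_def V_def
    by (rule zs_fund[OF sobolev_jet_0(1)[OF T(1)[OF that] N] sobolev_jet_0(1)[OF T(2)[OF that] N]])+
  interpret dir: zs_family N M T a b z U V
    by unfold_locales (use N T F in auto)
  interpret mir: zs_family N M T "\<lambda>t j x. - b t j x" "\<lambda>t j x. - a t j x" "\<lambda>t. - z t" V U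
    by unfold_locales (use N T F zs_sol_mirror sobolev_jet_minus in auto)
  have d: "unif_O T z (\<lambda>t x. exp (- \<i> * z t * of_real x) * V t x - 1) (inv_size z)"
    by (rule dir.crude_asymptotics)
  have m: "unif_O T z (\<lambda>t x. exp (\<i> * z t * of_real x) * U t x - 1) (inv_size z)"
    using mir.crude_asymptotics unfolding unif_O_uminus_param inv_size_uminus by simp
  obtain C1 K1 where 1: "C1 \<ge> 0" "K1 \<ge> 1" "\<And>t x. t \<in> T \<Longrightarrow> K1 \<le> norm (z t) \<Longrightarrow> x \<in> {0..1} \<Longrightarrow>
      norm (exp (- \<i> * z t * of_real x) * V t x - 1) \<le> C1 * inv_size z t"
    using unif_OE[OF d] by metis
  obtain C2 K2 where 2: "C2 \<ge> 0" "K2 \<ge> 1" "\<And>t x. t \<in> T \<Longrightarrow> K2 \<le> norm (z t) \<Longrightarrow> x \<in> {0..1} \<Longrightarrow>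
      norm (exp (\<i> * z t * of_real x) * U t x - 1) \<le> C2 * inv_size z t"
    using unif_OE[OF m] by metis
  show ?thesis
  proof (rule that[of "max C1 C2" "max K1 K2"])
    fix \<alpha> \<beta> w x assume h: "sobolev_jet N M \<alpha>" "sobolev_jet N M \<beta>" "\<bar>Im w\<bar> \<le> M" "max K1 K2 \<le> norm w" "x \<in> {0..1::real}"
    have t: "(\<alpha>, \<beta>, w) \<in> T" using h by (simp add: T_def)
    have "norm (exp (- \<i> * w * of_real x) * fundV (\<alpha> 0) (\<beta> 0) w x - 1) \<le> C1 / norm w"
      using 1(3)[OF t _ h(5)] h(4) by (simp add: U_def V_def a_def b_def z_def inv_size_def)
    moreover have "norm (exp (\<i> * w * of_real x) * fundU (\<alpha> 0) (\<beta> 0) w x - 1) \<le> C2 / norm w"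
      using 2(3)[OF t _ h(5)] h(4) by (simp add: U_def V_def a_def b_def z_def inv_size_def)
    moreover have "C1 / norm w \<le> max C1 C2 / norm w" "C2 / norm w \<le> max C1 C2 / norm w"
      by (intro divide_right_mono; simp)+
    ultimately show "norm (exp (- \<i> * w * of_real x) * fundV (\<alpha> 0) (\<beta> 0) w x - 1) \<le> max C1 C2 / norm w \<and>
       norm (exp (\<i> * w * of_real x) * fundU (\<alpha> 0) (\<beta> 0) w x - 1) \<le> max C1 C2 / norm w"
      by linarith
  qed (use 1 2 in auto)
qed

lemma exp_near_1_imp:
  assumes "norm (exp (2 * \<i> * z) - 1) < 1 / 2"
  obtains m :: int where "norm (z - npi m) \<le> norm (exp (2 * \<i> * z) - 1)"
proof -
  define x where "x = exp (2 * \<i> * z) - 1"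
  have "1 + x \<noteq> 0" by (simp add: x_def)
  then have "exp (2 * \<i> * z) = exp (Ln (1 + x))" by (simp add: x_def)
  then obtain m :: int where "2 * \<i> * z = Ln (1 + x) + of_real (of_int (2 * m) * pi) * \<i>"
    unfolding exp_eq by blast
  then have m: "2 * \<i> * z = Ln (1 + x) + npi (2 * m) * \<i>" by simp
  have e: "2 * \<i> * (z - npi m) = Ln (1 + x)" using m by (simp add: algebra_simps)
  have "2 * norm (z - npi m) = norm (Ln (1 + x))"
    unfolding e[symmetric] norm_mult by simp
  also have "\<dots> \<le> 2 * norm x" by (rule norm_Ln_le) (use assms in \<open>simp add: x_def\<close>)
  finally show ?thesis using that[of m] by (simp add: x_def)
qed

lemma integral_near_1_nonzero:
  fixes f :: cfn
  assumes "continuous_on {0..1} f" "\<And>x. x \<in> {0..1} \<Longrightarrow> norm (f x - 1) \<le> 1 / 2"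
  shows "integral {0..1} f \<noteq> 0"
proof
  assume 0: "integral {0..1} f = 0"
  have "norm (integral {0..1} (\<lambda>x. f x - 1)) \<le> integral {0..1} (\<lambda>x::real. 1 / 2)"
    by (rule integral_norm_bound_integral)
      (use assms in \<open>auto intro!: integrable_continuous_real continuous_intros\<close>)
  moreover have "integral {0..1} (\<lambda>x. f x - 1) = integral {0..1} f - integral {0..1} (\<lambda>x::real. 1::complex)"
    by (rule HK_integral_diff)
      (use assms in \<open>auto intro!: integrable_continuous_real continuous_intros\<close>)
  ultimately show False using 0 by simp
qed

lemma norm_mult_near_1:
  fixes f g :: complex
  assumes "norm (f - 1) \<le> d" "norm (g - 1) \<le> d'"
  shows "norm (f * g - 1) \<le> d + d' + d * d'"
proof -
  have "f * g - 1 = (f - 1) + (g - 1) + (f - 1) * (g - 1)" by (simp add: algebra_simps)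
  also have "norm \<dots> \<le> norm (f - 1) + norm (g - 1) + norm (f - 1) * norm (g - 1)"
    by (intro norm_triangle_mono order_refl) (simp add: norm_mult)
  also have "\<dots> \<le> d + d' + d * d'"
    using assms by (intro add_mono mult_mono') auto
  finally show ?thesis .
qed

lemma norm_near_multiple_pi:
  fixes z :: complex
  assumes "norm (z - npi m) \<le> 1 / 8" "m \<noteq> 0"
  shows "\<bar>real_of_int m\<bar> \<le> norm z"
proof -
  have m: "\<bar>real_of_int m\<bar> \<ge> 1" using assms(2) by linarith
  have "norm (npi m) = \<bar>real_of_int m\<bar> * pi" by (simp add: norm_mult)
  moreover have "\<bar>real_of_int m\<bar> * pi \<ge> \<bar>real_of_int m\<bar> * 2" using pi_ge_two by (intro mult_left_mono) auto
  moreover have "norm (npi m) \<le> norm z + norm (z - npi m)"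
    using norm_triangle_ineq4[of z "z - npi m"] by simp
  ultimately show ?thesis using assms m by linarith
qed

text \<open>
  (1) The boundary condition and the crude asymptotics force \<open>exp (2 i z)\<close> to be near 1. (2), (3) For nearby \<open>z\<close>,
  \<open>w\<close> the products \<open>U(z) V(w)\<close> are near 1, so the bilinear form does not vanish on the eigenfunctions; for distinct
  eigenvalues it would have to. (4) The characteristic function \<open>U 1 - V 1\<close>, times \<open>exp (i z)\<close>, is close to
  \<open>1 - exp (2 i z)\<close>, with slope \<open>- 2 i\<close> at \<open>m \<pi>\<close>. The corresponding Newton step is a continuous self-map of
  a disc, so Brouwer's theorem gives a zero without recourse to analyticity in \<open>z\<close>.
\<close>

theorem spectral_picture:
  assumes N: "N \<ge> 1" and M: "M \<ge> 1"
  obtains C K where "C \<ge> 0" "K \<ge> 1"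
    "\<And>a b z. sobolev_jet N M a \<Longrightarrow> sobolev_jet N M b \<Longrightarrow> dir_eigenvalue (a 0) (b 0) z \<Longrightarrow> K \<le> norm z \<Longrightarrow>
       \<exists>m::int. norm (z - npi m) \<le> C / norm z \<and> norm (z - npi m) \<le> 1 / 16"
    "\<And>a b z. sobolev_jet N M a \<Longrightarrow> sobolev_jet N M b \<Longrightarrow> dir_eigenvalue (a 0) (b 0) z \<Longrightarrow> K \<le> norm z \<Longrightarrow>
       integral {0..1} (\<lambda>x. fundU (a 0) (b 0) z x * fundV (a 0) (b 0) z x) \<noteq> 0"
    "\<And>a b z w. sobolev_jet N M a \<Longrightarrow> sobolev_jet N M b \<Longrightarrow> dir_eigenvalue (a 0) (b 0) z \<Longrightarrow>
       dir_eigenvalue (a 0) (b 0) w \<Longrightarrow> K \<le> norm z \<Longrightarrow> K \<le> norm w \<Longrightarrow>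
       norm (z - w) \<le> 1 / 4 \<Longrightarrow> z = w"
    "\<And>a b (m::int). sobolev_jet N M a \<Longrightarrow> sobolev_jet N M b \<Longrightarrow> K \<le> \<bar>real_of_int m\<bar> \<Longrightarrow>
       \<exists>z. dir_eigenvalue (a 0) (b 0) z \<and> norm (z - npi m) \<le> 1 / 8"
proof -
  obtain C K where C: "C \<ge> 0" "K \<ge> 1" and crude:
    "\<And>a b z x. sobolev_jet N M a \<Longrightarrow> sobolev_jet N M b \<Longrightarrow> \<bar>Im z\<bar> \<le> M \<Longrightarrow> K \<le> norm z \<Longrightarrow> x \<in> {0..1} \<Longrightarrow>
       norm (exp (- \<i> * z * of_real x) * fundV (a 0) (b 0) z x - 1) \<le> C / norm z \<and>
       norm (exp (\<i> * z * of_real x) * fundU (a 0) (b 0) z x - 1) \<le> C / norm z"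
    using crude_uniform[OF N] by metis
  \<comment> \<open>Beyond \<open>K'\<close> the crude error is at most \<open>1 / 64\<close>, small enough for all estimates below.\<close>
  define K' where "K' = max K (64 * C) + 1"
  have K': "K' \<ge> 1" "K \<le> K'" using C by (auto simp: K'_def)
  have small: "C / norm z \<le> 1 / 64" if "K' \<le> norm (z::complex)" for z
  proof -
    have "norm z > 0" "64 * C \<le> norm z" using that C by (auto simp: K'_def)
    then show ?thesis by (simp add: field_simps)
  qed
  have dV: "norm (exp (- \<i> * z * of_real x) * fundV (a 0) (b 0) z x - 1) \<le> C / norm z"
    and dU: "norm (exp (\<i> * z * of_real x) * fundU (a 0) (b 0) z x - 1) \<le> C / norm z"
    if "sobolev_jet N M a" "sobolev_jet N M b" "\<bar>Im z\<bar> \<le> M" "K' \<le> norm z" "x \<in> {0..1}" for a b z x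
    using crude[OF that(1-3) _ that(5)] that(4) K'(2) by auto
  have ex: "norm (exp (2 * \<i> * z) - 1) \<le> 4 * (C / norm z)"
    if a: "sobolev_jet N M a" and b: "sobolev_jet N M b" and ev: "dir_eigenvalue (a 0) (b 0) z" and z: "K' \<le> norm z" for a b z
  proof -
    note I = dir_eigenvalue_Im[OF a b N ev]
    define v where "v = fundV (a 0) (b 0) z 1"
    have v: "norm (exp (- \<i> * z) * v - 1) \<le> C / norm z" using dV[OF a b I z, of 1] by (simp add: v_def)
    have u: "norm (exp (\<i> * z) * v - 1) \<le> C / norm z"
      using dU[OF a b I z, of 1] ev by (simp add: v_def dir_eigenvalue_def)
    have e: "exp (2 * \<i> * z) * (exp (- \<i> * z) * v) = exp (\<i> * z) * v"
      by (simp add: mult.assoc[symmetric] mult_exp_exp)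
    have "norm (1 - exp (- \<i> * z) * v) \<le> 1 / 64"
      unfolding norm_minus_commute[of 1] by (rule order_trans[OF v small[OF z]])
    then have "norm (exp (- \<i> * z) * v) \<ge> 1 / 2"
      using norm_triangle_ineq2[of 1 "exp (- \<i> * z) * v"] unfolding norm_one by linarith
    then have "norm (exp (2 * \<i> * z) - 1) * (1 / 2) \<le> norm (exp (2 * \<i> * z) - 1) * norm (exp (- \<i> * z) * v)"
      by (intro mult_left_mono) auto
    also have "\<dots> = norm ((exp (\<i> * z) * v - 1) - (exp (- \<i> * z) * v - 1))"
      unfolding norm_mult[symmetric] left_diff_distrib e by simp
    also have "\<dots> \<le> C / norm z + C / norm z" by (rule order_trans[OF norm_triangle_ineq4 add_mono[OF u v]])
    finally show ?thesis by simp
  qed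
  have 1: "\<exists>m::int. norm (z - npi m) \<le> (4 * C) / norm z \<and> norm (z - npi m) \<le> 1 / 16"
    if "sobolev_jet N M a" "sobolev_jet N M b" "dir_eigenvalue (a 0) (b 0) z" "K' \<le> norm z" for a b z
  proof -
    note e = ex[OF that] and s = small[OF that(4)]
    have "norm (exp (2 * \<i> * z) - 1) < 1 / 2" using e s by linarith
    then obtain m :: int where m: "norm (z - npi m) \<le> norm (exp (2 * \<i> * z) - 1)"
      by (rule exp_near_1_imp)
    have "norm (z - npi m) \<le> 4 * (C / norm z)" using m e by linarith
    moreover from this have "norm (z - npi m) \<le> 1 / 16" using s by linarith
    ultimately show ?thesis by (intro exI[of _ m]) simp
  qed
  have cont: "continuous_on {0..1} (fundU (a 0) (b 0) z)" "continuous_on {0..1} (fundV (a 0) (b 0) z)"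
    if "sobolev_jet N M a" "sobolev_jet N M b" for a b z
    using zs_sol_continuous[OF zs_fund(1)[OF sobolev_jet_0(1)[OF that(1) N] sobolev_jet_0(1)[OF that(2) N]]] by auto
  have near: "norm (fundU (a 0) (b 0) z x * fundV (a 0) (b 0) w x - 1) \<le> 1 / 2"
    if a: "sobolev_jet N M a" and b: "sobolev_jet N M b" and I: "\<bar>Im z\<bar> \<le> M" "\<bar>Im w\<bar> \<le> M"
      and K: "K' \<le> norm z" "K' \<le> norm w" and zw: "norm (z - w) \<le> 1 / 4" and x: "x \<in> {0..1}" for a b z w x
  proof -
    define u v where "u = exp (\<i> * z * of_real x) * fundU (a 0) (b 0) z x"
      and "v = exp (- \<i> * w * of_real x) * fundV (a 0) (b 0) w x"
    have "norm (u - 1) \<le> 1 / 64" unfolding u_def using dU[OF a b I(1) K(1) x] small[OF K(1)] by linarith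
    moreover have "norm (v - 1) \<le> 1 / 64" unfolding v_def using dV[OF a b I(2) K(2) x] small[OF K(2)] by linarith
    ultimately have uv: "norm (u * v - 1) \<le> 1 / 64 + 1 / 64 + 1 / 64 * (1 / 64)" by (rule norm_mult_near_1)
    define y where "y = \<i> * (w - z) * of_real x"
    have ny: "norm y \<le> 1 / 4" using zw x mult_mono[OF zw, of "\<bar>x\<bar>" 1]
      by (simp add: y_def norm_mult norm_minus_commute)
    have "norm (exp y - 1) \<le> norm (exp y - 1 - y) + norm y" using norm_triangle_ineq[of "exp y - 1 - y" y] by simp
    also have "\<dots> \<le> 2 * (norm y)\<^sup>2 + norm y" using norm_exp_taylor2(1)[OF ny] by simp
    also have "\<dots> \<le> 2 * (1 / 4)\<^sup>2 + 1 / 4" using ny by (intro add_mono mult_left_mono power_mono) auto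
    finally have ey: "norm (exp y - 1) \<le> 3 / 8" by (simp add: power2_eq_square)
    have "exp y * (u * v) = (exp y * exp (\<i> * z * of_real x) * exp (- \<i> * w * of_real x)) * (fundU (a 0) (b 0) z x * fundV (a 0) (b 0) w x)"
      by (simp add: u_def v_def mult_ac)
    also have "exp y * exp (\<i> * z * of_real x) * exp (- \<i> * w * of_real x) = 1"
      unfolding mult_exp_exp by (simp add: y_def algebra_simps)
    finally have "fundU (a 0) (b 0) z x * fundV (a 0) (b 0) w x = exp y * (u * v)" by simp
    then show ?thesis using norm_mult_near_1[OF ey uv] by simp
  qed
  show ?thesis
  proof (rule that[of "4 * C" K', OF _ K'(1) 1])
    fix a b z assume a: "sobolev_jet N M a" and b: "sobolev_jet N M b"
      and ev: "dir_eigenvalue (a 0) (b 0) z" and z: "K' \<le> norm z"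
    show "integral {0..1} (\<lambda>x. fundU (a 0) (b 0) z x * fundV (a 0) (b 0) z x) \<noteq> 0"
    proof (rule integral_near_1_nonzero)
      show "continuous_on {0..1} (\<lambda>x. fundU (a 0) (b 0) z x * fundV (a 0) (b 0) z x)"
        by (intro continuous_intros cont a b)
      note I = dir_eigenvalue_Im[OF a b N ev]
      show "norm (fundU (a 0) (b 0) z x * fundV (a 0) (b 0) z x - 1) \<le> 1 / 2" if "x \<in> {0..1}" for x
        by (rule near[OF a b I I z z _ that]) simp
    qed
  next
    fix a b z w assume a: "sobolev_jet N M a" and b: "sobolev_jet N M b"
      and ev: "dir_eigenvalue (a 0) (b 0) z" "dir_eigenvalue (a 0) (b 0) w" and K: "K' \<le> norm z" "K' \<le> norm w"
      and zw: "norm (z - w) \<le> 1 / 4"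
    note I = dir_eigenvalue_Im[OF a b N ev(1)] dir_eigenvalue_Im[OF a b N ev(2)]
    note p = sobolev_jet_0(1)[OF a N] and q = sobolev_jet_0(1)[OF b N]
    note Fz = zs_fund[OF p q, of z] and Fw = zs_fund[OF p q, of w]
    let ?U = "fundU (a 0) (b 0) z" and ?V = "fundV (a 0) (b 0) z" and ?X = "fundU (a 0) (b 0) w" and ?Y = "fundV (a 0) (b 0) w"
    show "z = w"
    proof (rule ccontr)
      assume ne: "z \<noteq> w"
      have "((\<lambda>x. (w - z) * (?U x * ?Y x + ?V x * ?X x) + ((\<lambda>_. 0) x * ?U x + (\<lambda>_. 0) x * ?V x)) has_integral 0) {0..1}"
        by (rule zs_wronskian[OF Fz(1)])
          (use Fz Fw ev Fw(1)[unfolded zs_sol_def] in \<open>auto simp: dir_eigenvalue_def algebra_simps\<close>)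
      then have w0: "((\<lambda>x. (w - z) * (?U x * ?Y x + ?V x * ?X x)) has_integral 0) {0..1}" by simp
      have cancel: "(1 / (2 * d)) * (d * Q) = Q / 2" if "d \<noteq> 0" for d Q :: complex using that by simp
      have e: "(1 / (2 * (w - z))) * ((w - z) * Q) = Q / 2" for Q by (rule cancel) (use ne in simp)
      have "((\<lambda>x. (?U x * ?Y x + ?V x * ?X x) / 2) has_integral 0) {0..1}"
        using has_integral_mult_right[OF w0, of "1 / (2 * (w - z))"] unfolding e by simp
      then have "integral {0..1} (\<lambda>x. (?U x * ?Y x + ?V x * ?X x) / 2) = 0" by (rule integral_unique)
      moreover have "integral {0..1} (\<lambda>x. (?U x * ?Y x + ?V x * ?X x) / 2) \<noteq> 0"
      proof (rule integral_near_1_nonzero)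
        show "continuous_on {0..1} (\<lambda>x. (?U x * ?Y x + ?V x * ?X x) / 2)"
          by (intro continuous_intros cont a b) simp
        fix x :: real assume x: "x \<in> {0..1}"
        have 1: "norm (?U x * ?Y x - 1) \<le> 1 / 2" by (rule near[OF a b I K zw x])
        have 2: "norm (?X x * ?V x - 1) \<le> 1 / 2"
          by (rule near[OF a b I(2,1) K(2,1) _ x]) (use zw in \<open>simp add: norm_minus_commute\<close>)
        have "(?U x * ?Y x + ?V x * ?X x) / 2 - 1 = ((?U x * ?Y x - 1) + (?X x * ?V x - 1)) / 2"
          by (simp add: field_simps)
        then have "norm ((?U x * ?Y x + ?V x * ?X x) / 2 - 1) = norm ((?U x * ?Y x - 1) + (?X x * ?V x - 1)) / 2"
          by (simp only: norm_divide norm_numeral)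
        also have "\<dots> \<le> (1 / 2 + 1 / 2) / 2" by (intro divide_right_mono norm_triangle_mono 1 2) simp
        finally show "norm ((?U x * ?Y x + ?V x * ?X x) / 2 - 1) \<le> 1 / 2" by simp
      qed
      ultimately show False by simp
    qed
  next
    fix a b and m :: int assume a: "sobolev_jet N M a" and b: "sobolev_jet N M b" and m: "K' \<le> \<bar>real_of_int m\<bar>"
    note p = sobolev_jet_0(1)[OF a N] and q = sobolev_jet_0(1)[OF b N]
    let ?c = "npi m :: complex"
    have big: "K' \<le> norm z" if "norm (z - ?c) \<le> 1 / 8" for z
      using norm_near_multiple_pi[OF that] m K'(1) by linarith
    \<comment> \<open>The Newton step at \<open>m \<pi>\<close>; its fixed points are the zeros of the characteristic function.\<close>
    define \<Phi> where "\<Phi> z = z + exp (\<i> * z) * (fundU (a 0) (b 0) z 1 - fundV (a 0) (b 0) z 1) / (2 * \<i>)" for z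
    have "\<exists>z\<in>cball ?c (1 / 8). \<Phi> z = z"
    proof (rule brouwer[of "cball ?c (1 / 8)" \<Phi>])
      show "continuous_on (cball ?c (1 / 8)) \<Phi>"
        unfolding \<Phi>_def by (intro continuous_intros zs_fund_continuous[OF p q] bounded_cball) simp
      show "\<Phi> \<in> cball ?c (1 / 8) \<rightarrow> cball ?c (1 / 8)"
      proof
        fix z assume "z \<in> cball ?c (1 / 8)"
        then have d: "norm (z - ?c) \<le> 1 / 8" by (simp add: dist_norm norm_minus_commute)
        note z = big[OF d]
        have "\<bar>Im z\<bar> \<le> norm (z - ?c)" using abs_Im_le_cmod[of "z - ?c"] by simp
        then have I: "\<bar>Im z\<bar> \<le> M" using d M by linarith
        define u v where "u = exp (\<i> * z) * fundU (a 0) (b 0) z 1" and "v = exp (- \<i> * z) * fundV (a 0) (b 0) z 1"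
        have u: "norm (u - 1) \<le> 1 / 64" unfolding u_def using order_trans[OF dU[OF a b I z, of 1] small[OF z]] by simp
        have v: "norm (v - 1) \<le> 1 / 64" unfolding v_def using order_trans[OF dV[OF a b I z, of 1] small[OF z]] by simp
        define y where "y = 2 * \<i> * (z - ?c)"
        have ny: "norm y \<le> 1 / 4" using d by (simp add: y_def norm_mult)
        have ey: "exp y = exp (2 * \<i> * z)"
        proof -
          have "exp (2 * \<i> * ?c) = osc m 1" by (simp add: osc_def mult_ac)
          then have o: "exp (2 * \<i> * ?c) = 1" by (simp add: osc_1)
          have "exp (2 * \<i> * z) = exp (y + 2 * \<i> * ?c)" by (simp add: y_def algebra_simps)
          then show ?thesis unfolding exp_add o by simp
        qed
        have "exp (\<i> * z) * (fundU (a 0) (b 0) z 1 - fundV (a 0) (b 0) z 1) = u - exp y * v"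
          unfolding ey u_def v_def right_diff_distrib mult.assoc[symmetric] mult_exp_exp by (simp add: algebra_simps)
        then have "\<Phi> z - ?c = (y + (u - exp y * v)) / (2 * \<i>)"
          by (simp add: \<Phi>_def y_def field_simps)
        also have "y + (u - exp y * v) = (u - 1) - exp y * (v - 1) - (exp y - 1 - y)" by (simp add: algebra_simps)
        finally have "norm (\<Phi> z - ?c) = norm ((u - 1) - exp y * (v - 1) - (exp y - 1 - y)) / 2"
          by (simp add: norm_divide norm_mult)
        also have "norm ((u - 1) - exp y * (v - 1) - (exp y - 1 - y)) \<le> norm (u - 1) + norm (exp y * (v - 1)) + norm (exp y - 1 - y)"
          by (rule order_trans[OF norm_triangle_ineq4 add_right_mono[OF norm_triangle_ineq4]])
        also have "\<dots> \<le> 1 / 64 + 2 * (1 / 64) + 2 * (1 / 4)\<^sup>2"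
        proof (intro add_mono u)
          have "norm (exp y) \<le> 2" by (rule exp_bound_half) (use ny in simp)
          then show "norm (exp y * (v - 1)) \<le> 2 * (1 / 64)" unfolding norm_mult using v by (intro mult_mono) auto
          have "2 * (norm y)\<^sup>2 \<le> 2 * (1 / 4)\<^sup>2" using ny by (intro mult_left_mono power_mono) auto
          then show "norm (exp y - 1 - y) \<le> 2 * (1 / 4)\<^sup>2" using norm_exp_taylor2(1)[OF ny] by linarith
        qed
        finally have "norm (\<Phi> z - ?c) \<le> 1 / 8" by (simp add: power2_eq_square)
        then show "\<Phi> z \<in> cball ?c (1 / 8)" by (simp add: dist_norm norm_minus_commute)
      qed
    qed auto
    then obtain z where z: "norm (z - ?c) \<le> 1 / 8" "\<Phi> z = z" by (auto simp: dist_norm norm_minus_commute)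
    then have "dir_eigenvalue (a 0) (b 0) z" by (simp add: \<Phi>_def dir_eigenvalue_def)
    with z show "\<exists>z. dir_eigenvalue (a 0) (b 0) z \<and> norm (z - ?c) \<le> 1 / 8" by blast
  qed (use C in auto)
qed

section \<open>Algebraic multiplicities\<close>

locale classical_potential =
  fixes \<phi> :: fun_pair and p q :: cfn
  assumes p: "continuous_on {0..1} p" and q: "continuous_on {0..1} q"
    and \<phi>p: "AE x in lebesgue. x \<in> {0..1} \<longrightarrow> fst \<phi> x = p x"
    and \<phi>q: "AE x in lebesgue. x \<in> {0..1} \<longrightarrow> snd \<phi> x = q x"
begin

definition "eigenfn z = ((\<lambda>x. if x \<in> {0..1} then fundU p q z x else 0), (\<lambda>x. if x \<in> {0..1} then fundV p q z x else 0))"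

lemma ZS_domain_cont:
  assumes "ZS_dirichlet \<phi> F G"
  shows "continuous_on {0..1} (fst F)" "continuous_on {0..1} (snd F)"
  using assms unfolding ZS_dirichlet_def dirichlet_domain_def H1_01_def by (auto simp: mem_Times_iff)

lemma ZS_shift_classical:
  assumes F: "continuous_on {0..1} (fst F)" "continuous_on {0..1} (snd F)"
    and G: "continuous_on {0..1} (fst G)" "continuous_on {0..1} (snd G)"
  shows "ZS_dirichlet \<phi> F (cscale z F + G) \<longleftrightarrow>
    fst F 0 = snd F 0 \<and> fst F 1 = snd F 1 \<and> (\<forall>x. x \<notin> {0..1} \<longrightarrow> fst F x = 0 \<and> snd F x = 0) \<and>
    (\<forall>x\<in>{0..1}. (fst F has_vector_derivative - \<i> * (z * fst F x + fst G x) + \<i> * p x * snd F x) (at x within {0..1}) \<and>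
       (snd F has_vector_derivative \<i> * (z * snd F x + snd G x) - \<i> * q x * fst F x) (at x within {0..1}))"
proof -
  have e: "fst (cscale z F + G) = (\<lambda>x. z * fst F x + fst G x)" "snd (cscale z F + G) = (\<lambda>x. z * snd F x + snd G x)"
    by (auto simp: cscale_def fun_eq_iff)
  have c: "continuous_on {0..1} (fst (cscale z F + G))" "continuous_on {0..1} (snd (cscale z F + G))"
    unfolding e by (intro continuous_intros F G)+
  show ?thesis using ZS_dirichlet_classical[OF p q \<phi>p \<phi>q c] unfolding e .
qed

lemma zero_fun_pair: "fst (0 :: fun_pair) = (\<lambda>x. 0)" "snd (0 :: fun_pair) = (\<lambda>x. 0)"
  by (simp_all add: zero_fun_def)

lemma zero_fun_pair_cont: "continuous_on {0..1} (fst (0 :: fun_pair))" "continuous_on {0..1} (snd (0 :: fun_pair))"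
  unfolding zero_fun_pair by simp_all

lemma ZS_kernel:
  assumes "ZS_dirichlet \<phi> F (cscale z F + 0)"
  shows "F = cscale (fst F 0) (eigenfn z)" "F \<noteq> 0 \<Longrightarrow> dir_eigenvalue p q z"
proof -
  note c = ZS_domain_cont[OF assms]
  have R: "fst F 0 = snd F 0" "fst F 1 = snd F 1" "\<And>x. x \<notin> {0..1} \<Longrightarrow> fst F x = 0 \<and> snd F x = 0"
    and sol: "zs_sol p q z (fst F) (snd F)"
    using ZS_shift_classical[OF c zero_fun_pair_cont, THEN iffD1, OF assms] unfolding zs_sol_def zero_fun_pair
    by (simp_all add: mult.assoc)
  note f = zs_fund[OF p q, of z]
  have eq: "fst F x = fst F 0 * fundU p q z x" "snd F x = fst F 0 * fundV p q z x" if "x \<in> {0..1}" for x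
  proof -
    have i: "fst F 0 = fst F 0 * fundU p q z 0" "snd F 0 = fst F 0 * fundV p q z 0"
      using f(2,3) R(1) by simp_all
    show "fst F x = fst F 0 * fundU p q z x" "snd F x = fst F 0 * fundV p q z x"
      by (rule zs_sol_unique[OF sol f(1) p q i that])+
  qed
  show 1: "F = cscale (fst F 0) (eigenfn z)"
  proof (intro prod_eqI ext)
    fix x
    show "fst F x = fst (cscale (fst F 0) (eigenfn z)) x"
      using eq(1)[of x] R(3)[of x] unfolding cscale_def eigenfn_def fst_conv by (cases "x \<in> {0..1}") simp_all
    show "snd F x = snd (cscale (fst F 0) (eigenfn z)) x"
      using eq(2)[of x] R(3)[of x] unfolding cscale_def eigenfn_def fst_conv snd_conv by (cases "x \<in> {0..1}") simp_all
  qed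
  show "dir_eigenvalue p q z" if "F \<noteq> 0"
  proof -
    have "fst F 0 \<noteq> 0"
    proof
      assume "fst F 0 = 0"
      then have "F = 0" using 1 by (auto simp: cscale_def zero_prod_def zero_fun_def)
      with that show False by simp
    qed
    then show ?thesis using R(2) eq[of 1] by (simp add: dir_eigenvalue_def)
  qed
qed

lemma alg_mult_pos_imp_eigenvalue:
  assumes "alg_mult \<phi> z \<noteq> 0"
  shows "dir_eigenvalue p q z"
proof (rule ccontr)
  assume ne: "\<not> dir_eigenvalue p q z"
  have "root_space \<phi> z k \<subseteq> {0}" for k
  proof (induction k)
    case (Suc k)
    show ?case
    proof
      fix F assume "F \<in> root_space \<phi> z (Suc k)"
      then obtain G where G: "G \<in> root_space \<phi> z k" "ZS_dirichlet \<phi> F (cscale z F + G)" by auto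
      with Suc have "G = 0" by blast
      with G(2) have "ZS_dirichlet \<phi> F (cscale z F + 0)" by simp
      from ZS_kernel(2)[OF this] ne show "F \<in> {0}" by blast
    qed
  qed simp
  then have "(\<Union>k. root_space \<phi> z k) \<subseteq> cfun.span {}" by (auto simp: cfun.span_empty)
  then have "alg_mult \<phi> z \<le> card ({} :: fun_pair set)"
    unfolding alg_mult_def by (rule cfun.dim_le_card) simp
  with assms show False by simp
qed

text \<open>
  If \<open>(L - z) H = c F\<close> with the eigenfunction \<open>F\<close>, then the symmetry of \<open>L\<close> gives \<open>2 c \<integral> U V = 0\<close>. So there are no
  generalised eigenvectors beyond the multiples of \<open>F\<close>.
\<close>

lemma alg_mult_eq_1:
  assumes ev: "dir_eigenvalue p q z" and nz: "integral {0..1} (\<lambda>x. fundU p q z x * fundV p q z x) \<noteq> 0"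
  shows "alg_mult \<phi> z = 1"
proof -
  let ?F = "eigenfn z" and ?U = "fundU p q z" and ?V = "fundV p q z"
  note f = zs_fund[OF p q, of z]
  note fc = zs_sol_continuous[OF f(1)]
  have Fc: "continuous_on {0..1} (fst ?F)" "continuous_on {0..1} (snd ?F)"
    unfolding eigenfn_def using fc by (auto intro: continuous_on_eq)
  have Feq: "fst ?F x = ?U x" "snd ?F x = ?V x" if "x \<in> {0..1}" for x
    using that by (simp_all add: eigenfn_def)
  have "ZS_dirichlet \<phi> ?F (cscale z ?F + 0)"
  proof (rule ZS_shift_classical[OF Fc zero_fun_pair_cont, THEN iffD2], intro conjI ballI)
    show "fst ?F 0 = snd ?F 0" "fst ?F 1 = snd ?F 1" using f(2,3) ev by (simp_all add: eigenfn_def dir_eigenvalue_def)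
    show "\<forall>x. x \<notin> {0..1} \<longrightarrow> fst ?F x = 0 \<and> snd ?F x = 0" by (simp add: eigenfn_def)
    fix x :: real assume x: "x \<in> {0..1}"
    note s = f(1)[unfolded zs_sol_def, rule_format, OF x]
    show "(fst ?F has_vector_derivative - \<i> * (z * fst ?F x + fst 0 x) + \<i> * p x * snd ?F x) (at x within {0..1})"
      by (rule has_vector_derivative_transform[OF x Feq(1)]) (use s x in \<open>simp_all add: Feq zero_fun_pair mult.assoc\<close>)
    show "(snd ?F has_vector_derivative \<i> * (z * snd ?F x + snd 0 x) - \<i> * q x * fst ?F x) (at x within {0..1})"
      by (rule has_vector_derivative_transform[OF x Feq(2)]) (use s x in \<open>simp_all add: Feq zero_fun_pair mult.assoc\<close>)
  qed
  then have F1: "?F \<in> root_space \<phi> z (Suc 0)" by auto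
  have "root_space \<phi> z k \<subseteq> range (\<lambda>c. cscale c ?F)" for k
  proof (induction k)
    case 0
    have "cscale 0 ?F = 0" by (simp add: cscale_def zero_prod_def zero_fun_def)
    then show ?case by (auto intro: range_eqI[of _ _ 0])
  next
    case (Suc k)
    show ?case
    proof
      fix H assume "H \<in> root_space \<phi> z (Suc k)"
      then obtain G where G: "G \<in> root_space \<phi> z k" "ZS_dirichlet \<phi> H (cscale z H + G)" by auto
      then obtain c where c: "G = cscale c ?F" using Suc by auto
      have Gc: "continuous_on {0..1} (fst G)" "continuous_on {0..1} (snd G)"
        unfolding c cscale_def fst_conv snd_conv by (intro continuous_intros Fc)+
      note R = G(2)[unfolded ZS_shift_classical[OF ZS_domain_cont[OF G(2)] Gc]]
      have "((\<lambda>x. (z - z) * (?U x * snd H x + ?V x * fst H x) + (snd G x * ?U x + fst G x * ?V x)) has_integral 0) {0..1}"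
        by (rule zs_wronskian[OF f(1)]) (use R f ev in \<open>auto simp: dir_eigenvalue_def\<close>)
      then have "integral {0..1} (\<lambda>x. snd G x * ?U x + fst G x * ?V x) = 0" by (simp add: integral_unique)
      moreover have "integral {0..1} (\<lambda>x. snd G x * ?U x + fst G x * ?V x) = integral {0..1} (\<lambda>x. (2 * c) * (?U x * ?V x))"
        by (rule integral_cong) (auto simp: c cscale_def eigenfn_def)
      ultimately have "c = 0" using nz by simp
      then have "G = 0" by (simp add: c cscale_def zero_prod_def zero_fun_def)
      with G(2) have "ZS_dirichlet \<phi> H (cscale z H + 0)" by simp
      from ZS_kernel(1)[OF this] show "H \<in> range (\<lambda>c. cscale c ?F)" by (rule range_eqI)
    qed
  qed
  then have sub: "(\<Union>k. root_space \<phi> z k) \<subseteq> cfun.span {?F}"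
  proof (intro UN_least subsetI)
    fix k H assume "H \<in> root_space \<phi> z k"
    then obtain c where "H = cscale c ?F" using \<open>root_space \<phi> z k \<subseteq> range (\<lambda>c. cscale c ?F)\<close> by blast
    then show "H \<in> cfun.span {?F}" by (simp add: cfun.span_scale cfun.span_base)
  qed
  have "fst ?F 0 = 1" using f by (simp add: eigenfn_def)
  then have "?F \<noteq> 0" by (auto simp: zero_prod_def)
  then have "cfun.independent {?F}" by simp
  moreover have "{?F} \<subseteq> (\<Union>k. root_space \<phi> z k)" using F1 by blast
  ultimately show ?thesis unfolding alg_mult_def using sub by (intro cfun.dim_unique[of "{?F}"]) auto
qed

end

section \<open>Lexicographic enumerations\<close>

lemma lex_le_trans: "lex_le x y \<Longrightarrow> lex_le y w \<Longrightarrow> lex_le x w"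
  unfolding lex_le_def by auto

lemma lex_le_chain:
  assumes "\<And>n::int. lex_le (\<mu> n) (\<mu> (n + 1))" "i \<le> j"
  shows "lex_le (\<mu> i) (\<mu> j)"
  using assms(2)
proof (induction j rule: int_ge_induct)
  case base
  show ?case by (simp add: lex_le_def)
next
  case (step j)
  show ?case by (rule lex_le_trans[OF step(2) assms(1)])
qed

text \<open>
  Downward induction from a large index, where \<open>lim\<close> puts \<open>\<mu> n\<close> into its own disc. If \<open>\<mu> (j + 1) = w (j + 1)\<close>,
  then \<open>\<mu> j\<close> lies between \<open>w j\<close>, which occurs at an index \<open>\<le> j\<close>, and \<open>w (j + 1)\<close>; it is therefore one of the
  two, and not the second, which is taken only once.
\<close>

lemma lex_enumeration_pos:
  fixes \<mu> w :: "int \<Rightarrow> complex" and L :: int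
  assumes mono: "\<And>n. lex_le (\<mu> n) (\<mu> (n + 1))"
    and lim: "finite {n. \<not> norm (\<mu> n - npi n) \<le> 1 / 8}"
    and loc: "\<And>n. real_of_int L \<le> norm (\<mu> n) \<Longrightarrow> \<exists>m::int. norm (\<mu> n - npi m) \<le> 1 / 8"
    and w: "\<And>m. m \<ge> L \<Longrightarrow> norm (w m - npi m) \<le> 1 / 8"
    and uniq: "\<And>m n. m \<ge> L \<Longrightarrow> norm (\<mu> n - npi m) \<le> 1 / 8 \<Longrightarrow> \<mu> n = w m"
    and card: "\<And>m. m \<ge> L \<Longrightarrow> card {n. \<mu> n = w m} = 1" and L: "L \<ge> 1" and m: "m \<ge> L"
  shows "\<mu> m = w m"
proof -
  have Re: "\<bar>Re (v - npi k)\<bar> \<le> 1 / 8" if "norm (v - npi k) \<le> 1 / 8" for v and k :: int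
    using abs_Re_le_cmod[of "v - npi k"] that by linarith
  obtain n1 where n1: "\<And>n. n \<ge> n1 \<Longrightarrow> norm (\<mu> n - npi n) \<le> 1 / 8"
  proof -
    have "\<exists>M. \<forall>n\<in>{n. \<not> norm (\<mu> n - npi n) \<le> 1 / 8}. n \<le> M"
      using lim by (meson bdd_above_finite bdd_above_def)
    then obtain M where "\<And>n. \<not> norm (\<mu> n - npi n) \<le> 1 / 8 \<Longrightarrow> n \<le> M" by blast
    then show ?thesis by (intro that[of "M + 1"]) force
  qed
  have top: "\<mu> k = w k" if "k \<ge> max L n1" for k
    using uniq[of k k] n1[of k] that by auto
  show ?thesis
  proof (cases "m \<ge> max L n1")
    case False
    then have "m \<le> max L n1" by linarith
    then have "m \<ge> L \<longrightarrow> \<mu> m = w m"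
    proof (induction m rule: int_le_induct)
      case base
      show ?case using top by simp
    next
      case (step k)
      define j where "j = k - 1"
      have k: "k = j + 1" by (simp add: j_def)
      show ?case unfolding j_def[symmetric]
      proof
        assume jL: "j \<ge> L"
        have IH: "\<mu> (j + 1) = w (j + 1)" using step(2) jL k by simp
        have "card {n. \<mu> n = w j} = 1" using card[OF jL] .
        then obtain i where i: "\<mu> i = w j" by (metis (mono_tags) card_1_singletonE mem_Collect_eq singletonI)
        have rj: "\<bar>Re (w j) - real_of_int j * pi\<bar> \<le> 1 / 8" using Re[OF w[OF jL]] by simp
        have rk: "\<bar>Re (w (j + 1)) - (real_of_int j + 1) * pi\<bar> \<le> 1 / 8"
          using Re[OF w[of "j + 1"]] jL by simp
        have pi2: "pi \<ge> 2" by (rule pi_ge_two)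
        have e: "(real_of_int j + 1) * pi = real_of_int j * pi + pi" by (simp add: algebra_simps)
        have "i \<le> j"
        proof (rule ccontr)
          assume "\<not> i \<le> j"
          then have "lex_le (\<mu> (j + 1)) (\<mu> i)" by (intro lex_le_chain[where \<mu> = \<mu>, OF mono]) simp
          then have "Re (w (j + 1)) \<le> Re (w j)" unfolding IH i lex_le_def by auto
          then show False using rj rk e pi2 by linarith
        qed
        then have "lex_le (w j) (\<mu> j)" using lex_le_chain[where \<mu> = \<mu>, OF mono, of i j] i by simp
        then have "Re (w j) \<le> Re (\<mu> j)" unfolding lex_le_def by auto
        then have lo: "Re (\<mu> j) \<ge> real_of_int j * pi - 1 / 8" using rj by linarith
        have "lex_le (\<mu> j) (w (j + 1))" using mono[of j] IH by simp
        then have "Re (\<mu> j) \<le> Re (w (j + 1))" unfolding lex_le_def by auto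
        then have hi: "Re (\<mu> j) \<le> real_of_int j * pi + pi + 1 / 8" using rk e by linarith
        have "real_of_int j * pi \<ge> real_of_int j * 2" using jL L pi2 by (intro mult_left_mono) auto
        then have "real_of_int L \<le> Re (\<mu> j)" using lo jL L by linarith
        then have "real_of_int L \<le> norm (\<mu> j)" using complex_Re_le_cmod[of "\<mu> j"] by linarith
        then obtain l :: int where l: "norm (\<mu> j - npi l) \<le> 1 / 8" using loc by blast
        have rl: "\<bar>Re (\<mu> j) - real_of_int l * pi\<bar> \<le> 1 / 8" using Re[OF l] by simp
        \<comment> \<open>The real part of \<open>\<mu> j\<close> is confined between those of \<open>w j\<close> and \<open>w (j + 1)\<close>, up to \<open>1 / 8\<close>.\<close>
        have "l = j \<or> l = j + 1"
        proof -
          have "\<not> l < j"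
          proof
            assume "l < j"
            then have "real_of_int l \<le> real_of_int j - 1" by linarith
            then have "real_of_int l * pi \<le> (real_of_int j - 1) * pi" by (intro mult_right_mono) auto
            then show False using rl lo pi2 by (simp add: algebra_simps)
          qed
          moreover have "\<not> l > j + 1"
          proof
            assume "l > j + 1"
            then have "real_of_int j + 2 \<le> real_of_int l" by linarith
            then have "(real_of_int j + 2) * pi \<le> real_of_int l * pi" by (intro mult_right_mono) auto
            then show False using rl hi pi2 by (simp add: algebra_simps)
          qed
          ultimately show ?thesis by linarith
        qed
        moreover have "l \<noteq> j + 1"
        proof
          assume "l = j + 1"
          then have "\<mu> j = w (j + 1)" using uniq[of "j + 1" j] l jL by simp
          with IH have s: "{j, j + 1} \<subseteq> {n. \<mu> n = w (j + 1)}" by auto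
          have c1: "card {n. \<mu> n = w (j + 1)} = 1" using card[of "j + 1"] jL by simp
          then have "finite {n. \<mu> n = w (j + 1)}" using card.infinite by fastforce
          from card_mono[OF this s] c1 show False by simp
        qed
        ultimately show "\<mu> j = w j" using uniq[OF jL, of j] l by simp
      qed
    qed
    with m show ?thesis by simp
  qed (rule top)
qed

text \<open>
  The reflection \<open>n \<mapsto> - n\<close>, \<open>\<mu> \<mapsto> - \<mu>\<close> preserves the lexicographic order, which settles negative indices.
\<close>

lemma lex_enumeration:
  fixes \<mu> w :: "int \<Rightarrow> complex" and L :: int
  assumes mono: "\<And>n. lex_le (\<mu> n) (\<mu> (n + 1))"
    and lim: "finite {n. \<not> norm (\<mu> n - npi n) \<le> 1 / 8}"
    and loc: "\<And>n. real_of_int L \<le> norm (\<mu> n) \<Longrightarrow> \<exists>m::int. norm (\<mu> n - npi m) \<le> 1 / 8"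
    and w: "\<And>m. \<bar>m\<bar> \<ge> L \<Longrightarrow> norm (w m - npi m) \<le> 1 / 8"
    and uniq: "\<And>m n. \<bar>m\<bar> \<ge> L \<Longrightarrow> norm (\<mu> n - npi m) \<le> 1 / 8 \<Longrightarrow> \<mu> n = w m"
    and card: "\<And>m. \<bar>m\<bar> \<ge> L \<Longrightarrow> card {n. \<mu> n = w m} = 1" and L: "L \<ge> 1" and m: "\<bar>m\<bar> \<ge> L"
  shows "\<mu> m = w m"
proof (cases "m \<ge> 0")
  case True
  show ?thesis
    by (rule lex_enumeration_pos[OF mono lim loc, of L w m]) (use w uniq card L m True in auto)
next
  case False
  have neg: "norm (- v - npi k) = norm (v - npi (- k))" for v and k :: int
    by (metis (no_types) minus_diff_eq minus_diff_commute mult_minus_left norm_minus_cancel of_int_minus)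
  have "- \<mu> (- (- m)) = - w (- (- m))"
  proof (rule lex_enumeration_pos[where \<mu> = "\<lambda>n. - \<mu> (- n)" and w = "\<lambda>n. - w (- n)" and L = L])
    show "lex_le (- \<mu> (- n)) (- \<mu> (- (n + 1)))" for n
      using mono[of "- (n + 1)"] by (auto simp: lex_le_def)
    have "{n. \<not> norm (- \<mu> (- n) - npi n) \<le> 1 / 8} = uminus ` {n. \<not> norm (\<mu> n - npi n) \<le> 1 / 8}"
      unfolding neg by (auto simp: image_iff intro!: exI[of _ "- _"])
    then show "finite {n. \<not> norm (- \<mu> (- n) - npi n) \<le> 1 / 8}" using lim by simp
    show "\<exists>k::int. norm (- \<mu> (- n) - npi k) \<le> 1 / 8" if h: "real_of_int L \<le> norm (- \<mu> (- n))" for n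
    proof -
      obtain k :: int where "norm (\<mu> (- n) - npi k) \<le> 1 / 8" using loc[of "- n"] h by auto
      then show ?thesis unfolding neg by (intro exI[of _ "- k"]) simp
    qed
    show "norm (- w (- k) - npi k) \<le> 1 / 8" if "k \<ge> L" for k
      unfolding neg using w[of "- k"] that by simp
    show "- \<mu> (- n) = - w (- k)" if "k \<ge> L" "norm (- \<mu> (- n) - npi k) \<le> 1 / 8" for k n
      using uniq[of "- k" "- n"] that unfolding neg by simp
    show "card {n. - \<mu> (- n) = - w (- k)} = 1" if "k \<ge> L" for k
    proof -
      have "{n. - \<mu> (- n) = - w (- k)} = uminus ` {n. \<mu> n = w (- k)}"
        by (auto simp: image_iff intro!: exI[of _ "- _"])
      then show ?thesis using card[of "- k"] that by (simp add: card_image)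
    qed
  qed (use L m False in auto)
  then show ?thesis by simp
qed

section \<open>Bessel's inequality\<close>

lemma integral_osc: "integral {0..1} (osc m) = (if m = 0 then 1 else 0)"
proof (cases "m = 0")
  case True
  have "osc 0 = (\<lambda>_. 1)" by (simp add: osc_def fun_eq_iff)
  with True show ?thesis by simp
next
  case False
  let ?c = "2 * \<i> * npi m :: complex"
  have "((\<lambda>x. ?c * osc m x) has_integral osc m 1 - osc m 0) {0..1}"
    by (rule fundamental_theorem_of_calculus) (auto intro: osc_deriv)
  then have "?c * integral {0..1} (osc m) = 0"
    using integral_unique osc_0 osc_1 by (metis integral_mult_right diff_self)
  with False show ?thesis by simp
qed

lemma osc_mult: "osc m x * osc k x = osc (m + k) x"
  by (simp add: osc_def mult_exp_exp algebra_simps)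

lemma cnj_osc: "cnj (osc m x) = osc (- m) x"
  by (simp add: osc_def exp_cnj)

text \<open>
  With \<open>P\<close> the Fourier sum over \<open>A\<close>, both \<open>\<integral> g cnj P\<close> and \<open>\<integral> P cnj P\<close> equal the sum on the left, and
  \<open>\<integral> \<bar>g - P\<bar>\<^sup>2\<close> is nonnegative.
\<close>

lemma bessel_inequality:
  fixes g :: cfn
  assumes g: "g absolutely_integrable_on {0..1}" and g2: "(\<lambda>x. (norm (g x))\<^sup>2) integrable_on {0..1}"
    and A: "finite A"
  shows "(\<Sum>m\<in>A. (norm (integral {0..1} (\<lambda>y. g y * osc (- m) y)))\<^sup>2) \<le> integral {0..1} (\<lambda>y. (norm (g y))\<^sup>2)"
proof -
  define c where "c m = integral {0..1} (\<lambda>y. g y * osc (- m) y)" for m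
  define P where "P y = (\<Sum>m\<in>A. c m * osc m y)" for y
  define S where "S = (\<Sum>m\<in>A. (norm (c m))\<^sup>2)"
  have S: "complex_of_real S = (\<Sum>m\<in>A. cnj (c m) * c m)"
    unfolding S_def of_real_sum
    by (rule sum.cong[OF refl], subst complex_norm_square, rule mult.commute)
  have gi: "(\<lambda>y. g y * osc m y) integrable_on {0..1}" for m
    by (intro absolutely_integrableD(1) absolutely_integrable_mult_continuous' osc_cont g)
  have cP: "g y * cnj (P y) = (\<Sum>m\<in>A. cnj (c m) * (g y * osc (- m) y))" for y
    by (simp add: P_def cnj_osc sum_distrib_left mult_ac)
  have "((\<lambda>y. \<Sum>m\<in>A. cnj (c m) * (g y * osc (- m) y)) has_integral (\<Sum>m\<in>A. cnj (c m) * c m)) {0..1}"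
    unfolding c_def by (intro has_integral_sum A has_integral_mult_right integrable_integral gi)
  then have 1: "((\<lambda>y. g y * cnj (P y)) has_integral of_real S) {0..1}"
    unfolding cP S .
  have PP: "P y * cnj (P y) = (\<Sum>m\<in>A. \<Sum>k\<in>A. (c m * cnj (c k)) * osc (m + - k) y)" for y
    unfolding osc_mult[symmetric] by (simp add: P_def cnj_osc sum_product mult_ac)
  have "((\<lambda>y. \<Sum>m\<in>A. \<Sum>k\<in>A. (c m * cnj (c k)) * osc (m + - k) y) has_integral
     (\<Sum>m\<in>A. \<Sum>k\<in>A. (c m * cnj (c k)) * integral {0..1} (osc (m + - k)))) {0..1}"
    by (intro has_integral_sum A has_integral_mult_right integrable_integral integrable_continuous_real osc_cont)
  also have "(\<Sum>m\<in>A. \<Sum>k\<in>A. (c m * cnj (c k)) * integral {0..1} (osc (m + - k))) = (\<Sum>m\<in>A. c m * cnj (c m))"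
    unfolding integral_osc using A by (intro sum.cong refl) (simp add: if_distrib sum.delta cong: if_cong)
  finally have 2: "((\<lambda>y. P y * cnj (P y)) has_integral of_real S) {0..1}"
    unfolding PP S by (simp only: mult.commute)
  have r1: "((\<lambda>y. Re (g y * cnj (P y))) has_integral S) {0..1}"
    using has_integral_linear[OF 1 bounded_linear_Re] by (simp add: o_def)
  have r2: "((\<lambda>y. Re (P y * cnj (P y))) has_integral S) {0..1}"
    using has_integral_linear[OF 2 bounded_linear_Re] by (simp add: o_def)
  have "((\<lambda>y. (norm (g y))\<^sup>2 - 2 * Re (g y * cnj (P y)) + Re (P y * cnj (P y))) has_integral
     (integral {0..1} (\<lambda>y. (norm (g y))\<^sup>2) - 2 * S + S)) {0..1}"
    by (intro has_integral_add has_integral_diff has_integral_mult_right integrable_integral g2 r1 r2)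
  moreover have "(norm (g y))\<^sup>2 - 2 * Re (g y * cnj (P y)) + Re (P y * cnj (P y)) \<ge> 0" for y
  proof -
    have "(norm (g y))\<^sup>2 - 2 * Re (g y * cnj (P y)) + Re (P y * cnj (P y)) = (norm (g y - P y))\<^sup>2"
      unfolding cmod_power2 by (simp add: power2_eq_square algebra_simps)
    then show ?thesis by simp
  qed
  ultimately have "0 \<le> integral {0..1} (\<lambda>y. (norm (g y))\<^sup>2) - 2 * S + S"
    by (rule has_integral_nonneg)
  then show ?thesis unfolding S_def c_def by simp
qed

lemma bessel_trunc:
  assumes g: "g absolutely_integrable_on {0..1}" and g2: "(\<lambda>x. (norm (g x))\<^sup>2) integrable_on {0..1}"
    and A: "finite A" and x: "x \<in> {0..1}"
  shows "(\<Sum>m\<in>A. (norm (trunc_four g m x))\<^sup>2) \<le> integral {0..1} (\<lambda>y. (norm (g y))\<^sup>2)"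
proof -
  define h where "h y = (if y \<in> {0..x} then g y else 0)" for y
  have sub: "{0..x} \<inter> {0..1} = {0..x}" using x by auto
  have gx: "g absolutely_integrable_on {0..x}" by (rule set_integrable_subset[OF g]) (use x in auto)
  have hi: "h integrable_on {0..1}" "(\<lambda>y. norm (h y)) integrable_on {0..1}"
    using absolutely_integrableD[OF gx] unfolding h_def if_distrib[of norm] norm_zero
    by (simp_all only: Henstock_Kurzweil_Integration.integrable_restrict_Int sub)
  then have h: "h absolutely_integrable_on {0..1}" unfolding absolutely_integrable_on_def by blast
  have g2x: "(\<lambda>y. (norm (g y))\<^sup>2) integrable_on {0..x}" by (rule integrable_on_subinterval[OF g2]) (use x in auto)
  have e2: "(\<lambda>y. (norm (h y))\<^sup>2) = (\<lambda>y. if y \<in> {0..x} then (norm (g y))\<^sup>2 else 0)" by (auto simp: h_def)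
  have h2: "(\<lambda>y. (norm (h y))\<^sup>2) integrable_on {0..1}"
    unfolding e2 Henstock_Kurzweil_Integration.integrable_restrict_Int sub by (rule g2x)
  have "integral {0..1} (\<lambda>y. h y * osc (- m) y) = trunc_four g m x" for m
  proof -
    have "(\<lambda>y. h y * osc (- m) y) = (\<lambda>y. if y \<in> {0..x} then g y * osc (- m) y else 0)" by (auto simp: h_def)
    then show ?thesis unfolding trunc_four_def by (simp only: HK_restrict_Int sub)
  qed
  then have "(\<Sum>m\<in>A. (norm (trunc_four g m x))\<^sup>2) \<le> integral {0..1} (\<lambda>y. (norm (h y))\<^sup>2)"
    using bessel_inequality[OF h h2 A] by simp
  also have "\<dots> \<le> integral {0..1} (\<lambda>y. (norm (g y))\<^sup>2)"
    by (rule integral_le[OF h2 g2]) (simp add: h_def)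
  finally show ?thesis .
qed

text \<open>
  Bessel's inequality for the function cut off at \<open>x\<close>, integrated over \<open>x\<close>, plus the case \<open>x = 1\<close>.
\<close>

theorem bessel_four_energy:
  assumes g: "g absolutely_integrable_on {0..1}" and g2: "(\<lambda>x. (norm (g x))\<^sup>2) integrable_on {0..1}"
    and G: "integral {0..1} (\<lambda>y. (norm (g y))\<^sup>2) \<le> G" and A: "finite A"
  shows "(\<Sum>m\<in>A. four_energy g m) \<le> 2 * G"
proof -
  have i: "(\<lambda>x. (norm (trunc_four g m x))\<^sup>2) integrable_on {0..1}" for m
    by (intro integrable_continuous_real continuous_intros trunc_four_cont g)
  have c: "(\<lambda>x. G) integrable_on {0..1::real}" by (rule integrable_continuous_real) simp
  have "(\<Sum>m\<in>A. integral {0..1} (\<lambda>x. (norm (trunc_four g m x))\<^sup>2)) = integral {0..1} (\<lambda>x. \<Sum>m\<in>A. (norm (trunc_four g m x))\<^sup>2)"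
    by (rule integral_sum[OF A, symmetric]) (rule i)
  also have "\<dots> \<le> integral {0..1} (\<lambda>x::real. G)"
    by (rule integral_le[OF integrable_sum[OF A] c]) (rule i, rule order_trans[OF bessel_trunc[OF g g2 A] G])
  finally show ?thesis
    using order_trans[OF bessel_trunc[OF g g2 A, of 1] G] by (simp add: four_energy_def sum.distrib)
qed

lemma four_energy_nonneg:
  assumes "g absolutely_integrable_on {0..1}"
  shows "four_energy g m \<ge> 0"
proof -
  have "(\<lambda>x. (norm (trunc_four g m x))\<^sup>2) integrable_on {0..1}"
    by (intro integrable_continuous_real continuous_intros trunc_four_cont assms)
  from integral_nonneg[OF this] show ?thesis by (simp add: four_energy_def)
qed

section \<open>Formal inversion and its error\<close>

definition fps_agree :: "nat \<Rightarrow> complex fps \<Rightarrow> complex fps \<Rightarrow> bool" where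
  "fps_agree k F G \<longleftrightarrow> (\<forall>i<k. fps_nth F i = fps_nth G i)"

lemma fps_agree_mult:
  "fps_agree k F G \<Longrightarrow> fps_agree k F' G' \<Longrightarrow> fps_agree k (F * F') (G * G')"
  by (auto simp: fps_agree_def fps_mult_nth intro!: sum.cong)

lemma fps_agree_power: "fps_agree k F G \<Longrightarrow> fps_agree k (F ^ j) (G ^ j)"
proof (induction j)
  case 0
  show ?case by (simp add: fps_agree_def)
next
  case (Suc j)
  show ?case unfolding power_Suc by (rule fps_agree_mult[OF Suc.prems Suc.IH[OF Suc.prems]])
qed

lemma fps_agree_X: "fps_agree k F G \<Longrightarrow> fps_agree (Suc k) (fps_X * F) (fps_X * G)"
  by (auto simp: fps_agree_def)

lemma fps_agree_inverse:
  assumes "fps_agree k F G" "fps_nth F 0 \<noteq> 0" "fps_nth G 0 \<noteq> 0"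
  shows "fps_agree k (inverse F) (inverse G)"
proof -
  have "inverse F - inverse G = (G - F) * (inverse F * inverse G)"
    using inverse_mult_eq_1[OF assms(2)] inverse_mult_eq_1[OF assms(3)] by (simp add: algebra_simps)
  moreover have "fps_nth ((G - F) * (inverse F * inverse G)) i = 0" if "i < k" for i
    unfolding fps_mult_nth using assms(1) that by (intro sum.neutral) (auto simp: fps_agree_def)
  ultimately have "fps_nth (inverse F - inverse G) i = 0" if "i < k" for i using that by metis
  then show ?thesis by (simp add: fps_agree_def)
qed

text \<open>
  With \<open>X = 1 / n\<close>, this is \<open>1 / z\<close> for \<open>z = n \<pi> + C (1 / n)\<close>.
\<close>

definition inv_series :: "complex fps \<Rightarrow> complex fps" where
  "inv_series C = fps_X * inverse (fps_const (of_real pi) + fps_X * C)"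

definition inv_rhs :: "(nat \<Rightarrow> complex) \<Rightarrow> complex fps \<Rightarrow> nat \<Rightarrow> complex" where
  "inv_rhs \<kappa> C k = (\<Sum>j=1..k. \<kappa> j * fps_nth (inv_series C ^ j) k)"

text \<open>
  The \<open>k\<close>-th coefficient of \<open>\<Sum>j. \<kappa>\<^sub>j (inv_series C) ^ j\<close> depends only on the coefficients of \<open>C\<close> below \<open>k\<close>, since
  \<open>inv_series\<close> shifts by one. So the fixed point equation for \<open>C\<close> is a recursion.
\<close>

function inv_coeff :: "(nat \<Rightarrow> complex) \<Rightarrow> nat \<Rightarrow> complex" where
  "inv_coeff \<kappa> k = inv_rhs \<kappa> (Abs_fps (\<lambda>i. if i < k then inv_coeff \<kappa> i else 0)) k"
  by pat_completeness auto
termination by (relation "Wellfounded.measure snd") auto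

declare inv_coeff.simps [simp del]

lemma inv_series_agree:
  assumes "fps_agree k C D"
  shows "fps_agree (Suc k) (inv_series C) (inv_series D)"
proof -
  have "fps_agree (Suc k) (fps_X * C) (fps_X * D)" by (rule fps_agree_X[OF assms])
  then have "fps_agree (Suc k) (fps_const (of_real pi) + fps_X * C) (fps_const (of_real pi) + fps_X * D)"
    by (simp add: fps_agree_def)
  then have "fps_agree (Suc k) (inverse (fps_const (of_real pi) + fps_X * C)) (inverse (fps_const (of_real pi) + fps_X * D))"
    by (rule fps_agree_inverse) simp_all
  from fps_agree_X[OF this] show ?thesis unfolding inv_series_def fps_agree_def by simp
qed

lemma inv_coeff_fixed_point:
  "inv_coeff \<kappa> k = inv_rhs \<kappa> (Abs_fps (inv_coeff \<kappa>)) k"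
proof -
  have "fps_agree k (Abs_fps (\<lambda>i. if i < k then inv_coeff \<kappa> i else 0)) (Abs_fps (inv_coeff \<kappa>))"
    by (simp add: fps_agree_def)
  from fps_agree_power[OF inv_series_agree[OF this]]
  show ?thesis
    by (subst inv_coeff.simps) (simp add: inv_rhs_def fps_agree_def)
qed

text \<open>
  Abstract closure properties under which a property of \<open>\<kappa>\<^sub>j\<close> passes to the inverted coefficients. It is used
  twice: for being given by integrals of polynomials, and for boundedness on a set of potentials.
\<close>

locale graded_class =
  fixes A :: "nat \<Rightarrow> ('p \<Rightarrow> complex) \<Rightarrow> bool"
  assumes A_mono: "A i f \<Longrightarrow> i \<le> k \<Longrightarrow> A k f"
    and A_const: "A k (\<lambda>\<phi>. c)"
    and A_add: "A k f \<Longrightarrow> A k g \<Longrightarrow> A k (\<lambda>\<phi>. f \<phi> + g \<phi>)"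
    and A_mult: "A k f \<Longrightarrow> A k g \<Longrightarrow> A k (\<lambda>\<phi>. f \<phi> * g \<phi>)"
begin

definition "fam F \<longleftrightarrow> (\<forall>i. A i (\<lambda>\<phi>. fps_nth (F \<phi>) i))"

lemma A_sum: "(\<And>i. i \<in> S \<Longrightarrow> A k (f i)) \<Longrightarrow> A k (\<lambda>\<phi>. \<Sum>i\<in>S. f i \<phi>)"
  by (induction S rule: infinite_finite_induct) (auto intro: A_const A_add)

lemma fam_const: "fam (\<lambda>\<phi>. F)"
  by (simp add: fam_def A_const)

lemma fam_add: "fam F \<Longrightarrow> fam G \<Longrightarrow> fam (\<lambda>\<phi>. F \<phi> + G \<phi>)"
  by (simp add: fam_def A_add)

lemma fam_mult: "fam F \<Longrightarrow> fam G \<Longrightarrow> fam (\<lambda>\<phi>. F \<phi> * G \<phi>)"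
  unfolding fam_def fps_mult_nth
  by (intro allI A_sum A_mult) (auto intro: A_mono)

lemma fam_power: "fam F \<Longrightarrow> fam (\<lambda>\<phi>. F \<phi> ^ j)"
  by (induction j) (auto intro: fam_mult fam_const)

lemma fam_inverse:
  assumes F: "fam F" and c: "\<And>\<phi>. fps_nth (F \<phi>) 0 = c" "c \<noteq> 0"
  shows "fam (\<lambda>\<phi>. inverse (F \<phi>))"
  unfolding fam_def
proof
  fix k
  show "A k (\<lambda>\<phi>. fps_nth (inverse (F \<phi>)) k)"
  proof (induction k rule: less_induct)
    case (less k)
    have one: "fps_nth (F \<phi> * inverse (F \<phi>)) k = (if k = 0 then 1 else 0)" for \<phi>
      using inverse_mult_eq_1[of "F \<phi>"] c by (simp add: mult.commute)
    have "fps_nth (F \<phi> * inverse (F \<phi>)) k = c * fps_nth (inverse (F \<phi>)) k +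
        (\<Sum>i=1..k. fps_nth (F \<phi>) i * fps_nth (inverse (F \<phi>)) (k - i))" for \<phi>
      unfolding fps_mult_nth using c(1) by (simp add: sum.atLeast_Suc_atMost)
    then have e: "fps_nth (inverse (F \<phi>)) k = (1 / c) * ((if k = 0 then 1 else 0) +
        (\<Sum>i=1..k. (- 1) * (fps_nth (F \<phi>) i * fps_nth (inverse (F \<phi>)) (k - i))))" for \<phi>
      using one[of \<phi>] c(2) by (simp add: field_simps sum_negf)
    have "A k (\<lambda>\<phi>. (1 / c) * ((if k = 0 then 1 else 0) +
        (\<Sum>i=1..k. (- 1) * (fps_nth (F \<phi>) i * fps_nth (inverse (F \<phi>)) (k - i)))))"
    proof (intro A_mult A_const A_add A_sum)
      fix i assume i: "i \<in> {1..k}"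
      show "A k (\<lambda>\<phi>. fps_nth (F \<phi>) i)" using F i by (auto simp: fam_def intro: A_mono)
      show "A k (\<lambda>\<phi>. fps_nth (inverse (F \<phi>)) (k - i))" by (rule A_mono[OF less]) (use i in auto)
    qed
    then show ?case unfolding e[symmetric] .
  qed
qed

text \<open>
  Formal power series whose \<open>i\<close>-th coefficient is in the \<open>i\<close>-th class form a ring that is closed under inversion of
  series with constant nonzero term.
\<close>

lemma inv_coeff_class:
  assumes \<kappa>: "\<And>j. j \<ge> 1 \<Longrightarrow> A j (\<lambda>\<phi>. \<kappa> \<phi> j)"
  shows "A k (\<lambda>\<phi>. inv_coeff (\<kappa> \<phi>) k)"
proof (induction k rule: less_induct)
  case (less k)
  define C where "C \<phi> = Abs_fps (\<lambda>i. if i < k then inv_coeff (\<kappa> \<phi>) i else 0)" for \<phi>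
  have C: "fam C" unfolding fam_def
  proof
    fix i show "A i (\<lambda>\<phi>. fps_nth (C \<phi>) i)"
      using less[of i] by (cases "i < k") (simp_all add: C_def A_const)
  qed
  have "fam (\<lambda>\<phi>. inv_series (C \<phi>))"
    unfolding inv_series_def
    by (intro fam_mult fam_const fam_inverse[where c = "of_real pi"] fam_add C) auto
  then have "fam (\<lambda>\<phi>. inv_series (C \<phi>) ^ j)" for j by (rule fam_power)
  then have "A k (\<lambda>\<phi>. inv_rhs (\<kappa> \<phi>) (C \<phi>) k)"
    unfolding inv_rhs_def fam_def by (intro A_sum A_mult) (auto intro: A_mono[OF \<kappa>])
  then show ?case unfolding C_def inv_coeff.simps[of _ k, symmetric] .
qed

end

lemma graded_class_bounded: "graded_class (\<lambda>(k::nat) (f :: 'p \<Rightarrow> complex). \<exists>C. \<forall>\<phi>\<in>B. norm (f \<phi>) \<le> C)"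
proof
  fix f g :: "'p \<Rightarrow> complex"
  assume "\<exists>C. \<forall>\<phi>\<in>B. norm (f \<phi>) \<le> C" "\<exists>C. \<forall>\<phi>\<in>B. norm (g \<phi>) \<le> C"
  then obtain C D where CD: "\<And>\<phi>. \<phi> \<in> B \<Longrightarrow> norm (f \<phi>) \<le> C" "\<And>\<phi>. \<phi> \<in> B \<Longrightarrow> norm (g \<phi>) \<le> D" by blast
  show "\<exists>C. \<forall>\<phi>\<in>B. norm (f \<phi> + g \<phi>) \<le> C"
    by (intro exI[of _ "C + D"] ballI norm_triangle_mono CD)
  show "\<exists>C. \<forall>\<phi>\<in>B. norm (f \<phi> * g \<phi>) \<le> C"
    unfolding norm_mult by (intro exI[of _ "C * D"] ballI mult_mono' CD) auto
qed auto

definition ev :: "nat \<Rightarrow> complex fps \<Rightarrow> complex \<Rightarrow> complex" where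
  "ev K F \<epsilon> = (\<Sum>k\<le>K. fps_nth F k * \<epsilon> ^ k)"

lemma ev_mult_error:
  assumes b: "\<And>k. k \<le> K \<Longrightarrow> norm (fps_nth F k) \<le> b" "\<And>k. k \<le> K \<Longrightarrow> norm (fps_nth G k) \<le> b'" and \<epsilon>: "norm \<epsilon> \<le> 1"
  shows "norm (ev K (F * G) \<epsilon> - ev K F \<epsilon> * ev K G \<epsilon>) \<le> real ((Suc K)\<^sup>2) * (b * b') * norm \<epsilon> ^ Suc K"
proof -
  let ?f = "\<lambda>i j. fps_nth F i * fps_nth G j * \<epsilon> ^ (i + j)"
  let ?B = "{(i, j). i \<le> K \<and> j \<le> K \<and> K < i + j}"
  have fin: "finite ?B" by (rule finite_subset[of _ "{..K} \<times> {..K}"]) auto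
  have "ev K (F * G) \<epsilon> = (\<Sum>k\<le>K. \<Sum>i\<le>k. ?f i (k - i))"
    unfolding ev_def fps_mult_nth sum_distrib_right by (intro sum.cong) (auto simp: atLeast0AtMost)
  also have "\<dots> = (\<Sum>(k, i)\<in>(SIGMA k:{..K}. {..k}). ?f i (k - i))" by (rule sum.Sigma) auto
  also have "\<dots> = (\<Sum>(i, j)\<in>{(i, j). i + j \<le> K}. ?f i j)"
    by (rule sum.reindex_bij_witness[where i = "\<lambda>(i, j). (i + j, i)" and j = "\<lambda>(k, i). (i, k - i)"]) auto
  finally have 1: "ev K (F * G) \<epsilon> = (\<Sum>(i, j)\<in>{(i, j). i + j \<le> K}. ?f i j)" .
  have "ev K F \<epsilon> * ev K G \<epsilon> = (\<Sum>(i, j)\<in>{..K} \<times> {..K}. ?f i j)"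
    unfolding ev_def sum_product sum.cartesian_product by (intro sum.cong) (auto simp: power_add mult_ac)
  also have "{..K} \<times> {..K} = {(i, j). i + j \<le> K} \<union> ?B" by auto
  also have "(\<Sum>(i, j)\<in>{(i, j). i + j \<le> K} \<union> ?B. ?f i j) = (\<Sum>(i, j)\<in>{(i, j). i + j \<le> K}. ?f i j) + (\<Sum>(i, j)\<in>?B. ?f i j)"
    by (rule sum.union_disjoint) (auto intro: finite_subset[of _ "{..K} \<times> {..K}"] fin)
  finally have "ev K (F * G) \<epsilon> - ev K F \<epsilon> * ev K G \<epsilon> = - (\<Sum>(i, j)\<in>?B. ?f i j)" using 1 by simp
  then have "norm (ev K (F * G) \<epsilon> - ev K F \<epsilon> * ev K G \<epsilon>) = norm (\<Sum>(i, j)\<in>?B. ?f i j)" by simp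
  also have "\<dots> \<le> (\<Sum>(i, j)\<in>?B. b * b' * norm \<epsilon> ^ Suc K)"
  proof (rule sum_norm_le, clarify)
    fix i j assume ij: "i \<le> K" "j \<le> K" "K < i + j"
    have "norm \<epsilon> ^ (i + j) \<le> norm \<epsilon> ^ Suc K" using ij \<epsilon> by (intro power_decreasing) auto
    then show "norm (?f i j) \<le> b * b' * norm \<epsilon> ^ Suc K"
      unfolding norm_mult norm_power using b(1)[OF ij(1)] b(2)[OF ij(2)] by (intro mult_mono') auto
  qed
  also have "\<dots> = real (card ?B) * (b * b' * norm \<epsilon> ^ Suc K)" by (simp add: case_prod_unfold)
  also have "\<dots> \<le> real ((Suc K)\<^sup>2) * (b * b' * norm \<epsilon> ^ Suc K)"
  proof (rule mult_right_mono)
    have "card ?B \<le> card ({..K} \<times> {..K})" by (rule card_mono) auto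
    also have "\<dots> = (Suc K)\<^sup>2" unfolding card_cartesian_product by (simp only: card_atMost power2_eq_square)
    finally show "real (card ?B) \<le> real ((Suc K)\<^sup>2)" by (simp only: of_nat_le_iff)
    have "0 \<le> b" "0 \<le> b'" using order_trans[OF norm_ge_zero b(1)[of 0]] order_trans[OF norm_ge_zero b(2)[of 0]] by auto
    then show "0 \<le> b * b' * norm \<epsilon> ^ Suc K" by simp
  qed
  finally show ?thesis by (simp add: mult.assoc)
qed

context
  fixes B :: "'p set" and e0 :: real and K :: nat
  assumes e0: "0 < e0" "e0 \<le> 1"
begin

interpretation bd: graded_class "\<lambda>(k::nat) (f :: 'p \<Rightarrow> complex). \<exists>C. \<forall>\<phi>\<in>B. norm (f \<phi>) \<le> C"
  by (rule graded_class_bounded)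

text \<open>
  The truncation of \<open>F\<close> after order \<open>K\<close> approximates the function \<open>f\<close> up to \<open>O(\<epsilon> ^ (K + 1))\<close>, uniformly over the
  set \<open>B\<close>. Products and inverses of series correspond to those of functions, so formal identities carry over.
\<close>

definition "appr F f \<longleftrightarrow> (\<exists>C\<ge>0. \<forall>\<phi>\<in>B. \<forall>\<epsilon>. norm \<epsilon> \<le> e0 \<longrightarrow> norm (ev K (F \<phi>) \<epsilon> - f \<phi> \<epsilon>) \<le> C * norm \<epsilon> ^ Suc K)"

lemma fam_bound:
  assumes "bd.fam F"
  obtains b where "b \<ge> 0" "\<And>\<phi> k. \<phi> \<in> B \<Longrightarrow> k \<le> K \<Longrightarrow> norm (fps_nth (F \<phi>) k) \<le> b"
proof -
  have "\<forall>k. \<exists>C. \<forall>\<phi>\<in>B. norm (fps_nth (F \<phi>) k) \<le> C" using assms unfolding bd.fam_def by blast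
  then obtain c where c: "\<And>k \<phi>. \<phi> \<in> B \<Longrightarrow> norm (fps_nth (F \<phi>) k) \<le> c k" by metis
  show ?thesis
  proof (rule that[of "\<Sum>k\<le>K. \<bar>c k\<bar>"])
    fix \<phi> k assume "\<phi> \<in> B" "k \<le> K"
    have "norm (fps_nth (F \<phi>) k) \<le> \<bar>c k\<bar>" using c[OF \<open>\<phi> \<in> B\<close>, of k] by simp
    also have "\<dots> \<le> (\<Sum>k\<le>K. \<bar>c k\<bar>)" using \<open>k \<le> K\<close> by (intro member_le_sum) auto
    finally show "norm (fps_nth (F \<phi>) k) \<le> (\<Sum>k\<le>K. \<bar>c k\<bar>)" .
  qed (simp add: sum_nonneg)
qed

lemma ev_bound:
  assumes "\<And>k. k \<le> K \<Longrightarrow> norm (fps_nth F k) \<le> b" "norm \<epsilon> \<le> 1"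
  shows "norm (ev K F \<epsilon>) \<le> real (Suc K) * b"
proof -
  have "norm (ev K F \<epsilon>) \<le> (\<Sum>k\<le>K. b)"
    unfolding ev_def
  proof (rule sum_norm_le)
    fix k assume "k \<in> {..K}"
    then have "norm (fps_nth F k) * norm \<epsilon> ^ k \<le> b * 1"
      using assms by (intro mult_mono power_le_one) (auto intro: order_trans[OF norm_ge_zero])
    then show "norm (fps_nth F k * \<epsilon> ^ k) \<le> b" by (simp add: norm_mult norm_power)
  qed
  then show ?thesis by simp
qed

lemma appr_mult:
  assumes F: "bd.fam F" "appr F f" and G: "bd.fam G" "appr G g"
  shows "appr (\<lambda>\<phi>. F \<phi> * G \<phi>) (\<lambda>\<phi> \<epsilon>. f \<phi> \<epsilon> * g \<phi> \<epsilon>)"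
proof -
  obtain b where b: "b \<ge> 0" "\<And>\<phi> k. \<phi> \<in> B \<Longrightarrow> k \<le> K \<Longrightarrow> norm (fps_nth (F \<phi>) k) \<le> b"
    using fam_bound[OF F(1)] by blast
  obtain b' where b': "b' \<ge> 0" "\<And>\<phi> k. \<phi> \<in> B \<Longrightarrow> k \<le> K \<Longrightarrow> norm (fps_nth (G \<phi>) k) \<le> b'"
    using fam_bound[OF G(1)] by blast
  obtain C where C: "C \<ge> 0" "\<And>\<phi> \<epsilon>. \<phi> \<in> B \<Longrightarrow> norm \<epsilon> \<le> e0 \<Longrightarrow> norm (ev K (F \<phi>) \<epsilon> - f \<phi> \<epsilon>) \<le> C * norm \<epsilon> ^ Suc K"
    using F(2) unfolding appr_def by blast
  obtain C' where C': "C' \<ge> 0" "\<And>\<phi> \<epsilon>. \<phi> \<in> B \<Longrightarrow> norm \<epsilon> \<le> e0 \<Longrightarrow> norm (ev K (G \<phi>) \<epsilon> - g \<phi> \<epsilon>) \<le> C' * norm \<epsilon> ^ Suc K"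
    using G(2) unfolding appr_def by blast
  define L where "L = real ((Suc K)\<^sup>2) * (b * b') + C * (real (Suc K) * b') + (real (Suc K) * b + C) * C'"
  show ?thesis unfolding appr_def
  proof (intro exI[of _ L] conjI ballI allI impI)
    show "L \<ge> 0" unfolding L_def using b b' C C' by (intro add_nonneg_nonneg mult_nonneg_nonneg) auto
    fix \<phi> \<epsilon> assume \<phi>: "\<phi> \<in> B" and \<epsilon>: "norm (\<epsilon>::complex) \<le> e0"
    have \<epsilon>1: "norm \<epsilon> \<le> 1" using \<epsilon> e0 by linarith
    let ?E = "norm \<epsilon> ^ Suc K"
    have E1: "?E \<le> 1" using \<epsilon>1 by (intro power_le_one) auto
    let ?F = "ev K (F \<phi>) \<epsilon>" and ?G = "ev K (G \<phi>) \<epsilon>" and ?f = "f \<phi> \<epsilon>" and ?g = "g \<phi> \<epsilon>"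
    have 1: "norm (ev K (F \<phi> * G \<phi>) \<epsilon> - ?F * ?G) \<le> real ((Suc K)\<^sup>2) * (b * b') * ?E"
      by (rule ev_mult_error[OF b(2)[OF \<phi>] b'(2)[OF \<phi>] \<epsilon>1])
    have Fb: "norm ?F \<le> real (Suc K) * b" by (rule ev_bound[OF b(2)[OF \<phi>] \<epsilon>1])
    have Gb: "norm ?G \<le> real (Suc K) * b'" by (rule ev_bound[OF b'(2)[OF \<phi>] \<epsilon>1])
    have "C * ?E \<le> C * 1" using E1 C by (intro mult_left_mono) auto
    then have fb: "norm ?f \<le> real (Suc K) * b + C"
      using C(2)[OF \<phi> \<epsilon>] Fb norm_triangle_ineq3[of ?f ?F] by (simp add: norm_minus_commute)
    have 2: "norm ((?F - ?f) * ?G) \<le> (C * ?E) * (real (Suc K) * b')"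
      unfolding norm_mult by (intro mult_mono' C(2) \<phi> \<epsilon> Gb) auto
    have 3: "norm (?f * (?G - ?g)) \<le> (real (Suc K) * b + C) * (C' * ?E)"
      unfolding norm_mult by (intro mult_mono' C'(2) \<phi> \<epsilon> fb) auto
    have "ev K (F \<phi> * G \<phi>) \<epsilon> - ?f * ?g = (ev K (F \<phi> * G \<phi>) \<epsilon> - ?F * ?G) + (?F - ?f) * ?G + ?f * (?G - ?g)"
      by (simp add: algebra_simps)
    also have "norm \<dots> \<le> real ((Suc K)\<^sup>2) * (b * b') * ?E + (C * ?E) * (real (Suc K) * b') + (real (Suc K) * b + C) * (C' * ?E)"
      by (intro norm_triangle_mono 1 2 3)
    also have "\<dots> = L * ?E" by (simp add: L_def algebra_simps)
    finally show "norm (ev K (F \<phi> * G \<phi>) \<epsilon> - ?f * ?g) \<le> L * ?E" .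
  qed
qed

lemma ev_const: "ev K (fps_const c) \<epsilon> = c"
  unfolding ev_def by (subst sum.remove[of _ 0]) (auto intro!: sum.neutral)

lemma ev_add: "ev K (F + G) \<epsilon> = ev K F \<epsilon> + ev K G \<epsilon>"
  unfolding ev_def by (simp add: distrib_right sum.distrib)

lemma appr_X: "appr (\<lambda>\<phi>. fps_X) (\<lambda>\<phi> \<epsilon>. \<epsilon>)"
proof -
  have "ev K fps_X \<epsilon> = (if K = 0 then 0 else \<epsilon>)" for \<epsilon>
  proof (cases "K = 0")
    case False
    then have "ev K fps_X \<epsilon> = (\<Sum>k\<in>{1}. fps_nth fps_X k * \<epsilon> ^ k)"
      unfolding ev_def by (intro sum.mono_neutral_right) auto
    with False show ?thesis by simp
  qed (simp add: ev_def)
  then show ?thesis unfolding appr_def by (intro exI[of _ 1]) auto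
qed

lemma appr_ev: "appr F (\<lambda>\<phi> \<epsilon>. ev K (F \<phi>) \<epsilon>)"
  unfolding appr_def by (intro exI[of _ 0]) auto

lemma appr_one: "appr (\<lambda>\<phi>. 1) (\<lambda>\<phi> \<epsilon>. 1)"
  unfolding appr_def using ev_const[of 1] by (intro exI[of _ 0]) auto

lemma appr_power:
  assumes "bd.fam F" "appr F f"
  shows "appr (\<lambda>\<phi>. F \<phi> ^ j) (\<lambda>\<phi> \<epsilon>. f \<phi> \<epsilon> ^ j)"
proof (induction j)
  case 0
  show ?case using appr_one by simp
next
  case (Suc j)
  from appr_mult[OF assms bd.fam_power[OF assms(1)] Suc] show ?case by simp
qed

lemma appr_inv_series:
  assumes C: "bd.fam C"
    and d: "\<And>\<phi> \<epsilon>. \<phi> \<in> B \<Longrightarrow> norm \<epsilon> \<le> e0 \<Longrightarrow> 1 \<le> norm (of_real pi + \<epsilon> * ev K (C \<phi>) \<epsilon>)"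
  shows "appr (\<lambda>\<phi>. inv_series (C \<phi>)) (\<lambda>\<phi> \<epsilon>. \<epsilon> / (of_real pi + \<epsilon> * ev K (C \<phi>) \<epsilon>))"
    and "bd.fam (\<lambda>\<phi>. inv_series (C \<phi>))"
proof -
  define D where "D \<phi> = fps_const (of_real pi) + fps_X * C \<phi>" for \<phi>
  define dd where "dd \<phi> \<epsilon> = of_real pi + \<epsilon> * ev K (C \<phi>) \<epsilon>" for \<phi> \<epsilon>
  have fD: "bd.fam D" unfolding D_def by (intro bd.fam_add bd.fam_mult bd.fam_const C)
  have fI: "bd.fam (\<lambda>\<phi>. inverse (D \<phi>))"
    by (rule bd.fam_inverse[OF fD, of "of_real pi"]) (simp_all add: D_def)
  show "bd.fam (\<lambda>\<phi>. inv_series (C \<phi>))"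
    unfolding inv_series_def D_def[symmetric] by (intro bd.fam_mult bd.fam_const fI)
  have aD: "appr D dd"
    using appr_mult[OF bd.fam_const appr_X C appr_ev] unfolding appr_def D_def dd_def by (simp add: ev_add ev_const)
  have "D \<phi> * inverse (D \<phi>) = 1" for \<phi>
    using inverse_mult_eq_1[of "D \<phi>"] by (simp add: D_def mult.commute)
  then have "appr (\<lambda>\<phi>. 1) (\<lambda>\<phi> \<epsilon>. dd \<phi> \<epsilon> * ev K (inverse (D \<phi>)) \<epsilon>)"
    using appr_mult[OF fD aD fI appr_ev] by simp
  then obtain L where L: "L \<ge> 0" "\<And>\<phi> \<epsilon>. \<phi> \<in> B \<Longrightarrow> norm \<epsilon> \<le> e0 \<Longrightarrow>
     norm (1 - dd \<phi> \<epsilon> * ev K (inverse (D \<phi>)) \<epsilon>) \<le> L * norm \<epsilon> ^ Suc K"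
    unfolding appr_def using ev_const[of 1] by auto
  have "appr (\<lambda>\<phi>. inverse (D \<phi>)) (\<lambda>\<phi> \<epsilon>. 1 / dd \<phi> \<epsilon>)"
    unfolding appr_def
  proof (intro exI[of _ L] conjI ballI allI impI)
    fix \<phi> \<epsilon> assume h: "\<phi> \<in> B" "norm (\<epsilon>::complex) \<le> e0"
    have d1: "1 \<le> norm (dd \<phi> \<epsilon>)" using d[OF h] by (simp add: dd_def)
    then have nz: "dd \<phi> \<epsilon> \<noteq> 0" by auto
    have "norm (ev K (inverse (D \<phi>)) \<epsilon> - 1 / dd \<phi> \<epsilon>) * 1 \<le> norm (ev K (inverse (D \<phi>)) \<epsilon> - 1 / dd \<phi> \<epsilon>) * norm (dd \<phi> \<epsilon>)"
      using d1 by (intro mult_left_mono) auto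
    also have "\<dots> = norm (1 - dd \<phi> \<epsilon> * ev K (inverse (D \<phi>)) \<epsilon>)"
    proof -
      have "(ev K (inverse (D \<phi>)) \<epsilon> - 1 / dd \<phi> \<epsilon>) * dd \<phi> \<epsilon> = - (1 - dd \<phi> \<epsilon> * ev K (inverse (D \<phi>)) \<epsilon>)"
        unfolding left_diff_distrib using nz by simp
      then show ?thesis by (simp only: norm_mult[symmetric] norm_minus_cancel)
    qed
    also have "\<dots> \<le> L * norm \<epsilon> ^ Suc K" by (rule L(2)[OF h])
    finally show "norm (ev K (inverse (D \<phi>)) \<epsilon> - 1 / dd \<phi> \<epsilon>) \<le> L * norm \<epsilon> ^ Suc K" by simp
  qed (rule L(1))
  from appr_mult[OF bd.fam_const appr_X fI this]
  show "appr (\<lambda>\<phi>. inv_series (C \<phi>)) (\<lambda>\<phi> \<epsilon>. \<epsilon> / (of_real pi + \<epsilon> * ev K (C \<phi>) \<epsilon>))"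
    unfolding inv_series_def D_def dd_def by simp
qed

lemma appr_inversion:
  fixes \<kappa> :: "'p \<Rightarrow> nat \<Rightarrow> complex"
  assumes \<kappa>: "\<And>j. j \<ge> 1 \<Longrightarrow> \<exists>C. \<forall>\<phi>\<in>B. norm (\<kappa> \<phi> j) \<le> C"
    and d: "\<And>\<phi> \<epsilon>. \<phi> \<in> B \<Longrightarrow> norm \<epsilon> \<le> e0 \<Longrightarrow> 1 \<le> norm (of_real pi + \<epsilon> * ev K (Abs_fps (inv_coeff (\<kappa> \<phi>))) \<epsilon>)"
  shows "\<exists>L\<ge>0. \<forall>\<phi>\<in>B. \<forall>\<epsilon>. norm \<epsilon> \<le> e0 \<longrightarrow>
     norm (ev K (Abs_fps (inv_coeff (\<kappa> \<phi>))) \<epsilon> -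
       (\<Sum>j=1..K. \<kappa> \<phi> j * (\<epsilon> / (of_real pi + \<epsilon> * ev K (Abs_fps (inv_coeff (\<kappa> \<phi>))) \<epsilon>)) ^ j)) \<le> L * norm \<epsilon> ^ Suc K"
proof -
  define C where "C \<phi> = Abs_fps (inv_coeff (\<kappa> \<phi>))" for \<phi>
  have C: "bd.fam C" unfolding bd.fam_def C_def using bd.inv_coeff_class[OF \<kappa>] by simp
  define v where "v \<phi> \<epsilon> = \<epsilon> / (of_real pi + \<epsilon> * ev K (C \<phi>) \<epsilon>)" for \<phi> \<epsilon>
  have d': "1 \<le> norm (of_real pi + \<epsilon> * ev K (C \<phi>) \<epsilon>)" if "\<phi> \<in> B" "norm \<epsilon> \<le> e0" for \<phi> \<epsilon>
    unfolding C_def by (rule d[OF that])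
  note IS = appr_inv_series[OF C d', folded v_def]
  have "\<forall>j. \<exists>L\<ge>0. \<forall>\<phi>\<in>B. \<forall>\<epsilon>. norm \<epsilon> \<le> e0 \<longrightarrow> norm (ev K (inv_series (C \<phi>) ^ j) \<epsilon> - v \<phi> \<epsilon> ^ j) \<le> L * norm \<epsilon> ^ Suc K"
    using appr_power[OF IS(2,1)] unfolding appr_def by blast
  then obtain L where L: "\<And>j. L j \<ge> 0" "\<And>j \<phi> \<epsilon>. \<phi> \<in> B \<Longrightarrow> norm \<epsilon> \<le> e0 \<Longrightarrow>
     norm (ev K (inv_series (C \<phi>) ^ j) \<epsilon> - v \<phi> \<epsilon> ^ j) \<le> L j * norm \<epsilon> ^ Suc K"
    by metis
  have "\<forall>j. \<exists>b. j \<ge> 1 \<longrightarrow> (\<forall>\<phi>\<in>B. norm (\<kappa> \<phi> j) \<le> b)" using \<kappa> by blast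
  then obtain b where b: "\<And>j \<phi>. j \<ge> 1 \<Longrightarrow> \<phi> \<in> B \<Longrightarrow> norm (\<kappa> \<phi> j) \<le> b j" by metis
  have low: "fps_nth (inv_series F ^ j) k = 0" if "k < j" for F j k
    unfolding inv_series_def power_mult_distrib using that by (simp add: fps_X_power_mult_nth)
  have evC: "ev K (C \<phi>) \<epsilon> = (\<Sum>j=1..K. \<kappa> \<phi> j * ev K (inv_series (C \<phi>) ^ j) \<epsilon>)" for \<phi> \<epsilon>
  proof -
    have "fps_nth (C \<phi>) k = (\<Sum>j=1..K. \<kappa> \<phi> j * fps_nth (inv_series (C \<phi>) ^ j) k)" if "k \<le> K" for k
    proof -
      have "fps_nth (C \<phi>) k = inv_rhs (\<kappa> \<phi>) (C \<phi>) k"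
        unfolding C_def by (simp add: inv_coeff_fixed_point[symmetric])
      also have "\<dots> = (\<Sum>j=1..K. \<kappa> \<phi> j * fps_nth (inv_series (C \<phi>) ^ j) k)"
        unfolding inv_rhs_def using that by (intro sum.mono_neutral_left) (auto simp: low)
      finally show ?thesis .
    qed
    then have "ev K (C \<phi>) \<epsilon> = (\<Sum>k\<le>K. \<Sum>j=1..K. \<kappa> \<phi> j * fps_nth (inv_series (C \<phi>) ^ j) k * \<epsilon> ^ k)"
      unfolding ev_def by (intro sum.cong) (simp_all add: sum_distrib_right)
    also have "\<dots> = (\<Sum>j=1..K. \<kappa> \<phi> j * ev K (inv_series (C \<phi>) ^ j) \<epsilon>)"
      unfolding ev_def sum_distrib_left by (subst sum.swap) (simp add: mult.assoc)
    finally show ?thesis .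
  qed
  show ?thesis unfolding C_def[symmetric] v_def[symmetric]
  proof (intro exI[of _ "\<Sum>j=1..K. \<bar>b j\<bar> * L j"] conjI ballI allI impI)
    show "0 \<le> (\<Sum>j=1..K. \<bar>b j\<bar> * L j)" using L(1) by (intro sum_nonneg) auto
    fix \<phi> \<epsilon> assume h: "\<phi> \<in> B" "norm (\<epsilon>::complex) \<le> e0"
    have "ev K (C \<phi>) \<epsilon> - (\<Sum>j=1..K. \<kappa> \<phi> j * v \<phi> \<epsilon> ^ j) = (\<Sum>j=1..K. \<kappa> \<phi> j * (ev K (inv_series (C \<phi>) ^ j) \<epsilon> - v \<phi> \<epsilon> ^ j))"
      unfolding evC by (simp add: sum_subtractf[symmetric] right_diff_distrib)
    also have "norm \<dots> \<le> (\<Sum>j=1..K. \<bar>b j\<bar> * (L j * norm \<epsilon> ^ Suc K))"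
    proof (rule sum_norm_le)
      fix j assume "j \<in> {1..K}"
      then have "norm (\<kappa> \<phi> j) \<le> \<bar>b j\<bar>" using b[of j \<phi>] h by auto
      then show "norm (\<kappa> \<phi> j * (ev K (inv_series (C \<phi>) ^ j) \<epsilon> - v \<phi> \<epsilon> ^ j)) \<le> \<bar>b j\<bar> * (L j * norm \<epsilon> ^ Suc K)"
        unfolding norm_mult by (intro mult_mono' L(2) h) auto
    qed
    also have "\<dots> = (\<Sum>j=1..K. \<bar>b j\<bar> * L j) * norm \<epsilon> ^ Suc K" by (simp add: sum_distrib_right mult.assoc)
    finally show "norm (ev K (C \<phi>) \<epsilon> - (\<Sum>j=1..K. \<kappa> \<phi> j * v \<phi> \<epsilon> ^ j)) \<le> (\<Sum>j=1..K. \<bar>b j\<bar> * L j) * norm \<epsilon> ^ Suc K" .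
  qed
qed

end

section \<open>The coefficients of the expansion\<close>

lemma sobolev_jet_component:
  assumes a: "sobolev_jet N M a" and N: "N \<ge> 1" and M: "M \<ge> 1" and k: "k \<le> N"
  shows "a k absolutely_integrable_on {0..1}" "(\<lambda>x. (norm (a k x))\<^sup>2) integrable_on {0..1}"
    "integral {0..1} (\<lambda>x. (norm (a k x))\<^sup>2) \<le> M\<^sup>2"
proof -
  have MM: "M \<le> M\<^sup>2" using M by (simp add: power2_eq_square)
  have "a k absolutely_integrable_on {0..1} \<and> (\<lambda>x. (norm (a k x))\<^sup>2) integrable_on {0..1} \<and>
    integral {0..1} (\<lambda>x. (norm (a k x))\<^sup>2) \<le> M\<^sup>2"
  proof (cases "k = N")
    case True
    then show ?thesis using sobolev_jet_top[OF a] MM by auto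
  next
    case False
    then have "k < N" using k by simp
    note d = sobolev_jetD[OF a this]
    have i: "(\<lambda>x. (norm (a k x))\<^sup>2) integrable_on {0..1}"
      by (intro integrable_continuous_real continuous_intros d)
    have "integral {0..1} (\<lambda>x. (norm (a k x))\<^sup>2) \<le> integral {0..1} (\<lambda>x::real. M\<^sup>2)"
      by (rule integral_le[OF i]) (use d(4) in \<open>auto intro!: integrable_continuous_real power_mono\<close>)
    then show ?thesis using i absolutely_integrable_continuous_real[OF d(1)] by simp
  qed
  then show "a k absolutely_integrable_on {0..1}" "(\<lambda>x. (norm (a k x))\<^sup>2) integrable_on {0..1}"
    "integral {0..1} (\<lambda>x. (norm (a k x))\<^sup>2) \<le> M\<^sup>2" by blast+
qed

text \<open>
  For \<open>k = N\<close> the top derivative of \<open>b\<close> occurs linearly, next to continuous factors.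
\<close>

lemma riccati_density_integrable:
  assumes a: "sobolev_jet N M a" and b: "sobolev_jet N M b" and N: "N \<ge> 1" and M: "M \<ge> 1" and k: "k \<le> N"
  shows "(\<lambda>x. a 0 x * dval_at (ric_s k) a b x) absolutely_integrable_on {0..1}"
proof -
  have "continuous_on {0..1} (\<lambda>x. dval_at (ric_m k) a b x)"
    by (rule dval_continuous_on[OF ric_m_below]) (rule sobolev_jetD[OF a] sobolev_jetD[OF b], use k N in linarith)+
  then have "(\<lambda>x. b k x * \<i> + dval_at (ric_m k) a b x) absolutely_integrable_on {0..1}"
    by (intro set_integral_add(1) absolutely_integrable_continuous_real
        absolutely_integrable_mult_continuous' sobolev_jet_component(1)[OF b N M k] continuous_on_const)
  from absolutely_integrable_mult_continuous[OF sobolev_jet_0(1)[OF a N] this]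
  show ?thesis by (simp add: dval_ric_s mult.commute[of \<i>])
qed

lemma riccati_density_bounded:
  assumes N: "N \<ge> 1" and M: "M \<ge> 1" and k: "k \<le> N"
  shows "\<exists>C. \<forall>a b. sobolev_jet N M a \<longrightarrow> sobolev_jet N M b \<longrightarrow>
    norm (integral {0..1} (\<lambda>x. a 0 x * dval_at (ric_s k) a b x)) \<le> C"
proof -
  obtain C where C: "C \<ge> 0" "\<forall>a b. below (k - 1) (ric_m k) \<longrightarrow> (\<forall>j<k - 1. norm (a j) \<le> M \<and> norm (b j) \<le> M) \<longrightarrow>
      norm (dval (ric_m k) a b) \<le> C"
    using dval_bound by blast
  show ?thesis
  proof (intro exI allI impI)
    fix a b assume a: "sobolev_jet N M a" and b: "sobolev_jet N M b"
    note bk = sobolev_jet_component[OF b N M k]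
    have i: "(\<lambda>x. norm (b k x)) integrable_on {0..1}" by (rule absolutely_integrableD(2)[OF bk(1)])
    have c: "(\<lambda>x. C) integrable_on {0..1::real}" by (rule integrable_continuous_real) simp
    have "norm (integral {0..1} (\<lambda>x. a 0 x * dval_at (ric_s k) a b x))
        \<le> integral {0..1} (\<lambda>x. M * (norm (b k x) + C))"
    proof (rule integral_norm_bound_integral)
      show "(\<lambda>x. a 0 x * dval_at (ric_s k) a b x) integrable_on {0..1}"
        by (rule absolutely_integrableD(1)[OF riccati_density_integrable[OF a b N M k]])
      show "(\<lambda>x. M * (norm (b k x) + C)) integrable_on {0..1}"
        by (intro integrable_on_mult_right integrable_add i c)
      fix x :: real assume x: "x \<in> {0..1}"
      have "norm (dval_at (ric_m k) a b x) \<le> C"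
        by (rule C(2)[rule_format, OF ric_m_below], intro conjI sobolev_jetD(4)[OF a _ x] sobolev_jetD(4)[OF b _ x])
          (use k N in linarith)+
      then have "norm (dval_at (ric_s k) a b x) \<le> norm (b k x) + C"
        unfolding dval_ric_s by (intro norm_triangle_mono) (auto simp: norm_mult)
      then show "norm (a 0 x * dval_at (ric_s k) a b x) \<le> M * (norm (b k x) + C)"
        unfolding norm_mult by (intro mult_mono' sobolev_jet_0(2)[OF a N x]) auto
    qed
    also have "\<dots> = M * (integral {0..1} (\<lambda>x. norm (b k x)) + C)"
      using integral_add[OF i c] by simp
    also have "\<dots> \<le> M * (1 + M\<^sup>2 + C)"
      using integral_norm_le_of_square[OF bk] M by (intro mult_left_mono) auto
    finally show "norm (integral {0..1} (\<lambda>x. a 0 x * dval_at (ric_s k) a b x)) \<le> M * (1 + M\<^sup>2 + C)" .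
  qed
qed

text \<open>
  The density of the coefficient of \<open>z ^ - (k + 1)\<close>. The sign \<open>(- 1) ^ (k + 1)\<close> belongs to the mirrored term, in
  which \<open>\<zeta>\<close> changes sign.
\<close>

definition exp_density :: "nat \<Rightarrow> dexpr" where
  "exp_density k = Times (Cst (1 / (2 * (2 * \<i>) ^ Suc k)))
     (Plus (Times (VarP 0) (ric_s k)) (Times (Cst ((- 1) ^ Suc k)) (Times (VarQ 0) (dmirror (ric_s k)))))"

text \<open>
  The coefficients \<open>\<kappa>\<^sub>j\<close> of \<open>z - n \<pi>\<close> in powers of \<open>1 / z\<close>. Only \<open>j \<ge> 1\<close> is meaningful, hence the shift of the index.
\<close>

definition exp_coeff :: "fun_pair \<Rightarrow> nat \<Rightarrow> complex" where
  "exp_coeff \<phi> j = diff_poly_integral (to_diff_poly (exp_density (j - 1))) \<phi>"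

definition jet_coeff :: "(nat \<Rightarrow> cfn) \<Rightarrow> (nat \<Rightarrow> cfn) \<Rightarrow> nat \<Rightarrow> complex" where
  "jet_coeff a b k = 1 / (2 * (2 * \<i>) ^ Suc k) *
     (integral {0..1} (\<lambda>x. a 0 x * dval_at (ric_s k) a b x) -
      (- 1) ^ Suc k * integral {0..1} (\<lambda>x. - b 0 x * dval (ric_s k) (\<lambda>j. - b j x) (\<lambda>j. - a j x)))"

lemma below_exp_density: "below (Suc k) (exp_density k)"
  by (simp add: exp_density_def below_dmirror ric_s_below)

lemma dval_exp_density:
  "dval (exp_density k) a b = 1 / (2 * (2 * \<i>) ^ Suc k) *
     (a 0 * dval (ric_s k) a b - (- 1) ^ Suc k * (- b 0 * dval (ric_s k) (\<lambda>j. - b j) (\<lambda>j. - a j)))"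
  unfolding exp_density_def dval.simps dval_dmirror by (simp only: mult_minus_left mult_minus_right diff_minus_eq_add)

lemma exp_density_integral:
  assumes a: "sobolev_jet N M a" and b: "sobolev_jet N M b" and N: "N \<ge> 1" and M: "M \<ge> 1" and k: "k \<le> N"
  shows "(\<lambda>x. dval_at (exp_density k) a b x) absolutely_integrable_on {0..1}"
    and "integral {0..1} (\<lambda>x. dval_at (exp_density k) a b x) = jet_coeff a b k"
proof -
  note i1 = riccati_density_integrable[OF a b N M k]
  note i2 = riccati_density_integrable[OF sobolev_jet_minus[OF b] sobolev_jet_minus[OF a] N M k]
  have s: "(\<lambda>x. c * f x) absolutely_integrable_on {0..1}" if "f absolutely_integrable_on {0..1}" for c and f :: cfn
    by (rule absolutely_integrable_mult_continuous[OF continuous_on_const that])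
  show "(\<lambda>x. dval_at (exp_density k) a b x) absolutely_integrable_on {0..1}"
    unfolding dval_exp_density by (intro s set_integral_diff(1) i1 i2)
  show "integral {0..1} (\<lambda>x. dval_at (exp_density k) a b x) = jet_coeff a b k"
    unfolding dval_exp_density jet_coeff_def integral_mult_right
    by (subst HK_integral_diff)
      (simp_all only: integral_mult_right absolutely_integrableD(1)[OF i1] absolutely_integrableD(1)[OF s[OF i2]])
qed

lemma jet_coeff_bounded:
  assumes N: "N \<ge> 1" and M: "M \<ge> 1" and k: "k \<le> N"
  shows "\<exists>C. \<forall>a b. sobolev_jet N M a \<longrightarrow> sobolev_jet N M b \<longrightarrow> norm (jet_coeff a b k) \<le> C"
proof -
  obtain C where C: "\<And>a b. sobolev_jet N M a \<Longrightarrow> sobolev_jet N M b \<Longrightarrow>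
    norm (integral {0..1} (\<lambda>x. a 0 x * dval_at (ric_s k) a b x)) \<le> C"
    using riccati_density_bounded[OF N M k] by blast
  show ?thesis
  proof (intro exI allI impI)
    fix a b assume a: "sobolev_jet N M a" and b: "sobolev_jet N M b"
    show "norm (jet_coeff a b k) \<le> norm (1 / (2 * (2 * \<i>) ^ Suc k)) * (C + 1 * C)"
      unfolding jet_coeff_def norm_mult[of "1 / _"]
    proof (intro mult_left_mono norm_ge_zero order_trans[OF norm_triangle_ineq4] add_mono C[OF a b])
      have "norm (integral {0..1} (\<lambda>x. - b 0 x * dval (ric_s k) (\<lambda>j. - b j x) (\<lambda>j. - a j x))) \<le> C"
        by (rule C[OF sobolev_jet_minus[OF b] sobolev_jet_minus[OF a]])
      then show "norm ((- 1) ^ Suc k * integral {0..1} (\<lambda>x. - b 0 x * dval (ric_s k) (\<lambda>j. - b j x) (\<lambda>j. - a j x))) \<le> 1 * C"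
        by (simp only: norm_mult norm_power norm_minus_cancel norm_one power_one mult_1)
    qed
  qed
qed

text \<open>
  Classical data for a potential. For \<open>j = 0\<close> the function itself is compared as well, since \<open>weak_deriv 0\<close> agrees with
  it only almost everywhere.
\<close>

definition jets_of :: "nat \<Rightarrow> real \<Rightarrow> fun_pair \<Rightarrow> (nat \<Rightarrow> cfn) \<Rightarrow> (nat \<Rightarrow> cfn) \<Rightarrow> bool" where
  "jets_of N M \<phi> a b \<longleftrightarrow> sobolev_jet N M a \<and> sobolev_jet N M b \<and>
     (AE x in lebesgue. x \<in> {0..1} \<longrightarrow> (\<forall>j\<le>N. weak_deriv j (fst \<phi>) x = a j x \<and> weak_deriv j (snd \<phi>) x = b j x)) \<and>
     (AE x in lebesgue. x \<in> {0..1} \<longrightarrow> fst \<phi> x = a 0 x) \<and> (AE x in lebesgue. x \<in> {0..1} \<longrightarrow> snd \<phi> x = b 0 x)"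

lemma Hc_jets:
  assumes \<phi>: "\<phi> \<in> Hc N" and N: "N \<ge> 1" and R: "Hc_norm N \<phi> \<le> R"
  obtains a b where "jets_of N (1 + R\<^sup>2) \<phi> a b"
proof -
  have u: "fst \<phi> \<in> H_per N" "snd \<phi> \<in> H_per N" using \<phi> by (auto simp: Hc_def)
  have "H_norm N (fst \<phi>) \<le> R" "H_norm N (snd \<phi>) \<le> R"
    using real_sqrt_sum_squares_ge1[of "H_norm N (fst \<phi>)" "H_norm N (snd \<phi>)"]
      real_sqrt_sum_squares_ge2[of "H_norm N (snd \<phi>)" "H_norm N (fst \<phi>)"] R unfolding Hc_norm_def by linarith+
  note n = this
  obtain a where a: "sobolev_jet N (1 + R\<^sup>2) a"
    "\<And>j. j \<le> N \<Longrightarrow> AE x in lebesgue. x \<in> {0..1} \<longrightarrow> weak_deriv j (fst \<phi>) x = a j x"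
    "AE x in lebesgue. x \<in> {0..1} \<longrightarrow> fst \<phi> x = a 0 x" using H_per_sobolev_jet[OF u(1) N n(1)] by blast
  obtain b where b: "sobolev_jet N (1 + R\<^sup>2) b"
    "\<And>j. j \<le> N \<Longrightarrow> AE x in lebesgue. x \<in> {0..1} \<longrightarrow> weak_deriv j (snd \<phi>) x = b j x"
    "AE x in lebesgue. x \<in> {0..1} \<longrightarrow> snd \<phi> x = b 0 x" using H_per_sobolev_jet[OF u(2) N n(2)] by blast
  have "AE x in lebesgue. \<forall>j\<in>{..N}. x \<in> {0..1} \<longrightarrow> weak_deriv j (fst \<phi>) x = a j x \<and> weak_deriv j (snd \<phi>) x = b j x"
  proof (rule AE_finite_allI)
    fix j assume "j \<in> {..N}"
    then have "j \<le> N" by simp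
    from a(2)[OF this] b(2)[OF this]
    show "AE x in lebesgue. x \<in> {0..1} \<longrightarrow> weak_deriv j (fst \<phi>) x = a j x \<and> weak_deriv j (snd \<phi>) x = b j x"
      by eventually_elim simp
  qed simp
  then have "AE x in lebesgue. x \<in> {0..1} \<longrightarrow> (\<forall>j\<le>N. weak_deriv j (fst \<phi>) x = a j x \<and> weak_deriv j (snd \<phi>) x = b j x)"
    by eventually_elim simp
  with a b show ?thesis using that[of a b] unfolding jets_of_def by blast
qed

lemma exp_density_potential:
  assumes j: "jets_of N M \<phi> a b" and N: "N \<ge> 1" and M: "M \<ge> 1" and k: "k \<le> N"
  shows "set_integrable lebesgue {0..1} (\<lambda>x. diff_poly_eval (to_diff_poly (exp_density k)) (jet \<phi> x))"
    and "exp_coeff \<phi> (Suc k) = jet_coeff a b k"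
proof -
  note jj = j[unfolded jets_of_def]
  have ae: "AE x in lebesgue. x \<in> {0..1} \<longrightarrow> diff_poly_eval (to_diff_poly (exp_density k)) (jet \<phi> x) =
      dval_at (exp_density k) a b x"
    using conjunct1[OF conjunct2[OF conjunct2[OF jj]]]
  proof eventually_elim
    case (elim x)
    have "dval (exp_density k) (\<lambda>i. weak_deriv i (fst \<phi>) x) (\<lambda>i. weak_deriv i (snd \<phi>) x)
        = dval_at (exp_density k) a b x" if "x \<in> {0..1}"
      by (rule dval_cong[OF below_exp_density]) (use elim that k in auto)
    then show ?case unfolding jet_def diff_poly_eval_to_diff_poly by blast
  qed
  note e = exp_density_integral[OF conjunct1[OF jj] conjunct1[OF conjunct2[OF jj]] N M k]
  show i: "set_integrable lebesgue {0..1} (\<lambda>x. diff_poly_eval (to_diff_poly (exp_density k)) (jet \<phi> x))"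
    using e(1) integral_cong_AE_on(3)[OF ae order_refl] by simp
  show "exp_coeff \<phi> (Suc k) = jet_coeff a b k"
    unfolding exp_coeff_def diff_poly_integral_def diff_Suc_1 set_lebesgue_integral_eq_integral(2)[OF i]
    using e(2) integral_cong_AE_on(1)[OF ae order_refl] by simp
qed

lemma fourier_coeff_eq:
  assumes ae: "AE x in lebesgue. x \<in> {0..1} \<longrightarrow> u x = f x" and f: "continuous_on {0..1} f"
  shows "fourier_coeff u n = trunc_four f n 1"
proof -
  have ae': "AE x in lebesgue. x \<in> {0..1} \<longrightarrow> u x * exp (- 2 * of_real pi * \<i> * of_int n * of_real x) = f x * osc (- n) x"
    using ae by eventually_elim (auto simp: osc_def mult_ac)
  have "(\<lambda>x. f x * osc (- n) x) absolutely_integrable_on {0..1}"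
    by (intro absolutely_integrable_continuous_real continuous_intros f osc_cont)
  then have i: "(\<lambda>x. u x * exp (- 2 * of_real pi * \<i> * of_int n * of_real x)) absolutely_integrable_on {0..1}"
    using integral_cong_AE_on(3)[OF ae' order_refl] by simp
  show ?thesis
    unfolding fourier_coeff_def trunc_four_def set_lebesgue_integral_eq_integral(2)[OF i]
    by (rule integral_cong_AE_on(1)[OF ae' order_refl])
qed

text \<open>
  The potentials on which the \<open>k\<close>-th coefficient is defined. For \<open>k = N + 1\<close> its density contains the derivatives of
  order \<open>N\<close>.
\<close>

definition admissible :: "nat \<Rightarrow> fun_pair set" where
  "admissible k = (\<Union>N\<in>{N. 1 \<le> N \<and> k \<le> N + 1}. Hc N)"

lemma admissible_antimono: "i \<le> k \<Longrightarrow> admissible k \<subseteq> admissible i"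
  unfolding admissible_def by fastforce

lemma given_by_integrals_mono:
  assumes "given_by_integrals i X c" "i \<le> k" "Y \<subseteq> X"
  shows "given_by_integrals k Y c"
proof -
  have "Inl ` {..<i} \<union> Inr ` {..<i} \<subseteq> (Inl ` {..<k} \<union> Inr ` {..<k} :: (nat + nat) set)" using assms(2) by auto
  then have v: "diff_poly_vars p \<subseteq> Inl ` {..<k} \<union> Inr ` {..<k}" if "diff_poly_vars p \<subseteq> Inl ` {..<i} \<union> Inr ` {..<i}" for p
    using that by (rule order_trans[rotated])
  obtain P where P: "\<forall>ps\<in>set P. \<forall>p\<in>set ps. diff_poly_vars p \<subseteq> Inl ` {..<i} \<union> Inr ` {..<i} \<and>
           (\<forall>\<phi>\<in>X. set_integrable lebesgue {0..1} (\<lambda>x. diff_poly_eval p (jet \<phi> x)))"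
    "\<forall>\<phi>\<in>X. c \<phi> = (\<Sum>ps\<leftarrow>P. \<Prod>p\<leftarrow>ps. diff_poly_integral p \<phi>)"
    using assms(1) unfolding given_by_integrals_def by blast
  show ?thesis unfolding given_by_integrals_def
    by (rule exI[of _ P]) (intro conjI ballI v; use P assms(3) in blast)
qed

lemma given_by_integrals_add:
  assumes "given_by_integrals k X c" "given_by_integrals k X d"
  shows "given_by_integrals k X (\<lambda>\<phi>. c \<phi> + d \<phi>)"
proof -
  let ?ok = "\<lambda>p. diff_poly_vars p \<subseteq> Inl ` {..<k} \<union> Inr ` {..<k} \<and>
           (\<forall>\<phi>\<in>X. set_integrable lebesgue {0..1} (\<lambda>x. diff_poly_eval p (jet \<phi> x)))"
  obtain P where P: "\<forall>ps\<in>set P. \<forall>p\<in>set ps. ?ok p" "\<forall>\<phi>\<in>X. c \<phi> = (\<Sum>ps\<leftarrow>P. \<Prod>p\<leftarrow>ps. diff_poly_integral p \<phi>)"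
    using assms(1) unfolding given_by_integrals_def by blast
  obtain Q where Q: "\<forall>ps\<in>set Q. \<forall>p\<in>set ps. ?ok p" "\<forall>\<phi>\<in>X. d \<phi> = (\<Sum>ps\<leftarrow>Q. \<Prod>p\<leftarrow>ps. diff_poly_integral p \<phi>)"
    using assms(2) unfolding given_by_integrals_def by blast
  show ?thesis unfolding given_by_integrals_def
  proof (intro exI[of _ "P @ Q"] conjI)
    show "\<forall>ps\<in>set (P @ Q). \<forall>p\<in>set ps. ?ok p" using P(1) Q(1) unfolding set_append by blast
    show "\<forall>\<phi>\<in>X. c \<phi> + d \<phi> = (\<Sum>ps\<leftarrow>P @ Q. \<Prod>p\<leftarrow>ps. diff_poly_integral p \<phi>)"
      using P(2) Q(2) by simp
  qed
qed

lemma given_by_integrals_mult: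
  assumes "given_by_integrals k X c" "given_by_integrals k X d"
  shows "given_by_integrals k X (\<lambda>\<phi>. c \<phi> * d \<phi>)"
proof -
  let ?ok = "\<lambda>p. diff_poly_vars p \<subseteq> Inl ` {..<k} \<union> Inr ` {..<k} \<and>
           (\<forall>\<phi>\<in>X. set_integrable lebesgue {0..1} (\<lambda>x. diff_poly_eval p (jet \<phi> x)))"
  obtain P where P: "\<forall>ps\<in>set P. \<forall>p\<in>set ps. ?ok p" "\<forall>\<phi>\<in>X. c \<phi> = (\<Sum>ps\<leftarrow>P. \<Prod>p\<leftarrow>ps. diff_poly_integral p \<phi>)"
    using assms(1) unfolding given_by_integrals_def by blast
  obtain Q where Q: "\<forall>ps\<in>set Q. \<forall>p\<in>set ps. ?ok p" "\<forall>\<phi>\<in>X. d \<phi> = (\<Sum>ps\<leftarrow>Q. \<Prod>p\<leftarrow>ps. diff_poly_integral p \<phi>)"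
    using assms(2) unfolding given_by_integrals_def by blast
  have inner: "(\<Sum>qs\<leftarrow>Q. \<Prod>p\<leftarrow>ps @ qs. diff_poly_integral p \<phi>) =
      (\<Prod>p\<leftarrow>ps. diff_poly_integral p \<phi>) * (\<Sum>qs\<leftarrow>Q. \<Prod>p\<leftarrow>qs. diff_poly_integral p \<phi>)" for ps :: "diff_poly list" and \<phi> and Q
    by (induction Q) (simp_all add: distrib_left)
  have outer: "(\<Sum>rs\<leftarrow>concat (map (\<lambda>ps. map (\<lambda>qs. ps @ qs) Q) P). \<Prod>p\<leftarrow>rs. diff_poly_integral p \<phi>) =
      (\<Sum>ps\<leftarrow>P. \<Prod>p\<leftarrow>ps. diff_poly_integral p \<phi>) * (\<Sum>qs\<leftarrow>Q. \<Prod>p\<leftarrow>qs. diff_poly_integral p \<phi>)" for P \<phi>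
    using inner[of _ _ Q] by (induction P) (simp_all add: distrib_right comp_def)
  show ?thesis unfolding given_by_integrals_def
  proof (intro exI[of _ "concat (map (\<lambda>ps. map (\<lambda>qs. ps @ qs) Q) P)"] conjI)
    show "\<forall>ps\<in>set (concat (map (\<lambda>ps. map (\<lambda>qs. ps @ qs) Q) P)). \<forall>p\<in>set ps. ?ok p"
    proof (intro ballI)
      fix rs p assume "rs \<in> set (concat (map (\<lambda>ps. map (\<lambda>qs. ps @ qs) Q) P))" "p \<in> set rs"
      then obtain ps qs where "ps \<in> set P" "qs \<in> set Q" "p \<in> set ps \<union> set qs" by auto
      then show "?ok p" using P(1) Q(1) by blast
    qed
    show "\<forall>\<phi>\<in>X. c \<phi> * d \<phi> = (\<Sum>ps\<leftarrow>concat (map (\<lambda>ps. map (\<lambda>qs. ps @ qs) Q) P). \<Prod>p\<leftarrow>ps. diff_poly_integral p \<phi>)"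
      unfolding outer using P(2) Q(2) by simp
  qed
qed

lemma given_by_integrals_const: "given_by_integrals k X (\<lambda>\<phi>. c)"
proof -
  have e: "diff_poly_eval (to_diff_poly (Cst c)) a = c" for a
    using diff_poly_eval_to_diff_poly[of "Cst c" "a \<circ> Inl" "a \<circ> Inr"] by (simp add: diff_poly_eval_single monomial_eval_def)
  have i: "(\<lambda>x::real. c) absolutely_integrable_on {0..1}" by (rule absolutely_integrable_continuous_real) simp
  have "diff_poly_integral (to_diff_poly (Cst c)) \<phi> = c" for \<phi>
    unfolding diff_poly_integral_def e set_lebesgue_integral_eq_integral(2)[OF i] by simp
  moreover have "diff_poly_vars (to_diff_poly (Cst c)) \<subseteq> Inl ` {..<k} \<union> Inr ` {..<k}"
    by (rule diff_poly_vars_to_diff_poly) simp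
  ultimately show ?thesis
    unfolding given_by_integrals_def using i
    by (intro exI[of _ "[[to_diff_poly (Cst c)]]"]) (simp add: e del: to_diff_poly.simps)
qed

interpretation integrals: graded_class "\<lambda>k. given_by_integrals k (admissible k)"
proof
  fix i k :: nat and f assume f: "given_by_integrals i (admissible i) f" and ik: "i \<le> k"
  show "given_by_integrals k (admissible k) f"
    by (rule given_by_integrals_mono[OF f ik admissible_antimono[OF ik]])
qed (rule given_by_integrals_const | (rule given_by_integrals_add given_by_integrals_mult; assumption))+

lemma exp_coeff_given_by_integrals:
  assumes "j \<ge> 1"
  shows "given_by_integrals j (admissible j) (\<lambda>\<phi>. exp_coeff \<phi> j)"
proof -
  obtain k where k: "j = Suc k" using assms by (cases j) auto
  have i: "set_integrable lebesgue {0..1} (\<lambda>x. diff_poly_eval (to_diff_poly (exp_density k)) (jet \<phi> x))"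
    if "\<phi> \<in> admissible j" for \<phi>
  proof -
    obtain N where N: "1 \<le> N" "j \<le> N + 1" "\<phi> \<in> Hc N" using \<open>\<phi> \<in> admissible j\<close> unfolding admissible_def by blast
    obtain a b where "jets_of N (1 + (Hc_norm N \<phi>)\<^sup>2) \<phi> a b" using Hc_jets[OF N(3,1) order_refl] by blast
    from exp_density_potential(1)[OF this N(1), of k] show ?thesis using N(2) k by simp
  qed
  show ?thesis unfolding given_by_integrals_def
    by (rule exI[of _ "[[to_diff_poly (exp_density k)]]"])
      (use diff_poly_vars_to_diff_poly[OF below_exp_density, of k] i in \<open>auto simp: k exp_coeff_def\<close>)
qed

definition eig_coeff :: "nat \<Rightarrow> fun_pair \<Rightarrow> complex" where
  "eig_coeff k \<phi> = inv_coeff (exp_coeff \<phi>) k"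

theorem eig_coeff_given_by_integrals: "given_by_integrals k (admissible k) (eig_coeff k)"
  unfolding eig_coeff_def[abs_def] by (rule integrals.inv_coeff_class[OF exp_coeff_given_by_integrals])

section \<open>Numbering of the eigenvalues\<close>

lemma summable_imp_finite_large:
  fixes f :: "'a \<Rightarrow> real"
  assumes f: "f summable_on UNIV" "\<And>x. f x \<ge> 0" and c: "c > 0"
  shows "finite {x. f x \<ge> c}"
proof (rule ccontr)
  assume inf: "infinite {x. f x \<ge> c}"
  obtain m :: nat where m: "infsum f UNIV < real m * c" using c reals_Archimedean3 by blast
  obtain F where F: "finite F" "card F = m" "F \<subseteq> {x. f x \<ge> c}" using infinite_arbitrarily_large[OF inf] by blast
  have "real m * c = (\<Sum>x\<in>F. c)" using F by simp
  also have "\<dots> \<le> sum f F" using F by (intro sum_mono) auto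
  also have "\<dots> \<le> infsum f UNIV" by (rule finite_sum_le_infsum[OF f(1) F(1)]) (use f(2) in auto)
  finally show False using m by simp
qed

text \<open>
  The threshold \<open>L\<close> depends only on \<open>N\<close> and the bound \<open>M\<close>. The summability required of \<open>\<mu>\<close> serves only to start
  the induction of \<open>lex_enumeration\<close>, at an index that may depend on the potential.
\<close>

theorem dirichlet_numbering:
  assumes N: "N \<ge> 1" and M: "M \<ge> 1"
  obtains L :: int where "L \<ge> 1"
    "\<And>\<phi> a b \<mu> n. jets_of N M \<phi> a b \<Longrightarrow> dirichlet_eigenvalues \<phi> \<mu> \<Longrightarrow> \<bar>n\<bar> \<ge> L \<Longrightarrow>
       dir_eigenvalue (a 0) (b 0) (\<mu> n) \<and> norm (\<mu> n - npi n) \<le> 1 / 8"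
proof (rule spectral_picture[OF N M], goal_cases)
  case (1 C K)
  note K = 1(3) and loc = 1(4) and nz = 1(5) and uniq = 1(6) and ex = 1(7)
  define L where "L = \<lceil>K\<rceil>"
  have L: "K \<le> real_of_int L" "L \<ge> 1" using K unfolding L_def by linarith+
  show ?thesis
  proof (rule that[OF L(2)])
    fix \<phi> a b \<mu> and n :: int
    assume j: "jets_of N M \<phi> a b" and \<mu>: "dirichlet_eigenvalues \<phi> \<mu>" and n: "\<bar>n\<bar> \<ge> L"
    have a: "sobolev_jet N M a" and b: "sobolev_jet N M b"
      and ae: "AE x in lebesgue. x \<in> {0..1} \<longrightarrow> fst \<phi> x = a 0 x" "AE x in lebesgue. x \<in> {0..1} \<longrightarrow> snd \<phi> x = b 0 x"
      using j unfolding jets_of_def by blast+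
    interpret classical_potential \<phi> "a 0" "b 0"
      by unfold_locales (rule sobolev_jet_0(1)[OF a N] sobolev_jet_0(1)[OF b N] ae)+
    have fin: "finite {n. \<mu> n = z}" and card: "card {n. \<mu> n = z} = alg_mult \<phi> z" for z
      using \<mu> unfolding dirichlet_eigenvalues_def by blast+
    have ev: "dir_eigenvalue (a 0) (b 0) (\<mu> k)" for k
    proof (rule alg_mult_pos_imp_eigenvalue)
      have "card {n. \<mu> n = \<mu> k} \<noteq> 0" using fin[of "\<mu> k"] by auto
      then show "alg_mult \<phi> (\<mu> k) \<noteq> 0" using card by simp
    qed
    have "\<forall>m. \<exists>z. \<bar>m\<bar> \<ge> L \<longrightarrow> dir_eigenvalue (a 0) (b 0) z \<and> norm (z - npi m) \<le> 1 / 8"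
    proof
      fix m
      show "\<exists>z. \<bar>m\<bar> \<ge> L \<longrightarrow> dir_eigenvalue (a 0) (b 0) z \<and> norm (z - npi m) \<le> 1 / 8"
      proof (cases "\<bar>m\<bar> \<ge> L")
        case True
        then have "K \<le> \<bar>real_of_int m\<bar>" using L by linarith
        from ex[OF a b this] show ?thesis by blast
      qed simp
    qed
    then obtain w where w: "\<And>m. \<bar>m\<bar> \<ge> L \<Longrightarrow> dir_eigenvalue (a 0) (b 0) (w m)"
      "\<And>m. \<bar>m\<bar> \<ge> L \<Longrightarrow> norm (w m - npi m) \<le> 1 / 8" by metis
    have big: "K \<le> norm z" if "\<bar>m\<bar> \<ge> L" "norm (z - npi m) \<le> 1 / 8" for z :: complex and m
      using norm_near_multiple_pi[OF that(2)] that(1) L by linarith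
    have "\<mu> n = w n"
    proof (rule lex_enumeration[where L = L])
      show "lex_le (\<mu> n) (\<mu> (n + 1))" for n using \<mu> unfolding dirichlet_eigenvalues_def by blast
      have "(\<lambda>n. (norm (\<mu> n - npi n))\<^sup>2) summable_on UNIV"
        using \<mu> unfolding dirichlet_eigenvalues_def by blast
      from summable_imp_finite_large[OF this, of "(1 / 8)\<^sup>2"]
      have "finite {n. (1 / 8)\<^sup>2 \<le> (norm (\<mu> n - npi n))\<^sup>2}" by simp
      then show "finite {n. \<not> norm (\<mu> n - npi n) \<le> 1 / 8}"
        by (rule rev_finite_subset) (auto intro!: power_mono simp del: power_divide)
      fix k
      show "\<exists>m::int. norm (\<mu> k - npi m) \<le> 1 / 8" if "real_of_int L \<le> norm (\<mu> k)"
      proof -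
        have "K \<le> norm (\<mu> k)" using that L by linarith
        from loc[OF a b ev this] obtain m :: int where "norm (\<mu> k - npi m) \<le> 1 / 16" by blast
        then have "norm (\<mu> k - npi m) \<le> 1 / 8" by linarith
        then show ?thesis ..
      qed
      show "norm (w m - npi m) \<le> 1 / 8" if "\<bar>m\<bar> \<ge> L" for m by (rule w(2)[OF that])
      show "\<mu> k = w m" if m: "\<bar>m\<bar> \<ge> L" and d: "norm (\<mu> k - npi m) \<le> 1 / 8" for m
      proof (rule uniq[OF a b ev w(1)[OF m] big[OF m d] big[OF m w(2)[OF m]]])
        have "norm (\<mu> k - w m) = norm ((\<mu> k - npi m) - (w m - npi m))" by simp
        also have "\<dots> \<le> 1 / 8 + 1 / 8" by (rule norm_triangle_le_diff) (rule add_mono[OF d w(2)[OF m]])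
        finally show "norm (\<mu> k - w m) \<le> 1 / 4" by simp
      qed
      show "card {n. \<mu> n = w m} = 1" if m: "\<bar>m\<bar> \<ge> L" for m
        unfolding card by (rule alg_mult_eq_1[OF w(1)[OF m] nz[OF a b w(1)[OF m] big[OF m w(2)[OF m]]]])
    qed (use L n in auto)
    then show "dir_eigenvalue (a 0) (b 0) (\<mu> n) \<and> norm (\<mu> n - npi n) \<le> 1 / 8"
      using w n by simp
  qed
qed

section \<open>Asymptotics in powers of the eigenvalue\<close>

text \<open>
  The truncated Fourier coefficients that control the error: those of the top derivative of \<open>q\<close> and of the remainder
  \<open>rem1\<close>, from the residual, and of \<open>p'\<close>, from \<open>refined_integral\<close>.
\<close>

definition energy :: "nat \<Rightarrow> (nat \<Rightarrow> cfn) \<Rightarrow> (nat \<Rightarrow> cfn) \<Rightarrow> int \<Rightarrow> real" where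
  "energy N a b n = four_energy (b N) n +
     four_energy (\<lambda>x. dval_at (ric_m (Suc N)) a b x) n + four_energy (a 1) (- n)"

definition energies where
  "energies N a b n = energy N a b n + energy N (\<lambda>j x. - b j x) (\<lambda>j x. - a j x) (- n)"

definition bessel_class :: "real \<Rightarrow> (cfn) \<Rightarrow> bool" where
  "bessel_class G g \<longleftrightarrow> g absolutely_integrable_on {0..1} \<and> (\<lambda>x. (norm (g x))\<^sup>2) integrable_on {0..1} \<and>
     integral {0..1} (\<lambda>x. (norm (g x))\<^sup>2) \<le> G"

lemma ric_m_Suc_bessel:
  assumes N: "N \<ge> 1"
  shows "\<exists>G\<ge>0. \<forall>a b. sobolev_jet N M a \<longrightarrow> sobolev_jet N M b \<longrightarrow>
     bessel_class G (\<lambda>x. dval_at (ric_m (Suc N)) a b x)"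
proof -
  have bl: "below N (ric_m (Suc N))" using ric_m_below[of "Suc N"] by simp
  obtain C where C: "C \<ge> 0" "\<forall>a b. below N (ric_m (Suc N)) \<longrightarrow> (\<forall>j<N. norm (a j) \<le> M \<and> norm (b j) \<le> M) \<longrightarrow>
      norm (dval (ric_m (Suc N)) a b) \<le> C"
    using dval_bound by blast
  show ?thesis
  proof (intro exI[of _ "C\<^sup>2"] conjI allI impI)
    fix a b assume a: "sobolev_jet N M a" and b: "sobolev_jet N M b"
    let ?g = "\<lambda>x. dval_at (ric_m (Suc N)) a b x"
    have c: "continuous_on {0..1} ?g"
      by (rule dval_continuous_on[OF bl]) (erule sobolev_jetD[OF a] sobolev_jetD[OF b])+
    have i: "(\<lambda>x. (norm (?g x))\<^sup>2) integrable_on {0..1}"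
      by (intro integrable_continuous_real continuous_intros c)
    have "integral {0..1} (\<lambda>x. (norm (?g x))\<^sup>2) \<le> integral {0..1} (\<lambda>x::real. C\<^sup>2)"
    proof (rule integral_le[OF i])
      fix x :: real assume x: "x \<in> {0..1}"
      have "norm (?g x) \<le> C"
        by (rule C(2)[rule_format, OF bl]) (intro conjI sobolev_jetD(4)[OF a _ x] sobolev_jetD(4)[OF b _ x])
      then show "(norm (?g x))\<^sup>2 \<le> C\<^sup>2" by (intro power_mono) auto
    qed (intro integrable_continuous_real continuous_on_const)
    then show "bessel_class (C\<^sup>2) ?g"
      unfolding bessel_class_def using i absolutely_integrable_continuous_real[OF c] by simp
  qed simp
qed

lemma sum_int_uminus:
  fixes f :: "int \<Rightarrow> 'b::comm_monoid_add"
  shows "(\<Sum>n\<in>A. f (- n)) = (\<Sum>n\<in>uminus ` A. f n)"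
  by (subst sum.reindex) (auto simp: inj_on_def)

lemma energy_sum_bounded:
  assumes N: "N \<ge> 1" and M: "M \<ge> 1"
  shows "\<exists>G. \<forall>a b A. sobolev_jet N M a \<longrightarrow> sobolev_jet N M b \<longrightarrow> finite A \<longrightarrow> (\<Sum>n\<in>A. energy N a b n) \<le> G \<and>
     (\<forall>n. four_energy (b N) n \<ge> 0 \<and> four_energy (\<lambda>x. dval_at (ric_m (Suc N)) a b x) n \<ge> 0 \<and>
       four_energy (a 1) n \<ge> 0)"
proof -
  obtain G where G: "\<And>a b. sobolev_jet N M a \<Longrightarrow> sobolev_jet N M b \<Longrightarrow>
     bessel_class G (\<lambda>x. dval_at (ric_m (Suc N)) a b x)"
    using ric_m_Suc_bessel[OF N] by blast
  have bessel: "(\<Sum>n\<in>A. four_energy g n) \<le> 2 * H" if "bessel_class H g" "finite A" for H g A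
    using that bessel_four_energy unfolding bessel_class_def by blast
  have nonneg: "four_energy g n \<ge> 0" if "bessel_class H g" for H g n
    using that four_energy_nonneg unfolding bessel_class_def by blast
  show ?thesis
  proof (intro exI allI impI conjI)
    fix a b and A :: "int set" assume a: "sobolev_jet N M a" and b: "sobolev_jet N M b" and A: "finite A"
    have bN: "bessel_class (M\<^sup>2) (b N)" and a1: "bessel_class (M\<^sup>2) (a 1)"
      unfolding bessel_class_def using sobolev_jet_component[OF b N M order_refl] sobolev_jet_component[OF a N M N] by blast+
    have r: "bessel_class G (\<lambda>x. dval_at (ric_m (Suc N)) a b x)" by (rule G[OF a b])
    show "(\<Sum>n\<in>A. energy N a b n) \<le> 2 * M\<^sup>2 + 2 * G + 2 * M\<^sup>2"
      unfolding energy_def sum.distrib sum_int_uminus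
      by (intro add_mono bessel[OF bN A] bessel[OF r A] bessel[OF a1] finite_imageI A)
    fix n
    show "four_energy (b N) n \<ge> 0" by (rule nonneg[OF bN])
    show "four_energy (\<lambda>x. dval_at (ric_m (Suc N)) a b x) n \<ge> 0" by (rule nonneg[OF r])
    show "four_energy (a 1) n \<ge> 0" by (rule nonneg[OF a1])
  qed
qed

text \<open>
  The term \<open>1 / n\<^sup>2\<close> absorbs errors that are one power of \<open>n\<close> better than the Fourier coefficients.
\<close>

definition theta :: "nat \<Rightarrow> (nat \<Rightarrow> cfn) \<Rightarrow> (nat \<Rightarrow> cfn) \<Rightarrow> int \<Rightarrow> real" where
  "theta N a b n = sqrt (energies N a b n + 1 / (of_int n)\<^sup>2)"

lemma theta_properties:
  assumes N: "N \<ge> 1" and M: "M \<ge> 1"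
  obtains G where "G \<ge> 0"
    "\<And>a b n. sobolev_jet N M a \<Longrightarrow> sobolev_jet N M b \<Longrightarrow> energy N a b n \<le> (theta N a b n)\<^sup>2 \<and>
       energy N (\<lambda>j x. - b j x) (\<lambda>j x. - a j x) (- n) \<le> (theta N a b n)\<^sup>2 \<and>
       1 / \<bar>real_of_int n\<bar> \<le> theta N a b n"
    "\<And>a b A. sobolev_jet N M a \<Longrightarrow> sobolev_jet N M b \<Longrightarrow> finite A \<Longrightarrow> (\<Sum>n\<in>A. energies N a b n) \<le> G"
    "\<And>a b n. sobolev_jet N M a \<Longrightarrow> sobolev_jet N M b \<Longrightarrow> energies N a b n \<ge> 0"
    "\<And>a b n. sobolev_jet N M a \<Longrightarrow> sobolev_jet N M b \<Longrightarrow> n \<noteq> 0 \<Longrightarrow> theta N a b n \<le> sqrt (G + 1)"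
    "\<And>a b n. sobolev_jet N M a \<Longrightarrow> sobolev_jet N M b \<Longrightarrow>
       four_energy (b N) n \<le> energy N a b n \<and>
       four_energy (\<lambda>x. dval_at (ric_m (Suc N)) a b x) n \<le> energy N a b n \<and>
       four_energy (a 1) (- n) \<le> energy N a b n"
proof -
  obtain G where G: "\<forall>a b A. sobolev_jet N M a \<longrightarrow> sobolev_jet N M b \<longrightarrow> finite A \<longrightarrow> (\<Sum>n\<in>A. energy N a b n) \<le> G \<and>
     (\<forall>n. four_energy (b N) n \<ge> 0 \<and> four_energy (\<lambda>x. dval_at (ric_m (Suc N)) a b x) n \<ge> 0 \<and>
       four_energy (a 1) n \<ge> 0)"
    using energy_sum_bounded[OF N M] by metis
  have sumle: "(\<Sum>n\<in>A. energy N a b n) \<le> G" if "sobolev_jet N M a" "sobolev_jet N M b" "finite A" for a b A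
    using G[rule_format, OF that] by blast
  have parts: "four_energy (b N) n \<ge> 0" "four_energy (\<lambda>x. dval_at (ric_m (Suc N)) a b x) n \<ge> 0"
      "four_energy (a 1) n \<ge> 0" if "sobolev_jet N M a" "sobolev_jet N M b" for a b n
    using G[rule_format, OF that, of "{}"] by blast+
  have pos: "energy N a b n \<ge> 0" if "sobolev_jet N M a" "sobolev_jet N M b" for a b n
    unfolding energy_def by (intro add_nonneg_nonneg parts[OF that])
  have 1: "energies N a b n \<ge> 0" if "sobolev_jet N M a" "sobolev_jet N M b" for a b n
    unfolding energies_def by (intro add_nonneg_nonneg pos sobolev_jet_minus that)
  have 2: "(\<Sum>n\<in>A. energies N a b n) \<le> 2 * \<bar>G\<bar>" if a: "sobolev_jet N M a" and b: "sobolev_jet N M b" and A: "finite A" for a b A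
  proof -
    have "(\<Sum>n\<in>A. energies N a b n) \<le> G + G"
      unfolding energies_def sum.distrib sum_int_uminus
      by (intro add_mono sumle sobolev_jet_minus a b A finite_imageI)
    then show ?thesis by linarith
  qed
  have sq: "(theta N a b n)\<^sup>2 = energies N a b n + 1 / (of_int n)\<^sup>2" if "sobolev_jet N M a" "sobolev_jet N M b" for a b n
    unfolding theta_def using 1[OF that] by simp
  show ?thesis
  proof (rule that[of "2 * \<bar>G\<bar>"])
    fix a b n assume a: "sobolev_jet N M a" and b: "sobolev_jet N M b"
    have e: "energy N a b n \<ge> 0" "energy N (\<lambda>j x. - b j x) (\<lambda>j x. - a j x) (- n) \<ge> 0"
      by (intro pos sobolev_jet_minus a b)+
    have t: "1 / \<bar>real_of_int n\<bar> = sqrt (1 / (of_int n)\<^sup>2)" by (simp add: real_sqrt_divide)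
    have i: "(0::real) \<le> 1 / (of_int n)\<^sup>2" by simp
    have "energy N a b n \<le> (theta N a b n)\<^sup>2" "energy N (\<lambda>j x. - b j x) (\<lambda>j x. - a j x) (- n) \<le> (theta N a b n)\<^sup>2"
      unfolding sq[OF a b] energies_def using e i by linarith+
    moreover have "1 / \<bar>real_of_int n\<bar> \<le> theta N a b n"
      unfolding t theta_def by (rule real_sqrt_le_mono) (use 1[OF a b] in simp)
    ultimately show "energy N a b n \<le> (theta N a b n)\<^sup>2 \<and>
       energy N (\<lambda>j x. - b j x) (\<lambda>j x. - a j x) (- n) \<le> (theta N a b n)\<^sup>2 \<and> 1 / \<bar>real_of_int n\<bar> \<le> theta N a b n" by blast
    show "theta N a b n \<le> sqrt (2 * \<bar>G\<bar> + 1)" if n: "n \<noteq> 0"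
    proof -
      have "energies N a b n \<le> 2 * \<bar>G\<bar>" using 2[OF a b, of "{n}"] by simp
      moreover have "1 / (real_of_int n)\<^sup>2 \<le> 1"
      proof -
        have "1 \<le> \<bar>real_of_int n\<bar>" using n by linarith
        then have "1 \<le> \<bar>real_of_int n\<bar>\<^sup>2" by (rule one_le_power)
        then have "1 \<le> (real_of_int n)\<^sup>2" by simp
        from divide_left_mono[OF this, of 1] show ?thesis using n by simp
      qed
      ultimately show ?thesis unfolding theta_def by (intro real_sqrt_le_mono add_mono)
    qed
    show "four_energy (b N) n \<le> energy N a b n \<and>
       four_energy (\<lambda>x. dval_at (ric_m (Suc N)) a b x) n \<le> energy N a b n \<and>
       four_energy (a 1) (- n) \<le> energy N a b n"
      unfolding energy_def using parts(1)[OF a b, of n] parts(2)[OF a b, of n] parts(3)[OF a b, of "- n"] by linarith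
  qed (simp_all add: 1 2)
qed

text \<open>
  The parameter set of the abstract families consists of all potentials with the given bound, paired with an
  eigenvalue \<open>z\<close> and the index of the disc that contains it; this makes the constants uniform.
\<close>

theorem dirichlet_expansion:
  assumes N: "N \<ge> 1" and M: "M \<ge> 1"
  obtains C K where "C \<ge> 0" "K \<ge> 1"
    "\<And>a b z n. sobolev_jet N M a \<Longrightarrow> sobolev_jet N M b \<Longrightarrow> dir_eigenvalue (a 0) (b 0) z \<Longrightarrow>
       norm (z - npi n) \<le> 1 / 8 \<Longrightarrow> K \<le> \<bar>real_of_int n\<bar> \<Longrightarrow>
       norm (z - npi n - (\<Sum>k\<le>N. jet_coeff a b k / z ^ Suc k)
          - (trunc_four (a 0) (- n) 1 + trunc_four (b 0) n 1) / 2)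
        \<le> C * (theta N a b n / \<bar>real_of_int n\<bar> ^ Suc N) \<and>
       norm ((trunc_four (a 0) (- n) 1 + trunc_four (b 0) n 1) / 2) \<le> C * (theta N a b n / \<bar>real_of_int n\<bar> ^ N)"
proof -
  define T :: "((nat \<Rightarrow> cfn) \<times> (nat \<Rightarrow> cfn) \<times> complex \<times> int) set"
    where "T = {(a, b, z, n). sobolev_jet N M a \<and> sobolev_jet N M b \<and> dir_eigenvalue (a 0) (b 0) z \<and>
      norm (z - npi n) \<le> 1 / 8 \<and> n \<noteq> 0}"
  define a b z n where "a t = fst t" and "b t = fst (snd t)" and "z t = fst (snd (snd t))" and "n t = snd (snd (snd t))"
    for t :: "(nat \<Rightarrow> cfn) \<times> (nat \<Rightarrow> cfn) \<times> complex \<times> int"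
  have T: "sobolev_jet N M (a t)" "sobolev_jet N M (b t)" "dir_eigenvalue (a t 0) (b t 0) (z t)"
    "norm (z t - npi (n t)) \<le> 1 / 8" "n t \<noteq> 0" if "t \<in> T" for t
    using that by (auto simp: T_def a_def b_def z_def n_def)
  define U V where "U t = fundU (a t 0) (b t 0) (z t)" and "V t = fundV (a t 0) (b t 0) (z t)" for t
  have F: "zs_sol (a t 0) (b t 0) (z t) (U t) (V t)" "U t 0 = 1" "V t 0 = 1" if "t \<in> T" for t
    unfolding U_def V_def
    by (rule zs_fund[OF sobolev_jet_0(1)[OF T(1)[OF that] N] sobolev_jet_0(1)[OF T(2)[OF that] N]])+
  have UV: "U t 1 = V t 1" if "t \<in> T" for t
    using T(3)[OF that] unfolding U_def V_def dir_eigenvalue_def .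
  have I: "\<bar>Im (z t)\<bar> \<le> M" if "t \<in> T" for t
    by (rule dir_eigenvalue_Im[OF T(1)[OF that] T(2)[OF that] N T(3)[OF that]])
  have zn: "\<bar>real_of_int (n t)\<bar> \<le> norm (z t)" if "t \<in> T" for t
    by (rule norm_near_multiple_pi[OF T(4,5)[OF that]])
  interpret dir0: zs_family N M T a b z U V
    by unfold_locales (use N T F I in auto)
  interpret mir0: zs_family N M T "\<lambda>t j x. - b t j x" "\<lambda>t j x. - a t j x" "\<lambda>t. - z t" V U
    by unfold_locales (use N T F I zs_sol_mirror sobolev_jet_minus in auto)
  have cV: "unif_O T z (\<lambda>t x. exp (- \<i> * z t * of_real x) * V t x - 1) (inv_size z)"
    by (rule dir0.crude_asymptotics)
  have cU: "unif_O T z (\<lambda>t x. exp (\<i> * z t * of_real x) * U t x - 1) (inv_size z)"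
    using mir0.crude_asymptotics unfolding unif_O_uminus_param inv_size_uminus by simp
  have near: "unif_O T z (\<lambda>t x. z t - npi (n t)) (inv_size z)"
  proof (rule spectral_picture[OF N M], goal_cases)
    case (1 C K)
    note C = 1(1) and loc = 1(3)
    show ?thesis
    proof (rule unif_OI[OF C])
      fix t assume t: "t \<in> T" "K \<le> norm (z t)"
      obtain m :: int where m: "norm (z t - npi m) \<le> C / norm (z t)" "norm (z t - npi m) \<le> 1 / 16"
        using loc[OF T(1-3)[OF t(1)] t(2)] by blast
      have "norm (npi (n t) - npi m :: complex) =
         norm ((z t - npi m) - (z t - npi (n t)))" by simp
      also have "\<dots> \<le> 1 / 16 + 1 / 8" by (rule norm_triangle_le_diff) (rule add_mono[OF m(2) T(4)[OF t(1)]])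
      also have "npi (n t) - npi m = (npi (n t - m) :: complex)"
        by (simp add: left_diff_distrib)
      finally have "\<bar>real_of_int (n t - m)\<bar> * pi \<le> 1 / 16 + 1 / 8"
        unfolding norm_mult norm_of_int norm_of_real by simp
      moreover have "\<bar>real_of_int (n t - m)\<bar> * 2 \<le> \<bar>real_of_int (n t - m)\<bar> * pi" using pi_ge_two by (intro mult_left_mono) auto
      moreover have "r * 2 \<le> p \<Longrightarrow> p \<le> 1 / 16 + 1 / 8 \<Longrightarrow> r < 1" for r p :: real by linarith
      ultimately have "\<bar>real_of_int (n t - m)\<bar> < 1" by blast
      then have "n t = m" by linarith
      then show "norm (z t - npi (n t)) \<le> C * inv_size z t"
        using m(1) by (simp add: inv_size_def)
    qed
  qed
  obtain G where G: "G \<ge> 0"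
    "\<And>a b n. sobolev_jet N M a \<Longrightarrow> sobolev_jet N M b \<Longrightarrow> energy N a b n \<le> (theta N a b n)\<^sup>2 \<and>
       energy N (\<lambda>j x. - b j x) (\<lambda>j x. - a j x) (- n) \<le> (theta N a b n)\<^sup>2 \<and>
       1 / \<bar>real_of_int n\<bar> \<le> theta N a b n"
    "\<And>a b n. sobolev_jet N M a \<Longrightarrow> sobolev_jet N M b \<Longrightarrow> n \<noteq> 0 \<Longrightarrow> theta N a b n \<le> sqrt (G + 1)"
    "\<And>a b n. sobolev_jet N M a \<Longrightarrow> sobolev_jet N M b \<Longrightarrow>
       four_energy (b N) n \<le> energy N a b n \<and>
       four_energy (\<lambda>x. dval_at (ric_m (Suc N)) a b x) n \<le> energy N a b n \<and>
       four_energy (a 1) (- n) \<le> energy N a b n"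
    by (rule theta_properties[OF N M]) (rule that; (assumption | blast))
  define \<theta> where "\<theta> t = theta N (a t) (b t) (n t)" for t
  have \<theta>1: "energy N (a t) (b t) (n t) \<le> (\<theta> t)\<^sup>2 \<and>
       energy N (\<lambda>j x. - b t j x) (\<lambda>j x. - a t j x) (- n t) \<le> (\<theta> t)\<^sup>2 \<and>
       1 / \<bar>real_of_int (n t)\<bar> \<le> \<theta> t" if t: "t \<in> T" for t
    unfolding \<theta>_def by (rule G(2)[OF T(1,2)[OF t]])
  note d = G(4)[OF T(1,2)]
  note m = G(4)[OF sobolev_jet_minus[OF T(2)] sobolev_jet_minus[OF T(1)]]
  have ep: "inv_size z t \<le> \<theta> t" if t: "t \<in> T" for t
  proof -
    have "inv_size z t \<le> 1 / \<bar>real_of_int (n t)\<bar>"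
      unfolding inv_size_def by (rule frac_le) (use zn[OF t] T(5)[OF t] in auto)
    then show ?thesis using \<theta>1[OF t] by linarith
  qed
  interpret zs_pair N M T a b z U V n \<theta> "sqrt (G + 1)"
  proof (intro zs_pair.intro)
    show "zs_eigen N M T a b z U V n \<theta> (sqrt (G + 1))"
    proof unfold_locales
      fix t assume t: "t \<in> T"
      show "U t 1 = V t 1" by (rule UV[OF t])
      show "inv_size z t \<le> \<theta> t" by (rule ep[OF t])
      show "four_energy (b t N) (n t) \<le> (\<theta> t)\<^sup>2" using d[OF t t, of "n t"] \<theta>1[OF t] by linarith
      show "four_energy (dir0.rem1 t) (n t) \<le> (\<theta> t)\<^sup>2" unfolding dir0.rem1_eq using d[OF t t, of "n t"] \<theta>1[OF t] by linarith
      show "four_energy (a t 1) (- n t) \<le> (\<theta> t)\<^sup>2" using d[OF t t, of "n t"] \<theta>1[OF t] by linarith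
      show "\<theta> t \<le> sqrt (G + 1)" unfolding \<theta>_def by (rule G(3)[OF T(1,2,5)[OF t]])
    qed (rule cU near)+
    show "zs_eigen N M T (\<lambda>t j x. - b t j x) (\<lambda>t j x. - a t j x) (\<lambda>t. - z t) V U (\<lambda>t. - n t) \<theta> (sqrt (G + 1))"
    proof unfold_locales
      fix t assume t: "t \<in> T"
      show "V t 1 = U t 1" by (rule UV[OF t, symmetric])
      show "inv_size (\<lambda>t. - z t) t \<le> \<theta> t" unfolding inv_size_uminus by (rule ep[OF t])
      show "four_energy (\<lambda>x. - a t N x) (- n t) \<le> (\<theta> t)\<^sup>2" using m[OF t t, of "- n t"] \<theta>1[OF t] by linarith
      show "four_energy (mir0.rem1 t) (- n t) \<le> (\<theta> t)\<^sup>2" unfolding mir0.rem1_eq using m[OF t t, of "- n t"] \<theta>1[OF t] by linarith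
      show "four_energy (\<lambda>x. - b t 1 x) (- (- n t)) \<le> (\<theta> t)\<^sup>2" using m[OF t t, of "- n t"] \<theta>1[OF t] by linarith
      show "\<theta> t \<le> sqrt (G + 1)" unfolding \<theta>_def by (rule G(3)[OF T(1,2,5)[OF t]])
    next
      show "unif_O T (\<lambda>t. - z t) (\<lambda>t x. exp (\<i> * - z t * of_real x) * V t x - 1) (inv_size (\<lambda>t. - z t))"
        using cV unfolding unif_O_uminus_param inv_size_uminus by simp
      show "unif_O T (\<lambda>t. - z t) (\<lambda>t x. - z t - npi (- n t)) (inv_size (\<lambda>t. - z t))"
        using unif_O_minus[OF near] unfolding unif_O_uminus_param inv_size_uminus by simp
    qed
  qed
  obtain C K where C: "C \<ge> 0" "K \<ge> 1" "\<And>t. t \<in> T \<Longrightarrow> K \<le> norm (z t) \<Longrightarrow>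
      norm (z t - dir.nu t - (dir.Sser t - mir.Sser t + dir.fc t - mir.fc t) / 2) \<le> C * (inv_size z t ^ Suc N * \<theta> t) \<and>
      norm ((dir.fc t - mir.fc t) / 2) \<le> C * (inv_size z t ^ N * \<theta> t)"
  proof -
    have "unif_O T z (\<lambda>t _. (dir.fc t - mir.fc t) / 2) (\<lambda>t. inv_size z t ^ N * \<theta> t)"
    proof -
      have "unif_O T z (\<lambda>t _. mir.fc t) (\<lambda>t. inv_size z t ^ N * \<theta> t)"
        using mir.fc_O unfolding mir_O inv_size_uminus .
      from unif_O_cmult[OF unif_O_diff[OF dir.fc_O this], of "1 / 2"] show ?thesis by simp
    qed
    then obtain C2 K2 where 2: "C2 \<ge> 0" "K2 \<ge> 1" "\<And>t. t \<in> T \<Longrightarrow> K2 \<le> norm (z t) \<Longrightarrow>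
        norm ((dir.fc t - mir.fc t) / 2) \<le> C2 * (inv_size z t ^ N * \<theta> t)"
      by (rule unif_OE) (metis atLeastAtMost_iff order_refl zero_le_one)
    obtain C1 K1 where 1: "C1 \<ge> 0" "K1 \<ge> 1" "\<And>t. t \<in> T \<Longrightarrow> K1 \<le> norm (z t) \<Longrightarrow>
        norm (z t - dir.nu t - (dir.Sser t - mir.Sser t + dir.fc t - mir.fc t) / 2) \<le> C1 * (inv_size z t ^ Suc N * \<theta> t)"
      by (rule unif_OE[OF two_sided_expansion]) (metis atLeastAtMost_iff order_refl zero_le_one)
    have th: "0 \<le> inv_size z t ^ k * \<theta> t" if "t \<in> T" for t k
      using order_trans[OF inv_size_nonneg ep[OF that]] by (intro mult_nonneg_nonneg zero_le_power inv_size_nonneg)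
    show ?thesis
    proof (rule that[of "max C1 C2" "max K1 K2"])
      fix t assume t: "t \<in> T" "max K1 K2 \<le> norm (z t)"
      show "norm (z t - dir.nu t - (dir.Sser t - mir.Sser t + dir.fc t - mir.fc t) / 2) \<le> max C1 C2 * (inv_size z t ^ Suc N * \<theta> t) \<and>
          norm ((dir.fc t - mir.fc t) / 2) \<le> max C1 C2 * (inv_size z t ^ N * \<theta> t)"
        by (intro conjI order_trans[OF 1(3)[OF t(1)]] order_trans[OF 2(3)[OF t(1)]] mult_right_mono th[OF t(1)]) (use t in auto)
    qed (use 1 2 in auto)
  qed
  have fc: "(dir.fc t - mir.fc t) / 2 = (trunc_four (a t 0) (- n t) 1 + trunc_four (b t 0) (n t) 1) / 2" for t
    unfolding dir.fc_def mir.fc_def trunc_four_def by simp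
  have ser: "(dir.Sser t - mir.Sser t) / 2 = (\<Sum>k\<le>N. jet_coeff (a t) (b t) k / z t ^ Suc k)" for t
  proof -
    have z1: "dir0.zeta t ^ k = 1 / (2 * \<i>) ^ k * (1 / z t ^ k)" for k
      unfolding dir0.zeta_def by (simp add: power_divide power_mult_distrib)
    have "mir0.zeta t = (- 1) * dir0.zeta t" unfolding dir0.zeta_def mir0.zeta_def by simp
    then have z2: "mir0.zeta t ^ k = (- 1) ^ k * dir0.zeta t ^ k" for k by (simp only: power_mult_distrib)
    have "(dir.Sser t - mir.Sser t) / 2 = (\<Sum>k\<le>N. (dir0.zeta t ^ Suc k * integral {0..1} (\<lambda>x. a t 0 x * dir0.cs k t x)
       - mir0.zeta t ^ Suc k * integral {0..1} (\<lambda>x. - b t 0 x * mir0.cs k t x)) / 2)"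
      unfolding dir.Sser_def mir.Sser_def sum_subtractf[symmetric] sum_divide_distrib ..
    also have "\<dots> = (\<Sum>k\<le>N. jet_coeff (a t) (b t) k / z t ^ Suc k)"
    proof (rule sum.cong[OF refl])
      fix k
      have alg: "(d * e * X - s * (d * e) * Y) / 2 = 1 / 2 * d * (X - s * Y) * e" for d e X Y s :: complex
        by (simp add: algebra_simps diff_divide_distrib)
      have alg2: "1 / 2 * (1 / w) * D * (1 / v) = 1 / (2 * w) * D / v" for w D v :: complex by simp
      show "(dir0.zeta t ^ Suc k * integral {0..1} (\<lambda>x. a t 0 x * dir0.cs k t x)
         - mir0.zeta t ^ Suc k * integral {0..1} (\<lambda>x. - b t 0 x * mir0.cs k t x)) / 2 = jet_coeff (a t) (b t) k / z t ^ Suc k"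
        unfolding jet_coeff_def dir0.cs_def mir0.cs_def z2 z1 by (rule trans[OF alg alg2])
    qed
    finally show ?thesis .
  qed
  have pw: "inv_size z t ^ k * \<theta> t \<le> theta N (a t) (b t) (n t) / \<bar>real_of_int (n t)\<bar> ^ k" if t: "t \<in> T" for t k
  proof -
    have "0 \<le> \<theta> t" using ep[OF t] inv_size_nonneg[of z t] by linarith
    moreover have "inv_size z t \<le> 1 / \<bar>real_of_int (n t)\<bar>"
      unfolding inv_size_def by (rule frac_le) (use zn[OF t] T(5)[OF t] in auto)
    ultimately have "inv_size z t ^ k * \<theta> t \<le> (1 / \<bar>real_of_int (n t)\<bar>) ^ k * \<theta> t"
      by (intro mult_right_mono power_mono inv_size_nonneg)
    then show ?thesis by (simp add: \<theta>_def power_divide)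
  qed
  show ?thesis
  proof (rule that[OF C(1,2)])
    fix a' b' z' n'
    assume h: "sobolev_jet N M a'" "sobolev_jet N M b'" "dir_eigenvalue (a' 0) (b' 0) z'"
       "norm (z' - npi n') \<le> 1 / 8" "K \<le> \<bar>real_of_int n'\<bar>"
    define t where "t = (a', b', z', n')"
    have e: "a t = a'" "b t = b'" "z t = z'" "n t = n'" by (simp_all add: t_def a_def b_def z_def n_def)
    have "n' \<noteq> 0" using h(5) C(2) by auto
    then have t: "t \<in> T" using h by (simp add: t_def T_def)
    have K: "K \<le> norm (z t)" using zn[OF t] h(5) unfolding e by linarith
    have p: "C * (inv_size z t ^ k * \<theta> t) \<le> C * (theta N a' b' n' / \<bar>real_of_int n'\<bar> ^ k)" for k
      by (rule mult_left_mono[OF pw[OF t, unfolded e] C(1)])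
    have eq: "z t - dir.nu t - (dir.Sser t - mir.Sser t + dir.fc t - mir.fc t) / 2 =
        z t - npi (n t) - (\<Sum>k\<le>N. jet_coeff (a t) (b t) k / z t ^ Suc k)
        - (trunc_four (a t 0) (- n t) 1 + trunc_four (b t 0) (n t) 1) / 2"
      unfolding ser[symmetric] fc[symmetric] by (simp add: dir.nu_def diff_divide_distrib add_divide_distrib)
    show "norm (z' - npi n' - (\<Sum>k\<le>N. jet_coeff a' b' k / z' ^ Suc k)
          - (trunc_four (a' 0) (- n') 1 + trunc_four (b' 0) n' 1) / 2)
        \<le> C * (theta N a' b' n' / \<bar>real_of_int n'\<bar> ^ Suc N) \<and>
       norm ((trunc_four (a' 0) (- n') 1 + trunc_four (b' 0) n' 1) / 2) \<le> C * (theta N a' b' n' / \<bar>real_of_int n'\<bar> ^ N)"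
      using C(3)[OF t K, unfolded eq fc, unfolded e] p[of "Suc N"] p[of N] by (meson order_trans)
  qed
qed

section \<open>Asymptotics in powers of the index\<close>

text \<open>
  Both \<open>z\<close> and \<open>Z\<close> nearly solve \<open>w = z - \<Sum>j. \<kappa>\<^sub>j / z ^ j\<close>, but for \<open>z\<close> the term \<open>f\<close> is added. The sum is a contraction
  for large \<open>\<nu>\<close>, so \<open>z - Z\<close> is \<open>f\<close> up to an error in which \<open>f\<close> appears with the factor \<open>1 / \<nu>\<^sup>2\<close>.
\<close>

lemma inversion_compare:
  fixes z Z f w :: complex and \<kappa> :: "nat \<Rightarrow> complex"
  assumes \<nu>: "\<nu> \<ge> 1" "\<nu> \<le> norm z" "\<nu> \<le> norm Z"
    and hz: "norm (z - w - (\<Sum>j=1..K. \<kappa> j / z ^ j) - f) \<le> r1"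
    and hZ: "norm (Z - w - (\<Sum>j=1..K. \<kappa> j / Z ^ j)) \<le> r2"
    and S: "(\<Sum>j=1..K. norm (\<kappa> j) * real j) \<le> S" "2 * S \<le> \<nu>\<^sup>2"
  shows "norm (z - Z - f) \<le> 2 * (S * norm f / \<nu>\<^sup>2 + r1 + r2)"
proof -
  let ?D = "norm (z - Z - f)"
  have \<nu>2: "\<nu>\<^sup>2 > 0" using \<nu> by simp
  have S0: "S \<ge> 0" using S(1) by (rule order_trans[rotated]) (auto intro: sum_nonneg)
  have nz: "z \<noteq> 0" "Z \<noteq> 0" using \<nu> by auto
  have pw: "norm (1 / z ^ j - 1 / Z ^ j) \<le> real j * (norm (z - Z) / \<nu>\<^sup>2)" for j
  proof -
    have "norm ((1 / z) ^ j - (1 / Z) ^ j) \<le> real j * norm (1 / z - 1 / Z)"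
      by (rule norm_power_diff) (use \<nu> in \<open>auto simp: norm_divide divide_le_eq_1\<close>)
    also have "norm (1 / z - 1 / Z) = norm (z - Z) / (norm z * norm Z)"
      using nz by (simp add: diff_frac_eq norm_divide norm_mult norm_minus_commute)
    also have "\<dots> \<le> norm (z - Z) / \<nu>\<^sup>2"
      unfolding power2_eq_square using \<nu> by (intro frac_le mult_mono mult_pos_pos) auto
    finally show ?thesis by (simp add: power_one_over mult_left_mono)
  qed
  have "norm (\<Sum>j=1..K. \<kappa> j / z ^ j - \<kappa> j / Z ^ j) \<le> (\<Sum>j=1..K. norm (\<kappa> j) * (real j * (norm (z - Z) / \<nu>\<^sup>2)))"
  proof (rule sum_norm_le)
    fix j
    have "\<kappa> j / z ^ j - \<kappa> j / Z ^ j = \<kappa> j * (1 / z ^ j - 1 / Z ^ j)" by (simp add: right_diff_distrib)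
    then show "norm (\<kappa> j / z ^ j - \<kappa> j / Z ^ j) \<le> norm (\<kappa> j) * (real j * (norm (z - Z) / \<nu>\<^sup>2))"
      using mult_left_mono[OF pw[of j] norm_ge_zero[of "\<kappa> j"]] by (simp add: norm_mult)
  qed
  also have "\<dots> = (\<Sum>j=1..K. norm (\<kappa> j) * real j) * (norm (z - Z) / \<nu>\<^sup>2)"
    unfolding sum_distrib_right by (simp add: mult.assoc)
  also have "\<dots> \<le> S * ((?D + norm f) / \<nu>\<^sup>2)"
  proof (intro mult_mono S divide_right_mono S0)
    show "norm (z - Z) \<le> ?D + norm f" using norm_triangle_ineq[of "z - Z - f" f] by simp
  qed auto
  finally have "norm (\<Sum>j=1..K. \<kappa> j / z ^ j - \<kappa> j / Z ^ j) \<le> S * ((?D + norm f) / \<nu>\<^sup>2)" .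
  note diff = this
  have split: "z - Z - f = (z - w - (\<Sum>j=1..K. \<kappa> j / z ^ j) - f) - (Z - w - (\<Sum>j=1..K. \<kappa> j / Z ^ j))
      + (\<Sum>j=1..K. \<kappa> j / z ^ j - \<kappa> j / Z ^ j)"
    unfolding sum_subtractf by simp
  have "?D \<le> r1 + r2 + S * ((?D + norm f) / \<nu>\<^sup>2)"
    using norm_triangle_mono[OF order_trans[OF norm_triangle_ineq4 add_mono[OF hz hZ]] diff]
    unfolding split[symmetric] .
  also have "S * ((?D + norm f) / \<nu>\<^sup>2) = S / \<nu>\<^sup>2 * ?D + S * norm f / \<nu>\<^sup>2"
    by (simp add: add_divide_distrib distrib_left)
  finally have "?D \<le> r1 + r2 + (S / \<nu>\<^sup>2 * ?D + S * norm f / \<nu>\<^sup>2)" .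
  moreover have "S / \<nu>\<^sup>2 * ?D \<le> 1 / 2 * ?D"
    using S(2) \<nu>2 by (intro mult_right_mono) (auto simp: field_simps)
  moreover have "D \<le> r1 + r2 + (x + y) \<Longrightarrow> x \<le> 1 / 2 * D \<Longrightarrow> D \<le> 2 * (y + r1 + r2)" for D x y :: real
    by (simp add: field_simps)
  ultimately show ?thesis by blast
qed

lemma inv_coeff_cong:
  assumes "\<And>j. 1 \<le> j \<Longrightarrow> j \<le> k \<Longrightarrow> \<kappa> j = \<kappa>' j"
  shows "inv_coeff \<kappa> k = inv_coeff \<kappa>' k"
  using assms
proof (induction k rule: less_induct)
  case (less k)
  have "(\<lambda>i. if i < k then inv_coeff \<kappa> i else 0) = (\<lambda>i. if i < k then inv_coeff \<kappa>' i else 0)"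
    using less by (auto simp: fun_eq_iff)
  then show ?case
    unfolding inv_coeff.simps[of _ k] inv_rhs_def using less.prems by (auto intro!: sum.cong)
qed

lemma inv_coeff_0: "inv_coeff \<kappa> 0 = 0"
  by (simp add: inv_coeff.simps[of _ 0] inv_rhs_def)

lemma sum_inverse_squares_int:
  "\<exists>Q. \<forall>F. finite F \<longrightarrow> (\<Sum>n\<in>F. 1 / (real_of_int n)\<^sup>2) \<le> Q"
proof -
  have s: "summable (\<lambda>k. 1 / (real k)\<^sup>2)" using inverse_power_summable[of 2, where 'a = real] by (simp add: inverse_eq_divide power_divide)
  let ?Q = "suminf (\<lambda>k. 1 / (real k)\<^sup>2)"
  have le: "(\<Sum>k\<in>A. 1 / (real k)\<^sup>2) \<le> ?Q" if "finite A" for A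
    by (rule sum_le_suminf[OF s that]) simp
  show ?thesis
  proof (intro exI allI impI)
    fix F :: "int set" assume F: "finite F"
    have "(\<Sum>n\<in>F \<inter> {0..}. 1 / (real_of_int n)\<^sup>2) = (\<Sum>k\<in>nat ` (F \<inter> {0..}). 1 / (real k)\<^sup>2)"
      by (subst sum.reindex) (auto simp: inj_on_def)
    then have 1: "(\<Sum>n\<in>F \<inter> {0..}. 1 / (real_of_int n)\<^sup>2) \<le> ?Q" using le F by simp
    have "(\<Sum>n\<in>F - {0..}. 1 / (real_of_int n)\<^sup>2) = (\<Sum>k\<in>(\<lambda>n. nat (- n)) ` (F - {0..}). 1 / (real k)\<^sup>2)"
      by (subst sum.reindex) (auto simp: inj_on_def)
    then have 2: "(\<Sum>n\<in>F - {0..}. 1 / (real_of_int n)\<^sup>2) \<le> ?Q" using le F by simp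
    show "(\<Sum>n\<in>F. 1 / (real_of_int n)\<^sup>2) \<le> ?Q + ?Q"
      using sum.Int_Diff[OF F, of "\<lambda>n. 1 / (real_of_int n)\<^sup>2" "{0..}"] 1 2 by linarith
  qed
qed

lemma norm_pi_plus_ge_1:
  assumes "norm x < 1"
  shows "1 \<le> norm (of_real pi + x :: complex)"
proof -
  have "norm (of_real pi :: complex) \<le> norm (of_real pi + x) + norm x"
    using norm_triangle_ineq4[of "of_real pi + x" x] by simp
  then show ?thesis using assms pi_ge_two by simp
qed

text \<open>
  The \<open>\<kappa>\<^sub>j\<close> with \<open>j > K\<close> do not influence the first \<open>K\<close> coefficients, and the proof replaces them by 0. On a bounded
  set in \<open>H\<^sup>N\<close> there is no control over them: their densities contain derivatives that need not exist.
\<close>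

lemma inverted_expansion:
  fixes \<kappa> :: "'p \<Rightarrow> nat \<Rightarrow> complex"
  assumes \<kappa>: "\<And>j. 1 \<le> j \<Longrightarrow> j \<le> K \<Longrightarrow> \<exists>C. \<forall>\<phi>\<in>B. norm (\<kappa> \<phi> j) \<le> C"
  obtains L S e where "L \<ge> 0" "e \<ge> 1"
    "\<And>\<phi>. \<phi> \<in> B \<Longrightarrow> (\<Sum>j=1..K. norm (\<kappa> \<phi> j) * real j) \<le> S"
    "\<And>\<phi> n Z. \<phi> \<in> B \<Longrightarrow> e \<le> \<bar>real_of_int n\<bar> \<Longrightarrow> Z = npi n + (\<Sum>k=1..K. inv_coeff (\<kappa> \<phi>) k / of_int n ^ k) \<Longrightarrow>
       \<bar>real_of_int n\<bar> \<le> norm Z \<and>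
       norm (Z - npi n - (\<Sum>j=1..K. \<kappa> \<phi> j / Z ^ j)) \<le> L / \<bar>real_of_int n\<bar> ^ Suc K"
proof -
  define \<kappa>' where "\<kappa>' \<phi> j = (if 1 \<le> j \<and> j \<le> K then \<kappa> \<phi> j else 0)" for \<phi> j
  have \<kappa>': "\<exists>C. \<forall>\<phi>\<in>B. norm (\<kappa>' \<phi> j) \<le> C" for j
    using \<kappa>[of j] unfolding \<kappa>'_def by (cases "1 \<le> j \<and> j \<le> K") auto
  have eq: "inv_coeff (\<kappa>' \<phi>) k = inv_coeff (\<kappa> \<phi>) k" if "k \<le> K" for \<phi> k
    by (rule inv_coeff_cong) (use that in \<open>auto simp: \<kappa>'_def\<close>)
  obtain k where k: "\<And>j \<phi>. \<phi> \<in> B \<Longrightarrow> norm (\<kappa>' \<phi> j) \<le> k j" using \<kappa>' by metis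
  have "\<exists>C. \<forall>\<phi>\<in>B. norm (inv_coeff (\<kappa>' \<phi>) j) \<le> C" for j
    by (rule graded_class.inv_coeff_class[OF graded_class_bounded]) (rule \<kappa>')
  then obtain c where c: "\<And>j \<phi>. \<phi> \<in> B \<Longrightarrow> norm (inv_coeff (\<kappa>' \<phi>) j) \<le> c j" by metis
  define b where "b = (\<Sum>j\<le>K. \<bar>c j\<bar>)"
  have b: "b \<ge> 0" unfolding b_def by (intro sum_nonneg) auto
  let ?ev = "\<lambda>\<phi> \<epsilon>. ev K (Abs_fps (inv_coeff (\<kappa>' \<phi>))) \<epsilon>"
  have evb: "norm (?ev \<phi> \<epsilon>) \<le> b" if \<phi>: "\<phi> \<in> B" and \<epsilon>: "norm \<epsilon> \<le> 1" for \<phi> \<epsilon>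
    unfolding ev_def b_def
  proof (rule sum_norm_le)
    fix j
    have "norm (inv_coeff (\<kappa>' \<phi>) j) * norm \<epsilon> ^ j \<le> \<bar>c j\<bar> * 1"
      using c[OF \<phi>, of j] \<epsilon> by (intro mult_mono power_le_one) auto
    then show "norm (fps_nth (Abs_fps (inv_coeff (\<kappa>' \<phi>))) j * \<epsilon> ^ j) \<le> \<bar>c j\<bar>" by (simp add: norm_mult norm_power)
  qed
  \<comment> \<open>For \<open>\<bar>\<epsilon>\<bar> \<le> e0\<close> the correction to \<open>\<pi>\<close> stays below 1, so that the denominator has modulus at least \<open>\<pi> - 1\<close>.\<close>
  define e0 where "e0 = 1 / (b + 1)"
  have e0: "0 < e0" "e0 \<le> 1" using b unfolding e0_def by auto
  have d: "1 \<le> norm (of_real pi + \<epsilon> * ?ev \<phi> \<epsilon>)" if \<phi>: "\<phi> \<in> B" and \<epsilon>: "norm \<epsilon> \<le> e0" for \<phi> \<epsilon>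
  proof (rule norm_pi_plus_ge_1)
    have "norm \<epsilon> * norm (?ev \<phi> \<epsilon>) \<le> e0 * b" using evb[OF \<phi>, of \<epsilon>] \<epsilon> e0 by (intro mult_mono) auto
    also have "\<dots> < 1" using b unfolding e0_def by (simp add: field_simps)
    finally show "norm (\<epsilon> * ?ev \<phi> \<epsilon>) < 1" by (simp add: norm_mult)
  qed
  obtain L where L: "L \<ge> 0" "\<And>\<phi> \<epsilon>. \<phi> \<in> B \<Longrightarrow> norm \<epsilon> \<le> e0 \<Longrightarrow>
     norm (?ev \<phi> \<epsilon> - (\<Sum>j=1..K. \<kappa>' \<phi> j * (\<epsilon> / (of_real pi + \<epsilon> * ?ev \<phi> \<epsilon>)) ^ j)) \<le> L * norm \<epsilon> ^ Suc K"
    using appr_inversion[OF e0 \<kappa>' d] by blast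
  show ?thesis
  proof (rule that[of L "b + 1" "\<Sum>j=1..K. \<bar>k j\<bar> * real j"])
    fix \<phi> assume \<phi>: "\<phi> \<in> B"
    show "(\<Sum>j=1..K. norm (\<kappa> \<phi> j) * real j) \<le> (\<Sum>j=1..K. \<bar>k j\<bar> * real j)"
    proof (intro sum_mono mult_right_mono)
      fix j assume "j \<in> {1..K}"
      then show "norm (\<kappa> \<phi> j) \<le> \<bar>k j\<bar>" using k[OF \<phi>, of j] by (auto simp: \<kappa>'_def)
    qed simp
    fix n :: int and Z :: complex
    assume n: "b + 1 \<le> \<bar>real_of_int n\<bar>"
      and Z: "Z = npi n + (\<Sum>k=1..K. inv_coeff (\<kappa> \<phi>) k / of_int n ^ k)"
    have n0: "n \<noteq> 0" using n b by auto
    let ?\<epsilon> = "1 / of_int n :: complex"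
    have \<epsilon>: "norm ?\<epsilon> \<le> e0"
      unfolding e0_def norm_divide using n b by (auto intro!: divide_left_mono mult_pos_pos)
    have "?ev \<phi> ?\<epsilon> = (\<Sum>k\<le>K. inv_coeff (\<kappa> \<phi>) k / of_int n ^ k)"
      unfolding ev_def by (intro sum.cong) (auto simp: eq power_one_over)
    also have "\<dots> = (\<Sum>k=1..K. inv_coeff (\<kappa> \<phi>) k / of_int n ^ k)"
      unfolding atMost_atLeast0 by (simp add: sum.atLeast_Suc_atMost inv_coeff_0)
    finally have ev: "?ev \<phi> ?\<epsilon> = Z - npi n" using Z by simp
    have Z': "of_real pi + ?\<epsilon> * ?ev \<phi> ?\<epsilon> = Z / of_int n"
      unfolding ev using n0 by (simp add: field_simps)
    have "\<bar>real_of_int n\<bar> * 1 \<le> \<bar>real_of_int n\<bar> * norm (Z / of_int n)"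
      using d[OF \<phi> \<epsilon>] unfolding Z' by (intro mult_left_mono) auto
    then have 1: "\<bar>real_of_int n\<bar> \<le> norm Z" using n0 by (simp add: norm_divide)
    have "(\<Sum>j=1..K. \<kappa>' \<phi> j * (?\<epsilon> / (Z / of_int n)) ^ j) = (\<Sum>j=1..K. \<kappa> \<phi> j / Z ^ j)"
      using n0 by (intro sum.cong) (auto simp: \<kappa>'_def power_one_over)
    then have "norm (Z - npi n - (\<Sum>j=1..K. \<kappa> \<phi> j / Z ^ j)) \<le> L * norm ?\<epsilon> ^ Suc K"
      using L(2)[OF \<phi> \<epsilon>, unfolded Z', unfolded ev] by (simp only:)
    then show "\<bar>real_of_int n\<bar> \<le> norm Z \<and>
       norm (Z - npi n - (\<Sum>j=1..K. \<kappa> \<phi> j / Z ^ j)) \<le> L / \<bar>real_of_int n\<bar> ^ Suc K"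
      using 1 unfolding norm_divide norm_one norm_of_int power_one_over by simp
  qed (use L b in auto)
qed

text \<open>
  The expansion in powers of \<open>1 / z\<close> is inverted. The Fourier term has size \<open>\<theta>\<^sub>n / \<bar>n\<bar> ^ N\<close>, so that its contribution to the
  inversion error, smaller by \<open>1 / n\<^sup>2\<close>, is covered by the bound.
\<close>

theorem index_expansion:
  assumes N: "N \<ge> 1" and M: "M \<ge> 1" and B: "\<And>\<phi>. \<phi> \<in> B \<Longrightarrow> \<exists>a b. jets_of N M \<phi> a b"
  obtains n0 :: int and C where "n0 \<ge> 1" "C \<ge> 0"
    "\<And>\<phi> a b \<mu> n. \<phi> \<in> B \<Longrightarrow> jets_of N M \<phi> a b \<Longrightarrow> dirichlet_eigenvalues \<phi> \<mu> \<Longrightarrow> n0 \<le> \<bar>n\<bar> \<Longrightarrow>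
       norm (\<mu> n - (npi n + (\<Sum>k=1..N+1. eig_coeff k \<phi> / of_int n ^ k))
         - (1 / 2) * (fourier_coeff (fst \<phi>) (- n) + fourier_coeff (snd \<phi>) n))
       \<le> C * (theta N a b n / \<bar>real_of_int n\<bar> ^ (N + 1))"
proof -
  obtain L0 :: int where L0: "L0 \<ge> 1"
    "\<And>\<phi> a b \<mu> n. jets_of N M \<phi> a b \<Longrightarrow> dirichlet_eigenvalues \<phi> \<mu> \<Longrightarrow> \<bar>n\<bar> \<ge> L0 \<Longrightarrow>
       dir_eigenvalue (a 0) (b 0) (\<mu> n) \<and> norm (\<mu> n - npi n) \<le> 1 / 8"
    by (rule dirichlet_numbering[OF N M]) (rule that; (assumption | blast))
  obtain C K where C: "C \<ge> 0" "K \<ge> 1"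
    "\<And>a b z n. sobolev_jet N M a \<Longrightarrow> sobolev_jet N M b \<Longrightarrow> dir_eigenvalue (a 0) (b 0) z \<Longrightarrow>
       norm (z - npi n) \<le> 1 / 8 \<Longrightarrow> K \<le> \<bar>real_of_int n\<bar> \<Longrightarrow>
       norm (z - npi n - (\<Sum>k\<le>N. jet_coeff a b k / z ^ Suc k)
          - (trunc_four (a 0) (- n) 1 + trunc_four (b 0) n 1) / 2)
        \<le> C * (theta N a b n / \<bar>real_of_int n\<bar> ^ Suc N) \<and>
       norm ((trunc_four (a 0) (- n) 1 + trunc_four (b 0) n 1) / 2) \<le> C * (theta N a b n / \<bar>real_of_int n\<bar> ^ N)"
    by (rule dirichlet_expansion[OF N M]) (rule that; (assumption | blast))
  have bd: "\<exists>C. \<forall>\<phi>\<in>B. norm (exp_coeff \<phi> j) \<le> C" if "1 \<le> j" "j \<le> N + 1" for j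
  proof -
    define k where "k = j - 1"
    have k: "j = Suc k" "k \<le> N" using \<open>1 \<le> j\<close> \<open>j \<le> N + 1\<close> unfolding k_def by linarith+
    obtain c where c: "\<And>a b. sobolev_jet N M a \<Longrightarrow> sobolev_jet N M b \<Longrightarrow> norm (jet_coeff a b k) \<le> c"
      using jet_coeff_bounded[OF N M k(2)] by blast
    show ?thesis
    proof (intro exI ballI)
      fix \<phi> assume "\<phi> \<in> B"
      then obtain a b where j: "jets_of N M \<phi> a b" using B by blast
      show "norm (exp_coeff \<phi> j) \<le> c"
        unfolding k exp_density_potential(2)[OF j N M k(2)] using j unfolding jets_of_def by (intro c) auto
    qed
  qed
  obtain L S e where L: "L \<ge> 0" "e \<ge> 1"
    "\<And>\<phi>. \<phi> \<in> B \<Longrightarrow> (\<Sum>j=1..N+1. norm (exp_coeff \<phi> j) * real j) \<le> S"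
    "\<And>\<phi> n Z. \<phi> \<in> B \<Longrightarrow> e \<le> \<bar>real_of_int n\<bar> \<Longrightarrow> Z = npi n + (\<Sum>k=1..N+1. inv_coeff (exp_coeff \<phi>) k / of_int n ^ k) \<Longrightarrow>
       \<bar>real_of_int n\<bar> \<le> norm Z \<and>
       norm (Z - npi n - (\<Sum>j=1..N+1. exp_coeff \<phi> j / Z ^ j)) \<le> L / \<bar>real_of_int n\<bar> ^ Suc (N + 1)"
    by (rule inverted_expansion[of "N + 1" B exp_coeff, OF bd]) (assumption | (rule that; (assumption | blast)))+
  define n0 where "n0 = max (max L0 \<lceil>K\<rceil>) (max \<lceil>e\<rceil> \<lceil>2 * \<bar>S\<bar>\<rceil>)"
  have n0: "L0 \<le> n0" "K \<le> n0" "e \<le> n0" "2 * \<bar>S\<bar> \<le> n0" unfolding n0_def by linarith+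
  show ?thesis
  proof (rule that[of n0 "2 * (\<bar>S\<bar> * C + C + L)"])
    show "n0 \<ge> 1" using n0 L0 by linarith
    show "0 \<le> 2 * (\<bar>S\<bar> * C + C + L)" using C L by simp
    fix \<phi> a b \<mu> and n :: int
    assume \<phi>: "\<phi> \<in> B" and j: "jets_of N M \<phi> a b" and \<mu>: "dirichlet_eigenvalues \<phi> \<mu>" and n: "n0 \<le> \<bar>n\<bar>"
    have a: "sobolev_jet N M a" and b: "sobolev_jet N M b"
      and ae: "AE x in lebesgue. x \<in> {0..1} \<longrightarrow> fst \<phi> x = a 0 x" "AE x in lebesgue. x \<in> {0..1} \<longrightarrow> snd \<phi> x = b 0 x"
      using j unfolding jets_of_def by blast+
    let ?\<nu> = "\<bar>real_of_int n\<bar>" and ?\<theta> = "theta N a b n"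
    have \<nu>: "1 \<le> ?\<nu>" "L0 \<le> \<bar>n\<bar>" "K \<le> ?\<nu>" "e \<le> ?\<nu>" "2 * \<bar>S\<bar> \<le> ?\<nu>" using n n0 L0 C(2) by linarith+
    define f where "f = (trunc_four (a 0) (- n) 1 + trunc_four (b 0) n 1) / 2"
    have f: "(1 / 2) * (fourier_coeff (fst \<phi>) (- n) + fourier_coeff (snd \<phi>) n) = f"
      unfolding f_def fourier_coeff_eq[OF ae(1) sobolev_jet_0(1)[OF a N]] fourier_coeff_eq[OF ae(2) sobolev_jet_0(1)[OF b N]]
      by simp
    note loc = L0(2)[OF j \<mu> \<nu>(2)]
    have z: "?\<nu> \<le> norm (\<mu> n)" using norm_near_multiple_pi[of "\<mu> n" n] loc \<nu>(1) by auto
    have ser: "(\<Sum>k\<le>N. jet_coeff a b k / \<mu> n ^ Suc k) = (\<Sum>j=1..N+1. exp_coeff \<phi> j / \<mu> n ^ j)"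
    proof -
      have "(\<Sum>j=1..N+1. exp_coeff \<phi> j / \<mu> n ^ j) = (\<Sum>k=0..N. exp_coeff \<phi> (Suc k) / \<mu> n ^ Suc k)"
        using sum.shift_bounds_cl_Suc_ivl[of "\<lambda>j. exp_coeff \<phi> j / \<mu> n ^ j" 0 N] by simp
      also have "\<dots> = (\<Sum>k\<le>N. jet_coeff a b k / \<mu> n ^ Suc k)"
        unfolding atMost_atLeast0 by (intro sum.cong) (auto simp: exp_density_potential(2)[OF j N M])
      finally show ?thesis ..
    qed
    define r where "r = ?\<theta> / ?\<nu> ^ (N + 1)"
    note exp = C(3)[OF a b conjunct1[OF loc] conjunct2[OF loc] \<nu>(3), folded f_def, unfolded ser]
    have \<theta>: "1 / ?\<nu> \<le> ?\<theta>"
      by (rule theta_properties[OF N M]) (use a b in blast)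
    have \<theta>0: "0 \<le> ?\<theta>" by (rule order_trans[OF _ \<theta>]) simp
    define Z where "Z = npi n + (\<Sum>k=1..N+1. eig_coeff k \<phi> / of_int n ^ k)"
    note Zb = L(4)[OF \<phi> \<nu>(4) Z_def[unfolded eig_coeff_def]]
    have "norm (\<mu> n - Z - f) \<le> 2 * (\<bar>S\<bar> * norm f / ?\<nu>\<^sup>2 + C * (?\<theta> / ?\<nu> ^ Suc N) + L / ?\<nu> ^ Suc (N + 1))"
    proof (rule inversion_compare[OF \<nu>(1) z conjunct1[OF Zb] conjunct1[OF exp] conjunct2[OF Zb]])
      show "(\<Sum>j=1..N+1. norm (exp_coeff \<phi> j) * real j) \<le> \<bar>S\<bar>" using L(3)[OF \<phi>] by linarith
      have "?\<nu> * 1 \<le> ?\<nu> * ?\<nu>" using \<nu>(1) by (intro mult_left_mono) auto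
      then show "2 * \<bar>S\<bar> \<le> ?\<nu>\<^sup>2" using \<nu>(5) by (simp add: power2_eq_square)
    qed
    also have "\<dots> \<le> 2 * (\<bar>S\<bar> * C * r + C * r + L * r)"
    proof (rule mult_left_mono, intro add_mono)
      have "\<bar>S\<bar> * norm f / ?\<nu>\<^sup>2 \<le> \<bar>S\<bar> * (C * (?\<theta> / ?\<nu> ^ N)) / ?\<nu>\<^sup>2"
        using conjunct2[OF exp] by (intro divide_right_mono mult_left_mono) auto
      also have "\<dots> = \<bar>S\<bar> * C * (?\<theta> / ?\<nu> ^ (N + 2))"
        unfolding power_add times_divide_eq_right divide_divide_eq_left by (simp only: mult.assoc)
      also have "\<dots> \<le> \<bar>S\<bar> * C * r"
        unfolding r_def using C(1) \<nu>(1) \<theta>0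
        by (intro mult_left_mono divide_left_mono power_increasing mult_nonneg_nonneg) auto
      finally show "\<bar>S\<bar> * norm f / ?\<nu>\<^sup>2 \<le> \<bar>S\<bar> * C * r" .
      show "C * (?\<theta> / ?\<nu> ^ Suc N) \<le> C * r" by (simp add: r_def)
      have "1 / ?\<nu> ^ Suc (N + 1) = (1 / ?\<nu>) / ?\<nu> ^ (N + 1)" by simp
      also have "\<dots> \<le> r" unfolding r_def by (intro divide_right_mono \<theta>) auto
      finally show "L / ?\<nu> ^ Suc (N + 1) \<le> L * r"
        using mult_left_mono[OF _ L(1)] by fastforce
    qed simp
    also have "\<dots> = 2 * (\<bar>S\<bar> * C + C + L) * r" by (simp add: algebra_simps)
    finally show "norm (\<mu> n - (npi n + (\<Sum>k=1..N+1. eig_coeff k \<phi> / of_int n ^ k))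
         - (1 / 2) * (fourier_coeff (fst \<phi>) (- n) + fourier_coeff (snd \<phi>) n))
       \<le> 2 * (\<bar>S\<bar> * C + C + L) * (?\<theta> / ?\<nu> ^ (N + 1))"
      unfolding f Z_def r_def .
  qed
qed

lemma theta_square_sums:
  assumes N: "N \<ge> 1" and M: "M \<ge> 1"
  obtains G where "G \<ge> 0"
    "\<And>a b A. sobolev_jet N M a \<Longrightarrow> sobolev_jet N M b \<Longrightarrow> finite A \<Longrightarrow> (\<Sum>n\<in>A. (theta N a b n)\<^sup>2) \<le> G"
proof -
  obtain Q where Q: "\<And>F. finite F \<Longrightarrow> (\<Sum>n\<in>F. 1 / (real_of_int n)\<^sup>2) \<le> Q" using sum_inverse_squares_int by blast
  obtain G where G: "\<And>a b A. sobolev_jet N M a \<Longrightarrow> sobolev_jet N M b \<Longrightarrow> finite A \<Longrightarrow> (\<Sum>n\<in>A. energies N a b n) \<le> G"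
    "\<And>a b n. sobolev_jet N M a \<Longrightarrow> sobolev_jet N M b \<Longrightarrow> energies N a b n \<ge> 0"
    by (rule theta_properties[OF N M]) (rule that; (assumption | blast))
  show ?thesis
  proof (rule that[of "\<bar>G + Q\<bar>"])
    fix a b and A :: "int set" assume a: "sobolev_jet N M a" and b: "sobolev_jet N M b" and A: "finite A"
    have "(\<Sum>n\<in>A. (theta N a b n)\<^sup>2) = (\<Sum>n\<in>A. energies N a b n) + (\<Sum>n\<in>A. 1 / (real_of_int n)\<^sup>2)"
      unfolding sum.distrib[symmetric] theta_def using G(2)[OF a b] by (intro sum.cong) auto
    also have "\<dots> \<le> \<bar>G + Q\<bar>" using G(1)[OF a b A] Q[OF A] by linarith
    finally show "(\<Sum>n\<in>A. (theta N a b n)\<^sup>2) \<le> \<bar>G + Q\<bar>" .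
  qed simp
qed

text \<open>
  With \<open>B\<close> in the ball of radius \<open>R\<close>, the bound for the jets is \<open>1 + R\<^sup>2\<close>. The error \<open>e n\<close> is at most \<open>C \<theta>\<^sub>n\<close>, and the
  \<open>\<theta>\<^sub>n\<^sup>2\<close> have uniformly bounded sums.
\<close>

theorem theorem1p1:
  "\<exists>c :: nat \<Rightarrow> fun_pair \<Rightarrow> complex.
     (\<forall>k\<ge>1. given_by_integrals k (\<Union>N\<in>{N. 1 \<le> N \<and> k \<le> N + 1}. Hc N) (c k)) \<and>
     (\<forall>N\<ge>1. \<forall>B. bounded_in_Hc N B \<longrightarrow>
        (\<exists>n0::int. n0 \<ge> 1 \<and> (\<exists>C::real. C > 0 \<and>
          (\<forall>\<phi>\<in>B. \<forall>\<mu>. dirichlet_eigenvalues \<phi> \<mu> \<longrightarrow>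
            (\<exists>e :: int \<Rightarrow> complex.
               (\<forall>n. \<bar>n\<bar> \<ge> n0 \<longrightarrow>
                  \<mu> n = of_int n * of_real pi
                      + (\<Sum>k=1..N+1. c k \<phi> / of_int n ^ k)
                      + (1/2) * (fourier_coeff (fst \<phi>) (- n) + fourier_coeff (snd \<phi>) n)
                      + e n / of_int n ^ (N+1)) \<and>
               (\<lambda>n. (norm (e n))\<^sup>2) summable_on {n. \<bar>n\<bar> \<ge> n0} \<and>
               (\<Sum>\<^sub>\<infinity>n\<in>{n. \<bar>n\<bar> \<ge> n0}. (norm (e n))\<^sup>2) \<le> C)))))"
proof (intro exI[of _ eig_coeff] conjI allI impI, goal_cases)
  case (1 k)
  show ?case by (rule eig_coeff_given_by_integrals[unfolded admissible_def])
next
  case (2 N B)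
  note N = \<open>1 \<le> N\<close>
  obtain R where R: "B \<subseteq> Hc N" "\<And>\<phi>. \<phi> \<in> B \<Longrightarrow> Hc_norm N \<phi> \<le> R"
    using \<open>bounded_in_Hc N B\<close> unfolding bounded_in_Hc_def by blast
  have M: "1 \<le> 1 + R\<^sup>2" by simp
  have jets: "\<exists>a b. jets_of N (1 + R\<^sup>2) \<phi> a b" if "\<phi> \<in> B" for \<phi>
    using Hc_jets[OF _ N R(2)[OF that]] R(1) that by blast
  obtain n0 :: int and C where n0: "n0 \<ge> 1" and C: "C \<ge> 0" and main:
    "\<And>\<phi> a b \<mu> n. \<phi> \<in> B \<Longrightarrow> jets_of N (1 + R\<^sup>2) \<phi> a b \<Longrightarrow> dirichlet_eigenvalues \<phi> \<mu> \<Longrightarrow> n0 \<le> \<bar>n\<bar> \<Longrightarrow>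
       norm (\<mu> n - (of_int n * of_real pi + (\<Sum>k=1..N+1. eig_coeff k \<phi> / of_int n ^ k))
         - (1 / 2) * (fourier_coeff (fst \<phi>) (- n) + fourier_coeff (snd \<phi>) n))
       \<le> C * (theta N a b n / \<bar>real_of_int n\<bar> ^ (N + 1))"
    by (rule index_expansion[where B = B, OF N M jets]) (assumption | (rule that; (assumption | blast)))+
  obtain G where G: "G \<ge> 0" "\<And>a b A. sobolev_jet N (1 + R\<^sup>2) a \<Longrightarrow> sobolev_jet N (1 + R\<^sup>2) b \<Longrightarrow> finite A \<Longrightarrow>
      (\<Sum>n\<in>A. (theta N a b n)\<^sup>2) \<le> G"
    by (rule theta_square_sums[OF N M]) (rule that; (assumption | blast))
  \<comment> \<open>The summand 1 only makes the bound positive.\<close>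
  show ?case
  proof (intro exI[of _ n0] exI[of _ "C\<^sup>2 * G + 1"] conjI ballI allI impI n0, goal_cases)
    case 1
    show ?case using G(1) by (intro add_nonneg_pos) auto
  next
    case (2 \<phi> \<mu>)
    note \<phi> = \<open>\<phi> \<in> B\<close> and \<mu> = \<open>dirichlet_eigenvalues \<phi> \<mu>\<close>
    obtain a b where j: "jets_of N (1 + R\<^sup>2) \<phi> a b" using jets[OF \<phi>] by blast
    define e where "e n = (\<mu> n - (of_int n * of_real pi + (\<Sum>k=1..N+1. eig_coeff k \<phi> / of_int n ^ k))
         - (1 / 2) * (fourier_coeff (fst \<phi>) (- n) + fourier_coeff (snd \<phi>) n)) * of_int n ^ (N + 1)" for n
    have e: "(norm (e n))\<^sup>2 \<le> C\<^sup>2 * (theta N a b n)\<^sup>2" if n: "n0 \<le> \<bar>n\<bar>" for n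
    proof -
      have "norm (e n) \<le> C * (theta N a b n / \<bar>real_of_int n\<bar> ^ (N + 1)) * \<bar>real_of_int n\<bar> ^ (N + 1)"
        unfolding e_def norm_mult[of _ "of_int n ^ (N + 1)"] norm_power norm_of_int
        by (intro mult_right_mono main[OF \<phi> j \<mu> n]) auto
      also have "\<dots> = C * theta N a b n" using n n0 by simp
      finally show ?thesis unfolding power_mult_distrib[symmetric] by (rule power_mono) simp
    qed
    have fin: "(\<Sum>n\<in>F. (norm (e n))\<^sup>2) \<le> C\<^sup>2 * G + 1" if F: "finite F" "F \<subseteq> {n. \<bar>n\<bar> \<ge> n0}" for F
    proof -
      have "(\<Sum>n\<in>F. (norm (e n))\<^sup>2) \<le> (\<Sum>n\<in>F. C\<^sup>2 * (theta N a b n)\<^sup>2)" by (intro sum_mono e) (use F in auto)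
      also have "\<dots> = C\<^sup>2 * (\<Sum>n\<in>F. (theta N a b n)\<^sup>2)" by (simp add: sum_distrib_left)
      also have "\<dots> \<le> C\<^sup>2 * G"
        using j unfolding jets_of_def by (intro mult_left_mono G(2) F) auto
      finally show ?thesis by simp
    qed
    have sum: "(\<lambda>n. (norm (e n))\<^sup>2) summable_on {n. \<bar>n\<bar> \<ge> n0}"
      by (rule nonneg_bounded_partial_sums_imp_summable_on[where C = "C\<^sup>2 * G + 1"])
        (auto intro!: eventually_finite_subsets_at_top_weakI fin)
    show ?case
    proof (intro exI[of _ e] conjI allI impI sum infsum_le_finite_sums[OF sum fin])
      fix n :: int assume n: "\<bar>n\<bar> \<ge> n0"
      have nz: "(of_int n :: complex) ^ (N + 1) \<noteq> 0" using n n0 by auto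
      show "\<mu> n = of_int n * of_real pi + (\<Sum>k=1..N+1. eig_coeff k \<phi> / of_int n ^ k)
          + (1/2) * (fourier_coeff (fst \<phi>) (- n) + fourier_coeff (snd \<phi>) n) + e n / of_int n ^ (N+1)"
        unfolding e_def nonzero_mult_div_cancel_right[OF nz] by simp
    qed
  qed
qed

end
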